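(* Let $K,K'$ be (oriented) classical knots such that $K$ and $K'$ are S-equivalent. Then $f(K)-f(K')$ is divisible in $\mathbb{Z}[A,A^{-1}]$ by $A^{36}-A^{32}+A^{28}-A^{24}-A^{12}+A^8-A^4+1$.
   Context: Two classical knots are S-equivalent if they have Seifert matrices related by a finite sequence of elementary enlargements (and their inverses) and integral congruences $V\mapsto P^{T}VP$ with $P$ invertible over $\mathbb{Z}$ (i.e. S-equivalence of Seifert matrices in the usual sense). For an oriented link diagram $D$, $f(D)=(-A^3)^{-w(D)}\langle D\rangle\in\mathbb{Z}[A,A^{-1}]$, where $w$ is the writhe and $\langle\cdot\rangle$ is the Kauffman bracket: at a crossing drawn so that the over-strand runs from bottom left to top right, $\langle D\rangle=A\langle D_A\rangle+A^{-1}\langle D_B\rangle$, where $D_A$ joins the two left ends together and the two right ends together, and $D_B$ joins the two top ends together and the two bottom ends together; $\langle\bigcirc\sqcup D\rangle=(-A^2-A^{-2})\langle D\rangle$; $\langle\bigcirc\rangle=1$. It is a link invariant giving the Jones polynomial at $A=t^{-1/4}$. *)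

theory Defs
  imports "HOL-Library.Poly_Mapping" "Jordan_Normal_Form.Matrix"
begin

section \<open>The ring \<open>\<int>[A, A\<^sup>-\<^sup>1]\<close>\<close>

text \<open>A Laurent polynomial is a finitely supported function from exponents to coefficients;
  the ring structure of \<^theory>\<open>HOL-Library.Poly_Mapping\<close> is the convolution product, so
  \<open>dvd\<close> on this type is divisibility in \<open>\<int>[A, A\<^sup>-\<^sup>1]\<close>.\<close>

type_synonym laurent = "int \<Rightarrow>\<^sub>0 int"

definition A_var :: laurent where
  "A_var = Poly_Mapping.single 1 1"

definition A_inv :: laurent where
  "A_inv = Poly_Mapping.single (-1) 1"


section \<open>Crossings\<close>

text \<open>A crossing is drawn with both strands oriented upwards: one strand runs from the end
  \<open>sw\<close> (bottom left) to the end \<open>ne\<close> (top right), the other one from \<open>se\<close> to \<open>nw\<close>. The crossing is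
  positive iff the strand from \<open>sw\<close> to \<open>ne\<close> is the over-strand. The four ends are named by the
  edges of the diagram they belong to.\<close>

datatype 'e crossing = Crossing (sw: 'e) (se: 'e) (nw: 'e) (ne: 'e) (positive: bool)

text \<open>The crossing of the given sign, from the incoming and outgoing edges of its over-strand and
  of its under-strand.\<close>

definition mk_crossing :: "bool \<Rightarrow> 'e \<Rightarrow> 'e \<Rightarrow> 'e \<Rightarrow> 'e \<Rightarrow> 'e crossing" where
  "mk_crossing s over_in over_out under_in under_out =
     (if s then Crossing over_in under_in under_out over_out True
      else Crossing under_in over_in over_out under_out False)"

text \<open>A smoothing is recorded as the set of pairs of ends that it joins. The A-smoothing is defined
  with respect to the picture in which the over-strand runs from bottom left to top right. A positive
  crossing already is in this position; a negative one is brought into it by a quarter turn, which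
  exchanges ``left and right'' with ``top and bottom''.\<close>

definition joins_left_right :: "'e crossing \<Rightarrow> ('e \<times> 'e) set" where
  "joins_left_right x = {(sw x, nw x), (se x, ne x)}"

definition joins_top_bottom :: "'e crossing \<Rightarrow> ('e \<times> 'e) set" where
  "joins_top_bottom x = {(nw x, ne x), (sw x, se x)}"

definition A_smoothing :: "'e crossing \<Rightarrow> ('e \<times> 'e) set" where
  "A_smoothing x = (if positive x then joins_left_right x else joins_top_bottom x)"

definition B_smoothing :: "'e crossing \<Rightarrow> ('e \<times> 'e) set" where
  "B_smoothing x = (if positive x then joins_top_bottom x else joins_left_right x)"

text \<open>Each edge has two sides. In a small neighbourhood of a crossing the plane is divided into four
  corners, each of which is adjacent to one side of each of two ends.\<close>

datatype side = Left_Side | Right_Side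

definition corners :: "'e crossing \<Rightarrow> (('e \<times> side) \<times> ('e \<times> side)) set" where
  "corners x = {((sw x, Left_Side), (nw x, Left_Side)),
                ((se x, Right_Side), (ne x, Right_Side)),
                ((sw x, Right_Side), (se x, Left_Side)),
                ((nw x, Right_Side), (ne x, Left_Side))}"

definition num_classes :: "'x set \<Rightarrow> ('x \<times> 'x) set \<Rightarrow> nat" where
  "num_classes X R = card (X // (R \<union> R\<inverse>)\<^sup>*)"


section \<open>Oriented knot diagrams\<close>

text \<open>A knot diagram is represented by its signed Gauss code, the cyclic word of the crossings met
  when travelling once along the oriented knot. An entry \<open>(c, ov, s)\<close> means that the crossing with
  label \<open>c\<close> is passed on the over-strand (\<open>ov\<close>) or on the under-strand (\<open>\<not> ov\<close>), and that its sign is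
  positive (\<open>s\<close>) or negative (\<open>\<not> s\<close>). A signed Gauss code determines the diagram on the sphere up to
  orientation preserving homeomorphism.\<close>

type_synonym gauss_entry = "nat \<times> bool \<times> bool"
type_synonym gauss_code = "gauss_entry list"

definition matched :: "gauss_code \<Rightarrow> bool" where
  "matched w \<longleftrightarrow> distinct w \<and>
     (\<forall>c ov s. (c, ov, s) \<in> set w \<longrightarrow> (c, \<not> ov, s) \<in> set w \<and> (c, ov, \<not> s) \<notin> set w)"

text \<open>Edge \<open>i\<close> of the diagram leads to the \<open>i\<close>-th entry of the word, and edge \<open>i + 1\<close> (cyclically)
  leaves it. The diagram without crossings has the single closed edge \<open>0\<close>.\<close>

definition edges :: "gauss_code \<Rightarrow> nat set" where
  "edges w = {..<max 1 (length w)}"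

definition crossings :: "gauss_code \<Rightarrow> nat crossing list" where
  "crossings w =
     [mk_crossing (snd (snd (w ! i))) i (Suc i mod length w) j (Suc j mod length w).
        i \<leftarrow> [0..<length w], j \<leftarrow> [0..<length w],
        fst (snd (w ! i)) \<and> w ! j = (fst (w ! i), False, snd (snd (w ! i)))]"

text \<open>The faces of the closed oriented surface carrying the diagram are the classes of sides of
  edges under adjacency at corners. There are \<open>n\<close> vertices and \<open>2n\<close> edges (respectively one closed
  edge, on a sphere with two faces, if \<open>n = 0\<close>), so Euler's formula says that the surface is a sphere
  iff there are \<open>n + 2\<close> faces.\<close>

definition planar :: "gauss_code \<Rightarrow> bool" where
  "planar w \<longleftrightarrow>
     num_classes (edges w \<times> UNIV) (\<Union>x\<in>set (crossings w). corners x) = length (crossings w) + 2"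

definition knot_diagram :: "gauss_code \<Rightarrow> bool" where
  "knot_diagram w \<longleftrightarrow> matched w \<and> planar w"


section \<open>Kauffman bracket and the polynomial \<open>f\<close>\<close>

text \<open>\<open>bracket_expand E xs J\<close> is the bracket of the diagram with edges \<open>E\<close> and crossings \<open>xs\<close> in which
  the pairs of edge ends in \<open>J\<close> have been joined at the crossings already smoothed. Without
  crossings, the diagram is a disjoint union of as many circles as there are classes of edges.\<close>

fun bracket_expand :: "'e set \<Rightarrow> 'e crossing list \<Rightarrow> ('e \<times> 'e) set \<Rightarrow> laurent" where
  "bracket_expand E [] J = (- (A_var ^ 2) - A_inv ^ 2) ^ (num_classes E J - 1)"
| "bracket_expand E (x # xs) J =
     A_var * bracket_expand E xs (J \<union> A_smoothing x) + A_inv * bracket_expand E xs (J \<union> B_smoothing x)"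

definition bracket :: "gauss_code \<Rightarrow> laurent" where
  "bracket w = bracket_expand (edges w) (crossings w) {}"

definition sign :: "bool \<Rightarrow> int" where
  "sign s = (if s then 1 else -1)"

definition writhe :: "gauss_code \<Rightarrow> int" where
  "writhe w = (\<Sum>(c, ov, s)\<leftarrow>w. if ov then sign s else 0)"

text \<open>The factor is \<open>(- A\<^sup>3)\<close> to the integer power \<open>- writhe w\<close>; the inverse of \<open>- A\<^sup>3\<close> is
  \<open>- A_inv ^ 3\<close>.\<close>

definition f_poly :: "gauss_code \<Rightarrow> laurent" where
  "f_poly w = (if writhe w \<ge> 0 then (- (A_inv ^ 3)) ^ nat (writhe w)
          else (- (A_var ^ 3)) ^ nat (- writhe w)) * bracket w"


section \<open>Knots: diagrams up to Reidemeister moves\<close>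

text \<open>The segment of a strand that traverses the two given passages in this order, or in the opposite
  order.\<close>

definition traverse :: "bool \<Rightarrow> 'x list \<Rightarrow> 'x list" where
  "traverse d xs = (if d then xs else rev xs)"

text \<open>The first two rules express that labels and base point of a Gauss code are immaterial. The
  moves are only used between planar Gauss codes (see \<open>knot_equiv\<close>).

  In \<open>R2\<close> the two new crossings have opposite signs. In a planar diagram this is equivalent to the two
  edges between the crossings bounding a bigon.

  In \<open>R3\<close> the crossing of the top with the middle strand is \<open>a\<close>, of the top with the bottom strand \<open>b\<close>,
  of the middle with the bottom strand \<open>c\<close>. The booleans \<open>t\<close>, \<open>m\<close>, \<open>l\<close> tell in which order the top, middle,
  bottom strand pass their two crossings; each strand passes them in the opposite order after the
  move. The conditions on signs say that the three edges bound a triangular face, i.e.\ that at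
  each of the three crossings the sides of the two edges facing each other agree with those at the other
  crossings. Both cyclic arrangements of the strands along the knot are covered.\<close>

inductive diagram_move :: "gauss_code \<Rightarrow> gauss_code \<Rightarrow> bool" where
  relabel: "inj h \<Longrightarrow> diagram_move w (map (map_prod h id) w)"
| rotate: "diagram_move (u @ v) (v @ u)"
| R1: "diagram_move u ([(a, ov, s), (a, \<not> ov, s)] @ u)"
| R2: "diagram_move (u @ v)
         ([(a, True, s), (b, True, \<not> s)] @ u @
          traverse d [(a, False, s), (b, False, \<not> s)] @ v)"
| R3: "\<lbrakk> T = [(a, True, sa), (b, True, sb)];
         M = [(a, False, sa), (c, True, sc)];
         L = [(b, False, sb), (c, False, sc)];
         (sa = sb) = (m = l); (sa = sc) = (t = l); (sb = sc) = (t = m) \<rbrakk> \<Longrightarrow>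
       diagram_move
         (traverse t T @ u @ traverse m M @ v @ traverse l L @ x)
         (traverse (\<not> t) T @ u @ traverse (\<not> m) M @ v @ traverse (\<not> l) L @ x)"
| R3': "\<lbrakk> T = [(a, True, sa), (b, True, sb)];
         M = [(a, False, sa), (c, True, sc)];
         L = [(b, False, sb), (c, False, sc)];
         (sa = sb) = (m = l); (sa = sc) = (t = l); (sb = sc) = (t = m) \<rbrakk> \<Longrightarrow>
       diagram_move
         (traverse t T @ u @ traverse l L @ v @ traverse m M @ x)
         (traverse (\<not> t) T @ u @ traverse (\<not> l) L @ v @ traverse (\<not> m) M @ x)"

text \<open>Two knot diagrams represent the same oriented classical knot. The intermediate diagrams are
  planar, so these are the ordinary Reidemeister moves of knot diagrams on the sphere.\<close>

definition knot_equiv :: "gauss_code \<Rightarrow> gauss_code \<Rightarrow> bool" where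
  "knot_equiv = equivclp (\<lambda>w w'. knot_diagram w \<and> knot_diagram w' \<and> diagram_move w w')"


section \<open>Seifert surfaces\<close>

text \<open>A Seifert surface is presented in the usual normal form, to which every Seifert surface (compact,
  connected, oriented, with boundary the knot) can be brought by an isotopy: a flat disc, below a
  horizontal line in the plane, to which \<open>n\<close> bands are attached along this line. The bands lie
  flat in the plane, except that they pass over and under each other and themselves; a full twist in a
  band is represented by a curl. The positive side of the surface is the one turned towards the viewer.

  \<open>feet\<close> lists the ends of the bands from left to right, where \<open>(i, True)\<close> is the foot at which the core of
  band \<open>i\<close> starts, and \<open>(i, False)\<close> the one at which it ends. \<open>cores ! i\<close> lists the crossings met by the core
  of band \<open>i\<close> from its start to its end, in the format of Gauss codes.\<close>

record band_surface =
  feet :: "(nat \<times> bool) list"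
  cores :: "gauss_code list"

definition num_bands :: "band_surface \<Rightarrow> nat" where
  "num_bands F = length (cores F)"

text \<open>\<open>(i, k)\<close> is the part of core \<open>i\<close> that leads to its \<open>k\<close>-th entry (from its \<open>(k-1)\<close>-st entry, or from
  the disc); the part leading to the disc has \<open>k = length (cores F ! i)\<close>.\<close>

definition core_edges :: "band_surface \<Rightarrow> (nat \<times> nat) set" where
  "core_edges F = {(i, k). i < num_bands F \<and> k \<le> length (cores F ! i)}"

definition core_crossings :: "band_surface \<Rightarrow> (nat \<times> nat) crossing set" where
  "core_crossings F =
     {mk_crossing s (i, k) (i, Suc k) (j, l) (j, Suc l) | c s i k j l.
        i < num_bands F \<and> k < length (cores F ! i) \<and> cores F ! i ! k = (c, True, s) \<and>
        j < num_bands F \<and> l < length (cores F ! j) \<and> cores F ! j ! l = (c, False, s)}"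

text \<open>The sides of the core to the right and to the left of a foot, for a viewer standing on the disc
  and looking along the band.\<close>

fun foot_right :: "band_surface \<Rightarrow> nat \<times> bool \<Rightarrow> (nat \<times> nat) \<times> side" where
  "foot_right F (i, start) =
     (if start then ((i, 0), Right_Side) else ((i, length (cores F ! i)), Left_Side))"

fun foot_left :: "band_surface \<Rightarrow> nat \<times> bool \<Rightarrow> (nat \<times> nat) \<times> side" where
  "foot_left F (i, start) =
     (if start then ((i, 0), Left_Side) else ((i, length (cores F ! i)), Right_Side))"

definition disc_corners ::
  "band_surface \<Rightarrow> (((nat \<times> nat) \<times> side) \<times> ((nat \<times> nat) \<times> side)) set" where
  "disc_corners F = {(foot_right F p, foot_left F q) | p q.
                       (p, q) \<in> set (zip (feet F) (rotate1 (feet F)))}"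

text \<open>Contracting the disc to a vertex, the cores form a connected graph with \<open>c + 1\<close> vertices and
  \<open>2c + n\<close> edges, where \<open>c\<close> is the number of crossings and \<open>n > 0\<close> the number of bands. By Euler's
  formula, it is embedded in the sphere iff there are \<open>c + n + 1\<close> faces.\<close>

definition planar_cores :: "band_surface \<Rightarrow> bool" where
  "planar_cores F \<longleftrightarrow> num_bands F = 0 \<or>
     num_classes (core_edges F \<times> UNIV) ((\<Union>x\<in>core_crossings F. corners x) \<union> disc_corners F)
       = card (core_crossings F) + num_bands F + 1"

text \<open>The boundary is oriented such that the surface lies to its left. It thus leaves the disc along
  the right edge of a band, returns to the disc on the left of the other foot of this band, and continues
  along the disc to the next foot on the left (cyclically).\<close>

fun next_foot :: "band_surface \<Rightarrow> nat \<times> bool \<Rightarrow> nat \<times> bool" where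
  "next_foot F (i, start) = the (map_of (zip (rotate1 (feet F)) (feet F)) (i, \<not> start))"

definition boundary_feet :: "band_surface \<Rightarrow> (nat \<times> bool) list" where
  "boundary_feet F = map (\<lambda>k. (next_foot F ^^ k) (hd (feet F))) [0..<length (feet F)]"

text \<open>Where one band crosses another one, their four edges cross four times. An edge of a band is named
  \<open>True\<close> if it is the right edge with respect to the core, in which case the boundary runs parallel to the
  core, and \<open>False\<close> if it is the left edge, in which case it runs antiparallel. The crossing of edge \<open>d\<close>
  of the over-band with edge \<open>e\<close> of the under-band at the core crossing \<open>c\<close> is labelled injectively.\<close>

definition edge_label :: "nat \<Rightarrow> bool \<Rightarrow> bool \<Rightarrow> nat" where
  "edge_label c d e = 4 * c + 2 * of_bool d + of_bool e"

text \<open>The two crossings met by edge \<open>d\<close> of a band, travelling in the direction of the core, at an entry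
  of the core. At a positive crossing the over-core sees the under-core passing from right to left, hence
  meets its left edge first; the under-core sees the over-core passing from left to right, hence meets
  its right edge first. At negative crossings it is the other way round.\<close>

fun double_entry :: "bool \<Rightarrow> gauss_entry \<Rightarrow> gauss_code" where
  "double_entry d (c, ov, s) =
     map (\<lambda>e. (if ov then edge_label c d e else edge_label c e d, ov, s = (d = e)))
       (if ov = s then [False, True] else [True, False])"

fun band_edge :: "band_surface \<Rightarrow> nat \<times> bool \<Rightarrow> gauss_code" where
  "band_edge F (i, start) = traverse start (concat (map (double_entry start) (cores F ! i)))"

definition boundary :: "band_surface \<Rightarrow> gauss_code" where
  "boundary F = concat (map (band_edge F) (boundary_feet F))"

text \<open>The last condition says that the boundary is connected.\<close>

definition seifert_surface :: "band_surface \<Rightarrow> bool" where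
  "seifert_surface F \<longleftrightarrow>
     distinct (feet F) \<and> set (feet F) = {..<num_bands F} \<times> UNIV \<and>
     matched (concat (cores F)) \<and> planar_cores F \<and> distinct (boundary_feet F)"

text \<open>Let \<open>x\<^sub>i\<close> be the loop that runs along the core of band \<open>i\<close> and returns through the disc. These loops
  form a basis of the first homology of \<open>F\<close>. The entry \<open>(i, j)\<close> of the Seifert matrix is the linking
  number of \<open>x\<^sub>i\<close> with the push-off of \<open>x\<^sub>j\<close> to the positive side. This linking number is the sum of the
  signs of the crossings at which \<open>x\<^sub>i\<close> passes over the push-off. As the push-off is towards the viewer,
  these are the crossings at which the core of band \<open>i\<close> passes over the core of band \<open>j\<close> (for \<open>i = j\<close>:
  the self-crossings of the core).\<close>

definition core_seifert_matrix :: "band_surface \<Rightarrow> int mat" where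
  "core_seifert_matrix F = mat (num_bands F) (num_bands F) (\<lambda>(i, j).
     \<Sum>(c, ov, s)\<leftarrow>cores F ! i. if ov \<and> (c, False, s) \<in> set (cores F ! j) then sign s else 0)"

definition congruent :: "int mat \<Rightarrow> int mat \<Rightarrow> bool" where
  "congruent V W \<longleftrightarrow> (\<exists>n P. V \<in> carrier_mat n n \<and> P \<in> carrier_mat n n \<and> invertible_mat P \<and>
     W = transpose_mat P * V * P)"

text \<open>Seifert matrices of the knot represented by \<open>K\<close>, with respect to arbitrary Seifert surfaces and
  arbitrary bases of their first homology.\<close>

definition is_seifert_matrix :: "int mat \<Rightarrow> gauss_code \<Rightarrow> bool" where
  "is_seifert_matrix V K \<longleftrightarrow>
     (\<exists>F. seifert_surface F \<and> knot_equiv (boundary F) K \<and> congruent (core_seifert_matrix F) V)"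


section \<open>S-equivalence\<close>

text \<open>The elementary enlargements of \<open>V\<close> are the block matrices
  \<open>(V \<xi> 0; 0 0 1; 0 0 0)\<close> and \<open>(V 0 0; \<xi>\<^sup>T 0 0; 0 1 0)\<close>.\<close>

inductive elementary_enlargement :: "int mat \<Rightarrow> int mat \<Rightarrow> bool" where
  column: "\<lbrakk> V \<in> carrier_mat n n; \<xi> \<in> carrier_vec n \<rbrakk> \<Longrightarrow>
    elementary_enlargement V
      (four_block_mat V (mat n 2 (\<lambda>(i, j). if j = 0 then \<xi> $ i else 0))
         (0\<^sub>m 2 n) (mat 2 2 (\<lambda>(i, j). if i = 0 \<and> j = 1 then 1 else 0)))"
| row: "\<lbrakk> V \<in> carrier_mat n n; \<xi> \<in> carrier_vec n \<rbrakk> \<Longrightarrow>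
    elementary_enlargement V
      (four_block_mat V (0\<^sub>m n 2)
         (mat 2 n (\<lambda>(i, j). if i = 0 then \<xi> $ j else 0))
         (mat 2 2 (\<lambda>(i, j). if i = 1 \<and> j = 0 then 1 else 0)))"

definition S_equivalent :: "int mat \<Rightarrow> int mat \<Rightarrow> bool" where
  "S_equivalent = equivclp (\<lambda>V W. congruent V W \<or> elementary_enlargement V W)"

definition S_equivalent_knots :: "gauss_code \<Rightarrow> gauss_code \<Rightarrow> bool" where
  "S_equivalent_knots K K' \<longleftrightarrow>
     (\<exists>V V'. is_seifert_matrix V K \<and> is_seifert_matrix V' K' \<and> S_equivalent V V')"

end

theory Submission
  imports "Jordan_Normal_Form.Determinant" "HOL-Number_Theory.Cong" Defs
begin

text \<open>Let \<open>W\<close> be the Seifert matrix of a band surface whose boundary is the knot, and let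
  \<open>u = A\<^sup>4 = y\<^sup>2\<close>. The writhe of the boundary vanishes, and up to a power of \<open>A\<close> its bracket is a polynomial
  in \<open>u\<close>. It suffices to show that, at the roots of the divisor \<open>(u - 1) (u\<^sup>6 - 1) (u\<^sup>2 + 1)\<close>,
  this polynomial only depends on the S-equivalence class of \<open>W\<close>.

  Shade the surface. A state of the boundary is determined by the set of crossings at
  which the shaded regions are merged, and on the sphere its number of loops is determined by the number of regions.
  This makes the bracket a Potts partition function with \<open>q = (y + y\<^sup>-\<^sup>1)\<^sup>2\<close> colours. For \<open>q = 1, 2, 3\<close>, the weight of the
  four crossings at a crossing of cores is a character of the product of the jumps of the
  colour along the two cores, so that Fourier transform yields a Gauss sum of
  the quadratic form of \<open>W\<close>; this covers the roots with \<open>u\<^sup>2 + u + 1 = 0\<close>, \<open>u\<^sup>2 + 1 = 0\<close>,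
  \<open>u\<^sup>2 - u + 1 = 0\<close>. For \<open>u = -1\<close> only spanning trees contribute, and the matrix-tree theorem gives the determinant
  of \<open>W + W\<^sup>T\<close> up to sign. At the double root \<open>u = 1\<close> the value and the derivative of the state sum
  are known for every knot, from a three-term relation between the resolutions of a crossing; they also fix the sign at
  \<open>u = -1\<close> by a congruence modulo 4.\<close>

section \<open>Connectivity classes\<close>

text \<open>A weight that only tests whether two colours agree is a Gaussian in their difference
  exactly as long as squares of nonzero differences act alike. For one or two colours such a square
  is 1; for three colours it is 1 or 4, and \<open>Y ^ 3 = 1\<close> identifies the two. In the
  product over four crossings the pure squares cancel, and the mixed term that survives is the
  linking pairing of two bands.

  Planarity is used by counting: an upper bound for the loops of a state by shaded regions, the same
  bound for unshaded regions, and submodularity of graphic rank. Euler's formula for the cores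
  forces equality in all three.

  The determinant leaves a sign open at \<open>u = -1\<close>. A polynomial with value 1 and
  derivative \<open>M\<close> at 1 is congruent to \<open>1 - 2 * M\<close> modulo 4 at -1. This is
  odd, so two such values cannot be opposite. The polynomials of both knots therefore have to carry
  the same shift \<open>M\<close>, which is taken large enough for both.

  Vanishing at complex points gives divisibility over the integers since the divisor is monic; one
  factor \<open>u - 1\<close> is split off beforehand so that the remaining roots are
  simple.\<close>

definition conn :: "('x \<times> 'x) set \<Rightarrow> 'x \<Rightarrow> 'x \<Rightarrow> bool" where
  "conn R x y \<longleftrightarrow> (x, y) \<in> (R \<union> R\<inverse>)\<^sup>*"

lemma conn_refl [simp, intro]: "conn R x x"
  by (simp add: conn_def)

lemma conn_sym: "conn R x y \<Longrightarrow> conn R y x"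
  unfolding conn_def by (metis converse_Un converse_converse rtrancl_converseI sup_commute)

lemma conn_trans [trans]: "conn R x y \<Longrightarrow> conn R y z \<Longrightarrow> conn R x z"
  unfolding conn_def by (rule rtrancl_trans)

lemma conn_base: "(x, y) \<in> R \<Longrightarrow> conn R x y"
  by (auto simp: conn_def)

lemma conn_base': "(y, x) \<in> R \<Longrightarrow> conn R x y"
  by (auto simp: conn_def)

lemma conn_induct [consumes 1, case_names refl step]:
  assumes "conn R x y" "P x"
    "\<And>y z. conn R x y \<Longrightarrow> (y, z) \<in> R \<or> (z, y) \<in> R \<Longrightarrow> P y \<Longrightarrow> P z"
  shows "P y"
  using assms(1) unfolding conn_def
  by (induction rule: rtrancl_induct) (use assms(2,3) in \<open>auto simp: conn_def\<close>)

lemma conn_map: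
  assumes "conn R x y" "\<And>a b. (a, b) \<in> R \<Longrightarrow> conn R' (h a) (h b)"
  shows "conn R' (h x) (h y)"
  using assms(1)
proof (induction rule: conn_induct)
  case (step y z)
  then show ?case using assms(2) conn_sym conn_trans by metis
qed simp

lemma conn_mono: "conn R x y \<Longrightarrow> R \<subseteq> R' \<Longrightarrow> conn R' x y"
  using conn_map[of R x y R' id] by (auto intro: conn_base)

lemma conn_cong_sets:
  assumes "\<And>a b. (a, b) \<in> R \<Longrightarrow> conn R' a b" "\<And>a b. (a, b) \<in> R' \<Longrightarrow> conn R a b"
  shows "conn R = conn R'"
  using conn_map[of R _ _ R' id] conn_map[of R' _ _ R id] assms by (intro ext) auto

lemma conn_invariant:
  assumes "conn R x y" "\<And>a b. (a, b) \<in> R \<Longrightarrow> f a = f b"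
  shows "f x = f y"
  using assms(1) by (induction rule: conn_induct) (use assms(2) in auto)

lemma conn_in:
  assumes "conn R x y" "R \<subseteq> X \<times> X" "x \<in> X" shows "y \<in> X"
  using assms(1) by (induction rule: conn_induct) (use assms in auto)

text \<open>A path can be shortened until it passes the new pair at most once; the last two
  disjuncts are the two directions of passing it.\<close>

lemma conn_insert:
  "conn (insert (a, b) R) x y \<longleftrightarrow>
     conn R x y \<or> conn R x a \<and> conn R b y \<or> conn R x b \<and> conn R a y"
proof
  assume "conn (insert (a, b) R) x y"
  then show "conn R x y \<or> conn R x a \<and> conn R b y \<or> conn R x b \<and> conn R a y"
  proof (induction rule: conn_induct)
    case (step y z)
    from step(2) have "conn R y z \<or> (y = a \<and> z = b) \<or> (y = b \<and> z = a)"
      by (auto intro: conn_base conn_base')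
    then show ?case using step(3) by (metis conn_trans conn_refl conn_sym)
  qed simp
next
  have m: "conn (insert (a, b) R) u v" if "conn R u v" for u v
    using that by (rule conn_mono) auto
  have ab: "conn (insert (a, b) R) a b" by (rule conn_base) simp
  assume "conn R x y \<or> conn R x a \<and> conn R b y \<or> conn R x b \<and> conn R a y"
  then show "conn (insert (a, b) R) x y"
    using m ab by (meson conn_trans conn_sym)
qed

definition cls :: "('x \<times> 'x) set \<Rightarrow> 'x \<Rightarrow> 'x set" where "cls R x = Collect (conn R x)"

lemma num_classes_cls: "num_classes X R = card (cls R ` X)"
  unfolding num_classes_def cls_def conn_def quotient_def Image_def
  by (rule arg_cong[of _ _ card]) auto

lemma cls_eq_iff: "cls R x = cls R y \<longleftrightarrow> conn R x y"
  unfolding cls_def by (auto intro: conn_trans conn_sym)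

lemma num_classes_cong:
  assumes "\<And>x y. x \<in> X \<Longrightarrow> y \<in> X \<Longrightarrow> conn R x y = conn R' x y"
  shows "num_classes X R = num_classes X R'"
proof -
  have "bij_betw (\<lambda>c. cls R' (inv_into X (cls R) c)) (cls R ` X) (cls R' ` X)"
  proof (rule bij_betwI')
    fix c d assume "c \<in> cls R ` X" "d \<in> cls R ` X"
    then obtain x y where xy: "x \<in> X" "y \<in> X" "c = cls R x" "d = cls R y" by auto
    let ?x = "inv_into X (cls R) c" and ?y = "inv_into X (cls R) d"
    have 1: "?x \<in> X" "?y \<in> X" "cls R ?x = c" "cls R ?y = d"
      using xy by (simp_all add: f_inv_into_f inv_into_into)
    show "(cls R' ?x = cls R' ?y) = (c = d)"
      using 1 assms by (metis cls_eq_iff)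
    show "cls R' ?x \<in> cls R' ` X" using 1 by auto
  next
    fix d assume "d \<in> cls R' ` X"
    then obtain y where y: "y \<in> X" "d = cls R' y" by auto
    let ?x = "inv_into X (cls R) (cls R y)"
    have 1: "?x \<in> X" "cls R ?x = cls R y" using y by (simp_all add: f_inv_into_f inv_into_into)
    then show "\<exists>c\<in>cls R ` X. d = cls R' (inv_into X (cls R) c)"
      using y assms by (intro bexI[of _ "cls R y"]) (auto simp: cls_eq_iff intro: conn_sym)
  qed
  then show ?thesis by (simp add: num_classes_cls bij_betw_same_card)
qed

text \<open>Classes are compared through representatives, so injectivity and surjectivity of
  \<open>h\<close> on classes suffice; \<open>h\<close> may identify connected elements.\<close>

lemma num_classes_inj_transfer:
  assumes "\<And>x x'. x \<in> X \<Longrightarrow> x' \<in> X \<Longrightarrow> conn R x x' \<longleftrightarrow> conn R' (h x) (h x')"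
    and "\<And>y. y \<in> Y \<Longrightarrow> \<exists>x\<in>X. conn R' y (h x)" and "h ` X \<subseteq> Y"
  shows "num_classes X R = num_classes Y R'"
proof -
  have "bij_betw (\<lambda>c. cls R' (h (inv_into X (cls R) c))) (cls R ` X) (cls R' ` Y)"
  proof (rule bij_betwI')
    fix c d assume cd: "c \<in> cls R ` X" "d \<in> cls R ` X"
    let ?x = "inv_into X (cls R) c" and ?y = "inv_into X (cls R) d"
    have 1: "?x \<in> X" "?y \<in> X" "cls R ?x = c" "cls R ?y = d"
      using cd by (simp_all add: f_inv_into_f inv_into_into)
    show "(cls R' (h ?x) = cls R' (h ?y)) = (c = d)"
      using 1 assms(1) by (metis cls_eq_iff)
    show "cls R' (h ?x) \<in> cls R' ` Y" using 1 assms(3) by auto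
  next
    fix d assume "d \<in> cls R' ` Y"
    then obtain y where y: "y \<in> Y" "d = cls R' y" by auto
    then obtain x where x: "x \<in> X" "conn R' y (h x)" using assms(2) by blast
    let ?x = "inv_into X (cls R) (cls R x)"
    have 1: "?x \<in> X" "cls R ?x = cls R x" using x by (simp_all add: f_inv_into_f inv_into_into)
    then have "conn R' (h ?x) (h x)" using assms(1) x by (metis cls_eq_iff)
    then show "\<exists>c\<in>cls R ` X. d = cls R' (h (inv_into X (cls R) c))"
      using x y by (intro bexI[of _ "cls R x"]) (auto simp: cls_eq_iff intro: conn_sym conn_trans)
  qed
  then show ?thesis by (simp add: num_classes_cls bij_betw_same_card)
qed

text \<open>The maps are inverse to each other up to connectedness. This is how loops of one picture
  are matched with loops, faces or regions of another.\<close>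

lemma num_classes_transfer:
  assumes "\<And>a b. (a, b) \<in> R \<Longrightarrow> conn R' (h a) (h b)" "\<And>a b. (a, b) \<in> R' \<Longrightarrow> conn R (g a) (g b)"
    and "\<And>x. x \<in> X \<Longrightarrow> conn R x (g (h x))" "\<And>y. y \<in> Y \<Longrightarrow> conn R' y (h (g y))"
    and "h ` X \<subseteq> Y" "g ` Y \<subseteq> X"
  shows "num_classes X R = num_classes Y R'"
proof (rule num_classes_inj_transfer[where h = h])
  fix x x' assume x: "x \<in> X" "x' \<in> X"
  show "conn R x x' \<longleftrightarrow> conn R' (h x) (h x')"
    using conn_map[of R x x' R' h] conn_map[of R' "h x" "h x'" R g] assms(1,2) assms(3)[OF x(1)]
      assms(3)[OF x(2)] by (meson conn_sym conn_trans)
next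
  fix y assume "y \<in> Y" then show "\<exists>x\<in>X. conn R' y (h x)"
    using assms(4,6) by blast
qed (use assms in auto)

lemma num_classes_collapse:
  assumes "\<And>x y. x \<in> X \<Longrightarrow> y \<in> X \<Longrightarrow> h x = h y \<Longrightarrow> conn R x y" "R \<subseteq> X \<times> X"
  shows "num_classes X R = num_classes (h ` X) (map_prod h h ` R)"
proof (rule num_classes_transfer[where h = h and g = "inv_into X h"])
  fix a b assume "(a, b) \<in> map_prod h h ` R"
  then obtain x y where xy: "(x, y) \<in> R" "a = h x" "b = h y" by auto
  then have "x \<in> X" "y \<in> X" using assms(2) by auto
  then have "conn R (inv_into X h a) x" "conn R y (inv_into X h b)"
    using xy by (auto intro!: assms(1) inv_into_into simp: f_inv_into_f)
  then show "conn R (inv_into X h a) (inv_into X h b)"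
    using xy(1) by (meson conn_base conn_trans)
next
  fix x assume "x \<in> X" then show "conn R x (inv_into X h (h x))"
    by (intro assms(1)) (auto intro: inv_into_into simp: f_inv_into_f)
qed (auto intro: conn_base inv_into_into simp: f_inv_into_f)

text \<open>A pair between two different classes merges exactly these two. Changes of loop and
  region counts are later reduced to this step.\<close>

lemma num_classes_insert:
  assumes "finite X" "a \<in> X" "b \<in> X"
  shows "num_classes X R = num_classes X (insert (a, b) R) + (if conn R a b then 0 else 1)"
proof (cases "conn R a b")
  case True
  then have "conn (insert (a, b) R) = conn R"
    by (intro conn_cong_sets) (auto intro: conn_base)
  then have "num_classes X R = num_classes X (insert (a, b) R)"
    by (intro num_classes_cong) auto
  then show ?thesis using True by simp
next
  case False
  let ?R = "insert (a, b) R"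
  have *: "cls ?R x = (if conn R x a \<or> conn R x b then cls R a \<union> cls R b else cls R x)" for x
    unfolding cls_def conn_insert by (auto intro: conn_trans conn_sym)
  have 1: "cls R ` X = insert (cls R a) (insert (cls R b) {c\<in>cls R ` X. c \<noteq> cls R a \<and> c \<noteq> cls R b})"
    using assms by auto
  have 2: "cls ?R ` X = insert (cls R a \<union> cls R b) {c\<in>cls R ` X. c \<noteq> cls R a \<and> c \<noteq> cls R b}"
  proof
    show "cls ?R ` X \<subseteq> insert (cls R a \<union> cls R b) {c\<in>cls R ` X. c \<noteq> cls R a \<and> c \<noteq> cls R b}"
    proof
      fix c assume "c \<in> cls ?R ` X"
      then obtain x where x: "x \<in> X" "c = cls ?R x" by auto
      show "c \<in> insert (cls R a \<union> cls R b) {c\<in>cls R ` X. c \<noteq> cls R a \<and> c \<noteq> cls R b}"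
      proof (cases "conn R x a \<or> conn R x b")
        case True
        then have "c = cls R a \<union> cls R b" using x(2) by (simp only: * if_True)
        then show ?thesis by blast
      next
        case False
        then have "c = cls R x" using x(2) by (simp only: * if_False)
        moreover from this have "c \<noteq> cls R a" "c \<noteq> cls R b" using False by (simp_all add: cls_eq_iff)
        ultimately show ?thesis using x(1) by blast
      qed
    qed
    have "cls R a \<union> cls R b = cls ?R a" by (simp add: *)
    then have "cls R a \<union> cls R b \<in> cls ?R ` X" using assms(2) by (rule image_eqI)
    moreover have "cls R x = cls ?R x" if "x \<in> X" "cls R x \<noteq> cls R a" "cls R x \<noteq> cls R b" for x
      using that by (auto simp: * cls_eq_iff)
    ultimately show "insert (cls R a \<union> cls R b) {c\<in>cls R ` X. c \<noteq> cls R a \<and> c \<noteq> cls R b} \<subseteq> cls ?R ` X"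
      by blast
  qed
  have 3: "cls R a \<union> cls R b \<notin> {c\<in>cls R ` X. c \<noteq> cls R a \<and> c \<noteq> cls R b}"
  proof
    assume "cls R a \<union> cls R b \<in> {c\<in>cls R ` X. c \<noteq> cls R a \<and> c \<noteq> cls R b}"
    then obtain x where x: "cls R a \<union> cls R b = cls R x" "cls R x \<noteq> cls R a" by auto
    have "a \<in> cls R a" by (simp add: cls_def)
    then have "a \<in> cls R x" using x by auto
    then show False using x(2) by (simp add: cls_eq_iff) (simp add: cls_def)
  qed
  have 4: "cls R a \<noteq> cls R b" using False by (simp add: cls_eq_iff)
  have fin: "finite {c\<in>cls R ` X. c \<noteq> cls R a \<and> c \<noteq> cls R b}" using assms by auto
  have "num_classes X R = card {c\<in>cls R ` X. c \<noteq> cls R a \<and> c \<noteq> cls R b} + 2"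
    unfolding num_classes_cls by (subst 1) (use 4 fin in auto)
  moreover have "num_classes X ?R = card {c\<in>cls R ` X. c \<noteq> cls R a \<and> c \<noteq> cls R b} + 1"
    unfolding num_classes_cls by (subst 2) (use 3 fin in auto)
  ultimately show ?thesis using False by simp
qed

lemma conn_empty [simp]: "conn {} x y \<longleftrightarrow> x = y"
  by (auto simp: conn_def)

lemma num_classes_empty [simp]: "num_classes X {} = card X"
proof -
  have "inj_on (cls {}) X" by (auto simp: inj_on_def cls_eq_iff)
  then show ?thesis by (simp add: num_classes_cls card_image)
qed

lemma num_classes_pos: "finite X \<Longrightarrow> X \<noteq> {} \<Longrightarrow> num_classes X R > 0"
  by (simp add: num_classes_cls card_gt_0_iff)

lemma num_classes_le_card: "finite X \<Longrightarrow> num_classes X R \<le> card X"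
  by (simp add: num_classes_cls card_image_le)

lemma num_classes_one_iff:
  assumes "finite X" "X \<noteq> {}"
  shows "num_classes X R = 1 \<longleftrightarrow> (\<forall>x\<in>X. \<forall>y\<in>X. conn R x y)"
proof
  assume "num_classes X R = 1"
  then obtain c where "cls R ` X = {c}" by (auto simp: num_classes_cls card_1_singleton_iff)
  then have "cls R x = c" if "x \<in> X" for x using that by auto
  then show "\<forall>x\<in>X. \<forall>y\<in>X. conn R x y" by (metis cls_eq_iff)
next
  assume *: "\<forall>x\<in>X. \<forall>y\<in>X. conn R x y"
  obtain x where "x \<in> X" using assms by auto
  moreover from this have "cls R y = cls R x" if "y \<in> X" for y using * that by (simp add: cls_eq_iff)
  ultimately have "cls R ` X = {cls R x}" by blast
  then show "num_classes X R = 1" by (simp add: num_classes_cls)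
qed

lemma num_classes_antimono:
  assumes "finite X" "R \<subseteq> R'" shows "num_classes X R' \<le> num_classes X R"
proof -
  have "cls R' ` X = (\<lambda>c. \<Union>x\<in>c. cls R' x) ` (cls R ` X)"
  proof -
    have "(\<Union>z\<in>cls R x. cls R' z) = cls R' x" for x
    proof -
      have "cls R' z = cls R' x" if "z \<in> cls R x" for z
      proof -
        have "conn R x z" using that by (simp add: cls_def)
        then have "conn R' x z" using assms(2) by (rule conn_mono)
        then show ?thesis by (simp add: cls_eq_iff conn_sym)
      qed
      moreover have "x \<in> cls R x" by (simp add: cls_def)
      ultimately show ?thesis by blast
    qed
    then show ?thesis by (simp add: image_image)
  qed
  then show ?thesis using assms(1) by (simp add: num_classes_cls card_image_le)
qed

text \<open>Starting from singletons, each pair lowers the number of classes by at most one.\<close>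

lemma num_classes_ge:
  assumes "finite X" "finite R" "R \<subseteq> X \<times> X"
  shows "card X \<le> num_classes X R + card R"
  using assms(2,3)
proof (induction R rule: finite_induct)
  case (insert p R)
  obtain a b where p: "p = (a, b)" by force
  have "num_classes X R \<le> num_classes X (insert p R) + 1"
    using num_classes_insert[of X a b R] insert assms by (auto simp: p split: if_splits)
  with insert show ?case by simp
qed simp

text \<open>A function that is constant on classes is a function on the set of classes. This turns a
  power whose exponent is a class count into a number of colourings, the Fortuin-Kasteleyn step of
  the Potts model.\<close>

lemma card_const_functions:
  assumes "finite X"
  shows "card {s \<in> X \<rightarrow>\<^sub>E A. \<forall>x\<in>X. \<forall>y\<in>X. conn R x y \<longrightarrow> s x = s y} = card A ^ num_classes X R"
proof -
  let ?F = "{s \<in> X \<rightarrow>\<^sub>E A. \<forall>x\<in>X. \<forall>y\<in>X. conn R x y \<longrightarrow> s x = s y}"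
  let ?\<Phi> = "\<lambda>t. restrict (\<lambda>x. t (cls R x)) X"
  have "bij_betw ?\<Phi> ((cls R ` X) \<rightarrow>\<^sub>E A) ?F"
  proof (rule bij_betwI')
    fix t t' assume t: "t \<in> (cls R ` X) \<rightarrow>\<^sub>E A" "t' \<in> (cls R ` X) \<rightarrow>\<^sub>E A"
    show "(?\<Phi> t = ?\<Phi> t') = (t = t')"
    proof
      assume *: "?\<Phi> t = ?\<Phi> t'"
      have "t (cls R x) = t' (cls R x)" if "x \<in> X" for x using fun_cong[OF *, of x] that by simp
      then show "t = t'" using t by (intro PiE_ext) auto
    qed simp
    show "?\<Phi> t \<in> ?F"
    proof (intro CollectI conjI ballI impI)
      fix x y assume "x \<in> X" "y \<in> X" "conn R x y"
      then show "?\<Phi> t x = ?\<Phi> t y" using cls_eq_iff[of R x y] by simp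
    qed (use t in auto)
  next
    fix s assume s: "s \<in> ?F"
    let ?t = "restrict (\<lambda>c. s (inv_into X (cls R) c)) (cls R ` X)"
    have *: "inv_into X (cls R) c \<in> X" "cls R (inv_into X (cls R) c) = c" if "c \<in> cls R ` X" for c
      using that by (simp_all add: f_inv_into_f inv_into_into)
    have "?t \<in> (cls R ` X) \<rightarrow>\<^sub>E A" using s *(1) by auto
    moreover have "s = ?\<Phi> ?t"
    proof
      fix x show "s x = ?\<Phi> ?t x"
      proof (cases "x \<in> X")
        case True
        then have "conn R x (inv_into X (cls R) (cls R x))" using *(2) cls_eq_iff by (metis imageI)
        then have "s x = s (inv_into X (cls R) (cls R x))" using s True * by blast
        then show ?thesis using True by simp
      qed (use s in \<open>simp add: PiE_def extensional_def\<close>)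
    qed
    ultimately show "\<exists>t\<in>(cls R ` X) \<rightarrow>\<^sub>E A. s = ?\<Phi> t" by blast
  qed
  then have "card ?F = card ((cls R ` X) \<rightarrow>\<^sub>E A)" by (rule bij_betw_same_card[symmetric])
  also have "\<dots> = card A ^ num_classes X R" using assms by (simp add: card_funcsetE num_classes_cls)
  finally show ?thesis .
qed

section \<open>State sums\<close>

definition smoothing :: "bool \<Rightarrow> 'e crossing \<Rightarrow> ('e \<times> 'e) set" where
  "smoothing a x = (if a then A_smoothing x else B_smoothing x)"

definition entry_crossing ::
  "(gauss_entry \<Rightarrow> 'e) \<Rightarrow> (gauss_entry \<Rightarrow> 'e) \<Rightarrow> bool \<Rightarrow> nat \<Rightarrow> 'e crossing" where
  "entry_crossing inn out s c =
     mk_crossing s (inn (c, True, s)) (out (c, True, s)) (inn (c, False, s)) (out (c, False, s))"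

definition labels :: "gauss_code \<Rightarrow> nat set" where
  "labels w = fst ` set w"

definition crossing_sign :: "gauss_code \<Rightarrow> nat \<Rightarrow> bool" where
  "crossing_sign w c \<longleftrightarrow> (c, True, True) \<in> set w"

text \<open>The names \<open>inn\<close> and \<open>out\<close> of the edges at an entry are
  parameters, so that one state can be read with positions in the code, with segments of the code,
  or with edges of bands.\<close>

definition state_joins ::
  "(gauss_entry \<Rightarrow> 'e) \<Rightarrow> (gauss_entry \<Rightarrow> 'e) \<Rightarrow> gauss_code \<Rightarrow> nat set \<Rightarrow> ('e \<times> 'e) set" where
  "state_joins inn out w S =
     (\<Union>c\<in>labels w. smoothing (c \<in> S) (entry_crossing inn out (crossing_sign w c) c))"

definition pos :: "gauss_code \<Rightarrow> gauss_entry \<Rightarrow> nat" where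
  "pos w e = (THE i. i < length w \<and> w ! i = e)"

definition next_pos :: "gauss_code \<Rightarrow> gauss_entry \<Rightarrow> nat" where
  "next_pos w e = Suc (pos w e) mod length w"

definition loops :: "gauss_code \<Rightarrow> nat set \<Rightarrow> nat" where
  "loops w S = num_classes (edges w) (state_joins (pos w) (next_pos w) w S)"

definition loop_value :: laurent where
  "loop_value = - (A_var ^ 2) - A_inv ^ 2"

lemma sum_Pow_insert:
  assumes "finite C" "c \<notin> C"
  shows "(\<Sum>S\<in>Pow (insert c C). f S) = (\<Sum>S\<in>Pow C. f (insert c S)) + (\<Sum>S\<in>Pow C. f S)"
proof -
  have "inj_on (insert c) (Pow C)" using assms(2) by (auto simp: inj_on_def insert_ident)
  then have "sum f (insert c ` Pow C) = (\<Sum>S\<in>Pow C. f (insert c S))"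
    by (simp add: sum.reindex)
  moreover have "sum f (Pow (insert c C)) = sum f (Pow C) + sum f (insert c ` Pow C)"
    unfolding Pow_insert using assms by (intro sum.union_disjoint) auto
  ultimately show ?thesis by (simp add: add.commute)
qed

text \<open>Unfolding the recursion gives Kauffman's state sum; \<open>S\<close> is the set of
  crossings with A-smoothing. The joins \<open>J\<close> are kept general because the recursion
  enlarges them at each crossing.\<close>

lemma bracket_expand_states:
  "distinct cs \<Longrightarrow> bracket_expand E (map X cs) J =
     (\<Sum>S\<in>Pow (set cs). A_var ^ card S * A_inv ^ card (set cs - S) *
        loop_value ^ (num_classes E (J \<union> (\<Union>c\<in>set cs. smoothing (c \<in> S) (X c))) - 1))"
proof (induction cs arbitrary: J)
  case Nil
  then show ?case by (simp add: loop_value_def)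
next
  case (Cons c cs)
  have c: "c \<notin> set cs" using Cons.prems by simp
  let ?f = "\<lambda>J S. A_var ^ card S * A_inv ^ card (set cs - S) *
        loop_value ^ (num_classes E (J \<union> (\<Union>c\<in>set cs. smoothing (c \<in> S) (X c))) - 1)"
  let ?g = "\<lambda>S. A_var ^ card S * A_inv ^ card (set (c # cs) - S) *
        loop_value ^ (num_classes E (J \<union> (\<Union>c\<in>set (c # cs). smoothing (c \<in> S) (X c))) - 1)"
  have 1: "?g (insert c S) = A_var * ?f (J \<union> A_smoothing (X c)) S" if "S \<in> Pow (set cs)" for S
  proof -
    have "finite S" "c \<notin> S" using that c finite_subset by auto
    moreover have "set (c # cs) - insert c S = set cs - S" using c by auto
    moreover have "(\<Union>c'\<in>set (c # cs). smoothing (c' \<in> insert c S) (X c')) =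
        A_smoothing (X c) \<union> (\<Union>c'\<in>set cs. smoothing (c' \<in> S) (X c'))"
      using c by (auto simp: smoothing_def split: if_splits)
    ultimately show ?thesis by (simp add: mult.assoc Un_assoc)
  qed
  have 2: "?g S = A_inv * ?f (J \<union> B_smoothing (X c)) S" if "S \<in> Pow (set cs)" for S
  proof -
    have "c \<notin> S" using that c by auto
    then have "set (c # cs) - S = insert c (set cs - S)" by auto
    moreover have "(\<Union>c'\<in>set (c # cs). smoothing (c' \<in> S) (X c')) =
        B_smoothing (X c) \<union> (\<Union>c'\<in>set cs. smoothing (c' \<in> S) (X c'))"
      using \<open>c \<notin> S\<close> by (auto simp: smoothing_def)
    ultimately show ?thesis using c by (simp add: mult_ac Un_assoc)
  qed
  have "bracket_expand E (map X (c # cs)) J =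
      (\<Sum>S\<in>Pow (set cs). ?g (insert c S)) + (\<Sum>S\<in>Pow (set cs). ?g S)"
  proof -
    have "bracket_expand E (map X (c # cs)) J =
        A_var * (\<Sum>S\<in>Pow (set cs). ?f (J \<union> A_smoothing (X c)) S) +
        A_inv * (\<Sum>S\<in>Pow (set cs). ?f (J \<union> B_smoothing (X c)) S)"
      using Cons.prems by (simp add: Cons.IH)
    then show ?thesis by (simp only: sum_distrib_left 1 2 cong: sum.cong)
  qed
  also have "\<dots> = (\<Sum>S\<in>Pow (insert c (set cs)). ?g S)"
    by (rule sum_Pow_insert[symmetric]) (use c in auto)
  finally show ?case by simp
qed

lemma pos_nth: "distinct w \<Longrightarrow> i < length w \<Longrightarrow> pos w (w ! i) = i"
  unfolding pos_def by (rule the_equality) (auto simp: nth_eq_iff_index_eq)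

lemma pos_in:
  assumes "distinct w" "e \<in> set w"
  shows "pos w e < length w" "w ! pos w e = e"
  using assms by (auto simp: in_set_conv_nth pos_nth)

text \<open>Both passages of a crossing occur, with one common sign; hence as a set a matched code
  is just a set of labels with one sign per label.\<close>

lemma matched_iff_sign:
  assumes "matched w"
  shows "(c, ov, s) \<in> set w \<longleftrightarrow> c \<in> labels w \<and> s = crossing_sign w c"
proof -
  have m: "(c', \<not> ov', s') \<in> set w \<and> (c', ov', \<not> s') \<notin> set w" if "(c', ov', s') \<in> set w" for c' ov' s'
    using assms that by (auto simp: matched_def)
  show ?thesis
  proof
    assume *: "(c, ov, s) \<in> set w"
    then have "c \<in> labels w" by (force simp: labels_def)
    with * show "c \<in> labels w \<and> s = crossing_sign w c"
      using m[OF *] m[of c True s] m[of c False s]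
      by (cases ov; cases s) (auto simp: crossing_sign_def)
  next
    assume *: "c \<in> labels w \<and> s = crossing_sign w c"
    then obtain ov' s' where "(c, ov', s') \<in> set w" by (auto simp: labels_def)
    then show "(c, ov, s) \<in> set w" using m[of c True s'] m[of c False s'] *
      by (cases ov; cases ov'; cases s'; cases s) (auto simp: crossing_sign_def)
  qed
qed

lemma finite_labels [simp]: "finite (labels w)"
  by (simp add: labels_def)

lemma concat_map_single:
  "distinct xs \<Longrightarrow> x \<in> set xs \<Longrightarrow> concat (map (\<lambda>y. if y = x then [f y] else []) xs) = [f x]"
proof (induction xs)
  case (Cons y ys)
  show ?case
  proof (cases "y = x")
    case True
    then have "x \<notin> set ys" using Cons.prems by auto
    then have "concat (map (\<lambda>y. if y = x then [f y] else []) ys) = []"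
      by (auto intro!: )
    then show ?thesis using True by simp
  qed (use Cons in auto)
qed simp

lemma concat_map_filter:
  "concat (map (\<lambda>y. if P y then [f y] else []) xs) = map f (filter P xs)"
  by (induction xs) auto

lemma crossings_eq:
  assumes "matched w"
  shows "crossings w = map (\<lambda>c. entry_crossing (pos w) (next_pos w) (crossing_sign w c) c)
     (map fst (filter (\<lambda>e. fst (snd e)) w))"
proof -
  have d: "distinct w" using assms by (simp add: matched_def)
  let ?n = "length w"
  let ?X = "\<lambda>c. entry_crossing (pos w) (next_pos w) (crossing_sign w c) c"
  \<comment> \<open>For fixed \<open>i\<close> at most one \<open>j\<close> passes the test, namely
    the under-passage of the same crossing, so the inner list is a singleton or empty.\<close>
  have row: "concat (map (\<lambda>j. if fst (snd (w ! i)) \<and> w ! j = (fst (w ! i), False, snd (snd (w ! i)))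
        then [mk_crossing (snd (snd (w ! i))) i (Suc i mod ?n) j (Suc j mod ?n)] else []) [0..<?n]) =
      (if fst (snd (w ! i)) then [?X (fst (w ! i))] else [])" if i: "i < ?n" for i
  proof (cases "fst (snd (w ! i))")
    case True
    obtain c s where e: "w ! i = (c, True, s)" using True by (metis prod.collapse)
    then have "(c, True, s) \<in> set w" using i by (metis nth_mem)
    then have cs: "c \<in> labels w" "s = crossing_sign w c" using matched_iff_sign[OF assms] by auto
    then have f: "(c, False, s) \<in> set w" using matched_iff_sign[OF assms] by auto
    let ?j = "pos w (c, False, s)"
    have j: "?j < ?n" "w ! ?j = (c, False, s)" using pos_in[OF d f] by auto
    have *: "w ! k = (c, False, s) \<longleftrightarrow> k = ?j" if "k \<in> set [0..<?n]" for k
      using j that d by (auto simp: nth_eq_iff_index_eq[symmetric] pos_nth)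
    have "concat (map (\<lambda>k. if w ! k = (c, False, s) then [mk_crossing s i (Suc i mod ?n) k (Suc k mod ?n)] else []) [0..<?n])
        = concat (map (\<lambda>k. if k = ?j then [mk_crossing s i (Suc i mod ?n) k (Suc k mod ?n)] else []) [0..<?n])"
      using * by (intro arg_cong[of _ _ concat] map_cong) auto
    also have "\<dots> = [mk_crossing s i (Suc i mod ?n) ?j (Suc ?j mod ?n)]"
      by (rule concat_map_single) (use j in auto)
    also have "\<dots> = [?X c]"
      using e pos_nth[OF d i] cs(2)[symmetric] by (simp add: entry_crossing_def next_pos_def)
    finally show ?thesis unfolding e fst_conv snd_conv by simp
  qed simp
  have "crossings w = concat (map (\<lambda>i. if fst (snd (w ! i)) then [?X (fst (w ! i))] else []) [0..<?n])"
    unfolding crossings_def by (intro arg_cong[of _ _ concat] map_cong refl row) auto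
  also have "\<dots> = concat (map (\<lambda>e. if fst (snd e) then [?X (fst e)] else []) (map (\<lambda>i. w ! i) [0..<?n]))"
    by (simp add: o_def)
  also have "\<dots> = map ?X (map fst (filter (\<lambda>e. fst (snd e)) w))"
    by (simp add: map_nth concat_map_filter)
  finally show ?thesis .
qed

lemma over_labels:
  assumes "matched w"
  shows "distinct (map fst (filter (\<lambda>e. fst (snd e)) w))" "set (map fst (filter (\<lambda>e. fst (snd e)) w)) = labels w"
proof -
  have "inj_on fst {e \<in> set w. fst (snd e)}"
    using matched_iff_sign[OF assms] by (auto simp: inj_on_def)
  then show "distinct (map fst (filter (\<lambda>e. fst (snd e)) w))"
    using assms by (simp add: distinct_map matched_def)
  show "set (map fst (filter (\<lambda>e. fst (snd e)) w)) = labels w"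
    using matched_iff_sign[OF assms] by (auto simp: labels_def image_iff)
qed

theorem bracket_loops:
  assumes "matched w"
  shows "bracket w = (\<Sum>S\<in>Pow (labels w). A_var ^ card S * A_inv ^ card (labels w - S) *
           loop_value ^ (loops w S - 1))"
  unfolding bracket_def crossings_eq[OF assms] bracket_expand_states[OF over_labels(1)[OF assms]]
    over_labels(2)[OF assms] loops_def state_joins_def by simp

lemma smoothing_entry_crossing_map:
  "map_prod h h ` smoothing a (entry_crossing inn out s c) =
     smoothing a (entry_crossing (\<lambda>e. h (inn e)) (\<lambda>e. h (out e)) s c)"
  by (auto simp: smoothing_def entry_crossing_def mk_crossing_def A_smoothing_def B_smoothing_def
      joins_left_right_def joins_top_bottom_def)

lemma state_joins_map:
  "map_prod h h ` state_joins inn out w S = state_joins (\<lambda>e. h (inn e)) (\<lambda>e. h (out e)) w S"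
  by (simp add: state_joins_def image_UN smoothing_entry_crossing_map)

lemma state_joins_cong:
  assumes "matched w" "\<And>e. e \<in> set w \<Longrightarrow> inn e = inn' e" "\<And>e. e \<in> set w \<Longrightarrow> out e = out' e"
  shows "state_joins inn out w S = state_joins inn' out' w S"
  unfolding state_joins_def entry_crossing_def
  using matched_iff_sign[OF assms(1)] assms(2,3) by (intro SUP_cong) auto

lemma state_joins_subset:
  assumes "matched w" "\<And>e. e \<in> set w \<Longrightarrow> inn e \<in> E" "\<And>e. e \<in> set w \<Longrightarrow> out e \<in> E"
  shows "state_joins inn out w S \<subseteq> E \<times> E"
proof -
  have "smoothing a (entry_crossing inn out (crossing_sign w c) c) \<subseteq> E \<times> E" if "c \<in> labels w" for a c
  proof -
    have "(c, ov, crossing_sign w c) \<in> set w" for ov using matched_iff_sign[OF assms(1)] that by simp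
    then have "inn (c, ov, crossing_sign w c) \<in> E" "out (c, ov, crossing_sign w c) \<in> E" for ov
      using assms(2,3) by auto
    then show ?thesis
      by (cases "crossing_sign w c") (auto simp: smoothing_def entry_crossing_def mk_crossing_def
          A_smoothing_def B_smoothing_def joins_left_right_def joins_top_bottom_def)
  qed
  then show ?thesis unfolding state_joins_def by blast
qed

lemma num_classes_cong_conn:
  "(\<And>a b. (a, b) \<in> R \<Longrightarrow> conn R' a b) \<Longrightarrow> (\<And>a b. (a, b) \<in> R' \<Longrightarrow> conn R a b) \<Longrightarrow>
   num_classes X R = num_classes X R'"
  using conn_cong_sets[of R R'] by (intro num_classes_cong) auto

lemma num_classes_collapse_to:
  assumes "\<And>x y. x \<in> X \<Longrightarrow> y \<in> X \<Longrightarrow> h x = h y \<Longrightarrow> conn (J \<union> R) x y"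
    and "J \<subseteq> X \<times> X" "R \<subseteq> X \<times> X" "\<And>a b. (a, b) \<in> J \<Longrightarrow> h a = h b"
  shows "num_classes X (J \<union> R) = num_classes (h ` X) (map_prod h h ` R)"
proof -
  have "num_classes X (J \<union> R) = num_classes (h ` X) (map_prod h h ` (J \<union> R))"
    by (rule num_classes_collapse) (use assms in auto)
  also have "\<dots> = num_classes (h ` X) (map_prod h h ` R)"
    using assms(4) by (intro num_classes_cong_conn) (auto simp: image_Un intro: conn_base)
  finally show ?thesis .
qed

section \<open>Gauss codes cut into consecutive segments\<close>

definition seg_start :: "'a list list \<Rightarrow> nat \<Rightarrow> nat" where
  "seg_start segs j = length (concat (take j segs))"

lemma seg_start_0 [simp]: "seg_start segs 0 = 0"
  by (simp add: seg_start_def)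

lemma seg_start_Suc: "j < length segs \<Longrightarrow> seg_start segs (Suc j) = seg_start segs j + length (segs ! j)"
  by (simp add: seg_start_def take_Suc_conv_app_nth)

lemma seg_start_length [simp]: "seg_start segs (length segs) = length (concat segs)"
  by (simp add: seg_start_def)

lemma seg_start_mono: "j \<le> j' \<Longrightarrow> j' \<le> length segs \<Longrightarrow> seg_start segs j \<le> seg_start segs j'"
proof (induction j' rule: dec_induct)
  case (step k)
  then show ?case using seg_start_Suc[of k segs] by simp
qed simp

lemma seg_start_le:
  assumes "j < length segs" "off \<le> length (segs ! j)"
  shows "seg_start segs j + off \<le> length (concat segs)"
  using seg_start_mono[of "Suc j" "length segs" segs] seg_start_Suc[of j segs] assms by simp

lemma nth_concat_seg:
  assumes "j < length segs" "off < length (segs ! j)"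
  shows "concat segs ! (seg_start segs j + off) = segs ! j ! off"
proof -
  have "concat segs = concat (take j segs) @ segs ! j @ concat (drop (Suc j) segs)"
    using assms(1) by (metis concat.simps(2) concat_append id_take_nth_drop)
  then show ?thesis using assms(2) by (simp add: seg_start_def nth_append)
qed

lemma seg_position_exists:
  assumes "p < length (concat segs)"
  shows "\<exists>j off. j < length segs \<and> off < length (segs ! j) \<and> p = seg_start segs j + off"
proof -
  have "\<exists>j off. j < length segs \<and> off < length (segs ! j) \<and> p = seg_start segs j + off"
    if "k \<le> length segs" "p < seg_start segs k" for k
    using that
  proof (induction k)
    case (Suc k)
    show ?case
    proof (cases "p < seg_start segs k")
      case False
      then show ?thesis using Suc seg_start_Suc[of k segs]
        by (intro exI[of _ k] exI[of _ "p - seg_start segs k"]) auto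
    qed (use Suc in auto)
  qed simp
  from this[of "length segs"] show ?thesis using assms by simp
qed

text \<open>The name \<open>nm j off\<close> stands for the edge before offset \<open>off\<close> of
  segment \<open>j\<close>. Each segment has its own first and last edge, so an edge between two
  segments has two names, which are joined here. Segments can then be moved without
  renumbering.\<close>

definition seg_joins :: "'a list list \<Rightarrow> (nat \<Rightarrow> nat \<Rightarrow> 'e) \<Rightarrow> ('e \<times> 'e) set" where
  "seg_joins segs nm = {(nm j (length (segs ! j)), nm (Suc j mod length segs) 0) | j. j < length segs}"

definition seg_edges :: "'a list list \<Rightarrow> (nat \<Rightarrow> nat \<Rightarrow> 'e) \<Rightarrow> 'e set" where
  "seg_edges segs nm = {nm j off | j off. j < length segs \<and> off \<le> length (segs ! j)}"

text \<open>If two places in different segments have the same position, the first is the end of its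
  segment and all segments strictly between are empty, so a chain of joins leads from one to the
  other.\<close>

lemma conn_segments_le:
  assumes "seg_start segs j + off = seg_start segs j' + off'" "j \<le> j'" "j' < length segs"
    "off \<le> length (segs ! j)" "off' \<le> length (segs ! j')"
  shows "conn (seg_joins segs nm) (nm j off) (nm j' off')"
  using assms(2,1,3,4,5)
proof (induction j arbitrary: off rule: inc_induct)
  case base then show ?case by simp
next
  case (step j)
  have "Suc j \<le> j'" "j < length segs" using step.hyps step.prems by auto
  then have *: "seg_start segs j + length (segs ! j) \<le> seg_start segs j'"
    using seg_start_mono[of "Suc j" j' segs] seg_start_Suc[of j segs] step.prems by simp
  then have off: "off = length (segs ! j)" using step.prems by linarith
  have "(nm j off, nm (Suc j) 0) \<in> seg_joins segs nm"
    unfolding seg_joins_def using off \<open>Suc j \<le> j'\<close> step.prems(2) \<open>j < length segs\<close> by force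
  moreover have "conn (seg_joins segs nm) (nm (Suc j) 0) (nm j' off')"
    using step.prems off \<open>j < length segs\<close> by (intro step.IH) (auto simp: seg_start_Suc)
  ultimately show ?case by (meson conn_base conn_trans)
qed

lemma conn_segments_eq:
  assumes "seg_start segs j + off = seg_start segs j' + off'" "j < length segs" "j' < length segs"
    "off \<le> length (segs ! j)" "off' \<le> length (segs ! j')"
  shows "conn (seg_joins segs nm) (nm j off) (nm j' off')"
  using conn_segments_le[of segs j off j' off' nm] conn_segments_le[of segs j' off' j off nm] assms
  by (cases "j \<le> j'") (auto intro: conn_sym)

lemma conn_segments:
  assumes "(seg_start segs j + off) mod length (concat segs) = (seg_start segs j' + off') mod length (concat segs)"
    "j < length segs" "j' < length segs" "off \<le> length (segs ! j)" "off' \<le> length (segs ! j')"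
  shows "conn (seg_joins segs nm) (nm j off) (nm j' off')"
proof -
  let ?n = "length (concat segs)" and ?m = "length segs"
  let ?p = "seg_start segs j + off" and ?q = "seg_start segs j' + off'"
  \<comment> \<open>The end of the code and its beginning are one place of the cyclic word; this is
    the only coincidence modulo the length that equality of positions misses.\<close>
  have wrap: "conn (seg_joins segs nm) (nm j off) (nm j' off')"
    if "seg_start segs j + off = ?n" "seg_start segs j' + off' = 0" "j < length segs" "j' < length segs"
      "off \<le> length (segs ! j)" "off' \<le> length (segs ! j')" for j j' off off'
  proof -
    have m: "?m > 0" "?m - 1 < ?m" "Suc (?m - 1) mod ?m = 0"
      using that(3) by (cases "length segs"; simp)+
    have "seg_start segs (?m - 1) + length (segs ! (?m - 1)) = ?n"
      using seg_start_Suc[OF m(2)] m(1) by simp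
    then have "conn (seg_joins segs nm) (nm j off) (nm (?m - 1) (length (segs ! (?m - 1))))"
      using that m by (intro conn_segments_eq) auto
    moreover have "(nm (?m - 1) (length (segs ! (?m - 1))), nm 0 0) \<in> seg_joins segs nm"
      unfolding seg_joins_def using m by force
    moreover have "conn (seg_joins segs nm) (nm 0 0) (nm j' off')"
      using that m by (intro conn_segments_eq) auto
    ultimately show ?thesis by (meson conn_base conn_trans)
  qed
  have le: "?p \<le> ?n" "?q \<le> ?n" using assms by (auto intro: seg_start_le)
  have "?p = ?q \<or> ?p = ?n \<and> ?q = 0 \<or> ?p = 0 \<and> ?q = ?n"
    using assms(1) le by (metis le_neq_implies_less mod_less mod_self)
  then show ?thesis
    using conn_segments_eq[OF _ assms(2-5)] wrap[of j off j' off'] wrap[of j' off' j off] assms(2-5)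
    by (auto intro: conn_sym)
qed

text \<open>Sending a name to its position contracts precisely the joins between segments, so loops
  may be counted with any injective naming of the pieces.\<close>

theorem loops_segments:
  assumes "matched (concat segs)" "segs \<noteq> []"
    and inj: "inj_on (\<lambda>(j, off). nm j off) {(j, off). j < length segs \<and> off \<le> length (segs ! j)}"
    and inn: "\<And>j off. j < length segs \<Longrightarrow> off < length (segs ! j) \<Longrightarrow> inn (segs ! j ! off) = nm j off"
    and out: "\<And>j off. j < length segs \<Longrightarrow> off < length (segs ! j) \<Longrightarrow> out (segs ! j ! off) = nm j (Suc off)"
  shows "loops (concat segs) S =
    num_classes (seg_edges segs nm) (seg_joins segs nm \<union> state_joins inn out (concat segs) S)"
proof -
  let ?w = "concat segs" and ?m = "length segs"
  let ?n = "length ?w"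
  let ?I = "{(j, off). j < length segs \<and> off \<le> length (segs ! j)}"
  let ?E = "seg_edges segs nm"
  have d: "distinct ?w" using assms(1) by (simp add: matched_def)
  define h where "h e = (case inv_into ?I (\<lambda>(j, off). nm j off) e of (j, off) \<Rightarrow> (seg_start segs j + off) mod ?n)" for e
  have h: "h (nm j off) = (seg_start segs j + off) mod ?n" if "j < ?m" "off \<le> length (segs ! j)" for j off
    using inv_into_f_f[OF inj, of "(j, off)"] that by (simp add: h_def)
  have ent: "\<exists>j off. j < ?m \<and> off < length (segs ! j) \<and> e = segs ! j ! off" if "e \<in> set ?w" for e
    using that unfolding set_concat by (auto simp: in_set_conv_nth) blast
  have pos: "pos ?w (segs ! j ! off) = seg_start segs j + off"
    if "j < ?m" "off < length (segs ! j)" for j off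
    using pos_nth[OF d, of "seg_start segs j + off"] nth_concat_seg[OF that] that
      seg_start_le[of j segs "Suc off"] by simp
  have lt: "seg_start segs j + off < ?n" if "j < ?m" "off < length (segs ! j)" for j off
    using seg_start_le[of j segs "Suc off"] that by simp
  have EE: "inn e \<in> ?E" "out e \<in> ?E" if "e \<in> set ?w" for e
    using ent[OF that] inn out by (fastforce simp: seg_edges_def)+
  have hp: "h (inn e) = pos ?w e" "h (out e) = next_pos ?w e" if "e \<in> set ?w" for e
    using ent[OF that] inn out h pos lt by (auto simp: next_pos_def)
  have JE: "seg_joins segs nm \<subseteq> ?E \<times> ?E"
    using assms(2) by (fastforce simp: seg_joins_def seg_edges_def)
  have m0: "?m > 0" using assms(2) by simp
  have "num_classes ?E (seg_joins segs nm \<union> state_joins inn out ?w S) =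
      num_classes (h ` ?E) (map_prod h h ` state_joins inn out ?w S)"
  proof (rule num_classes_collapse_to)
    fix x y assume "x \<in> ?E" "y \<in> ?E" "h x = h y"
    then have "conn (seg_joins segs nm) x y"
      by (auto simp: seg_edges_def h intro!: conn_segments)
    then show "conn (seg_joins segs nm \<union> state_joins inn out ?w S) x y"
      by (rule conn_mono) auto
  next
    fix a b assume "(a, b) \<in> seg_joins segs nm"
    then obtain j where j: "j < ?m" "a = nm j (length (segs ! j))" "b = nm (Suc j mod ?m) 0"
      by (auto simp: seg_joins_def)
    show "h a = h b"
    proof (cases "Suc j = ?m")
      case True
      then have "seg_start segs j + length (segs ! j) = ?n" using seg_start_Suc[OF j(1)] by simp
      then show ?thesis using j True m0 by (simp add: h)
    next
      case False
      then have "Suc j < ?m" using j by simp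
      then show ?thesis using j by (simp add: h seg_start_Suc)
    qed
  next
    show "state_joins inn out ?w S \<subseteq> ?E \<times> ?E" by (rule state_joins_subset[OF assms(1)]) (fact EE)+
  qed (fact JE)
  also have "h ` ?E = edges ?w"
  proof (cases "?n = 0")
    \<comment> \<open>The empty code still has its closed edge 0, onto which all names
      collapse.\<close>
    case True
    have "nm 0 0 \<in> ?E" using m0 by (auto simp: seg_edges_def)
    moreover have "h x = 0" if "x \<in> ?E" for x
      using that seg_start_le[of _ segs] True by (fastforce simp: seg_edges_def h)
    ultimately have "h ` ?E = {0}" by force
    then show ?thesis using True by (auto simp: edges_def)
  next
    case False
    have n0: "?n > 0" using False by linarith
    have "h ` ?E \<subseteq> {..<?n}"
      unfolding seg_edges_def using mod_less_divisor[OF n0] by (auto simp only: h lessThan_iff)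
    moreover have "p \<in> h ` ?E" if p: "p < ?n" for p
    proof -
      obtain j off where *: "j < ?m" "off < length (segs ! j)" "p = seg_start segs j + off"
        using seg_position_exists[OF p] by blast
      then have "h (nm j off) = p" using p by (simp add: h)
      moreover have "nm j off \<in> ?E" using * less_imp_le unfolding seg_edges_def by blast
      ultimately show ?thesis by blast
    qed
    ultimately have "h ` ?E = {..<?n}" by blast
    moreover have "max 1 ?n = ?n" using False by linarith
    ultimately show ?thesis by (simp add: edges_def)
  qed
  also have "map_prod h h ` state_joins inn out ?w S = state_joins (pos ?w) (next_pos ?w) ?w S"
    unfolding state_joins_map by (rule state_joins_cong[OF assms(1)]) (use hp in auto)
  finally show ?thesis by (simp add: loops_def)
qed

lemma smoothing_map_crossing:
  "A_smoothing (map_crossing g x) = map_prod g g ` A_smoothing x"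
  "B_smoothing (map_crossing g x) = map_prod g g ` B_smoothing x"
  by (cases x; simp add: A_smoothing_def B_smoothing_def joins_left_right_def joins_top_bottom_def)+

lemma mk_crossing_map:
  "mk_crossing s (g a) (g b) (g c) (g d) = map_crossing g (mk_crossing s a b c d)"
  by (simp add: mk_crossing_def)

lemma A_var_A_inv [simp]: "A_var * A_inv = 1" "A_inv * A_var = 1"
  by (simp_all add: A_var_def A_inv_def mult_single flip: single_one)

lemma bracket_segments:
  assumes "matched (concat segs)" "segs \<noteq> []"
    and "inj_on (\<lambda>(j, off). nm j off) {(j, off). j < length segs \<and> off \<le> length (segs ! j)}"
    and "\<And>j off. j < length segs \<Longrightarrow> off < length (segs ! j) \<Longrightarrow> inn (segs ! j ! off) = nm j off"
    and "\<And>j off. j < length segs \<Longrightarrow> off < length (segs ! j) \<Longrightarrow> out (segs ! j ! off) = nm j (Suc off)"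
    and "distinct cs" "set cs = labels (concat segs)"
  shows "bracket (concat segs) = bracket_expand (seg_edges segs nm)
    (map (\<lambda>c. entry_crossing inn out (crossing_sign (concat segs) c) c) cs) (seg_joins segs nm)"
proof -
  have "loops (concat segs) S = num_classes (seg_edges segs nm)
      (seg_joins segs nm \<union> state_joins inn out (concat segs) S)" for S
    by (rule loops_segments) (use assms in auto)
  then show ?thesis
    unfolding bracket_loops[OF assms(1)] bracket_expand_states[OF assms(6)] assms(7)
    by (simp only: state_joins_def)
qed

section \<open>Symbolic elimination of interior edges of a local picture\<close>

definition touching :: "('e \<times> 'e) set \<Rightarrow> 'e set" where
  "touching R = fst ` R \<union> snd ` R"

lemma conn_isolated:
  assumes "conn R x y" "x \<notin> touching R" shows "y = x"
  using assms(1) by (induction rule: conn_induct) (use assms(2) in \<open>force simp: touching_def\<close>)+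

lemma num_classes_isolated:
  assumes "finite E" "p \<in> E" "p \<notin> touching R"
  shows "num_classes E R = num_classes (E - {p}) R + 1"
proof -
  have "cls R ` E = insert (cls R p) (cls R ` (E - {p}))" using assms(2) by auto
  moreover have "cls R p \<notin> cls R ` (E - {p})"
    using conn_isolated[OF _ assms(3)] by (auto simp: cls_eq_iff)
  ultimately show ?thesis using assms(1) by (simp add: num_classes_cls)
qed

text \<open>With no further join at it, \<open>p\<close> is a subdivision point of an arc from
  \<open>a\<close> to \<open>b\<close>, and is removed from the arc; \<open>a = b\<close> is
  allowed.\<close>

lemma num_classes_eliminate:
  assumes "finite E" "p \<in> E" "a \<in> E" "b \<in> E" "a \<noteq> p" "b \<noteq> p" "p \<notin> touching R"
  shows "num_classes E (insert (a, p) (insert (p, b) R)) = num_classes (E - {p}) (insert (a, b) R)"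
proof -
  let ?R = "insert (a, b) R"
  have p: "p \<notin> touching ?R" using assms by (auto simp: touching_def)
  have "num_classes E (insert (a, p) (insert (p, b) R)) = num_classes E (insert (p, b) ?R)"
  proof (rule num_classes_cong_conn)
    have "conn (insert (p, b) ?R) a p"
      by (rule conn_trans[where y = b]) (auto intro: conn_base conn_base')
    then show "conn (insert (p, b) ?R) x y" if "(x, y) \<in> insert (a, p) (insert (p, b) R)" for x y
      using that by (auto intro: conn_base)
    have "conn (insert (a, p) (insert (p, b) R)) a b"
      by (rule conn_trans[where y = p]) (auto intro: conn_base)
    then show "conn (insert (a, p) (insert (p, b) R)) x y" if "(x, y) \<in> insert (p, b) ?R" for x y
      using that by (auto intro: conn_base)
  qed
  moreover have "num_classes E ?R = num_classes E (insert (p, b) ?R) + 1"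
    using num_classes_insert[OF assms(1,2,4), of ?R] conn_isolated[OF _ p] assms(6) by auto
  ultimately show ?thesis using num_classes_isolated[OF assms(1,2) p] by simp
qed

definition other_end :: "nat \<Rightarrow> nat \<times> nat \<Rightarrow> nat" where
  "other_end p z = (if fst z = p then snd z else fst z)"

text \<open>An interior edge has two ends, both among the recorded pairs. Either a pair joins it to
  itself, which is a circle counted by the second component, or two pairs meet at it and are
  spliced. Other patterns give \<open>None\<close>, and computation shows that they do not occur in
  the pictures of the moves.\<close>

definition eliminate :: "nat \<Rightarrow> (nat \<times> nat) list \<Rightarrow> ((nat \<times> nat) list \<times> nat) option" where
  "eliminate p ps = (let rest = filter (\<lambda>z. fst z \<noteq> p \<and> snd z \<noteq> p) ps in
     case filter (\<lambda>z. fst z = p \<or> snd z = p) ps of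
       [z] \<Rightarrow> if z = (p, p) then Some (rest, 1) else None
     | [y, z] \<Rightarrow> if other_end p y \<noteq> p \<and> other_end p z \<noteq> p
         then Some ((other_end p y, other_end p z) # rest, 0) else None
     | _ \<Rightarrow> None)"

lemma num_classes_flip:
  "num_classes E (insert (a, b) R) = num_classes E (insert (b, a) R)"
  by (intro num_classes_cong_conn) (auto intro: conn_base conn_base')

text \<open>The map \<open>g\<close> places the numbered local edges in the diagram. That
  \<open>g p\<close> is outside \<open>touching R\<close> expresses that \<open>p\<close> is
  interior: every join at it is among the recorded pairs.\<close>

lemma eliminate_correct:
  assumes "eliminate p ps = Some (qs, k)" "finite E" "g p \<in> E" "g p \<notin> touching R"
    and "\<And>q. q \<in> touching (set ps) \<Longrightarrow> g q \<in> E" "\<And>q. q \<in> touching (set ps) \<Longrightarrow> q \<noteq> p \<Longrightarrow> g q \<noteq> g p"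
  shows "num_classes E (R \<union> map_prod g g ` set ps) =
      num_classes (E - {g p}) (R \<union> map_prod g g ` set qs) + k"
    and "touching (set qs) \<subseteq> touching (set ps) - {p}"
proof -
  let ?rest = "filter (\<lambda>z. fst z \<noteq> p \<and> snd z \<noteq> p) ps"
  let ?inc = "filter (\<lambda>z. fst z = p \<or> snd z = p) ps"
  have split: "set ps = set ?inc \<union> set ?rest" by auto
  let ?R = "R \<union> map_prod g g ` set ?rest"
  have "g p \<noteq> g x \<and> g p \<noteq> g y" if "(x, y) \<in> set ?rest" for x y
    using that assms(6)[of x] assms(6)[of y] by (force simp: touching_def)
  then have pR: "g p \<notin> touching ?R" using assms(4) by (fastforce simp: touching_def)
  have "(\<exists>z. ?inc = [z]) \<or> (\<exists>y z. ?inc = [y, z])"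
    using assms(1) unfolding eliminate_def Let_def by (auto split: list.splits)
  then have "num_classes E (R \<union> map_prod g g ` set ps) =
      num_classes (E - {g p}) (R \<union> map_prod g g ` set qs) + k \<and>
      touching (set qs) \<subseteq> touching (set ps) - {p}"
  proof (elim disjE exE)
    fix z assume z: "?inc = [z]"
    then have *: "z = (p, p)" "qs = ?rest" "k = 1"
      using assms(1) unfolding eliminate_def by (auto split: if_splits)
    have "R \<union> map_prod g g ` set ps = insert (g p, g p) ?R"
      unfolding split unfolding z * by auto
    moreover have "num_classes E (insert (g p, g p) ?R) = num_classes E ?R"
      by (intro num_classes_cong_conn) (auto intro: conn_base)
    ultimately show ?thesis
      using num_classes_isolated[OF assms(2,3) pR] * by (auto simp: touching_def)
  next
    fix y z assume yz: "?inc = [y, z]"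
    then have *: "other_end p y \<noteq> p" "other_end p z \<noteq> p" "k = 0"
      "qs = (other_end p y, other_end p z) # ?rest"
      using assms(1) unfolding eliminate_def by (auto split: if_splits)
    have "y \<in> set ?inc" "z \<in> set ?inc" unfolding yz by auto
    then have y: "y \<in> set ps" "fst y = p \<or> snd y = p" and z: "z \<in> set ps" "fst z = p \<or> snd z = p"
      by auto
    then have t: "other_end p y \<in> touching (set ps)" "other_end p z \<in> touching (set ps)"
      by (auto simp: other_end_def touching_def)
    let ?a = "g (other_end p y)" and ?b = "g (other_end p z)"
    have ab: "?a \<in> E" "?b \<in> E" "?a \<noteq> g p" "?b \<noteq> g p" using t assms(5,6) * by auto
    have "R \<union> map_prod g g ` set ps = insert (map_prod g g y) (insert (map_prod g g z) ?R)"
      unfolding split unfolding yz by auto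
    also have "num_classes E \<dots> = num_classes E (insert (?a, g p) (insert (g p, ?b) ?R))"
    proof -
      have "map_prod g g y = (?a, g p) \<or> map_prod g g y = (g p, ?a)"
        using y(2) *(1) by (cases y) (auto simp: other_end_def)
      then have 1: "num_classes E (insert (map_prod g g y) X) = num_classes E (insert (?a, g p) X)" for X
        using num_classes_flip[of E "g p" ?a X] by (elim disjE) simp_all
      have "map_prod g g z = (?b, g p) \<or> map_prod g g z = (g p, ?b)"
        using z(2) *(2) by (cases z) (auto simp: other_end_def)
      then have 2: "num_classes E (insert (map_prod g g z) X) = num_classes E (insert (g p, ?b) X)" for X
        using num_classes_flip[of E "g p" ?b X] by (elim disjE) simp_all
      show ?thesis unfolding 1 by (subst (1 2) insert_commute) (rule 2)
    qed
    also have "\<dots> = num_classes (E - {g p}) (insert (?a, ?b) ?R)"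
      by (rule num_classes_eliminate) (use assms ab pR in auto)
    finally show ?thesis using * t by (auto simp: touching_def)
  qed
  then show "num_classes E (R \<union> map_prod g g ` set ps) =
      num_classes (E - {g p}) (R \<union> map_prod g g ` set qs) + k"
    "touching (set qs) \<subseteq> touching (set ps) - {p}" by auto
qed

fun eliminates :: "nat list \<Rightarrow> (nat \<times> nat) list \<Rightarrow> ((nat \<times> nat) list \<times> nat) option" where
  "eliminates [] ps = Some (ps, 0)"
| "eliminates (p # is) ps = (case eliminate p ps of None \<Rightarrow> None | Some (qs, k) \<Rightarrow>
     (case eliminates is qs of None \<Rightarrow> None | Some (rs, l) \<Rightarrow> Some (rs, k + l)))"

lemma eliminates_correct:
  assumes "eliminates is ps = Some (qs, k)" "finite E" "\<And>p. p \<in> set is \<Longrightarrow> g p \<in> E"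
    "\<And>p. p \<in> set is \<Longrightarrow> g p \<notin> touching R" "distinct is"
    "\<And>q. q \<in> touching (set ps) \<Longrightarrow> g q \<in> E"
    "\<And>p q. p \<in> set is \<Longrightarrow> q \<in> touching (set ps) \<union> set is \<Longrightarrow> q \<noteq> p \<Longrightarrow> g q \<noteq> g p"
  shows "num_classes E (R \<union> map_prod g g ` set ps) =
      num_classes (E - g ` set is) (R \<union> map_prod g g ` set qs) + k"
  using assms
proof (induction "is" arbitrary: ps k E)
  case (Cons p "is")
  obtain qs' k' l where *: "eliminate p ps = Some (qs', k')" "eliminates is qs' = Some (qs, l)" "k = k' + l"
    using Cons.prems(1) by (auto split: option.splits)
  note e = eliminate_correct[OF *(1), of E g R]
  have 1: "num_classes E (R \<union> map_prod g g ` set ps) =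
      num_classes (E - {g p}) (R \<union> map_prod g g ` set qs') + k'"
    by (rule e(1)) (use Cons.prems in auto)
  have 2: "touching (set qs') \<subseteq> touching (set ps) - {p}"
    by (rule e(2)) (use Cons.prems in auto)
  have "num_classes (E - {g p}) (R \<union> map_prod g g ` set qs') =
      num_classes (E - {g p} - g ` set is) (R \<union> map_prod g g ` set qs) + l"
  proof (rule Cons.IH[OF *(2)])
    fix q assume "q \<in> set is"
    then show "g q \<in> E - {g p}" using Cons.prems(3)[of q] Cons.prems(5) Cons.prems(7)[of p q] by auto
    show "g q \<notin> touching R" using \<open>q \<in> set is\<close> Cons.prems(4) by auto
  next
    fix q assume "q \<in> touching (set qs')"
    then show "g q \<in> E - {g p}" using 2 Cons.prems(6)[of q] Cons.prems(7)[of p q] by auto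
  next
    fix p' q assume "p' \<in> set is" "q \<in> touching (set qs') \<union> set is" "q \<noteq> p'"
    then show "g q \<noteq> g p'" using 2 Cons.prems(7)[of p' q] by auto
  qed (use Cons.prems in auto)
  moreover have "E - {g p} - g ` set is = E - g ` set (p # is)" by auto
  ultimately show ?case using 1 * by simp
qed simp

text \<open>A canonical order within and among pairs, so that equal pairings reached by different
  states become syntactically equal and their coefficients can be collected.\<close>

definition normalize_pairs :: "(nat \<times> nat) list \<Rightarrow> (nat \<times> nat) list" where
  "normalize_pairs ps = sort_key fst (map (\<lambda>(x, y). if x \<le> y then (x, y) else (y, x)) ps)"

lemma normalize_pairs_correct:
  "num_classes E (R \<union> map_prod g g ` set (normalize_pairs ps)) = num_classes E (R \<union> map_prod g g ` set ps)"
proof -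
  have *: "set (normalize_pairs ps) = (\<lambda>(x, y). if x \<le> y then (x, y) else (y, x)) ` set ps"
    by (simp add: normalize_pairs_def)
  show ?thesis
  proof (rule num_classes_cong_conn)
    fix a b assume "(a, b) \<in> R \<union> map_prod g g ` set (normalize_pairs ps)"
    then have "(a, b) \<in> R \<union> map_prod g g ` set ps \<or> (b, a) \<in> R \<union> map_prod g g ` set ps"
      unfolding * by (auto split: if_splits)
    then show "conn (R \<union> map_prod g g ` set ps) a b" by (auto intro: conn_base conn_base')
  next
    fix a b assume "(a, b) \<in> R \<union> map_prod g g ` set ps"
    then have "(a, b) \<in> R \<union> map_prod g g ` set (normalize_pairs ps) \<or>
        (b, a) \<in> R \<union> map_prod g g ` set (normalize_pairs ps)"
      unfolding * by (force split: if_splits)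
    then show "conn (R \<union> map_prod g g ` set (normalize_pairs ps)) a b"
      using conn_base conn_base' by metis
  qed
qed

definition A_pairs :: "'e crossing \<Rightarrow> ('e \<times> 'e) list" where
  "A_pairs x = (if positive x then [(sw x, nw x), (se x, ne x)] else [(nw x, ne x), (sw x, se x)])"

definition B_pairs :: "'e crossing \<Rightarrow> ('e \<times> 'e) list" where
  "B_pairs x = (if positive x then [(nw x, ne x), (sw x, se x)] else [(sw x, nw x), (se x, ne x)])"

lemma set_pairs: "set (A_pairs x) = A_smoothing x" "set (B_pairs x) = B_smoothing x"
  by (auto simp: A_pairs_def B_pairs_def A_smoothing_def B_smoothing_def joins_left_right_def joins_top_bottom_def)

fun states :: "nat crossing list \<Rightarrow> (nat \<times> nat) list \<Rightarrow> nat \<Rightarrow> nat \<Rightarrow> (nat \<times> nat \<times> (nat \<times> nat) list) list" where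
  "states [] ps a b = [(a, b, ps)]"
| "states (x # xs) ps a b = states xs (ps @ A_pairs x) (Suc a) b @ states xs (ps @ B_pairs x) a (Suc b)"

lemma bracket_expand_local:
  "A_var ^ a * A_inv ^ b * bracket_expand E (map (map_crossing g) xs) (R \<union> map_prod g g ` set ps) =
     (\<Sum>(a, b, ps) \<leftarrow> states xs ps a b. A_var ^ a * A_inv ^ b *
        loop_value ^ (num_classes E (R \<union> map_prod g g ` set ps) - 1))"
proof (induction xs arbitrary: ps a b)
  case Nil
  then show ?case by (simp add: loop_value_def)
next
  case (Cons x xs)
  show ?case
    using Cons.IH[of "Suc a" b "ps @ A_pairs x"] Cons.IH[of a "Suc b" "ps @ B_pairs x"]
    by (simp add: smoothing_map_crossing set_pairs image_Un Un_assoc algebra_simps)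
qed

text \<open>A tangle as an element of the skein module of a disc: for each state the exponents of
  \<open>A_var\<close> and \<open>A_inv\<close>, the number of circles split off, and the pairing of
  the outer ends.\<close>

definition reduced_states ::
  "nat list \<Rightarrow> nat crossing list \<Rightarrow> (nat \<times> nat \<times> nat \<times> (nat \<times> nat) list) option list" where
  "reduced_states is xs = map (\<lambda>(a, b, ps). case eliminates is ps of None \<Rightarrow> None
     | Some (qs, k) \<Rightarrow> Some (a, b, k, normalize_pairs qs)) (states xs [] 0 0)"

text \<open>\<open>Z\<close> stands for the value of the rest of the diagram, which depends on the
  pairing of the outer ends. An identity valid for all \<open>Z\<close> is therefore a local skein
  relation. The value 0 at \<open>None\<close> is a dummy.\<close>

definition state_sum :: "((nat \<times> nat) list \<Rightarrow> laurent) \<Rightarrow> (nat \<times> nat \<times> nat \<times> (nat \<times> nat) list) option list \<Rightarrow> laurent" where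
  "state_sum Z ts = (\<Sum>t\<leftarrow>ts. case t of None \<Rightarrow> 0
     | Some (a, b, k, qs) \<Rightarrow> A_var ^ a * A_inv ^ b * loop_value ^ k * Z qs)"

definition crossing_ends :: "'e crossing \<Rightarrow> 'e set" where
  "crossing_ends x = {sw x, se x, nw x, ne x}"

lemma touching_states:
  "(a', b', qs) \<in> set (states xs ps a b) \<Longrightarrow>
     touching (set qs) \<subseteq> touching (set ps) \<union> (\<Union>x\<in>set xs. crossing_ends x)"
proof (induction xs arbitrary: ps a b)
  case (Cons x xs)
  have "touching (set (ps @ A_pairs x)) \<subseteq> touching (set ps) \<union> crossing_ends x"
    "touching (set (ps @ B_pairs x)) \<subseteq> touching (set ps) \<union> crossing_ends x"
    by (auto simp: touching_def A_pairs_def B_pairs_def crossing_ends_def split: if_splits)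
  moreover have "(a', b', qs) \<in> set (states xs (ps @ A_pairs x) (Suc a) b) \<or>
      (a', b', qs) \<in> set (states xs (ps @ B_pairs x) a (Suc b))"
    using Cons.prems by simp
  then have "touching (set qs) \<subseteq> touching (set (ps @ A_pairs x)) \<union> (\<Union>x\<in>set xs. crossing_ends x) \<or>
      touching (set qs) \<subseteq> touching (set (ps @ B_pairs x)) \<union> (\<Union>x\<in>set xs. crossing_ends x)"
    using Cons.IH by blast
  ultimately show ?case unfolding list.set(2) UN_insert by blast
qed simp

text \<open>Circles inside the local picture become powers of the loop value; the rest of the
  diagram sees only the pairing of the outer ends.\<close>

theorem bracket_expand_reduced:
  assumes "finite E" "E - g ` set is \<noteq> {}" "distinct is" "None \<notin> set (reduced_states is xs)"
    and "\<And>p. p \<in> set is \<Longrightarrow> g p \<in> E \<and> g p \<notin> touching R"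
    and "\<And>q x. x \<in> set xs \<Longrightarrow> q \<in> crossing_ends x \<Longrightarrow> g q \<in> E"
    and "\<And>p q. p \<in> set is \<Longrightarrow> q \<in> (\<Union>x\<in>set xs. crossing_ends x) \<union> set is \<Longrightarrow> q \<noteq> p \<Longrightarrow> g q \<noteq> g p"
  shows "bracket_expand E (map (map_crossing g) xs) R =
    state_sum (\<lambda>qs. loop_value ^ (num_classes (E - g ` set is) (R \<union> map_prod g g ` set qs) - 1)) (reduced_states is xs)"
proof -
  let ?Z = "\<lambda>qs. loop_value ^ (num_classes (E - g ` set is) (R \<union> map_prod g g ` set qs) - 1)"
  have "bracket_expand E (map (map_crossing g) xs) R = (\<Sum>(a, b, ps) \<leftarrow> states xs [] 0 0. A_var ^ a * A_inv ^ b *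
        loop_value ^ (num_classes E (R \<union> map_prod g g ` set ps) - 1))"
    using bracket_expand_local[of 0 0 E g xs R "[]"] by simp
  also have "\<dots> = state_sum ?Z (reduced_states is xs)"
    unfolding state_sum_def reduced_states_def map_map o_def
  proof (intro arg_cong[of _ _ sum_list] map_cong refl)
    fix t assume t: "t \<in> set (states xs [] 0 0)"
    obtain a b ps where abp: "t = (a, b, ps)" by (cases t) auto
    have tch: "touching (set ps) \<subseteq> (\<Union>x\<in>set xs. crossing_ends x)"
      using touching_states[of a b ps xs "[]" 0 0] t abp by (simp add: touching_def)
    have "eliminates is ps \<noteq> None"
      using assms(4) t abp by (force simp: reduced_states_def image_iff split: option.splits)
    then obtain qs k where q: "eliminates is ps = Some (qs, k)" by auto
    have "num_classes E (R \<union> map_prod g g ` set ps) =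
        num_classes (E - g ` set is) (R \<union> map_prod g g ` set qs) + k"
    proof (rule eliminates_correct[OF q assms(1)])
      show "g q \<in> E" if "q \<in> touching (set ps)" for q using that tch assms(6) by blast
      show "g q \<noteq> g p" if "p \<in> set is" "q \<in> touching (set ps) \<union> set is" "q \<noteq> p" for p q
        using that tch by (intro assms(7)) auto
    qed (use assms(3,5) in auto)
    \<comment> \<open>Positivity lets the \<open>k\<close> circles be split off despite the
      truncated \<open>- 1\<close> in the exponent.\<close>
    moreover have "num_classes (E - g ` set is) (R \<union> map_prod g g ` set qs) > 0"
      using assms(1,2) by (intro num_classes_pos) auto
    ultimately show "(case t of (a, b, ps) \<Rightarrow> A_var ^ a * A_inv ^ b *
        loop_value ^ (num_classes E (R \<union> map_prod g g ` set ps) - 1)) =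
      (case case t of (a, b, ps) \<Rightarrow> case eliminates is ps of None \<Rightarrow> None
          | Some (qs, k) \<Rightarrow> Some (a, b, k, normalize_pairs qs) of None \<Rightarrow> 0
        | Some (a, b, k, qs) \<Rightarrow> A_var ^ a * A_inv ^ b * loop_value ^ k * ?Z qs)"
      by (simp add: abp q normalize_pairs_correct power_add[symmetric] mult.assoc add.commute
          del: power_add)
  qed
  finally show ?thesis .
qed

text \<open>The crossings \<open>xs\<close> outside the local picture are expanded first, so a
  relation for the inner crossings is applied inside every outer state. The restriction on
  \<open>S\<close> guarantees that outer states do not touch interior edges.\<close>

lemma bracket_expand_append:
  assumes "\<And>S. (\<And>p. p \<in> touching S \<Longrightarrow> p \<in> touching R \<or> (\<exists>x\<in>set xs. p \<in> crossing_ends x)) \<Longrightarrow>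
      bracket_expand E ys S = c * bracket_expand E' ys' (S \<union> J)"
  shows "bracket_expand E (xs @ ys) R = c * bracket_expand E' (xs @ ys') (R \<union> J)"
  using assms
proof (induction xs arbitrary: R)
  case Nil
  then show ?case by simp
next
  case (Cons x xs)
  have t: "touching (R \<union> A_smoothing x) \<subseteq> touching R \<union> crossing_ends x"
    "touching (R \<union> B_smoothing x) \<subseteq> touching R \<union> crossing_ends x"
    by (auto simp: touching_def A_smoothing_def B_smoothing_def joins_left_right_def
        joins_top_bottom_def crossing_ends_def split: if_splits)
  have "bracket_expand E (xs @ ys) (R \<union> A_smoothing x) = c * bracket_expand E' (xs @ ys') ((R \<union> A_smoothing x) \<union> J)"
    by (rule Cons.IH, rule Cons.prems) (use t in auto)
  moreover have "bracket_expand E (xs @ ys) (R \<union> B_smoothing x) = c * bracket_expand E' (xs @ ys') ((R \<union> B_smoothing x) \<union> J)"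
    by (rule Cons.IH, rule Cons.prems) (use t in auto)
  ultimately show ?case by (simp add: algebra_simps Un_ac)
qed

section \<open>Reidemeister moves\<close>

text \<open>In this and the next two models the edges are numbered along the strands, three per
  strand, so that 1, 4 and 7 are interior and the others are outer ends.\<close>

definition kink :: "bool \<Rightarrow> bool \<Rightarrow> nat crossing list" where
  "kink ov s = [if ov then mk_crossing s 0 1 1 2 else mk_crossing s 1 2 0 1]"

definition bigon :: "bool \<Rightarrow> bool \<Rightarrow> nat crossing list" where
  "bigon d s = (let i = of_bool (\<not> d); j = of_bool d in
     [mk_crossing s 0 1 (3 + i) (4 + i), mk_crossing (\<not> s) 1 2 (3 + j) (4 + j)])"

definition triangle :: "bool \<Rightarrow> bool \<Rightarrow> bool \<Rightarrow> bool \<Rightarrow> bool \<Rightarrow> bool \<Rightarrow> nat crossing list" where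
  "triangle t m l sa sb sc =
    (let p = of_bool (\<not> t); p' = of_bool t; q = of_bool (\<not> m); q' = of_bool m; r = of_bool (\<not> l); r' = of_bool l in
     [mk_crossing sa p (1 + p) (3 + q) (4 + q), mk_crossing sb p' (1 + p') (6 + r) (7 + r),
      mk_crossing sc (3 + q') (4 + q') (6 + r') (7 + r')])"

lemma A_cancel: "A_var * (A_inv * t) = t" "A_inv * (A_var * t) = t"
  by (simp_all flip: mult.assoc)

lemmas local_state_simps = reduced_states_def state_sum_def kink_def bigon_def triangle_def
  mk_crossing_def A_pairs_def B_pairs_def eliminate_def other_end_def normalize_pairs_def
  loop_value_def power2_eq_square power3_eq_cube algebra_simps A_cancel

text \<open>One of the two states splits off a circle; for a positive kink the sum is
  \<open>A * (- A^2 - A^-2) + A^-1 = - A^3\<close>.\<close>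

lemma kink_states:
  "None \<notin> set (reduced_states [1] (kink ov s))"
  "state_sum Z (reduced_states [1] (kink ov s)) = - ((if s then A_var else A_inv) ^ 3) * Z [(0, 2)]"
  by (cases ov; cases s; simp add: local_state_simps)+

text \<open>One of the four states gives the two straight strands with coefficient 1. The other
  three share one pairing, with coefficients \<open>A^2\<close>, \<open>A^-2\<close> and the loop
  value, which cancel.\<close>

lemma bigon_states:
  "None \<notin> set (reduced_states [1, 4] (bigon d s))"
  "state_sum Z (reduced_states [1, 4] (bigon d s)) = Z [(0, 2), (3, 5)]"
  by (cases d; cases s; simp add: local_state_simps)+

text \<open>The sign conditions express \<open>sb\<close> and \<open>sc\<close> by \<open>sa\<close>
  and the directions. This leaves 16 pictures, in each of which the eight states on either side are
  computed and compared.\<close>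

lemma triangle_states:
  assumes "(sa = sb) = (m = l)" "(sa = sc) = (t = l)" "(sb = sc) = (t = m)"
  shows "None \<notin> set (reduced_states [1, 4, 7] (triangle t m l sa sb sc))"
    and "state_sum Z (reduced_states [1, 4, 7] (triangle t m l sa sb sc)) =
      state_sum Z (reduced_states [1, 4, 7] (triangle (\<not> t) (\<not> m) (\<not> l) sa sb sc))"
proof -
  have "sb = (sa = (m = l))" "sc = (sa = (t = l))" using assms by auto
  then show "None \<notin> set (reduced_states [1, 4, 7] (triangle t m l sa sb sc))"
    "state_sum Z (reduced_states [1, 4, 7] (triangle t m l sa sb sc)) =
      state_sum Z (reduced_states [1, 4, 7] (triangle (\<not> t) (\<not> m) (\<not> l) sa sb sc))"
    by (cases t; cases m; cases l; cases sa; simp add: local_state_simps)+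
qed

section \<open>Invariance of the bracket under moves, with edges named by segment and offset\<close>

definition entry_loc :: "gauss_code list \<Rightarrow> gauss_entry \<Rightarrow> nat \<times> nat" where
  "entry_loc segs e = (THE p. fst p < length segs \<and> snd p < length (segs ! fst p) \<and> segs ! fst p ! snd p = e)"

definition entry_end :: "gauss_code list \<Rightarrow> gauss_entry \<Rightarrow> nat \<times> nat" where
  "entry_end segs e = (fst (entry_loc segs e), Suc (snd (entry_loc segs e)))"

lemma entry_loc_nth:
  assumes "matched (concat segs)" "j < length segs" "off < length (segs ! j)"
  shows "entry_loc segs (segs ! j ! off) = (j, off)"
  unfolding entry_loc_def
proof (rule the_equality)
  fix p assume p: "fst p < length segs \<and> snd p < length (segs ! fst p) \<and> segs ! fst p ! snd p = segs ! j ! off"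
  obtain j' off' where p': "p = (j', off')" by force
  have d: "distinct (concat segs)" using assms(1) by (simp add: matched_def)
  have "concat segs ! (seg_start segs j' + off') = concat segs ! (seg_start segs j + off)"
    using p p' assms by (simp add: nth_concat_seg)
  moreover have "seg_start segs j' + off' < length (concat segs)" "seg_start segs j + off < length (concat segs)"
    using seg_start_le[of j' segs "Suc off'"] seg_start_le[of j segs "Suc off"] p p' assms by auto
  ultimately have *: "seg_start segs j' + off' = seg_start segs j + off"
    using d by (simp add: nth_eq_iff_index_eq)
  have "j' = j"
  proof (rule ccontr)
    assume "j' \<noteq> j"
    then consider "j' < j" | "j < j'" by linarith
    then show False
      using seg_start_mono[of "Suc j'" j segs] seg_start_mono[of "Suc j" j' segs]
        seg_start_Suc[of j' segs] seg_start_Suc[of j segs] * p p' assms by cases auto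
  qed
  then show "p = (j, off)" using * p' by simp
qed (use assms in auto)

lemma entry_end_nth:
  assumes "matched (concat segs)" "j < length segs" "off < length (segs ! j)"
  shows "entry_end segs (segs ! j ! off) = (j, Suc off)"
  using entry_loc_nth[OF assms] by (simp add: entry_end_def)

lemma inj_on_Pair: "inj_on (\<lambda>(j, off). (j, off)) A"
  by (auto simp: inj_on_def)

lemma bracket_segments_Pair:
  assumes "matched (concat segs)" "segs \<noteq> []" "distinct cs" "set cs = labels (concat segs)"
  shows "bracket (concat segs) = bracket_expand (seg_edges segs Pair)
    (map (\<lambda>c. entry_crossing (entry_loc segs) (entry_end segs) (crossing_sign (concat segs) c) c) cs)
    (seg_joins segs Pair)"
  by (rule bracket_segments[OF assms(1,2) inj_on_Pair entry_loc_nth[OF assms(1)]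
      entry_end_nth[OF assms(1)] assms(3,4)])

text \<open>If segment \<open>j\<close> of the rotated code is named as segment
  \<open>1 - j\<close>, both codes have literally the same edges, joins and crossings.\<close>

lemma bracket_rotate:
  assumes "matched (u @ v)"
  shows "bracket (v @ u) = bracket (u @ v)"
proof -
  have m: "matched (concat [u, v])" "matched (concat [v, u])"
    using assms by (auto simp: matched_def)
  obtain cs where cs: "distinct cs" "set cs = labels (concat [u, v])"
    using finite_distinct_list[OF finite_labels] by metis
  let ?inn = "entry_loc [u, v]" and ?out = "entry_end [u, v]"
  have less: "j < length [u, v] \<longleftrightarrow> j = 0 \<or> j = 1" for j by auto
  have "bracket (concat [u, v]) = bracket_expand (seg_edges [u, v] Pair)
    (map (\<lambda>c. entry_crossing ?inn ?out (crossing_sign (concat [u, v]) c) c) cs) (seg_joins [u, v] Pair)"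
    by (rule bracket_segments_Pair[OF m(1) _ cs]) simp
  moreover let ?nm = "\<lambda>j. Pair (1 - j)"
  have "bracket (concat [v, u]) = bracket_expand (seg_edges [v, u] ?nm)
    (map (\<lambda>c. entry_crossing ?inn ?out (crossing_sign (concat [v, u]) c) c) cs) (seg_joins [v, u] ?nm)"
  proof (rule bracket_segments[OF m(2)])
    fix j off assume "j < length [v, u]" "off < length ([v, u] ! j)"
    then show "?inn ([v, u] ! j ! off) = (1 - j, off)" "?out ([v, u] ! j ! off) = (1 - j, Suc off)"
      using entry_loc_nth[OF m(1), of "1 - j" off] entry_end_nth[OF m(1), of "1 - j" off]
      by (auto simp: less_Suc_eq)
  qed (use cs in \<open>auto simp: inj_on_def labels_def\<close>)
  moreover have "seg_edges [v, u] ?nm = seg_edges [u, v] Pair"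
    unfolding seg_edges_def by (auto simp: less_Suc_eq) force+
  moreover have "seg_joins [v, u] ?nm = seg_joins [u, v] Pair"
    unfolding seg_joins_def by (auto simp: less_Suc_eq) force+
  moreover have "crossing_sign (concat [v, u]) = crossing_sign (concat [u, v])"
    by (auto simp: crossing_sign_def fun_eq_iff)
  ultimately show ?thesis by simp
qed

text \<open>Crossings are built from positions; labels serve only to find the partner of a passage,
  which an injective relabelling preserves.\<close>

lemma bracket_relabel:
  assumes "inj h"
  shows "bracket (map (map_prod h id) w) = bracket w"
proof -
  have *: "map_prod h id (w ! j) = (h (fst (w ! i)), False, snd (snd (w ! i)))
      \<longleftrightarrow> w ! j = (fst (w ! i), False, snd (snd (w ! i)))" for i j
    using assms by (cases "w ! j") (auto simp: inj_eq)
  have "crossings (map (map_prod h id) w) = crossings w"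
    unfolding crossings_def length_map
    by (intro arg_cong[of _ _ concat] map_cong refl) (simp add: * )
  then show ?thesis by (simp add: bracket_def edges_def)
qed

lemma seg_joins_code:
  "seg_joins segs nm = set (map (\<lambda>j. (nm j (length (segs ! j)), nm (Suc j mod length segs) 0)) [0..<length segs])"
  by (auto simp: seg_joins_def)

lemma upt_numerals:
  "[0..<Suc (Suc 0)] = [0, 1]" "[0..<Suc (Suc (Suc 0))] = [0, 1, 2]"
  "[0..<Suc (Suc (Suc (Suc 0)))] = [0, 1, 2, 3]"
  "[0..<Suc (Suc (Suc (Suc (Suc (Suc 0)))))] = [0, 1, 2, 3, 4, 5]"
  by (simp_all add: upt_rec)

lemma seg_joins_numeral:
  "seg_joins [a, b] nm = {(nm 0 (length a), nm 1 0), (nm 1 (length b), nm 0 0)}"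
  "seg_joins [a, b, c] nm = {(nm 0 (length a), nm 1 0), (nm 1 (length b), nm 2 0), (nm 2 (length c), nm 0 0)}"
  "seg_joins [a, b, c, d] nm = {(nm 0 (length a), nm 1 0), (nm 1 (length b), nm 2 0),
     (nm 2 (length c), nm 3 0), (nm 3 (length d), nm 0 0)}"
  "seg_joins [a, b, c, d, e, f] nm = {(nm 0 (length a), nm 1 0), (nm 1 (length b), nm 2 0),
     (nm 2 (length c), nm 3 0), (nm 3 (length d), nm 4 0), (nm 4 (length e), nm 5 0), (nm 5 (length f), nm 0 0)}"
  unfolding seg_joins_code list.size add_0 add_Suc_right add_0_right
  by (simp_all add: upt_numerals, simp_all flip: numeral_2_eq_2)

lemma finite_seg_edges [simp]: "finite (seg_edges segs nm)"
proof -
  have "seg_edges segs nm = (\<lambda>(j, off). nm j off) ` (SIGMA j:{..<length segs}. {..length (segs ! j)})"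
    by (auto simp: seg_edges_def)
  then show ?thesis by simp
qed

lemma seg_edges_Pair: "(j, off) \<in> seg_edges segs Pair \<longleftrightarrow> j < length segs \<and> off \<le> length (segs ! j)"
  by (auto simp: seg_edges_def)

lemma crossing_ends_mk [simp]: "crossing_ends (mk_crossing s a b c d) = {a, b, c, d}"
  by (auto simp: crossing_ends_def mk_crossing_def)

lemma crossing_ends_entry:
  assumes "p \<in> crossing_ends (entry_crossing inn out s c)"
  obtains ov where "p = inn (c, ov, s) \<or> p = out (c, ov, s)"
  using assms by (auto simp: entry_crossing_def)

lemma entry_loc_in:
  assumes "matched (concat segs)" "j < length segs" "e \<in> set (segs ! j)"
  shows "fst (entry_loc segs e) = j" "fst (entry_end segs e) = j"
proof -
  obtain off where "off < length (segs ! j)" "e = segs ! j ! off"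
    using assms(3) by (auto simp: in_set_conv_nth)
  then show "fst (entry_loc segs e) = j" "fst (entry_end segs e) = j"
    using entry_loc_nth[OF assms(1,2)] entry_end_nth[OF assms(1,2)] by auto
qed

text \<open>The crossing of the kink is put last in the expansion, so that its local relation
  applies within each state of the rest.\<close>

lemma bracket_R1:
  assumes m: "matched ([(a, ov, s), (a, \<not> ov, s)] @ u)" and mu: "matched u"
  shows "bracket ([(a, ov, s), (a, \<not> ov, s)] @ u) = - ((if s then A_var else A_inv) ^ 3) * bracket u"
proof -
  let ?K = "[(a, ov, s), (a, \<not> ov, s)]"
  let ?w = "concat [?K, u]"
  have mw: "matched ?w" using m by simp
  obtain cs where cs: "distinct cs" "set cs = labels u"
    using finite_distinct_list[OF finite_labels] by metis
  have lab: "labels ?w = insert a (labels u)" by (auto simp: labels_def)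
  \<comment> \<open>A further occurrence of \<open>a\<close> would carry the same sign and hence
    repeat an entry of the kink.\<close>
  have a: "a \<notin> labels u"
  proof
    assume "a \<in> labels u"
    then obtain s' where "(a, True, s') \<in> set u" "(a, False, s') \<in> set u"
      using matched_iff_sign[OF mu] by blast
    moreover have "s' = s" using matched_iff_sign[OF mw, of a True s'] matched_iff_sign[OF mw, of a True s]
      calculation by (cases ov) auto
    ultimately show False using mw by (cases ov) (auto simp: matched_def)
  qed
  let ?inn = "entry_loc [?K, u]" and ?out = "entry_end [?K, u]"
  let ?E = "seg_edges [?K, u] Pair" and ?J = "seg_joins [?K, u] Pair"
  let ?X = "\<lambda>c. entry_crossing ?inn ?out (crossing_sign ?w c) c"
  have names: "?inn (?K ! i) = (0, i)" "?out (?K ! i) = (0, Suc i)" if "i < 2" for i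
    using entry_loc_nth[OF mw, of 0 i] entry_end_nth[OF mw, of 0 i] that by auto
  have nu: "?inn (u ! i) = (1, i)" "?out (u ! i) = (1, Suc i)" if "i < length u" for i
    using entry_loc_nth[OF mw, of 1 i] entry_end_nth[OF mw, of 1 i] that by auto
  let ?g = "\<lambda>p::nat. (0::nat, p)"
  have sa: "crossing_sign ?w a = s"
    using matched_iff_sign[OF mw, of a ov s] by simp
  have Xa: "[?X a] = map (map_crossing ?g) (kink ov s)"
    using names[of 0] names[of 1] sa by (cases ov) (simp_all add: kink_def entry_crossing_def mk_crossing_map numeral_2_eq_2)
  have "bracket ?w = bracket_expand ?E (map ?X (cs @ [a])) ?J"
    by (rule bracket_segments_Pair[OF mw]) (use cs a lab in simp_all)
  also have "\<dots> = bracket_expand ?E (map ?X cs @ map (map_crossing ?g) (kink ov s)) ?J"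
    using Xa by simp
  also have "\<dots> = - ((if s then A_var else A_inv) ^ 3) *
      bracket_expand (?E - {(0, 1)}) (map ?X cs @ []) (?J \<union> {((0, 0), (0, 2))})"
  proof (rule bracket_expand_append)
    fix S assume S: "\<And>p. p \<in> touching S \<Longrightarrow> p \<in> touching ?J \<or> (\<exists>x\<in>set (map ?X cs). p \<in> crossing_ends x)"
    have tS: "(0, 1) \<notin> touching S"
    proof
      assume "(0, 1) \<in> touching S"
      then consider "(0, 1) \<in> touching ?J" | c where "c \<in> labels u" "(0, 1) \<in> crossing_ends (?X c)"
        using S[OF \<open>(0, 1) \<in> touching S\<close>] cs(2) unfolding set_map by blast
      then show False
      proof cases
        case 1
        then show ?thesis by (auto simp: seg_joins_numeral touching_def)
      next
        case (2 c)
        let ?s = "crossing_sign ?w c"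
        have "(c, ov', ?s) \<in> set u" for ov'
          using 2(1) a matched_iff_sign[OF mw, of c ov' ?s] lab by auto
        then have "fst (?inn (c, ov', ?s)) = 1 \<and> fst (?out (c, ov', ?s)) = 1" for ov'
          using entry_loc_in[OF mw, of 1] by simp
        then show ?thesis using 2(2) by (elim crossing_ends_entry) (metis fst_conv zero_neq_one)
      qed
    qed
    have E: "(0, p) \<in> ?E \<longleftrightarrow> p \<le> 2" for p by (simp add: seg_edges_Pair numeral_2_eq_2)
    have ends: "q \<le> 2" if "x \<in> set (kink ov s)" "q \<in> crossing_ends x" for q x
      using that by (auto simp: kink_def split: if_splits)
    have "bracket_expand ?E (map (map_crossing ?g) (kink ov s)) S =
      state_sum (\<lambda>qs. loop_value ^ (num_classes (?E - ?g ` set [1]) (S \<union> map_prod ?g ?g ` set qs) - 1))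
        (reduced_states [1] (kink ov s))"
    proof (rule bracket_expand_reduced)
      show "?E - ?g ` set [1] \<noteq> {}" using E[of 0] by auto
      show "None \<notin> set (reduced_states [1] (kink ov s))" by (rule kink_states)
    qed (use tS E ends in auto)
    then show "bracket_expand ?E (map (map_crossing ?g) (kink ov s)) S =
        - ((if s then A_var else A_inv) ^ 3) * bracket_expand (?E - {(0, 1)}) [] (S \<union> {((0, 0), (0, 2))})"
      unfolding kink_states by (simp add: loop_value_def)
  qed
  also have "bracket_expand (?E - {(0, 1)}) (map ?X cs @ []) (?J \<union> {((0, 0), (0, 2))}) = bracket (concat [[], [], u])"
  proof -
    \<comment> \<open>Two empty segments remain in place of the kink. They carry its outer edges
      \<open>(0, 0)\<close> and \<open>(0, 2)\<close>, and the join between them is the pairing left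
      by the local relation.\<close>
    let ?nm = "\<lambda>j off. if j = 0 then (0::nat, 0::nat) else if j = 1 then (0, 2) else (1, off)"
    have less: "j < 3 \<longleftrightarrow> j = 0 \<or> j = 1 \<or> j = (2::nat)" for j by auto
    have "bracket (concat [[], [], u]) = bracket_expand (seg_edges [[], [], u] ?nm)
      (map (\<lambda>c. entry_crossing ?inn ?out (crossing_sign (concat [[], [], u]) c) c) cs) (seg_joins [[], [], u] ?nm)"
    proof (rule bracket_segments)
      show "inj_on (\<lambda>(j, off). ?nm j off) {(j, off). j < length [[], [], u] \<and> off \<le> length ([[], [], u] ! j)}"
        by (auto simp: inj_on_def less split: if_splits)
    qed (use mu cs nu in \<open>auto simp: less_Suc_eq\<close>)
    moreover have "seg_edges [[], [], u] ?nm = ?E - {(0, 1)}"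
    proof (intro equalityI subsetI)
      fix p assume "p \<in> seg_edges [[], [], u] ?nm"
      then show "p \<in> ?E - {(0, 1)}"
        unfolding seg_edges_def by (auto simp: less_Suc_eq)
    next
      fix p assume p: "p \<in> ?E - {(0, 1)}"
      obtain j off where jo: "p = (j, off)" "j < 2" "off \<le> length ([?K, u] ! j)"
        using p by (auto simp: seg_edges_def)
      have "\<exists>j' off'. p = ?nm j' off' \<and> j' < length [[], [], u] \<and> off' \<le> length ([[], [], u] ! j')"
      proof -
        consider "j = 0" "off = 0" | "j = 0" "off = 2" | "j = 1"
          using jo p by (auto simp: le_Suc_eq less_Suc_eq numeral_2_eq_2)
        then show ?thesis
        proof cases
          case 1 then show ?thesis using jo by (intro exI[of _ 0] exI[of _ "0::nat"]) auto
        next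
          case 2 then show ?thesis using jo by (intro exI[of _ 1] exI[of _ "0::nat"]) auto
        next
          case 3 then show ?thesis using jo by (intro exI[of _ 2] exI[of _ off]) auto
        qed
      qed
      then show "p \<in> seg_edges [[], [], u] ?nm" unfolding seg_edges_def by blast
    qed
    moreover have "seg_joins [[], [], u] ?nm = ?J \<union> {((0, 0), (0, 2))}"
      unfolding seg_joins_numeral by auto
    moreover have "map (\<lambda>c. entry_crossing ?inn ?out (crossing_sign (concat [[], [], u]) c) c) cs = map ?X cs"
    proof (rule map_cong[OF refl])
      fix c assume "c \<in> set cs"
      then have "crossing_sign (concat [[], [], u]) c = crossing_sign ?w c"
        using cs a by (auto simp: crossing_sign_def)
      then show "entry_crossing ?inn ?out (crossing_sign (concat [[], [], u]) c) c = ?X c" by simp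
    qed
    ultimately show ?thesis by (simp only: append_Nil2)
  qed
  finally show ?thesis by simp
qed

lemma bracket_R2:
  assumes m: "matched ([(a, True, s), (b, True, \<not> s)] @ u @ traverse d [(a, False, s), (b, False, \<not> s)] @ v)"
    and mu: "matched (u @ v)"
  shows "bracket ([(a, True, s), (b, True, \<not> s)] @ u @ traverse d [(a, False, s), (b, False, \<not> s)] @ v)
    = bracket (u @ v)"
proof -
  let ?T = "[(a, True, s), (b, True, \<not> s)]" and ?M = "traverse d [(a, False, s), (b, False, \<not> s)]"
  let ?segs = "[?T, u, ?M, v]"
  let ?w = "concat ?segs"
  have mw: "matched ?w" using m by simp
  obtain cs where cs: "distinct cs" "set cs = labels (u @ v)"
    using finite_distinct_list[OF finite_labels] by metis
  have setM: "set ?M = {(a, False, s), (b, False, \<not> s)}" and lenM: "length ?M = 2"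
    by (auto simp: traverse_def)
  have dist: "distinct ?w" using mw by (simp add: matched_def)
  have "(a, True, s) \<notin> set (u @ v)" "(b, True, \<not> s) \<notin> set (u @ v)" "(a, True, s) \<noteq> (b, True, \<not> s)"
    using dist by auto
  moreover have sgn: "crossing_sign ?w a = s" "crossing_sign ?w b = (\<not> s)"
    using matched_iff_sign[OF mw, of a True s] matched_iff_sign[OF mw, of b True "\<not> s"] by auto
  moreover have "s' = crossing_sign ?w c" if "(c, True, s') \<in> set (u @ v)" for c s'
    using matched_iff_sign[OF mw, of c True s'] that by auto
  ultimately have ab: "a \<notin> labels (u @ v)" "b \<notin> labels (u @ v)" "a \<noteq> b"
    using matched_iff_sign[OF mu, of a True] matched_iff_sign[OF mu, of b True] by auto
  have lab: "labels ?w = insert a (insert b (labels (u @ v)))"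
    unfolding labels_def by (auto simp: setM)
  let ?inn = "entry_loc ?segs" and ?out = "entry_end ?segs"
  let ?E = "seg_edges ?segs Pair" and ?J = "seg_joins ?segs Pair"
  let ?X = "\<lambda>c. entry_crossing ?inn ?out (crossing_sign ?w c) c"
  have nT: "?inn (?T ! i) = (0, i)" "?out (?T ! i) = (0, Suc i)" if "i < 2" for i
    using entry_loc_nth[OF mw, of 0 i] entry_end_nth[OF mw, of 0 i] that by auto
  have nM: "?inn (?M ! i) = (2, i)" "?out (?M ! i) = (2, Suc i)" if "i < 2" for i
    using entry_loc_nth[OF mw, of 2 i] entry_end_nth[OF mw, of 2 i] that lenM by auto
  have nu: "?inn (u ! i) = (1, i)" "?out (u ! i) = (1, Suc i)" if "i < length u" for i
    using entry_loc_nth[OF mw, of 1 i] entry_end_nth[OF mw, of 1 i] that by auto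
  have nv: "?inn (v ! i) = (3, i)" "?out (v ! i) = (3, Suc i)" if "i < length v" for i
    using entry_loc_nth[OF mw, of 3 i] entry_end_nth[OF mw, of 3 i] that by auto
  define g :: "nat \<Rightarrow> nat \<times> nat" where "g p = (if p < 3 then (0, p) else (2, p - 3))" for p
  have Xab: "[?X a, ?X b] = map (map_crossing g) (bigon d s)"
  proof -
    have f1: "?inn (a, True, s) = g 0" "?out (a, True, s) = g 1" "?inn (b, True, \<not> s) = g 1" "?out (b, True, \<not> s) = g 2"
      using nT[of 0] nT[of 1] by (simp_all add: g_def numeral_2_eq_2)
    have f2: "?inn (a, False, s) = g (3 + of_bool (\<not> d))" "?out (a, False, s) = g (4 + of_bool (\<not> d))"
      "?inn (b, False, \<not> s) = g (3 + of_bool d)" "?out (b, False, \<not> s) = g (4 + of_bool d)"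
      using nM[of 0] nM[of 1] by (cases d; simp add: traverse_def g_def numeral_2_eq_2)+
    show ?thesis
      unfolding bigon_def Let_def entry_crossing_def sgn list.map f1 f2 mk_crossing_map ..
  qed
  have gI: "g ` set [1, 4] = {(0, 1), (2, 1)}" by (auto simp: g_def)
  have "bracket ?w = bracket_expand ?E (map ?X (cs @ [a, b])) ?J"
    by (rule bracket_segments_Pair[OF mw]) (use cs ab lab in auto)
  also have "\<dots> = bracket_expand ?E (map ?X cs @ map (map_crossing g) (bigon d s)) ?J"
    using Xab by simp
  also have "\<dots> = 1 * bracket_expand (?E - {(0, 1), (2, 1)}) (map ?X cs @ []) (?J \<union> {((0, 0), (0, 2)), ((2, 0), (2, 2))})"
  proof (rule bracket_expand_append)
    fix S assume S: "\<And>p. p \<in> touching S \<Longrightarrow> p \<in> touching ?J \<or> (\<exists>x\<in>set (map ?X cs). p \<in> crossing_ends x)"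
    have tS: "p \<notin> touching S" if p: "p = (0, 1) \<or> p = (2, 1)" for p
    proof
      assume "p \<in> touching S"
      then consider "p \<in> touching ?J" | c where "c \<in> labels (u @ v)" "p \<in> crossing_ends (?X c)"
        using S cs(2) unfolding set_map by blast
      then show False
      proof cases
        case 1
        then show ?thesis using p lenM by (auto simp: seg_joins_numeral touching_def)
      next
        case (2 c)
        let ?s = "crossing_sign ?w c"
        have "(c, ov', ?s) \<in> set u \<or> (c, ov', ?s) \<in> set v" for ov'
          using 2(1) ab matched_iff_sign[OF mw, of c ov' ?s] lab setM by auto
        then have "fst (?inn (c, ov', ?s)) \<in> {1, 3} \<and> fst (?out (c, ov', ?s)) \<in> {1, 3}" for ov'
          using entry_loc_in[OF mw, of 1] entry_loc_in[OF mw, of 3] by fastforce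
        moreover obtain ov' where "p = ?inn (c, ov', ?s) \<or> p = ?out (c, ov', ?s)"
          using crossing_ends_entry[OF 2(2)] by blast
        ultimately have "fst p \<in> {1, 3}" by metis
        then show ?thesis using p by auto
      qed
    qed
    have E: "g p \<in> ?E" if "p \<le> 5" for p using that lenM by (auto simp: seg_edges_Pair g_def)
    have ends: "q \<le> 5" if "x \<in> set (bigon d s)" "q \<in> crossing_ends x" for q x
      using that by (auto simp: bigon_def Let_def)
    have g_inj: "g p \<noteq> g q" if "p \<le> 5" "q \<le> 5" "p \<noteq> q" for p q
      using that by (auto simp: g_def)
    have "bracket_expand ?E (map (map_crossing g) (bigon d s)) S =
      state_sum (\<lambda>qs. loop_value ^ (num_classes (?E - g ` set [1, 4]) (S \<union> map_prod g g ` set qs) - 1))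
        (reduced_states [1, 4] (bigon d s))"
    proof (rule bracket_expand_reduced)
      have "(0, 0) \<in> ?E" by (simp add: seg_edges_Pair)
      then show "?E - g ` set [1, 4] \<noteq> {}" unfolding gI by auto
      show "g q \<noteq> g p" if "p \<in> set [1, 4]" "q \<in> (\<Union>x\<in>set (bigon d s). crossing_ends x) \<union> set [1, 4]" "q \<noteq> p" for p q
        using that ends by (intro g_inj) auto
      show "g p \<in> ?E \<and> g p \<notin> touching S" if "p \<in> set [1, 4]" for p
      proof -
        have "g p = (0, 1) \<or> g p = (2, 1)" "p \<le> 5" using that by (auto simp: g_def)
        then show ?thesis using E[of p] tS[of "g p"] by simp
      qed
      show "g q \<in> ?E" if "x \<in> set (bigon d s)" "q \<in> crossing_ends x" for q x
        using ends[OF that] E by simp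
      show "None \<notin> set (reduced_states [1, 4] (bigon d s))" by (rule bigon_states)
    qed simp_all
    then show "bracket_expand ?E (map (map_crossing g) (bigon d s)) S =
        1 * bracket_expand (?E - {(0, 1), (2, 1)}) [] (S \<union> {((0, 0), (0, 2)), ((2, 0), (2, 2))})"
      unfolding bigon_states gI by (simp add: loop_value_def g_def)
  qed
  also have "bracket_expand (?E - {(0, 1), (2, 1)}) (map ?X cs @ []) (?J \<union> {((0, 0), (0, 2)), ((2, 0), (2, 2))})
    = bracket (concat [[], [], u, [], [], v])"
  proof -
    \<comment> \<open>As for the kink, each strand of the removed bigon leaves two empty segments,
      carrying its outer edges.\<close>
    let ?nm = "\<lambda>j off. if j = 0 then (0::nat, 0::nat) else if j = 1 then (0, 2) else if j = 2 then (1, off)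
      else if j = 3 then (2, 0) else if j = 4 then (2, 2) else (3, off)"
    let ?segs' = "[[], [], u, [], [], v]"
    have less: "j < length ?segs' \<longleftrightarrow> j = 0 \<or> j = 1 \<or> j = 2 \<or> j = 3 \<or> j = 4 \<or> j = 5" for j
      by (auto simp: less_Suc_eq)
    have less4: "j < length ?segs \<longleftrightarrow> j = 0 \<or> j = 1 \<or> j = 2 \<or> j = 3" for j
      by (auto simp: less_Suc_eq)
    have "bracket (concat ?segs') = bracket_expand (seg_edges ?segs' ?nm)
      (map (\<lambda>c. entry_crossing ?inn ?out (crossing_sign (concat ?segs') c) c) cs) (seg_joins ?segs' ?nm)"
    proof (rule bracket_segments)
      show "inj_on (\<lambda>(j, off). ?nm j off) {(j, off). j < length ?segs' \<and> off \<le> length (?segs' ! j)}"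
      proof (rule inj_onI)
        fix x y assume x: "x \<in> {(j, off). j < length ?segs' \<and> off \<le> length (?segs' ! j)}"
          and y: "y \<in> {(j, off). j < length ?segs' \<and> off \<le> length (?segs' ! j)}"
          and eq: "(\<lambda>(j, off). ?nm j off) x = (\<lambda>(j, off). ?nm j off) y"
        obtain j off j' off' where xy: "x = (j, off)" "y = (j', off')" by (cases x, cases y)
        have "j < length ?segs'" "off \<le> length (?segs' ! j)" "j' < length ?segs'" "off' \<le> length (?segs' ! j')"
          using x y xy by simp_all
        then show "x = y" using eq unfolding xy less prod.case by (elim disjE) simp_all
      qed
      show "?inn (?segs' ! j ! off) = ?nm j off" "?out (?segs' ! j ! off) = ?nm j (Suc off)"
        if "j < length ?segs'" "off < length (?segs' ! j)" for j off
        using that nu nv unfolding less by auto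
    qed (use mu cs in auto)
    moreover have "seg_edges ?segs' ?nm = ?E - {(0, 1), (2, 1)}"
    proof (intro equalityI subsetI)
      fix p assume "p \<in> seg_edges ?segs' ?nm"
      then show "p \<in> ?E - {(0, 1), (2, 1)}"
        unfolding seg_edges_def less less4 using lenM by auto
    next
      fix p assume p: "p \<in> ?E - {(0, 1), (2, 1)}"
      obtain j off where jo: "p = (j, off)" "j < length ?segs" "off \<le> length (?segs ! j)"
        using p by (auto simp: seg_edges_def)
      have "\<exists>j' off'. p = ?nm j' off' \<and> j' < length ?segs' \<and> off' \<le> length (?segs' ! j')"
      proof -
        consider "j = 0" "off = 0" | "j = 0" "off = 2" | "j = 1" | "j = 2" "off = 0" | "j = 2" "off = 2" | "j = 3"
          using jo p lenM unfolding less4 by (auto simp: le_Suc_eq numeral_2_eq_2)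
        then show ?thesis
        proof cases
          case 1 then show ?thesis using jo by (intro exI[of _ 0] exI[of _ "0::nat"]) auto
        next
          case 2 then show ?thesis using jo by (intro exI[of _ 1] exI[of _ "0::nat"]) auto
        next
          case 3 then show ?thesis using jo by (intro exI[of _ 2] exI[of _ off]) auto
        next
          case 4 then show ?thesis using jo by (intro exI[of _ 3] exI[of _ "0::nat"]) auto
        next
          case 5 then show ?thesis using jo by (intro exI[of _ 4] exI[of _ "0::nat"]) auto
        next
          case 6 then show ?thesis using jo by (intro exI[of _ 5] exI[of _ off]) auto
        qed
      qed
      then show "p \<in> seg_edges ?segs' ?nm" unfolding seg_edges_def by blast
    qed
    moreover have "seg_joins ?segs' ?nm = ?J \<union> {((0, 0), (0, 2)), ((2, 0), (2, 2))}"
      unfolding seg_joins_numeral lenM by (simp flip: numeral_2_eq_2) blast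
    moreover have "map (\<lambda>c. entry_crossing ?inn ?out (crossing_sign (concat ?segs') c) c) cs = map ?X cs"
    proof (rule map_cong[OF refl])
      fix c assume "c \<in> set cs"
      then have "crossing_sign (concat ?segs') c = crossing_sign ?w c"
        using cs ab setM by (auto simp: crossing_sign_def)
      then show "entry_crossing ?inn ?out (crossing_sign (concat ?segs') c) c = ?X c" by simp
    qed
    ultimately show ?thesis by (simp only: append_Nil2)
  qed
  finally show ?thesis by simp
qed

text \<open>Both codes are cut into six segments of the same lengths, so edges, joins and all outer
  crossings agree and only the triangle changes. The indices \<open>jm\<close> and \<open>jl\<close>
  of the middle and bottom strand cover both cyclic arrangements.\<close>

lemma bracket_R3:
  assumes m: "matched (concat segs)" and m': "matched (concat segs')"
    and len: "length segs = 6" "length segs' = 6" and jml: "(jm, jl) = (2, 4) \<or> (jm, jl) = (4, 2)"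
    and rest: "segs' ! 1 = segs ! 1" "segs' ! 3 = segs ! 3" "segs' ! 5 = segs ! 5"
    and T: "segs ! 0 = traverse t [(a, True, sa), (b, True, sb)]"
      "segs' ! 0 = traverse (\<not> t) [(a, True, sa), (b, True, sb)]"
    and M: "segs ! jm = traverse m [(a, False, sa), (c, True, sc)]"
      "segs' ! jm = traverse (\<not> m) [(a, False, sa), (c, True, sc)]"
    and L: "segs ! jl = traverse l [(b, False, sb), (c, False, sc)]"
      "segs' ! jl = traverse (\<not> l) [(b, False, sb), (c, False, sc)]"
    and signs: "(sa = sb) = (m = l)" "(sa = sc) = (t = l)" "(sb = sc) = (t = m)"
  shows "bracket (concat segs') = bracket (concat segs)"
proof -
  let ?w = "concat segs"
  define g :: "nat \<Rightarrow> nat \<times> nat" where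
    "g p = (if p < 3 then (0, p) else if p < 6 then (jm, p - 3) else (jl, p - 6))" for p
  have less: "j < 6 \<longleftrightarrow> j = 0 \<or> j = 1 \<or> j = jm \<or> j = 3 \<or> j = jl \<or> j = 5" for j :: nat
    using jml by (auto simp: less_Suc_eq numeral_eq_Suc)
  have jl6: "0 < (6::nat)" "jm < 6" "jl < 6" "jm \<noteq> 0" "jl \<noteq> 0" "jm \<noteq> jl" "jm \<noteq> 1" "jm \<noteq> 3" "jm \<noteq> 5"
    "jl \<noteq> 1" "jl \<noteq> 3" "jl \<noteq> 5" using jml by auto
  have lens: "length (segs' ! j) = length (segs ! j)" if "j < 6" for j
    using that rest T M L unfolding less by (auto simp: traverse_def)
  have sets: "set (segs' ! j) = set (segs ! j)" if "j < 6" for j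
    using that rest T M L unfolding less by (auto simp: traverse_def)
  have set_w: "set (concat segs') = set ?w"
  proof -
    have "set (concat xs) = (\<Union>j<length xs. set (xs ! j))" for xs :: "gauss_code list"
      by (auto simp: set_conv_nth[of xs])
    then show ?thesis using len sets by auto
  qed
  have lab: "labels (concat segs') = labels ?w" and sgn': "crossing_sign (concat segs') = crossing_sign ?w"
    unfolding labels_def crossing_sign_def set_w by auto
  have in_w: "e \<in> set ?w" if "e \<in> set (segs ! j)" "j < 6" for e j
    using that len nth_mem[of j segs] by auto
  have ent: "(a, True, sa) \<in> set ?w" "(b, True, sb) \<in> set ?w" "(c, True, sc) \<in> set ?w"
    using in_w[of _ 0] in_w[of _ jm] T(1) M(1) jl6 by (auto simp: traverse_def)
  have dw: "distinct ?w" using m by (simp add: matched_def)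
  have sgn: "crossing_sign ?w a = sa" "crossing_sign ?w b = sb" "crossing_sign ?w c = sc"
    and abc_lab: "{a, b, c} \<subseteq> labels ?w"
    using ent matched_iff_sign[OF m] by auto
  have loc: "entry_loc ss e = (j, off)" "entry_end ss e = (j, Suc off)"
    if "matched (concat ss)" "length ss = 6" "j < 6" "off < length (ss ! j)" "ss ! j ! off = e" for ss j off e
    using entry_loc_nth[of ss j off] entry_end_nth[of ss j off] that by auto
  have T_loc: "entry_loc ss (a, True, sa) = g (of_bool (\<not> r)) \<and> entry_end ss (a, True, sa) = g (1 + of_bool (\<not> r)) \<and>
      entry_loc ss (b, True, sb) = g (of_bool r) \<and> entry_end ss (b, True, sb) = g (1 + of_bool r)"
    if "matched (concat ss)" "length ss = 6" "ss ! 0 = traverse r [(a, True, sa), (b, True, sb)]" for ss r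
    using loc[OF that(1,2), of 0 0] loc[OF that(1,2), of 0 1] that(3) jl6
    by (cases r) (auto simp: traverse_def g_def)
  have M_loc: "entry_loc ss (a, False, sa) = g (3 + of_bool (\<not> r)) \<and> entry_end ss (a, False, sa) = g (4 + of_bool (\<not> r)) \<and>
      entry_loc ss (c, True, sc) = g (3 + of_bool r) \<and> entry_end ss (c, True, sc) = g (4 + of_bool r)"
    if "matched (concat ss)" "length ss = 6" "ss ! jm = traverse r [(a, False, sa), (c, True, sc)]" for ss r
    using loc[OF that(1,2), of jm 0] loc[OF that(1,2), of jm 1] that(3) jl6
    by (cases r) (auto simp: traverse_def g_def)
  have L_loc: "entry_loc ss (b, False, sb) = g (6 + of_bool (\<not> r)) \<and> entry_end ss (b, False, sb) = g (7 + of_bool (\<not> r)) \<and>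
      entry_loc ss (c, False, sc) = g (6 + of_bool r) \<and> entry_end ss (c, False, sc) = g (7 + of_bool r)"
    if "matched (concat ss)" "length ss = 6" "ss ! jl = traverse r [(b, False, sb), (c, False, sc)]" for ss r
    using loc[OF that(1,2), of jl 0] loc[OF that(1,2), of jl 1] that(3) jl6
    by (cases r) (auto simp: traverse_def g_def)
  have fst_loc: "fst (entry_loc segs (a, True, sa)) = 0" "fst (entry_loc segs (b, True, sb)) = 0"
    "fst (entry_loc segs (c, True, sc)) = jm"
    by (rule entry_loc_in(1)[OF m]; use len jl6 T(1) M(1) in \<open>simp add: traverse_def\<close>)+
  have "distinct (segs ! 0)" using dw len by (simp add: distinct_concat_iff)
  then have ab: "a \<noteq> b" using T(1) sgn by (auto simp: traverse_def split: if_splits)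
  moreover have ac: "a \<noteq> c" using fst_loc(1,3) jl6 sgn by auto
  moreover have bc: "b \<noteq> c" using fst_loc(2,3) jl6 sgn by auto
  ultimately have abc: "a \<noteq> b" "a \<noteq> c" "b \<noteq> c" by auto
  obtain cs where cs: "distinct cs" "set cs = labels ?w - {a, b, c}"
    using finite_distinct_list[of "labels ?w - {a, b, c}"] by auto
  let ?E = "seg_edges segs Pair" and ?J = "seg_joins segs Pair"
  let ?X = "\<lambda>ss c. entry_crossing (entry_loc ss) (entry_end ss) (crossing_sign ?w c) c"
  have local: "map (?X ss) [a, b, c] = map (map_crossing g) (triangle r1 r2 r3 sa sb sc)"
    if "matched (concat ss)" "length ss = 6" "ss ! 0 = traverse r1 [(a, True, sa), (b, True, sb)]"
      "ss ! jm = traverse r2 [(a, False, sa), (c, True, sc)]"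
      "ss ! jl = traverse r3 [(b, False, sb), (c, False, sc)]" for ss r1 r2 r3
    using T_loc[OF that(1-3)] M_loc[OF that(1,2,4)] L_loc[OF that(1,2,5)]
    unfolding triangle_def Let_def list.map entry_crossing_def sgn mk_crossing_map[symmetric] by simp
  have EJ: "seg_edges segs' Pair = ?E" "seg_joins segs' Pair = ?J"
    unfolding seg_edges_def seg_joins_def using len lens by auto
  have rest_entry: "\<exists>j. j \<in> {1, 3, 5} \<and> (x, ov, crossing_sign ?w x) \<in> set (segs ! j)"
    if "x \<in> set cs" for x ov
  proof -
    have "(x, ov, crossing_sign ?w x) \<in> set ?w" "x \<notin> {a, b, c}"
      using that cs matched_iff_sign[OF m] by auto
    then obtain j where j: "j < 6" "(x, ov, crossing_sign ?w x) \<in> set (segs ! j)"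
      using len by (auto simp: set_conv_nth[of segs])
    moreover have "set (segs ! 0) = {(a, True, sa), (b, True, sb)}" "set (segs ! jm) = {(a, False, sa), (c, True, sc)}"
      "set (segs ! jl) = {(b, False, sb), (c, False, sc)}"
      unfolding T(1) M(1) L(1) by (auto simp: traverse_def)
    then have "j \<noteq> 0" "j \<noteq> jm" "j \<noteq> jl"
      using j(2) \<open>x \<notin> {a, b, c}\<close> by auto
    ultimately show ?thesis unfolding less by blast
  qed
  have rest_X: "?X segs' x = ?X segs x" if xcs: "x \<in> set cs" for x
  proof -
    have "entry_loc segs' (x, ov, crossing_sign ?w x) = entry_loc segs (x, ov, crossing_sign ?w x) \<and>
        entry_end segs' (x, ov, crossing_sign ?w x) = entry_end segs (x, ov, crossing_sign ?w x)" for ov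
    proof -
      obtain j where j: "j \<in> {1, 3, 5}" "(x, ov, crossing_sign ?w x) \<in> set (segs ! j)"
        using rest_entry[OF xcs] by blast
      then obtain off where off: "off < length (segs ! j)" "segs ! j ! off = (x, ov, crossing_sign ?w x)"
        by (auto simp: in_set_conv_nth)
      have "segs' ! j = segs ! j" "j < 6" using j rest by auto
      then show ?thesis using loc[OF m len(1) _ off] loc[OF m' len(2), of j off] off by simp
    qed
    then show ?thesis by (simp add: entry_crossing_def)
  qed
  have segs_ne: "segs \<noteq> []" "segs' \<noteq> []" using len by auto
  have csabc: "distinct (cs @ [a, b, c])" "set (cs @ [a, b, c]) = labels ?w"
    using cs abc apply simp
    unfolding set_append cs(2) using abc_lab by auto
  have "bracket ?w = bracket_expand ?E (map (?X segs) (cs @ [a, b, c])) ?J"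
    by (rule bracket_segments_Pair[OF m segs_ne(1) csabc])
  also have "\<dots> = bracket_expand ?E (map (?X segs) cs @ map (map_crossing g) (triangle t m l sa sb sc)) ?J"
    using local[OF m len(1) T(1) M(1) L(1)] by simp
  also have "\<dots> = 1 * bracket_expand ?E (map (?X segs) cs @ map (map_crossing g) (triangle (\<not> t) (\<not> m) (\<not> l) sa sb sc)) (?J \<union> {})"
  proof (rule bracket_expand_append)
    fix S assume S: "\<And>p. p \<in> touching S \<Longrightarrow> p \<in> touching ?J \<or> (\<exists>x\<in>set (map (?X segs) cs). p \<in> crossing_ends x)"
    have tS: "p \<notin> touching S" if p: "p = (0, 1) \<or> p = (jm, 1) \<or> p = (jl, 1)" for p
    proof
      assume "p \<in> touching S"
      then consider "p \<in> touching ?J" | x where "x \<in> set cs" "p \<in> crossing_ends (?X segs x)"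
        using S unfolding set_map by blast
      then show False
      proof cases
        case 1
        have "length (segs ! 0) = 2" "length (segs ! jm) = 2" "length (segs ! jl) = 2"
          using T(1) M(1) L(1) by (simp_all add: traverse_def)
        then show ?thesis using p 1 by (auto simp: seg_joins_def touching_def)
      next
        case (2 x)
        let ?s = "crossing_sign ?w x"
        have "fst (entry_loc segs (x, ov', ?s)) \<in> {1, 3, 5} \<and> fst (entry_end segs (x, ov', ?s)) \<in> {1, 3, 5}" for ov'
        proof -
          obtain j where j: "j \<in> {1, 3, 5}" "(x, ov', ?s) \<in> set (segs ! j)"
            using rest_entry[OF 2(1)] by blast
          then have "j < length segs" using len by auto
          from entry_loc_in[OF m this j(2)] show ?thesis using j(1) by simp
        qed
        moreover obtain ov' where "p = entry_loc segs (x, ov', ?s) \<or> p = entry_end segs (x, ov', ?s)"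
          using crossing_ends_entry[OF 2(2)] by blast
        ultimately have "fst p \<in> {1, 3, 5}" by metis
        then show ?thesis using p jl6 by auto
      qed
    qed
    have E: "g p \<in> ?E" if "p \<le> 8" for p
      using that T(1) M(1) L(1) jl6 len by (auto simp: seg_edges_Pair g_def traverse_def)
    have ends: "q \<le> 8" if "x \<in> set (triangle r1 r2 r3 sa sb sc)" "q \<in> crossing_ends x" for q x r1 r2 r3
      using that by (auto simp: triangle_def Let_def of_bool_def split: if_splits)
    have g_inj: "g p \<noteq> g q" if "p \<le> 8" "q \<le> 8" "p \<noteq> q" for p q
      using that jl6 by (auto simp: g_def)
    have reduce: "bracket_expand ?E (map (map_crossing g) (triangle r1 r2 r3 sa sb sc)) S =
      state_sum (\<lambda>qs. loop_value ^ (num_classes (?E - g ` set [1, 4, 7]) (S \<union> map_prod g g ` set qs) - 1))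
        (reduced_states [1, 4, 7] (triangle r1 r2 r3 sa sb sc))"
      if "None \<notin> set (reduced_states [1, 4, 7] (triangle r1 r2 r3 sa sb sc))" for r1 r2 r3
    proof (rule bracket_expand_reduced)
      have "(0, 0) \<in> ?E" using len by (simp add: seg_edges_Pair)
      moreover have "(0, 0) \<notin> g ` set [1, 4, 7]" using jl6 by (simp add: g_def)
      ultimately show "?E - g ` set [1, 4, 7] \<noteq> {}" by blast
      show "g q \<noteq> g p" if "p \<in> set [1, 4, 7]"
        "q \<in> (\<Union>x\<in>set (triangle r1 r2 r3 sa sb sc). crossing_ends x) \<union> set [1, 4, 7]" "q \<noteq> p" for p q
        using that ends by (intro g_inj) auto
      show "g p \<in> ?E \<and> g p \<notin> touching S" if "p \<in> set [1, 4, 7]" for p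
      proof -
        have "g p = (0, 1) \<or> g p = (jm, 1) \<or> g p = (jl, 1)" "p \<le> 8" using that by (auto simp: g_def)
        then show ?thesis using E[of p] tS[of "g p"] by simp
      qed
      show "g q \<in> ?E" if "x \<in> set (triangle r1 r2 r3 sa sb sc)" "q \<in> crossing_ends x" for q x
        using ends[OF that] E by simp
      show "None \<notin> set (reduced_states [1, 4, 7] (triangle r1 r2 r3 sa sb sc))" by fact
    qed simp_all
    have signs': "(sa = sb) = ((\<not> m) = (\<not> l))" "(sa = sc) = ((\<not> t) = (\<not> l))" "(sb = sc) = ((\<not> t) = (\<not> m))"
      using signs by auto
    show "bracket_expand ?E (map (map_crossing g) (triangle t m l sa sb sc)) S =
        1 * bracket_expand ?E (map (map_crossing g) (triangle (\<not> t) (\<not> m) (\<not> l) sa sb sc)) (S \<union> {})"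
      unfolding Un_empty_right mult_1 reduce[OF triangle_states(1)[OF signs]]
        reduce[OF triangle_states(1)[OF signs']] by (rule triangle_states(2)[OF signs])
  qed
  also have "\<dots> = bracket_expand ?E (map (?X segs') (cs @ [a, b, c])) ?J"
    using local[OF m' len(2) T(2) M(2) L(2)] rest_X by (simp cong: map_cong)
  also have "\<dots> = bracket (concat segs')"
    using bracket_segments_Pair[OF m' segs_ne(2), of "cs @ [a, b, c]"] csabc
    unfolding lab EJ sgn' by metis
  finally show ?thesis by simp
qed

section \<open>Writhe normalisation and invariance of \<open>f_poly\<close>\<close>

definition writhe_factor :: "int \<Rightarrow> laurent" where
  "writhe_factor k = (if k \<ge> 0 then (- (A_inv ^ 3)) ^ nat k else (- (A_var ^ 3)) ^ nat (- k))"

lemma cube_inverse: "A_var ^ 3 * (A_inv ^ 3 * t) = t" "A_inv ^ 3 * (A_var ^ 3 * t) = t"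
  by (simp_all add: power3_eq_cube A_cancel mult.assoc mult.left_commute)

text \<open>The power law for an integer exponent; the step from -1 to 0, where the two branches
  meet, uses that \<open>A_var\<close> and \<open>A_inv\<close> are inverse to each other.\<close>

lemma writhe_factor_add1: "writhe_factor (k + 1) = writhe_factor k * - (A_inv ^ 3)"
proof (cases "k \<ge> 0")
  case True
  then show ?thesis by (simp add: writhe_factor_def nat_add_distrib)
next
  case False
  then obtain n where n: "k = - int (Suc n)" by (metis linorder_not_le negD)
  show ?thesis
  proof (cases n)
    case 0
    then show ?thesis using cube_inverse(1)[of 1] by (simp add: n writhe_factor_def)
  next
    case (Suc n')
    then have *: "nat (- (k + 1)) = Suc n'" "nat (- k) = Suc (Suc n')" "\<not> k + 1 \<ge> 0" using n by auto
    from * have "writhe_factor k * - (A_inv ^ 3) = (- (A_var ^ 3)) ^ Suc n' * (- (A_var ^ 3) * - (A_inv ^ 3))"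
      using False unfolding writhe_factor_def by (simp only: if_False power_Suc2 mult.assoc)
    also have "- (A_var ^ 3) * - (A_inv ^ 3) = 1" using cube_inverse(1)[of 1] by simp
    finally show ?thesis using * unfolding writhe_factor_def by (simp only: if_False mult_1_right)
  qed
qed

text \<open>The bracket factor of a kink is cancelled by the change of the writhe.\<close>

lemma writhe_factor_sign:
  "writhe_factor (k + sign s) * - ((if s then A_var else A_inv) ^ 3) = writhe_factor k"
proof (cases s)
  case True
  then show ?thesis using cube_inverse[of "writhe_factor k"]
    by (simp add: sign_def writhe_factor_add1 mult_ac)
next
  case False
  then show ?thesis using writhe_factor_add1[of "k - 1"] by (simp add: sign_def)
qed

lemma f_poly_factor: "f_poly w = writhe_factor (writhe w) * bracket w"
  by (simp add: f_poly_def writhe_factor_def)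

lemma writhe_append: "writhe (u @ v) = writhe u + writhe v"
  by (simp add: writhe_def)

lemma writhe_traverse: "writhe (traverse d u) = writhe u"
  by (simp add: writhe_def traverse_def rev_map[symmetric])

lemma f_poly_diagram_move:
  assumes "diagram_move w w'" "matched w" "matched w'"
  shows "f_poly w' = f_poly w"
  using assms
proof (induction rule: diagram_move.induct)
  case (relabel h w)
  have "writhe (map (map_prod h id) w) = writhe w"
    by (induction w) (auto simp: writhe_def)
  then show ?case by (simp add: f_poly_factor bracket_relabel[OF relabel(1)])
next
  case (rotate u v)
  then show ?case by (simp add: f_poly_factor bracket_rotate writhe_append add.commute)
next
  case (R1 u a ov s)
  have "writhe ([(a, ov, s), (a, \<not> ov, s)] @ u) = writhe u + sign s"
    by (simp add: writhe_def)
  then show ?case using bracket_R1[OF R1(2,1)] writhe_factor_sign[of "writhe u" s]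
    by (simp add: f_poly_factor mult.assoc[symmetric] del: mult_minus_left mult_minus_right)
next
  case (R2 u v a s b d)
  have "writhe ([(a, True, s), (b, True, \<not> s)] @ u @ traverse d [(a, False, s), (b, False, \<not> s)] @ v) = writhe (u @ v)"
    unfolding writhe_append writhe_traverse by (simp add: writhe_def sign_def)
  then show ?case by (simp only: f_poly_factor bracket_R2[OF R2(2,1)])
next
  case (R3 T a sa b sb M c sc L m l t u v x)
  let ?s = "[traverse t T, u, traverse m M, v, traverse l L, x]"
  let ?s' = "[traverse (\<not> t) T, u, traverse (\<not> m) M, v, traverse (\<not> l) L, x]"
  have "bracket (concat ?s') = bracket (concat ?s)"
    by (rule bracket_R3[of _ _ 2 4 t a sa b sb m c sc l]) (use R3 in simp_all)
  moreover have "writhe (concat ?s') = writhe (concat ?s)"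
    by (simp add: writhe_append writhe_traverse)
  ultimately show ?case by (simp add: f_poly_factor)
next
  case (R3' T a sa b sb M c sc L m l t u v x)
  let ?s = "[traverse t T, u, traverse l L, v, traverse m M, x]"
  let ?s' = "[traverse (\<not> t) T, u, traverse (\<not> l) L, v, traverse (\<not> m) M, x]"
  have "bracket (concat ?s') = bracket (concat ?s)"
    by (rule bracket_R3[of _ _ 4 2 t a sa b sb m c sc l]) (use R3' in simp_all)
  moreover have "writhe (concat ?s') = writhe (concat ?s)"
    by (simp add: writhe_append writhe_traverse)
  ultimately show ?case by (simp add: f_poly_factor)
qed

theorem f_poly_knot_equiv:
  assumes "knot_equiv w w'"
  shows "f_poly w' = f_poly w"
  using assms unfolding knot_equiv_def
proof (induction rule: equivclp_induct)
  case (step y z)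
  then show ?case using f_poly_diagram_move by (metis knot_diagram_def)
qed simp

text \<open>Serves to show that \<open>boundary F\<close> is matched, which is not part of
  \<open>seifert_surface\<close>: a nontrivial chain of moves starts at a knot diagram, and a
  trivial one at the given code.\<close>

lemma knot_equiv_matched:
  assumes "knot_equiv w w'" "matched w'"
  shows "matched w"
proof (cases "w = w'")
  case False
  have "equivclp (\<lambda>w w'. knot_diagram w \<and> knot_diagram w' \<and> diagram_move w w') w w'"
    using assms(1) by (simp add: knot_equiv_def)
  then show ?thesis using assms(2)
  proof (induction rule: converse_equivclp_induct)
    case (step y z)
    then show ?case by (auto simp: knot_diagram_def)
  qed simp
qed (use assms in simp)

section \<open>Resolutions of crossings\<close>

text \<open>If \<open>p\<close>, \<open>q\<close> are the incoming and outgoing edges of one strand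
  and \<open>r\<close>, \<open>s\<close> those of the other, 0 lets the strands pass through each
  other, 1 is the smoothing that respects orientations and 2 is the other smoothing.\<close>

definition resolution :: "nat \<Rightarrow> 'e \<Rightarrow> 'e \<Rightarrow> 'e \<Rightarrow> 'e \<Rightarrow> ('e \<times> 'e) set" where
  "resolution k p q r s = (if k = 0 then {(p, q), (r, s)} else if k = 1 then {(p, s), (r, q)} else {(p, r), (q, s)})"

lemma conn_edge: "(a, b) \<in> R \<Longrightarrow> conn R x a = conn R x b"
  using conn_trans[of R x a b] conn_trans[of R x b a] conn_base[of a b R] conn_base'[of a b R] by blast

lemma num_classes_insert2:
  assumes "finite E" "a \<in> E" "b \<in> E" "c \<in> E" "d \<in> E"
  shows "num_classes E R = num_classes E (insert (a, b) (insert (c, d) R)) +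
    of_bool (\<not> conn R c d) + of_bool (\<not> conn (insert (c, d) R) a b)"
  using num_classes_insert[of E c d R] num_classes_insert[of E a b "insert (c, d) R"] assms by simp

lemma even_middle: "even (a :: nat) \<Longrightarrow> even c \<Longrightarrow> 2 * d = a + (b + c) \<Longrightarrow> even b"
  by presburger

text \<open>\<open>handshake\<close> says that every edge has two ends among the joins
  \<open>J\<close> and the crossings \<open>C\<close>. It is stated for arbitrary weights so that
  indicator functions of components can be inserted.\<close>

locale four_ends =
  fixes E :: "'e set" and J :: "('e \<times> 'e) set" and C :: "'c set" and p q r s :: "'c \<Rightarrow> 'e"
  assumes finE: "finite E" and finJ: "finite J" and finC: "finite C"
    and JE: "J \<subseteq> E \<times> E"
    and ends: "\<And>c. c \<in> C \<Longrightarrow> p c \<in> E \<and> q c \<in> E \<and> r c \<in> E \<and> s c \<in> E"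
    and handshake: "\<And>\<chi> :: 'e \<Rightarrow> nat. 2 * (\<Sum>x\<in>E. \<chi> x) =
      (\<Sum>(a, b)\<in>J. \<chi> a + \<chi> b) + (\<Sum>c\<in>C. \<chi> (p c) + \<chi> (q c) + \<chi> (r c) + \<chi> (s c))"
begin

definition joins :: "'c set \<Rightarrow> ('c \<Rightarrow> nat) \<Rightarrow> ('e \<times> 'e) set" where
  "joins D k = J \<union> (\<Union>c\<in>D. resolution (k c) (p c) (q c) (r c) (s c))"

lemma joins_insert: "joins (insert c D) k = joins D k \<union> resolution (k c) (p c) (q c) (r c) (s c)"
  by (auto simp: joins_def)

lemma joins_subset: "D \<subseteq> C \<Longrightarrow> joins D k \<subseteq> E \<times> E"
  using JE ends by (fastforce simp: joins_def resolution_def split: if_splits)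

lemma finite_joins: "D \<subseteq> C \<Longrightarrow> finite (joins D k)"
  using joins_subset finE by (meson finite_SigmaI finite_subset)

text \<open>Without \<open>c\<close> a component is a circle or an arc, so it has an even number of
  free ends. The handshake identity for its indicator function gives this modulo 2, as every
  remaining pair lies inside or outside the component.\<close>

lemma parity:
  assumes "c \<in> C"
  shows "even (of_bool (conn (joins (C - {c}) k) x (p c)) + of_bool (conn (joins (C - {c}) k) x (q c)) +
    of_bool (conn (joins (C - {c}) k) x (r c)) + of_bool (conn (joins (C - {c}) k) x (s c)) :: nat)"
proof -
  let ?R = "joins (C - {c}) k"
  define \<chi> :: "'e \<Rightarrow> nat" where "\<chi> y = of_bool (conn ?R x y)" for y
  have eq: "\<chi> a = \<chi> b" if "(a, b) \<in> ?R" for a b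
    using conn_edge[OF that] by (simp add: \<chi>_def)
  have "even (\<Sum>(a, b)\<in>J. \<chi> a + \<chi> b)"
  proof (rule dvd_sum, clarify)
    fix a b assume "(a, b) \<in> J"
    then have "\<chi> a = \<chi> b" by (intro eq) (simp add: joins_def)
    then show "even (\<chi> a + \<chi> b)" by simp
  qed
  moreover have "even (\<Sum>c'\<in>C - {c}. \<chi> (p c') + \<chi> (q c') + \<chi> (r c') + \<chi> (s c'))"
  proof (rule dvd_sum)
    fix c' assume "c' \<in> C - {c}"
    then have "resolution (k c') (p c') (q c') (r c') (s c') \<subseteq> ?R" by (auto simp: joins_def)
    then show "even (\<chi> (p c') + \<chi> (q c') + \<chi> (r c') + \<chi> (s c'))"
      using eq[of "p c'"] eq[of "r c'"] eq[of "q c'" "s c'"]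
      by (auto simp: resolution_def split: if_splits)
  qed
  moreover have "2 * (\<Sum>x\<in>E. \<chi> x) = (\<Sum>(a, b)\<in>J. \<chi> a + \<chi> b) +
      (\<chi> (p c) + \<chi> (q c) + \<chi> (r c) + \<chi> (s c) + (\<Sum>c'\<in>C - {c}. \<chi> (p c') + \<chi> (q c') + \<chi> (r c') + \<chi> (s c')))"
    using handshake[of \<chi>] sum.remove[OF finC assms, of "\<lambda>c. \<chi> (p c) + \<chi> (q c) + \<chi> (r c) + \<chi> (s c)"] by simp
  ultimately have "even (\<chi> (p c) + \<chi> (q c) + \<chi> (r c) + \<chi> (s c))"
    using even_middle by blast
  then show ?thesis by (simp add: \<chi>_def)
qed

text \<open>A component \<open>K\<close> containing all four free ends would have
  \<open>card K - 2\<close> joins by counting ends, which is one fewer than connectedness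
  requires.\<close>

lemma not_all_connected:
  assumes "c \<in> C"
  shows "\<not> (conn (joins (C - {c}) k) (p c) (q c) \<and> conn (joins (C - {c}) k) (p c) (r c) \<and>
    conn (joins (C - {c}) k) (p c) (s c))"
proof
  let ?R = "joins (C - {c}) k"
  assume *: "conn ?R (p c) (q c) \<and> conn ?R (p c) (r c) \<and> conn ?R (p c) (s c)"
  define K where "K = {y \<in> E. conn ?R (p c) y}"
  define \<chi> :: "'e \<Rightarrow> nat" where "\<chi> y = of_bool (conn ?R (p c) y)" for y
  have eq: "\<chi> a = \<chi> b" if "(a, b) \<in> ?R" for a b
    using conn_edge[OF that] by (simp add: \<chi>_def)
  let ?RK = "{(a, b) \<in> ?R. a \<in> K}"
  let ?JK = "{(a, b) \<in> J. a \<in> K}" and ?CK = "\<lambda>c'. {(a, b) \<in> resolution (k c') (p c') (q c') (r c') (s c'). a \<in> K}"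
  have RE: "?R \<subseteq> E \<times> E" by (rule joins_subset) auto
  have pE: "p c \<in> E" using ends assms by blast
  have K1: "num_classes K ?RK = 1"
  proof -
    have "conn ?RK (p c) y" if "conn ?R (p c) y" for y
      using that
    proof (induction rule: conn_induct)
      case (step y z)
      have "y \<in> K" "z \<in> K"
        using step conn_in[OF step(1) RE pE] RE conn_trans[OF step(1)] conn_base[of y z ?R] conn_base'[of z y ?R]
        by (auto simp: K_def)
      then have "conn ?RK y z" using step(2) by (auto intro: conn_base conn_base')
      with step(3) show ?case by (rule conn_trans)
    qed simp
    then have 1: "conn ?RK (p c) y" if "y \<in> K" for y using that by (simp add: K_def)
    have "conn ?RK y z" if "y \<in> K" "z \<in> K" for y z
      using conn_trans[OF conn_sym[OF 1[OF that(1)]] 1[OF that(2)]] .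
    moreover have "p c \<in> K" using pE by (simp add: K_def)
    moreover have "finite K" using finE by (simp add: K_def)
    ultimately show ?thesis by (subst num_classes_one_iff) auto
  qed
  have cardJ: "2 * card ?JK \<le> (\<Sum>(a, b)\<in>J. \<chi> a + \<chi> b)"
  proof -
    have "(\<Sum>(a, b)\<in>?JK. \<chi> a + \<chi> b) = (\<Sum>z\<in>?JK. 2)"
    proof (rule sum.cong[OF refl])
      fix z assume "z \<in> ?JK"
      then obtain a b where z: "z = (a, b)" "(a, b) \<in> J" "a \<in> K" by auto
      then show "(case z of (a, b) \<Rightarrow> \<chi> a + \<chi> b) = 2"
        using eq[of a b] by (simp add: joins_def K_def \<chi>_def)
    qed
    moreover have "(\<Sum>(a, b)\<in>?JK. \<chi> a + \<chi> b) \<le> (\<Sum>(a, b)\<in>J. \<chi> a + \<chi> b)"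
      using finJ by (intro sum_mono2) auto
    ultimately show ?thesis by simp
  qed
  have cardC: "2 * card (?CK c') \<le> \<chi> (p c') + \<chi> (q c') + \<chi> (r c') + \<chi> (s c')" if "c' \<in> C - {c}" for c'
  proof -
    have sub: "resolution (k c') (p c') (q c') (r c') (s c') \<subseteq> ?R" using that by (auto simp: joins_def)
    have two: "2 * card {(a, b) \<in> {(a1, b1), (a2, b2)}. a \<in> K} \<le> \<chi> a1 + \<chi> b1 + \<chi> a2 + \<chi> b2"
      if "{(a1, b1), (a2, b2)} \<subseteq> ?R" for a1 b1 a2 b2
    proof -
      have e: "\<chi> a1 = \<chi> b1" "\<chi> a2 = \<chi> b2" using eq that by auto
      have "a1 \<in> K \<Longrightarrow> \<chi> a1 = 1" "a2 \<in> K \<Longrightarrow> \<chi> a2 = 1" by (auto simp: K_def \<chi>_def)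
      moreover have "{(a, b) \<in> {(a1, b1), (a2, b2)}. a \<in> K} =
          (if a1 \<in> K then {(a1, b1)} else {}) \<union> (if a2 \<in> K then {(a2, b2)} else {})" by auto
      ultimately show ?thesis using e by (auto simp: card_insert_if)
    qed
    consider "k c' = 0" | "k c' = 1" | "k c' \<noteq> 0" "k c' \<noteq> 1" by blast
    then show ?thesis
    proof cases
      case 1
      then show ?thesis using two[of "p c'" "q c'" "r c'" "s c'"] sub by (simp add: resolution_def)
    next
      case 2
      then have "2 * card (?CK c') \<le> \<chi> (p c') + \<chi> (s c') + \<chi> (r c') + \<chi> (q c')"
        using two[of "p c'" "s c'" "r c'" "q c'"] sub by (simp add: resolution_def)
      then show ?thesis by simp
    next
      case 3
      then have "2 * card (?CK c') \<le> \<chi> (p c') + \<chi> (r c') + \<chi> (q c') + \<chi> (s c')"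
        using two[of "p c'" "r c'" "q c'" "s c'"] sub by (simp add: resolution_def)
      then show ?thesis by simp
    qed
  qed
  have "?RK \<subseteq> ?JK \<union> (\<Union>c'\<in>C - {c}. ?CK c')" by (auto simp: joins_def)
  moreover have fin: "finite (?CK c')" for c' by (rule finite_subset[of _ "resolution (k c') (p c') (q c') (r c') (s c')"])
    (auto simp: resolution_def)
  moreover have finJK: "finite ?JK" using finJ by (rule rev_finite_subset) auto
  ultimately have "card ?RK \<le> card (?JK \<union> (\<Union>c'\<in>C - {c}. ?CK c'))"
    using finC by (intro card_mono) auto
  also have "\<dots> \<le> card ?JK + card (\<Union>c'\<in>C - {c}. ?CK c')" by (rule card_Un_le)
  also have "card (\<Union>c'\<in>C - {c}. ?CK c') \<le> (\<Sum>c'\<in>C - {c}. card (?CK c'))"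
    using finC by (intro card_UN_le) auto
  finally have "2 * card ?RK \<le> 2 * card ?JK + (\<Sum>c'\<in>C - {c}. 2 * card (?CK c'))"
    by (simp add: sum_distrib_left[symmetric])
  also have "\<dots> \<le> (\<Sum>(a, b)\<in>J. \<chi> a + \<chi> b) + (\<Sum>c'\<in>C - {c}. \<chi> (p c') + \<chi> (q c') + \<chi> (r c') + \<chi> (s c'))"
    using cardJ cardC by (intro add_mono sum_mono) auto
  \<comment> \<open>The surplus 4 comes from the free ends at \<open>c\<close>, which lie in
    \<open>K\<close> but belong to no remaining join.\<close>
  finally have "2 * card ?RK + 4 \<le> 2 * (\<Sum>x\<in>E. \<chi> x)"
    using handshake[of \<chi>] sum.remove[OF finC assms, of "\<lambda>c. \<chi> (p c) + \<chi> (q c) + \<chi> (r c) + \<chi> (s c)"] *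
    by (simp add: \<chi>_def)
  moreover have "(\<Sum>x\<in>E. \<chi> x) = card K"
    using finE by (simp add: \<chi>_def K_def of_bool_def sum.If_cases Int_def)
  moreover have "card K \<le> num_classes K ?RK + card ?RK"
  proof (rule num_classes_ge)
    show "finite K" using finE by (simp add: K_def)
    have fR: "finite ?R" by (rule finite_joins) auto
    show "finite ?RK" by (rule finite_subset[OF _ fR]) auto
    show "?RK \<subseteq> K \<times> K"
    proof (rule subsetI)
      fix z assume "z \<in> ?RK"
      then obtain a b where z: "z = (a, b)" and ab: "(a, b) \<in> ?R" "a \<in> K" by auto
      from ab have "b \<in> E" "conn ?R (p c) b" using RE conn_trans[OF _ conn_base] by (auto simp: K_def)
      then show "z \<in> K \<times> K" using ab z by (simp add: K_def)
    qed
  qed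
  ultimately show False using K1 by linarith
qed

text \<open>Without the crossing \<open>c\<close>, the state consists of circles and of two arcs that pair the four
  ends at \<open>c\<close>.\<close>

lemma arcs:
  fixes k :: "'c \<Rightarrow> nat"
  assumes "c \<in> C"
  defines "R \<equiv> joins (C - {c}) k"
  shows "(conn R (p c) (q c) \<and> conn R (r c) (s c) \<and> \<not> conn R (p c) (r c)) \<or>
    (conn R (p c) (r c) \<and> conn R (q c) (s c) \<and> \<not> conn R (p c) (q c)) \<or>
    (conn R (p c) (s c) \<and> conn R (q c) (r c) \<and> \<not> conn R (p c) (q c))"
proof -
  note P = parity[OF assms(1), of k, folded R_def]
  have tr: "conn R x z" if "conn R x y" "conn R y z" for x y z using that by (rule conn_trans)
  have sy: "conn R x y = conn R y x" for x y using conn_sym by metis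
  have N: "\<not> (conn R (p c) (q c) \<and> conn R (p c) (r c) \<and> conn R (p c) (s c))"
    using not_all_connected[OF assms(1), of k] by (simp add: R_def)
  have Pp: "conn R (p c) (q c) \<or> conn R (p c) (r c) \<or> conn R (p c) (s c)"
    "\<not> (conn R (p c) (q c) \<and> conn R (p c) (r c))" "\<not> (conn R (p c) (q c) \<and> conn R (p c) (s c))"
    "\<not> (conn R (p c) (r c) \<and> conn R (p c) (s c))"
    using P[of "p c"] N by (auto simp: of_bool_def split: if_splits)
  have Pq: "conn R (q c) (p c) \<or> conn R (q c) (r c) \<or> conn R (q c) (s c)"
    using P[of "q c"] by (auto simp: of_bool_def split: if_splits)
  have Pr: "conn R (r c) (p c) \<or> conn R (r c) (q c) \<or> conn R (r c) (s c)"
    using P[of "r c"] by (auto simp: of_bool_def split: if_splits)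
  show ?thesis using Pp Pq Pr tr sy by metis
qed

text \<open>Closing the two outer arcs by the resolution with the same pairing gives two circles, by
  either of the others one circle. In the second part the single loop and the unconnected ends
  \<open>p c\<close>, \<open>r c\<close> decide which pairing the arcs have.\<close>

lemma three_term:
  assumes "c \<in> C"
  shows "(-2 :: int) ^ num_classes E (joins C (k(c := 0))) + (-2) ^ num_classes E (joins C (k(c := 1)))
    + (-2) ^ num_classes E (joins C (k(c := 2))) = 0"
    and "num_classes E (joins C (k(c := 0))) = 1 \<Longrightarrow> \<not> conn (joins (C - {c}) k) (p c) (r c) \<Longrightarrow>
      num_classes E (joins C (k(c := 1))) = 2 \<and> num_classes E (joins C (k(c := 2))) = 1"
proof -
  let ?R = "joins (C - {c}) k"
  have J: "joins C (k(c := i)) = ?R \<union> resolution i (p c) (q c) (r c) (s c)" for i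
    using assms unfolding joins_def by (auto split: if_splits)
  have e: "p c \<in> E" "q c \<in> E" "r c \<in> E" "s c \<in> E" using ends[OF assms] by auto
  note n = num_classes_insert2[OF finE, of _ _ _ _ ?R]
  have J0: "joins C (k(c := 0)) = insert (p c, q c) (insert (r c, s c) ?R)"
    and J1: "joins C (k(c := 1)) = insert (p c, s c) (insert (r c, q c) ?R)"
    and J2: "joins C (k(c := 2)) = insert (p c, r c) (insert (q c, s c) ?R)"
    unfolding J resolution_def by auto
  let ?n = "num_classes E ?R"
  have sy: "conn ?R x y = conn ?R y x" for x y using conn_sym by metis
  have tr: "conn ?R x z" if "conn ?R x y" "conn ?R y z" for x y z using that by (rule conn_trans)
  consider (0) "conn ?R (p c) (q c)" "conn ?R (r c) (s c)" "\<not> conn ?R (p c) (r c)"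
    | (2) "conn ?R (p c) (r c)" "conn ?R (q c) (s c)" "\<not> conn ?R (p c) (q c)"
    | (1) "conn ?R (p c) (s c)" "conn ?R (q c) (r c)" "\<not> conn ?R (p c) (q c)"
    using arcs[OF assms] by blast
  then have "(num_classes E (joins C (k(c := 0))) = ?n \<and> num_classes E (joins C (k(c := 1))) + 1 = ?n
        \<and> num_classes E (joins C (k(c := 2))) + 1 = ?n \<and> \<not> conn ?R (p c) (r c) \<and> ?n > 1) \<or>
     (num_classes E (joins C (k(c := 0))) + 1 = ?n \<and> num_classes E (joins C (k(c := 1))) = ?n
        \<and> num_classes E (joins C (k(c := 2))) + 1 = ?n \<and> \<not> conn ?R (p c) (r c)) \<or>
     (num_classes E (joins C (k(c := 0))) + 1 = ?n \<and> num_classes E (joins C (k(c := 1))) + 1 = ?n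
        \<and> num_classes E (joins C (k(c := 2))) = ?n \<and> conn ?R (p c) (r c))"
  proof cases
    case 0
    have "\<not> conn ?R (r c) (q c)" "\<not> conn ?R (q c) (s c)" "\<not> conn ?R (p c) (s c)" using 0 sy tr by metis+
    moreover have "num_classes E (joins C (k(c := 1))) > 0" using finE e by (intro num_classes_pos) auto
    ultimately show ?thesis
      using 0 n[of "p c" "q c" "r c" "s c"] n[of "p c" "s c" "r c" "q c"] n[of "p c" "r c" "q c" "s c"] e sy
      unfolding J0 J1 J2 by (auto simp: conn_insert)
  next
    case 2
    have "\<not> conn ?R (r c) (q c)" "\<not> conn ?R (r c) (s c)" "\<not> conn ?R (p c) (s c)" using 2 sy tr by metis+
    then show ?thesis
      using 2 n[of "p c" "q c" "r c" "s c"] n[of "p c" "s c" "r c" "q c"] n[of "p c" "r c" "q c" "s c"] e sy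
      unfolding J0 J1 J2 by (auto simp: conn_insert)
  next
    case 1
    have "\<not> conn ?R (q c) (s c)" "\<not> conn ?R (r c) (s c)" "\<not> conn ?R (p c) (r c)" using 1 sy tr by metis+
    then show ?thesis
      using 1 n[of "p c" "q c" "r c" "s c"] n[of "p c" "s c" "r c" "q c"] n[of "p c" "r c" "q c" "s c"] e sy
      unfolding J0 J1 J2 by (auto simp: conn_insert)
  qed
  note cases = this
  obtain m where m: "?n = Suc m" using num_classes_pos[OF finE, of ?R] e by (cases ?n) auto
  show "(-2 :: int) ^ num_classes E (joins C (k(c := 0))) + (-2) ^ num_classes E (joins C (k(c := 1)))
    + (-2) ^ num_classes E (joins C (k(c := 2))) = 0"
    using cases m by auto
  show "num_classes E (joins C (k(c := 0))) = 1 \<Longrightarrow> \<not> conn ?R (p c) (r c) \<Longrightarrow>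
      num_classes E (joins C (k(c := 1))) = 2 \<and> num_classes E (joins C (k(c := 2))) = 1"
    using cases by linarith
qed

end

section \<open>The state sum at \<open>A\<^sup>4 = 1\<close>\<close>

context four_ends begin

definition weight :: "('c \<Rightarrow> nat) \<Rightarrow> int" where
  "weight k = (-2) ^ num_classes E (joins C k)"

text \<open>By the three-term relation, summing over both smoothings at one crossing replaces it by
  minus the resolution 0; the induction does this at all crossings of \<open>D\<close>.\<close>

lemma sum_states:
  assumes "finite D" "D \<subseteq> C" "\<And>c. c \<in> D \<Longrightarrow> {\<alpha> c, \<beta> c} = {1, 2}"
  shows "(\<Sum>S\<in>Pow D. weight (\<lambda>c. if c \<in> D then (if c \<in> S then \<alpha> c else \<beta> c) else k c)) =
    (-1) ^ card D * weight (\<lambda>c. if c \<in> D then 0 else k c)"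
  using assms
proof (induction D arbitrary: k rule: finite_induct)
  case (insert c D)
  let ?f = "\<lambda>k S c'. if c' \<in> D then (if c' \<in> S then \<alpha> c' else \<beta> c') else k c'"
  let ?g = "\<lambda>S c'. if c' \<in> insert c D then (if c' \<in> S then \<alpha> c' else \<beta> c') else k c'"
  have "weight (?g (insert c S)) + weight (?g S) = - weight (?f (k(c := 0)) S)" if "S \<in> Pow D" for S
  proof -
    have "c \<notin> S" using that insert.hyps by auto
    then have "?g (insert c S) = (?f k S)(c := \<alpha> c)" "?g S = (?f k S)(c := \<beta> c)"
      "?f (k(c := 0)) S = (?f k S)(c := 0)"
      using insert.hyps by (auto simp: fun_eq_iff)
    moreover have "{\<alpha> c, \<beta> c} = {1, 2}" using insert.prems by auto
    then have "\<alpha> c = 1 \<and> \<beta> c = 2 \<or> \<alpha> c = 2 \<and> \<beta> c = 1" by (auto simp: doubleton_eq_iff)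
    moreover have "c \<in> C" using insert.prems by auto
    ultimately show ?thesis
      using three_term(1)[of c "?f k S"] by (auto simp: weight_def)
  qed
  then have "(\<Sum>S\<in>Pow (insert c D). weight (?g S)) = (\<Sum>S\<in>Pow D. - weight (?f (k(c := 0)) S))"
    using sum_Pow_insert[OF insert.hyps(1,2), of "\<lambda>S. weight (?g S)"]
    by (simp add: sum.distrib[symmetric])
  also have "\<dots> = - ((-1) ^ card D * weight (\<lambda>c'. if c' \<in> D then 0 else (k(c := 0)) c'))"
    using insert.IH[of "k(c := 0)"] insert.prems by (simp add: sum_negf)
  also have "(\<lambda>c'. if c' \<in> D then 0 else (k(c := 0)) c') = (\<lambda>c'. if c' \<in> insert c D then 0 else k c')"
    by (auto simp: fun_eq_iff)
  finally show ?case using insert.hyps by simp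
qed simp

end

text \<open>The smoothing respecting orientations is the A-smoothing at positive and the B-smoothing
  at negative crossings.\<close>

lemma num_classes_state:
  fixes sg :: "nat \<Rightarrow> bool"
  shows "num_classes E (\<Union>c\<in>C. smoothing (c \<in> S) (entry_crossing inn out (sg c) c)) =
   num_classes E (\<Union>c\<in>C. resolution (if (c \<in> S) = sg c then 1 else 2) (inn (c, True, sg c)) (out (c, True, sg c))
      (inn (c, False, sg c)) (out (c, False, sg c)))"
proof (rule num_classes_cong_conn)
  let ?A = "\<lambda>c. smoothing (c \<in> S) (entry_crossing inn out (sg c) c)"
  let ?B = "\<lambda>c. resolution (if (c \<in> S) = sg c then 1 else 2) (inn (c, True, sg c)) (out (c, True, sg c))
      (inn (c, False, sg c)) (out (c, False, sg c))"
  have 1: "(a, b) \<in> ?B c \<or> (b, a) \<in> ?B c" if "(a, b) \<in> ?A c" for a b c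
    using that by (cases "sg c"; cases "c \<in> S") (auto simp: smoothing_def entry_crossing_def mk_crossing_def
        A_smoothing_def B_smoothing_def joins_left_right_def joins_top_bottom_def resolution_def)
  have 2: "(a, b) \<in> ?A c \<or> (b, a) \<in> ?A c" if "(a, b) \<in> ?B c" for a b c
    using that by (cases "sg c"; cases "c \<in> S") (auto simp: smoothing_def entry_crossing_def mk_crossing_def
        A_smoothing_def B_smoothing_def joins_left_right_def joins_top_bottom_def resolution_def)
  show "conn (\<Union>c\<in>C. ?B c) a b" if ab: "(a, b) \<in> (\<Union>c\<in>C. ?A c)" for a b
  proof -
    obtain c where "c \<in> C" "(a, b) \<in> ?A c" using ab by blast
    then have "(a, b) \<in> (\<Union>c\<in>C. ?B c) \<or> (b, a) \<in> (\<Union>c\<in>C. ?B c)" using 1 by blast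
    then show ?thesis by (elim disjE) (rule conn_base conn_base', assumption)+
  qed
  show "conn (\<Union>c\<in>C. ?A c) a b" if ab: "(a, b) \<in> (\<Union>c\<in>C. ?B c)" for a b
  proof -
    obtain c where "c \<in> C" "(a, b) \<in> ?B c" using ab by blast
    then have "(a, b) \<in> (\<Union>c\<in>C. ?A c) \<or> (b, a) \<in> (\<Union>c\<in>C. ?A c)" using 2 by blast
    then show ?thesis by (elim disjE) (rule conn_base conn_base', assumption)+
  qed
qed

lemma sum_entries:
  assumes "matched w"
  shows "(\<Sum>e\<in>set w. f e) = (\<Sum>c\<in>labels w. f (c, True, crossing_sign w c) + f (c, False, crossing_sign w c))"
proof -
  have "set w = (\<lambda>(c, ov). (c, ov, crossing_sign w c)) ` (labels w \<times> UNIV)"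
    using matched_iff_sign[OF assms] by (auto simp: image_iff)
  moreover have inj: "inj_on (\<lambda>(c, ov). (c, ov, crossing_sign w c)) (labels w \<times> UNIV)" by (auto simp: inj_on_def)
  ultimately have "(\<Sum>e\<in>set w. f e) = (\<Sum>(c, ov)\<in>labels w \<times> UNIV. f (c, ov, crossing_sign w c))"
    using sum.reindex[OF inj, of f] by (simp only: o_def case_prod_unfold)
  also have "\<dots> = (\<Sum>c\<in>labels w. \<Sum>ov\<in>UNIV. f (c, ov, crossing_sign w c))"
    by (simp add: sum.cartesian_product)
  finally show ?thesis by (simp add: UNIV_bool add.commute)
qed

lemma writhe_labels:
  assumes "matched w"
  shows "writhe w = (\<Sum>c\<in>labels w. sign (crossing_sign w c))"
proof -
  have "distinct w" using assms by (simp add: matched_def)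
  then have "writhe w = (\<Sum>(c, ov, s)\<in>set w. if ov then sign s else 0)"
    by (simp add: writhe_def sum_list_distinct_conv_sum_set)
  then show ?thesis by (simp add: sum_entries[OF assms])
qed

lemma sum_pos:
  assumes "distinct w"
  shows "(\<Sum>e\<in>set w. f (pos w e)) = (\<Sum>i<length w. f i)"
    and "(\<Sum>e\<in>set w. f (next_pos w e)) = (\<Sum>i<length w. f i)"
proof -
  have bij: "bij_betw (pos w) (set w) {..<length w}"
    by (rule bij_betw_byWitness[where f' = "\<lambda>i. w ! i"]) (use pos_in[OF assms] pos_nth[OF assms] in auto)
  show "(\<Sum>e\<in>set w. f (pos w e)) = (\<Sum>i<length w. f i)"
    using sum.reindex_bij_betw[OF bij] by simp
  have "bij_betw (\<lambda>i. Suc i mod length w) {..<length w} {..<length w}"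
  proof (cases w)
    case (Cons a u)
    let ?n = "length w"
    show ?thesis
    proof (rule bij_betw_byWitness[where f' = "\<lambda>i. (i + (?n - 1)) mod ?n"])
      show "\<forall>i\<in>{..<?n}. (Suc i mod ?n + (?n - 1)) mod ?n = i"
      proof
        fix i assume "i \<in> {..<?n}"
        then have "(i + ?n) mod ?n = i" by simp
        moreover have "Suc i + (?n - 1) = i + ?n" using Cons by simp
        ultimately have "(Suc i + (?n - 1)) mod ?n = i" by metis
        then show "(Suc i mod ?n + (?n - 1)) mod ?n = i" by (simp add: mod_add_left_eq)
      qed
      show "\<forall>i\<in>{..<?n}. Suc ((i + (?n - 1)) mod ?n) mod ?n = i"
      proof
        fix i assume "i \<in> {..<?n}"
        then have "(i + ?n) mod ?n = i" by simp
        moreover have "Suc (i + (?n - 1)) = i + ?n" using Cons by simp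
        ultimately have "Suc (i + (?n - 1)) mod ?n = i" by metis
        then show "Suc ((i + (?n - 1)) mod ?n) mod ?n = i" by (simp add: mod_Suc_eq)
      qed
    qed (use Cons in auto)
  qed simp
  then have "bij_betw (next_pos w) (set w) {..<length w}"
    using bij_betw_trans[OF bij] by (simp add: next_pos_def[abs_def] o_def)
  then show "(\<Sum>e\<in>set w. f (next_pos w e)) = (\<Sum>i<length w. f i)"
    using sum.reindex_bij_betw by blast
qed

lemma four_ends_positions:
  assumes "matched w" "w \<noteq> []"
  shows "four_ends {..<length w} {} (labels w)
    (\<lambda>c. pos w (c, True, crossing_sign w c)) (\<lambda>c. next_pos w (c, True, crossing_sign w c))
    (\<lambda>c. pos w (c, False, crossing_sign w c)) (\<lambda>c. next_pos w (c, False, crossing_sign w c))"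
proof
  have d: "distinct w" using assms by (simp add: matched_def)
  show "pos w (c, True, crossing_sign w c) \<in> {..<length w} \<and>
      next_pos w (c, True, crossing_sign w c) \<in> {..<length w} \<and>
      pos w (c, False, crossing_sign w c) \<in> {..<length w} \<and>
      next_pos w (c, False, crossing_sign w c) \<in> {..<length w}" if "c \<in> labels w" for c
    using that matched_iff_sign[OF assms(1)] pos_in(1)[OF d] assms(2) by (simp add: next_pos_def)
  fix \<chi> :: "nat \<Rightarrow> nat"
  have "2 * (\<Sum>i<length w. \<chi> i) = (\<Sum>e\<in>set w. \<chi> (pos w e) + \<chi> (next_pos w e))"
    by (simp add: sum.distrib sum_pos[OF d])
  also have "\<dots> = (\<Sum>c\<in>labels w. \<chi> (pos w (c, True, crossing_sign w c)) + \<chi> (next_pos w (c, True, crossing_sign w c)) +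
    \<chi> (pos w (c, False, crossing_sign w c)) + \<chi> (next_pos w (c, False, crossing_sign w c)))"
    unfolding sum_entries[OF assms(1)] by (simp add: add.assoc)
  finally show "2 * (\<Sum>i<length w. \<chi> i) = (\<Sum>(a, b)\<in>{}. \<chi> a + \<chi> b) + (\<Sum>c\<in>labels w. \<chi> (pos w (c, True, crossing_sign w c)) + \<chi> (next_pos w (c, True, crossing_sign w c)) +
    \<chi> (pos w (c, False, crossing_sign w c)) + \<chi> (next_pos w (c, False, crossing_sign w c)))" by simp
qed auto

text \<open>At \<open>A = 1\<close> the bracket sees each crossing as minus the crossing of two strands that pass
  through each other, since three ways of joining four ends have loop counts
  \<open>m, m - 1, m - 1\<close> and \<open>(-2)\<^sup>m + 2 (-2)\<^sup>m\<^sup>-\<^sup>1 = 0\<close>.\<close>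

theorem state_sums_at_1:
  assumes "matched w"
  shows "(\<Sum>S\<in>Pow (labels w). (-2 :: int) ^ (loops w S - 1)) = (-1) ^ card (labels w)"
    and "(\<Sum>S\<in>Pow (labels w). (2 * int (card S) - int (card (labels w))) * (-2) ^ (loops w S - 1)) =
      3 * (-1) ^ card (labels w) * writhe w"
proof -
  let ?C = "labels w" and ?sg = "crossing_sign w"
  have "(\<Sum>S\<in>Pow ?C. (-2 :: int) ^ (loops w S - 1)) = (-1) ^ card ?C \<and>
    (\<Sum>S\<in>Pow ?C. (2 * int (card S) - int (card ?C)) * (-2) ^ (loops w S - 1)) = 3 * (-1) ^ card ?C * writhe w"
  proof (cases "w = []")
    case True
    then have "loops w {} = 1"
      by (simp add: loops_def state_joins_def labels_def edges_def)
    then show ?thesis using True by (simp add: labels_def writhe_def)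
  next
    case False
    interpret four_ends "{..<length w}" "{}" ?C
      "\<lambda>c. pos w (c, True, ?sg c)" "\<lambda>c. next_pos w (c, True, ?sg c)"
      "\<lambda>c. pos w (c, False, ?sg c)" "\<lambda>c. next_pos w (c, False, ?sg c)"
      by (rule four_ends_positions[OF assms False])
    have d: "distinct w" using assms by (simp add: matched_def)
    have E: "edges w = {..<length w}" using False by (cases w) (auto simp: edges_def)
    let ?n = "length w"
    have n0: "?n > 0" using False by simp
    define \<alpha> \<beta> :: "nat \<Rightarrow> nat" where "\<alpha> c = (if ?sg c then 1 else 2)" and "\<beta> c = (if ?sg c then 2 else 1)" for c
    let ?k = "\<lambda>D S c. if c \<in> D then (if c \<in> S then \<alpha> c else \<beta> c) else 0"
    have ab: "{\<alpha> c, \<beta> c} = {1, 2}" for c by (auto simp: \<alpha>_def \<beta>_def)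
    have loops: "loops w S = num_classes {..<?n} (joins ?C (?k ?C S))" for S
      unfolding loops_def state_joins_def num_classes_state E joins_def Un_empty_left
      by (intro arg_cong[of _ _ "num_classes {..<?n}"] SUP_cong refl) (auto simp: \<alpha>_def \<beta>_def)
    have pos_loops: "loops w S > 0" for S
      unfolding loops by (rule num_classes_pos) (use False in auto)
    have wt: "weight (?k ?C S) = -2 * (-2) ^ (loops w S - 1)" for S
      unfolding weight_def loops[symmetric] using pos_loops[of S] by (cases "loops w S") auto
    \<comment> \<open>Going straight through every crossing traverses the knot once.\<close>
    have through: "num_classes {..<?n} (joins ?C (\<lambda>c. 0)) = 1"
    proof -
      have step: "conn (joins ?C (\<lambda>c. 0)) i (Suc i mod ?n)" if "i < ?n" for i
      proof -
        obtain c ov s where e: "w ! i = (c, ov, s)" by (cases "w ! i") auto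
        then have "(c, ov, s) \<in> set w" using that nth_mem by metis
        then have c: "c \<in> ?C" "s = ?sg c" using matched_iff_sign[OF assms] by auto
        have "pos w (c, ov, ?sg c) = i" "next_pos w (c, ov, ?sg c) = Suc i mod ?n"
          using pos_nth[OF d that] e c by (auto simp: next_pos_def)
        then have "(i, Suc i mod ?n) \<in> resolution 0 (pos w (c, True, ?sg c)) (next_pos w (c, True, ?sg c))
            (pos w (c, False, ?sg c)) (next_pos w (c, False, ?sg c))"
          by (cases ov) (simp_all add: resolution_def)
        then have "(i, Suc i mod ?n) \<in> joins ?C (\<lambda>c. 0)"
          using c(1) unfolding joins_def by blast
        then show ?thesis by (rule conn_base)
      qed
      have c0: "conn (joins ?C (\<lambda>c. 0)) 0 i" if "i < ?n" for i
        using that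
      proof (induction i)
        case (Suc i)
        then show ?case using step[of i] conn_trans[of _ 0 i "Suc i"] by simp
      qed simp
      have "conn (joins ?C (\<lambda>c. 0)) i j" if "i < ?n" "j < ?n" for i j
        by (rule conn_trans[OF conn_sym[OF c0[OF that(1)]] c0[OF that(2)]])
      moreover have "{..<?n} \<noteq> {}" using n0 by (metis lessThan_iff empty_iff)
      ultimately show ?thesis using num_classes_one_iff[of "{..<?n}" "joins ?C (\<lambda>c. 0)"] by auto
    qed
    have "(-2) * (\<Sum>S\<in>Pow ?C. (-2 :: int) ^ (loops w S - 1)) = (\<Sum>S\<in>Pow ?C. weight (?k ?C S))"
      by (simp add: wt sum_distrib_left)
    also have "\<dots> = (-1) ^ card ?C * weight (\<lambda>c. if c \<in> ?C then 0 else 0)"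
      by (rule sum_states) (use ab in auto)
    also have "\<dots> = (-1) ^ card ?C * (-2)" using through by (simp add: weight_def)
    finally have first: "(\<Sum>S\<in>Pow ?C. (-2 :: int) ^ (loops w S - 1)) = (-1) ^ card ?C" by simp

    \<comment> \<open>The sign factor blocks the relation at \<open>c\<close>; all other crossings
      become straight. There the smoothing respecting orientations has two loops, weight 4, and the
      other one has one loop, weight -2; the difference is 6.\<close>
    have one: "(\<Sum>S\<in>Pow ?C. (if c \<in> S then 1 else -1) * weight (?k ?C S)) =
        (-1) ^ (card ?C - 1) * 6 * sign (?sg c)" if c: "c \<in> ?C" for c
    proof -
      let ?D = "?C - {c}"
      have C: "?C = insert c ?D" "finite ?D" "c \<notin> ?D" "card ?D = card ?C - 1" using c by auto
      let ?kk = "\<lambda>v S c'. if c' \<in> ?D then (if c' \<in> S then \<alpha> c' else \<beta> c') else if c' = c then v else 0"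
      have k: "?k ?C (insert c S) = ?kk (\<alpha> c) S" "?k ?C S = ?kk (\<beta> c) S" if "S \<in> Pow ?D" for S
        using that c by (auto simp: fun_eq_iff)
      have s: "(\<Sum>S\<in>Pow ?D. weight (?kk v S)) = (-1) ^ (card ?C - 1) * weight ((\<lambda>c. 0)(c := v))" for v
      proof -
        have "(\<Sum>S\<in>Pow ?D. weight (?kk v S)) = (-1) ^ card ?D * weight (\<lambda>c'. if c' \<in> ?D then 0 else if c' = c then v else 0)"
          by (rule sum_states) (use ab in auto)
        moreover have "(\<lambda>c'. if c' \<in> ?D then 0 else if c' = c then v else 0) = (\<lambda>c. 0)(c := v)"
          by (auto simp: fun_eq_iff)
        ultimately show ?thesis using C(4) by simp
      qed
      have "(\<Sum>S\<in>Pow (insert c ?D). (if c \<in> S then 1 else -1) * weight (?k ?C S)) =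
        (\<Sum>S\<in>Pow ?D. (if c \<in> insert c S then 1 else -1) * weight (?k ?C (insert c S))) +
        (\<Sum>S\<in>Pow ?D. (if c \<in> S then 1 else -1) * weight (?k ?C S))"
        by (rule sum_Pow_insert[OF C(2,3)])
      also have "(\<Sum>S\<in>Pow ?D. (if c \<in> insert c S then 1 else -1) * weight (?k ?C (insert c S))) =
          (\<Sum>S\<in>Pow ?D. weight (?kk (\<alpha> c) S))"
        by (intro sum.cong refl) (simp only: k if_True insertI1 mult_1)
      also have "(\<Sum>S\<in>Pow ?D. (if c \<in> S then 1 else -1) * weight (?k ?C S)) =
          (\<Sum>S\<in>Pow ?D. - weight (?kk (\<beta> c) S))"
      proof (intro sum.cong refl)
        fix S assume "S \<in> Pow ?D"
        moreover from this have "c \<notin> S" by auto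
        ultimately show "(if c \<in> S then 1 else -1) * weight (?k ?C S) = - weight (?kk (\<beta> c) S)"
          by (simp only: k if_False mult_minus1)
      qed
      finally have *: "(\<Sum>S\<in>Pow ?C. (if c \<in> S then 1 else -1) * weight (?k ?C S)) =
          (-1) ^ (card ?C - 1) * (weight ((\<lambda>c. 0)(c := \<alpha> c)) - weight ((\<lambda>c. 0)(c := \<beta> c)))"
        using C(1) by (simp only: sum_negf s) (simp add: algebra_simps)
      have thr: "(\<lambda>c. 0)(c := 0) = (\<lambda>c. 0 :: nat)" by auto
      \<comment> \<open>Cut at \<open>c\<close>, the knot consists of two arcs, each leading from an
        outgoing to an incoming edge. If the two incoming edges were connected, counting incoming
        and outgoing edges in their component would put all four ends into it.\<close>
      have "\<not> conn (joins ?D (\<lambda>c. 0)) (pos w (c, True, ?sg c)) (pos w (c, False, ?sg c))"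
      proof
        let ?R = "joins ?D (\<lambda>c. 0)"
        let ?p = "\<lambda>c. pos w (c, True, ?sg c)" and ?q = "\<lambda>c. next_pos w (c, True, ?sg c)"
        let ?r = "\<lambda>c. pos w (c, False, ?sg c)" and ?s = "\<lambda>c. next_pos w (c, False, ?sg c)"
        assume pr: "conn ?R (?p c) (?r c)"
        define \<chi> :: "nat \<Rightarrow> nat" where "\<chi> y = of_bool (conn ?R (?p c) y)" for y
        have eq: "\<chi> (?p c') = \<chi> (?q c') \<and> \<chi> (?r c') = \<chi> (?s c')" if "c' \<in> ?D" for c'
        proof -
          have "(?p c', ?q c') \<in> ?R" "(?r c', ?s c') \<in> ?R"
            using that unfolding joins_def resolution_def by auto
          then show ?thesis unfolding \<chi>_def by (simp only: conn_edge)
        qed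
        have "(\<Sum>c\<in>?C. \<chi> (?p c) + \<chi> (?r c)) = (\<Sum>c\<in>?C. \<chi> (?q c) + \<chi> (?s c))"
          using sum_pos[OF d, of \<chi>] sum_entries[OF assms, of "\<lambda>e. \<chi> (pos w e)"]
            sum_entries[OF assms, of "\<lambda>e. \<chi> (next_pos w e)"] by simp
        moreover have "(\<Sum>c\<in>?C. \<chi> (?p c) + \<chi> (?r c)) = \<chi> (?p c) + \<chi> (?r c) + (\<Sum>c\<in>?D. \<chi> (?p c) + \<chi> (?r c))"
          "(\<Sum>c\<in>?C. \<chi> (?q c) + \<chi> (?s c)) = \<chi> (?q c) + \<chi> (?s c) + (\<Sum>c\<in>?D. \<chi> (?q c) + \<chi> (?s c))"
          using c by (simp_all add: sum.remove)
        moreover have "(\<Sum>c\<in>?D. \<chi> (?p c) + \<chi> (?r c)) = (\<Sum>c\<in>?D. \<chi> (?q c) + \<chi> (?s c))"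
          using eq by (intro sum.cong refl) simp
        ultimately have "\<chi> (?p c) + \<chi> (?r c) = \<chi> (?q c) + \<chi> (?s c)" by linarith
        then have "conn ?R (?p c) (?q c) \<and> conn ?R (?p c) (?s c)"
          using pr by (simp add: \<chi>_def of_bool_def split: if_splits)
        then show False using not_all_connected[OF c, of "\<lambda>c. 0"] pr by blast
      qed
      then have "num_classes {..<?n} (joins ?C ((\<lambda>c. 0)(c := 1))) = 2 \<and> num_classes {..<?n} (joins ?C ((\<lambda>c. 0)(c := 2))) = 1"
        using three_term(2)[OF c, of "\<lambda>c. 0"] through unfolding thr by blast
      then have "weight ((\<lambda>c. 0)(c := 1)) = 4" "weight ((\<lambda>c. 0)(c := 2)) = -2"
        by (simp_all add: weight_def)
      then show ?thesis using * by (simp add: \<alpha>_def \<beta>_def sign_def)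
    qed
    have aux: "(-2) * x = y * 6 * z \<Longrightarrow> x = - 3 * y * z" for x y z :: int by simp
    \<comment> \<open>\<open>2 * card S - card ?C\<close> is the sum of +1 over the crossings in
      \<open>S\<close> and -1 over the others, which reduces the sum to one crossing at a
      time.\<close>
    have "(-2) * (\<Sum>S\<in>Pow ?C. (2 * int (card S) - int (card ?C)) * (-2) ^ (loops w S - 1)) =
        (\<Sum>S\<in>Pow ?C. \<Sum>c\<in>?C. (if c \<in> S then 1 else -1) * weight (?k ?C S))"
    proof -
      have "(\<Sum>c\<in>?C. (if c \<in> S then 1 else -1)) = 2 * int (card S) - int (card ?C)" if "S \<in> Pow ?C" for S
      proof -
        have "(\<Sum>c\<in>?C. (if c \<in> S then 1 else -1)) = (\<Sum>c\<in>?C. 2 * of_bool (c \<in> S) - (1::int))"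
          by (intro sum.cong) auto
        also have "\<dots> = 2 * int (card (?C \<inter> S)) - int (card ?C)"
          by (simp add: sum_subtractf flip: sum_distrib_left)
        finally show ?thesis using that by (simp add: Int_absorb1)
      qed
      then have "(\<Sum>S\<in>Pow ?C. \<Sum>c\<in>?C. (if c \<in> S then 1 else -1) * weight (?k ?C S)) =
        (\<Sum>S\<in>Pow ?C. (2 * int (card S) - int (card ?C)) * weight (?k ?C S))"
        by (intro sum.cong refl) (simp only: flip: sum_distrib_right)
      then show ?thesis unfolding wt by (simp add: sum_distrib_left mult_ac)
    qed
    also have "\<dots> = (\<Sum>c\<in>?C. (-1) ^ (card ?C - 1) * 6 * sign (?sg c))"
      by (subst sum.swap) (intro sum.cong refl one)
    also have "\<dots> = (-1) ^ (card ?C - 1) * 6 * writhe w"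
      by (simp add: writhe_labels[OF assms] sum_distrib_left)
    finally have "(\<Sum>S\<in>Pow ?C. (2 * int (card S) - int (card ?C)) * (-2) ^ (loops w S - 1)) =
        - 3 * (-1) ^ (card ?C - 1) * writhe w" by (rule aux)
    moreover have "card ?C > 0" using False by (simp add: card_gt_0_iff labels_def)
    then have "(-1 :: int) ^ card ?C = - ((-1) ^ (card ?C - 1))" by (cases "card ?C") auto
    ultimately show ?thesis using first by (simp only: mult_minus_left mult_minus_right)
  qed
  then show "(\<Sum>S\<in>Pow ?C. (-2 :: int) ^ (loops w S - 1)) = (-1) ^ card ?C"
    "(\<Sum>S\<in>Pow ?C. (2 * int (card S) - int (card ?C)) * (-2) ^ (loops w S - 1)) = 3 * (-1) ^ card ?C * writhe w"
    by blast+
qed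

section \<open>The boundary of a band surface\<close>

lemma length_double_entry [simp]: "length (double_entry d e) = 2"
  by (cases e) auto

lemma double_entry_nth:
  "r < 2 \<Longrightarrow> double_entry d (c, ov, s) ! r =
     (if ov then edge_label c d ((r = 1) = (ov = s)) else edge_label c ((r = 1) = (ov = s)) d, ov,
      s = (d = ((r = 1) = (ov = s))))"
  by (auto simp: less_2_cases_iff)

lemma edge_label_inj: "edge_label c d e = edge_label c' d' e' \<longleftrightarrow> c = c' \<and> d = d' \<and> e = e'"
proof
  assume *: "edge_label c d e = edge_label c' d' e'"
  have "edge_label c d e mod 2 = of_bool e" "edge_label c d e div 2 mod 2 = of_bool d" "edge_label c d e div 4 = c"
    for c d e by (cases d; cases e; simp add: edge_label_def; presburger)+
  then show "c = c' \<and> d = d' \<and> e = e'" using * by (metis of_bool_eq_iff)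
qed simp

definition label_core :: "nat \<Rightarrow> nat" where "label_core l = l div 4"
definition label_over :: "nat \<Rightarrow> bool" where "label_over l = odd (l div 2)"
definition label_under :: "nat \<Rightarrow> bool" where "label_under l = odd l"

lemma edge_label_sel [simp]:
  "label_core (edge_label c d e) = c" "label_over (edge_label c d e) = d" "label_under (edge_label c d e) = e"
  by (auto simp: edge_label_def label_core_def label_over_def label_under_def)

lemma seg_start_const:
  "(\<And>x. x \<in> set xs \<Longrightarrow> length (f x) = m) \<Longrightarrow> k \<le> length xs \<Longrightarrow> seg_start (map f xs) k = m * k"
proof (induction k)
  case (Suc k)
  then show ?case by (simp add: seg_start_Suc)
qed simp

locale surface =
  fixes F :: band_surface
  assumes F: "seifert_surface F" and boundary_matched: "matched (boundary F)"
begin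

definition "n = num_bands F"
definition "len i = length (cores F ! i)"
definition "Cs = labels (concat (cores F))"
definition "sg = crossing_sign (concat (cores F))"
definition "over_loc c = entry_loc (cores F) (c, True, sg c)"
definition "under_loc c = entry_loc (cores F) (c, False, sg c)"

lemma matched_cores: "matched (concat (cores F))"
  using F by (simp add: seifert_surface_def)

lemma length_cores: "length (cores F) = n"
  by (simp add: n_def num_bands_def)

lemma core_entry:
  assumes "i < n" "k < len i" "cores F ! i ! k = (c, ov, s)"
  shows "c \<in> Cs" "s = sg c" "entry_loc (cores F) (c, ov, s) = (i, k)"
proof -
  have "(c, ov, s) \<in> set (cores F ! i)" using assms by (metis len_def nth_mem)
  then have "(c, ov, s) \<in> set (concat (cores F))"
    using assms(1) length_cores by (auto intro: nth_mem)
  then show "c \<in> Cs" "s = sg c"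
    using matched_iff_sign[OF matched_cores] by (auto simp: Cs_def sg_def)
  show "entry_loc (cores F) (c, ov, s) = (i, k)"
    using entry_loc_nth[OF matched_cores, of i k] assms by (simp add: length_cores len_def)
qed

lemma core_loc:
  assumes "c \<in> Cs"
  shows "fst (over_loc c) < n" "snd (over_loc c) < len (fst (over_loc c))"
    "cores F ! fst (over_loc c) ! snd (over_loc c) = (c, True, sg c)"
    "fst (under_loc c) < n" "snd (under_loc c) < len (fst (under_loc c))"
    "cores F ! fst (under_loc c) ! snd (under_loc c) = (c, False, sg c)"
proof -
  have *: "fst p < n \<and> snd p < len (fst p) \<and> cores F ! fst p ! snd p = (c, ov, sg c)"
    if "p = entry_loc (cores F) (c, ov, sg c)" for ov p
  proof -
    have "(c, ov, sg c) \<in> set (concat (cores F))"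
      using assms matched_iff_sign[OF matched_cores] by (simp add: Cs_def sg_def)
    then obtain i k where ik: "i < n" "k < len i" "cores F ! i ! k = (c, ov, sg c)"
      by (auto simp: in_set_conv_nth length_cores len_def set_conv_nth[of "cores F"])
    then show ?thesis using core_entry(3)[OF ik] that by simp
  qed
  show "fst (over_loc c) < n" "snd (over_loc c) < len (fst (over_loc c))"
    "cores F ! fst (over_loc c) ! snd (over_loc c) = (c, True, sg c)"
    using *[of "over_loc c" True] by (auto simp: over_loc_def)
  show "fst (under_loc c) < n" "snd (under_loc c) < len (fst (under_loc c))"
    "cores F ! fst (under_loc c) ! snd (under_loc c) = (c, False, sg c)"
    using *[of "under_loc c" False] by (auto simp: under_loc_def)
qed

lemma finite_Cs [simp]: "finite Cs"
  by (simp add: Cs_def)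

text \<open>The edges of the boundary diagram: piece \<open>off\<close> of edge \<open>d\<close> of
  band \<open>i\<close>, counted along the core. Each entry of the core yields two crossings. Pieces
  with even offset lie between entries, those with odd offset lie within the square where two bands
  cross.\<close>

definition X :: "(nat \<times> bool \<times> nat) set" where
  "X = {(i, d, off). i < n \<and> off \<le> 2 * len i}"

text \<open>Seen from the disc, the right edge of a band is the right edge of its core at the first
  foot and the left one at the last foot, so its name is \<open>snd p\<close> in both cases.\<close>

definition right_end :: "nat \<times> bool \<Rightarrow> nat \<times> bool \<times> nat" where
  "right_end p = (fst p, snd p, if snd p then 0 else 2 * len (fst p))"

definition left_end :: "nat \<times> bool \<Rightarrow> nat \<times> bool \<times> nat" where
  "left_end p = (fst p, \<not> snd p, if snd p then 0 else 2 * len (fst p))"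

definition disc_pairs :: "((nat \<times> bool) \<times> (nat \<times> bool)) set" where
  "disc_pairs = set (zip (feet F) (rotate1 (feet F)))"

definition disc_joins :: "((nat \<times> bool \<times> nat) \<times> (nat \<times> bool \<times> nat)) set" where
  "disc_joins = (\<lambda>(q, p). (left_end p, right_end q)) ` disc_pairs"

text \<open>Names of the crossings of the boundary: a crossing of cores, the edge of the over-band,
  the edge of the under-band.\<close>

definition Q :: "(nat \<times> bool \<times> bool) set" where "Q = Cs \<times> UNIV \<times> UNIV"

text \<open>0 or 1 according to whether this crossing is the first or the second that the edge of
  the over-band meets here; this is the order in \<open>double_entry\<close>.\<close>

definition arm_over :: "nat \<times> bool \<times> bool \<Rightarrow> nat" where
  "arm_over z = (case z of (c, d, e) \<Rightarrow> of_bool (e = sg c))"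

definition arm_under :: "nat \<times> bool \<times> bool \<Rightarrow> nat" where
  "arm_under z = (case z of (c, d, e) \<Rightarrow> of_bool (d \<noteq> sg c))"

text \<open>Of the two pieces of a band edge at a crossing, the outer one leaves the square where
  the bands cross and the middle one lies inside it.\<close>

definition outer_over :: "nat \<times> bool \<times> bool \<Rightarrow> nat \<times> bool \<times> nat" where
  "outer_over z = (case z of (c, d, e) \<Rightarrow> (fst (over_loc c), d, 2 * snd (over_loc c) + 2 * arm_over z))"

definition mid_over :: "nat \<times> bool \<times> bool \<Rightarrow> nat \<times> bool \<times> nat" where
  "mid_over z = (case z of (c, d, e) \<Rightarrow> (fst (over_loc c), d, 2 * snd (over_loc c) + 1))"

definition outer_under :: "nat \<times> bool \<times> bool \<Rightarrow> nat \<times> bool \<times> nat" where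
  "outer_under z = (case z of (c, d, e) \<Rightarrow> (fst (under_loc c), e, 2 * snd (under_loc c) + 2 * arm_under z))"

definition mid_under :: "nat \<times> bool \<times> bool \<Rightarrow> nat \<times> bool \<times> nat" where
  "mid_under z = (case z of (c, d, e) \<Rightarrow> (fst (under_loc c), e, 2 * snd (under_loc c) + 1))"

text \<open>Shading the disc and the bands outside the crossings of cores gives a checkerboard colouring
  of the diagram of the boundary. The first smoothing merges the two shaded regions at a crossing, the
  second one separates them.\<close>

definition merging :: "nat \<times> bool \<times> bool \<Rightarrow> ((nat \<times> bool \<times> nat) \<times> (nat \<times> bool \<times> nat)) set" where
  "merging z = {(outer_over z, outer_under z), (mid_over z, mid_under z)}"

definition separating :: "nat \<times> bool \<times> bool \<Rightarrow> ((nat \<times> bool \<times> nat) \<times> (nat \<times> bool \<times> nat)) set" where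
  "separating z = {(outer_over z, mid_under z), (mid_over z, outer_under z)}"

definition smoothed :: "(nat \<times> bool \<times> bool) set \<Rightarrow> ((nat \<times> bool \<times> nat) \<times> (nat \<times> bool \<times> nat)) set" where
  "smoothed T = disc_joins \<union> (\<Union>z\<in>Q. if z \<in> T then merging z else separating z)"

text \<open>The crossings at which the merging smoothing is the A-smoothing.\<close>

definition type_A :: "nat \<times> bool \<times> bool \<Rightarrow> bool" where
  "type_A z = (case z of (c, d, e) \<Rightarrow> (d = e) = sg c)"

text \<open>Offsets in \<open>X\<close> count along the core, whereas boundary segments are read in
  the direction of the boundary; on left edges the two directions are opposite.\<close>

definition edge_name :: "nat \<times> bool \<Rightarrow> nat \<Rightarrow> nat \<times> bool \<times> nat" where
  "edge_name p off = (fst p, snd p, if snd p then off else 2 * len (fst p) - off)"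

text \<open>The core crossing and the two edges are decoded from the label. On an antiparallel edge
  the incoming piece is the one with the larger offset, hence the last summand.\<close>

definition entry_in :: "gauss_entry \<Rightarrow> nat \<times> bool \<times> nat" where
  "entry_in x = (case x of (l, ov, s) \<Rightarrow> let c = label_core l; d = label_over l; e = label_under l in
     if ov then (fst (over_loc c), d, 2 * snd (over_loc c) + of_bool (e = sg c) + of_bool (\<not> d))
     else (fst (under_loc c), e, 2 * snd (under_loc c) + of_bool (d \<noteq> sg c) + of_bool (\<not> e)))"

definition entry_out :: "gauss_entry \<Rightarrow> nat \<times> bool \<times> nat" where
  "entry_out x = (case x of (l, ov, s) \<Rightarrow> let c = label_core l; d = label_over l; e = label_under l in
     if ov then (fst (over_loc c), d, 2 * snd (over_loc c) + of_bool (e = sg c) + of_bool d)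
     else (fst (under_loc c), e, 2 * snd (under_loc c) + of_bool (d \<noteq> sg c) + of_bool e))"

lemma length_band_edge: "length (band_edge F p) = 2 * len (fst p)"
proof -
  have "length (concat (map (double_entry d) xs)) = 2 * length xs" for d xs
    by (induction xs) auto
  then show ?thesis by (cases p) (simp add: traverse_def len_def)
qed

lemma band_edge_nth:
  assumes "i < n" "k < len i" "r < 2" "cores F ! i ! k = (c, ov, s)"
  shows "concat (map (double_entry d) (cores F ! i)) ! (2 * k + r) =
     (if ov then edge_label c d ((r = 1) = s) else edge_label c ((r = 1) = (\<not> s)) d, ov,
      s = (d = ((r = 1) = (ov = s))))"
proof -
  have "concat (map (double_entry d) (cores F ! i)) ! (seg_start (map (double_entry d) (cores F ! i)) k + r) =
      double_entry d (cores F ! i ! k) ! r"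
    using assms nth_concat_seg[of k "map (double_entry d) (cores F ! i)" r] by (simp add: len_def)
  moreover have "seg_start (map (double_entry d) (cores F ! i)) k = 2 * k"
    using assms by (intro seg_start_const) (auto simp: len_def)
  ultimately show ?thesis using assms double_entry_nth[of r d c ov s] by (cases ov) simp_all
qed

lemma entry_in_band_edge:
  assumes "fst p < n" "off < 2 * len (fst p)"
  shows "entry_in (band_edge F p ! off) = edge_name p off"
    and "entry_out (band_edge F p ! off) = edge_name p (Suc off)"
proof -
  obtain i d where p: "p = (i, d)" by force
  define pos where "pos = (if d then off else 2 * len i - Suc off)"
  define k r where "k = pos div 2" and "r = pos mod 2"
  have pos: "pos < 2 * len i" "pos = 2 * k + r" "r < 2" using assms p by (auto simp: pos_def k_def r_def)
  then have k: "k < len i" by simp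
  obtain c ov s where e: "cores F ! i ! k = (c, ov, s)" by (cases "cores F ! i ! k") auto
  have i: "i < n" using assms p by simp
  note c = core_entry[OF i k e]
  have "length (concat (map (double_entry d) (cores F ! i))) = 2 * len i"
    using length_band_edge[of "(i, True)"] length_band_edge[of "(i, False)"] by (cases d) (simp_all add: traverse_def)
  then have "band_edge F p ! off = concat (map (double_entry d) (cores F ! i)) ! pos"
    using assms by (auto simp: p pos_def traverse_def rev_nth)
  also have "\<dots> = (if ov then edge_label c d ((r = 1) = s) else edge_label c ((r = 1) = (\<not> s)) d, ov,
      s = (d = ((r = 1) = (ov = s))))"
    unfolding pos(2) by (rule band_edge_nth[OF i k pos(3) e])
  finally have b: "band_edge F p ! off = \<dots>" .
  have r: "r = of_bool (r = 1)" using pos(3) by auto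
  have loc: "ov \<Longrightarrow> over_loc c = (i, k)" "\<not> ov \<Longrightarrow> under_loc c = (i, k)"
    using c by (auto simp: over_loc_def under_loc_def)
  have nm: "edge_name p off = (i, d, 2 * k + r + of_bool (\<not> d))" "edge_name p (Suc off) = (i, d, 2 * k + r + of_bool d)"
    using assms p pos by (auto simp: edge_name_def pos_def)
  have x: "(((r = 1) = sg c) = sg c) = (r = 1)" "(((r = 1) = (\<not> sg c)) \<noteq> sg c) = (r = 1)" by auto
  show "entry_in (band_edge F p ! off) = edge_name p off" "entry_out (band_edge F p ! off) = edge_name p (Suc off)"
    unfolding nm b entry_in_def entry_out_def Let_def prod.case
    using loc r x c(2) by (cases ov; simp)+
qed

lemma finite_X [simp]: "finite X"
proof -
  have "X \<subseteq> {..<n} \<times> UNIV \<times> {..2 * (\<Sum>i<n. len i)}"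
  proof
    fix x assume "x \<in> X"
    then obtain i d off where x: "x = (i, d, off)" "i < n" "off \<le> 2 * len i" by (auto simp: X_def)
    then have "len i \<le> (\<Sum>i<n. len i)" by (intro member_le_sum) auto
    then show "x \<in> {..<n} \<times> UNIV \<times> {..2 * (\<Sum>i<n. len i)}" using x by auto
  qed
  then show ?thesis by (rule finite_subset) auto
qed

end

lemma num_classes_symmetric:
  assumes "\<And>a b. (a, b) \<in> R \<Longrightarrow> (a, b) \<in> R' \<or> (b, a) \<in> R'"
    "\<And>a b. (a, b) \<in> R' \<Longrightarrow> (a, b) \<in> R \<or> (b, a) \<in> R"
  shows "num_classes E R = num_classes E R'"
  by (rule num_classes_cong_conn) (use assms conn_base conn_base' in metis)+

definition foot_flip :: "nat \<times> bool \<Rightarrow> nat \<times> bool" where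
  "foot_flip p = (fst p, \<not> snd p)"

context surface begin

definition lab :: "nat \<times> bool \<times> bool \<Rightarrow> nat" where
  "lab z = (case z of (c, d, e) \<Rightarrow> edge_label c d e)"

lemma inj_lab: "inj lab"
  by (auto simp: inj_def lab_def edge_label_inj)

lemma feet: "distinct (feet F)" "set (feet F) = {..<n} \<times> UNIV"
  using F by (auto simp: seifert_surface_def n_def)

lemma length_feet: "length (feet F) = 2 * n"
  using distinct_card[OF feet(1)] by (simp add: feet(2) card_cartesian_product)

lemma disc_pairs_fun: "(q, p) \<in> disc_pairs \<Longrightarrow> (q, p') \<in> disc_pairs \<Longrightarrow> p = p'"
  using feet(1) by (auto simp: disc_pairs_def in_set_zip nth_eq_iff_index_eq)

lemma disc_pairs_fun': "(q, p) \<in> disc_pairs \<Longrightarrow> (q', p) \<in> disc_pairs \<Longrightarrow> q = q'"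
proof -
  assume a: "(q, p) \<in> disc_pairs" "(q', p) \<in> disc_pairs"
  have "distinct (rotate1 (feet F))" using feet(1) by simp
  then show "q = q'" using a by (auto simp: disc_pairs_def in_set_zip nth_eq_iff_index_eq)
qed

lemma disc_pairs_feet: "(q, p) \<in> disc_pairs \<Longrightarrow> q \<in> set (feet F) \<and> p \<in> set (feet F)"
  unfolding disc_pairs_def using set_zip_leftD set_zip_rightD by fastforce

lemma foot_flip_feet: "foot_flip p \<in> set (feet F) \<longleftrightarrow> p \<in> set (feet F)"
  by (cases p) (simp add: feet(2) foot_flip_def)

lemma next_foot_pair:
  assumes "p \<in> set (feet F)"
  shows "(next_foot F p, foot_flip p) \<in> disc_pairs"
proof -
  obtain i d where p: "p = (i, d)" by force
  have "(i, \<not> d) \<in> set (rotate1 (feet F))" using assms foot_flip_feet[of p] p by (simp add: foot_flip_def)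
  then obtain q where q: "map_of (zip (rotate1 (feet F)) (feet F)) (i, \<not> d) = Some q"
    by (metis length_rotate1 map_of_zip_is_Some)
  then have "((i, \<not> d), q) \<in> set (zip (rotate1 (feet F)) (feet F))" by (rule map_of_SomeD)
  then have "(q, (i, \<not> d)) \<in> set (zip (feet F) (rotate1 (feet F)))"
    by (auto simp: in_set_zip)
  then show ?thesis using q p by (simp add: disc_pairs_def foot_flip_def)
qed

lemma next_foot_feet: "p \<in> set (feet F) \<Longrightarrow> next_foot F p \<in> set (feet F)"
  using next_foot_pair disc_pairs_feet by blast

lemma disc_pairs_eq: "disc_pairs = (\<lambda>p. (next_foot F p, foot_flip p)) ` set (feet F)"
proof
  show "(\<lambda>p. (next_foot F p, foot_flip p)) ` set (feet F) \<subseteq> disc_pairs" using next_foot_pair by auto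
  show "disc_pairs \<subseteq> (\<lambda>p. (next_foot F p, foot_flip p)) ` set (feet F)"
  proof
    fix x assume x: "x \<in> disc_pairs"
    obtain q p where qp: "x = (q, p)" by (cases x) blast
    then have p: "foot_flip p \<in> set (feet F)" using x disc_pairs_feet foot_flip_feet by blast
    have "(next_foot F (foot_flip p), p) \<in> disc_pairs" using next_foot_pair[OF p] by (simp add: foot_flip_def)
    then have "q = next_foot F (foot_flip p)" using x qp disc_pairs_fun' by blast
    then have "x = (next_foot F (foot_flip p), foot_flip (foot_flip p))" using qp by (simp add: foot_flip_def)
    then show "x \<in> (\<lambda>p. (next_foot F p, foot_flip p)) ` set (feet F)" using p by blast
  qed
qed

lemma next_foot_inj:
  assumes "p \<in> set (feet F)" "p' \<in> set (feet F)" "next_foot F p = next_foot F p'"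
  shows "p = p'"
proof -
  have "foot_flip p = foot_flip p'"
    using next_foot_pair[OF assms(1)] next_foot_pair[OF assms(2)] assms(3) disc_pairs_fun by metis
  then show ?thesis by (cases p; cases p') (simp add: foot_flip_def)
qed

lemma length_boundary_feet: "length (boundary_feet F) = 2 * n"
  by (simp add: boundary_feet_def length_feet)

lemma boundary_feet_nth: "j < 2 * n \<Longrightarrow> boundary_feet F ! j = (next_foot F ^^ j) (hd (feet F))"
  by (simp add: boundary_feet_def length_feet)

lemma boundary_feet_in:
  assumes "n > 0"
  shows "(next_foot F ^^ j) (hd (feet F)) \<in> set (feet F)"
proof (induction j)
  case 0
  have "feet F \<noteq> []" using length_feet assms by auto
  then show ?case by simp
qed (simp add: next_foot_feet)

text \<open>The listed iterates are distinct and as many as the feet, so the boundary leaves the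
  disc at every foot. This is where its connectedness enters.\<close>

lemma set_boundary_feet:
  assumes "n > 0"
  shows "set (boundary_feet F) = set (feet F)"
proof (rule card_subset_eq)
  show "set (boundary_feet F) \<subseteq> set (feet F)"
    using boundary_feet_in[OF assms] by (auto simp: boundary_feet_def)
  have "distinct (boundary_feet F)" using F by (simp add: seifert_surface_def)
  then show "card (set (boundary_feet F)) = card (set (feet F))"
    using distinct_card feet(1) length_feet length_boundary_feet by metis
qed simp

lemma next_boundary_foot:
  assumes "n > 0" "j < 2 * n"
  shows "next_foot F (boundary_feet F ! j) = boundary_feet F ! (Suc j mod (2 * n))"
proof (cases "Suc j < 2 * n")
  case True
  then show ?thesis using assms by (simp add: boundary_feet_nth)
next
  case False
  then have j: "Suc j = 2 * n" using assms by simp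
  have d: "distinct (boundary_feet F)" using F by (simp add: seifert_surface_def)
  have in_feet: "boundary_feet F ! i \<in> set (feet F)" if "i < 2 * n" for i
    using that boundary_feet_in[OF assms(1)] by (simp add: boundary_feet_nth)
  have "next_foot F (boundary_feet F ! j) \<in> set (boundary_feet F)"
    using next_foot_feet[OF in_feet[OF assms(2)]] set_boundary_feet[OF assms(1)] by simp
  then obtain k where k: "k < 2 * n" "boundary_feet F ! k = next_foot F (boundary_feet F ! j)"
    by (auto simp: in_set_conv_nth length_boundary_feet)
  \<comment> \<open>Every later member of the orbit already has its predecessor in the list, so by
    injectivity the last one can only be followed by the first.\<close>
  have "k = 0"
  proof (rule ccontr)
    assume "k \<noteq> 0"
    then obtain k' where k': "k = Suc k'" using not0_implies_Suc by blast
    then have "boundary_feet F ! k = next_foot F (boundary_feet F ! k')"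
      using k(1) by (simp add: boundary_feet_nth)
    then have "boundary_feet F ! k' = boundary_feet F ! j"
      using next_foot_inj in_feet k k' assms(2) by (metis Suc_lessD)
    then have "k' = j" using d k k' assms(2) length_boundary_feet by (simp add: nth_eq_iff_index_eq)
    then show False using k k' j by simp
  qed
  then show ?thesis using k j by simp
qed

definition segments :: "gauss_code list" where
  "segments = map (band_edge F) (boundary_feet F)"

lemma boundary_segments: "boundary F = concat segments"
  by (simp add: boundary_def segments_def)

lemma length_segments: "length segments = 2 * n"
  and segments_nth: "j < 2 * n \<Longrightarrow> segments ! j = band_edge F (boundary_feet F ! j)"
  and length_segments_nth: "j < 2 * n \<Longrightarrow> length (segments ! j) = 2 * len (fst (boundary_feet F ! j))"
  by (simp_all add: segments_def length_boundary_feet length_band_edge del: band_edge.simps)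

lemma seg_joins_segments:
  assumes "n > 0"
  shows "seg_joins segments (\<lambda>j. edge_name (boundary_feet F ! j)) = disc_joins"
proof -
  let ?p = "\<lambda>j. boundary_feet F ! j"
  have e1: "edge_name p (2 * len (fst p)) = left_end (foot_flip p)" and e2: "edge_name p 0 = right_end p" for p
    by (cases p; simp add: edge_name_def left_end_def right_end_def foot_flip_def)+
  have "seg_joins segments (\<lambda>j. edge_name (?p j)) =
      (\<lambda>j. (edge_name (?p j) (2 * len (fst (?p j))), edge_name (?p (Suc j mod (2 * n))) 0)) ` {..<2 * n}"
    unfolding seg_joins_def length_segments
    by (auto simp: length_segments_nth) (metis length_segments_nth)
  also have "\<dots> = (\<lambda>j. (left_end (foot_flip (?p j)), right_end (next_foot F (?p j)))) ` {..<2 * n}"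
    by (intro image_cong refl) (simp add: e1 e2 next_boundary_foot[OF assms])
  also have "\<dots> = (\<lambda>p. (left_end (foot_flip p), right_end (next_foot F p))) ` set (boundary_feet F)"
    by (auto simp: set_conv_nth length_boundary_feet)
  also have "\<dots> = disc_joins"
    unfolding set_boundary_feet[OF assms] disc_joins_def disc_pairs_eq by (simp add: image_image)
  finally show ?thesis .
qed

lemma boundary_foot_less: "n > 0 \<Longrightarrow> j < 2 * n \<Longrightarrow> fst (boundary_feet F ! j) < n"
  using set_boundary_feet feet(2) nth_mem[of j "boundary_feet F"] length_boundary_feet by auto

lemma edge_name_X: "fst p < n \<Longrightarrow> off \<le> 2 * len (fst p) \<Longrightarrow> edge_name p off \<in> X"
  by (auto simp: edge_name_def X_def)

lemma seg_edges_segments: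
  assumes "n > 0"
  shows "seg_edges segments (\<lambda>j. edge_name (boundary_feet F ! j)) = X"
proof
  show "seg_edges segments (\<lambda>j. edge_name (boundary_feet F ! j)) \<subseteq> X"
    unfolding seg_edges_def length_segments using boundary_foot_less[OF assms]
    by (auto simp: length_segments_nth intro!: edge_name_X)
  show "X \<subseteq> seg_edges segments (\<lambda>j. edge_name (boundary_feet F ! j))"
  proof
    fix x assume "x \<in> X"
    then obtain i d off where x: "x = (i, d, off)" "i < n" "off \<le> 2 * len i" by (auto simp: X_def)
    then have "(i, d) \<in> set (boundary_feet F)" using set_boundary_feet[OF assms] feet(2) by simp
    then obtain j where j: "j < 2 * n" "boundary_feet F ! j = (i, d)"
      by (auto simp: in_set_conv_nth length_boundary_feet)
    let ?off = "if d then off else 2 * len i - off"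
    have "x = edge_name (boundary_feet F ! j) ?off" using x j by (simp add: edge_name_def)
    moreover have "j < length segments" "?off \<le> length (segments ! j)"
      using j x by (auto simp: length_segments length_segments_nth)
    ultimately show "x \<in> seg_edges segments (\<lambda>j. edge_name (boundary_feet F ! j))"
      unfolding seg_edges_def by blast
  qed
qed

lemma set_band_edge: "set (band_edge F (i, d)) = (\<Union>x\<in>set (cores F ! i). set (double_entry d x))"
  by (simp add: traverse_def)

lemma set_double_entry: "set (double_entry d (c, ov, s)) =
    (\<lambda>e. (if ov then edge_label c d e else edge_label c e d, ov, s = (d = e))) ` UNIV"
  by (auto simp: UNIV_bool)

text \<open>The sign is that of the core crossing, reversed once for each of the two edges that runs
  antiparallel to its core.\<close>

lemma boundary_entries:
  assumes "n > 0"
  shows "(l, ov, s) \<in> set (boundary F) \<longleftrightarrow> (\<exists>c d e. c \<in> Cs \<and> l = edge_label c d e \<and> s = (sg c = (d = e)))"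
proof
  assume "(l, ov, s) \<in> set (boundary F)"
  then obtain p where p: "p \<in> set (feet F)" "(l, ov, s) \<in> set (band_edge F p)"
    unfolding boundary_def using set_boundary_feet[OF assms] by auto
  obtain i d where id: "p = (i, d)" by force
  then have i: "i < n" using p feet(2) by auto
  obtain x where x: "x \<in> set (cores F ! i)" "(l, ov, s) \<in> set (double_entry d x)"
    using p(2) unfolding id set_band_edge by blast
  obtain c ov' s' where c: "x = (c, ov', s')" by (cases x) auto
  obtain k where "k < len i" "cores F ! i ! k = (c, ov', s')" using x(1) c by (auto simp: in_set_conv_nth len_def)
  then have "c \<in> Cs" "s' = sg c" using core_entry i by blast+
  moreover have "\<exists>e. (l, ov, s) = (if ov' then edge_label c d e else edge_label c e d, ov', s' = (d = e))"
    using x(2) unfolding c set_double_entry by blast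
  ultimately show "\<exists>c d e. c \<in> Cs \<and> l = edge_label c d e \<and> s = (sg c = (d = e))"
    by (cases ov') auto
next
  assume "\<exists>c d e. c \<in> Cs \<and> l = edge_label c d e \<and> s = (sg c = (d = e))"
  then obtain c d e where *: "c \<in> Cs" "l = edge_label c d e" "s = (sg c = (d = e))" by blast
  let ?p = "if ov then (fst (over_loc c), d) else (fst (under_loc c), e)"
  have "?p \<in> set (boundary_feet F)"
    unfolding set_boundary_feet[OF assms] feet(2) using core_loc[OF *(1)] by auto
  moreover have "(l, ov, s) \<in> set (band_edge F ?p)"
  proof (cases ov)
    case True
    have "(c, True, sg c) \<in> set (cores F ! fst (over_loc c))"
      using core_loc(2,3)[OF *(1)] nth_mem[of "snd (over_loc c)" "cores F ! fst (over_loc c)"]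
      unfolding len_def by simp
    moreover have "(l, ov, s) \<in> set (double_entry d (c, True, sg c))"
      unfolding set_double_entry * if_True using True by (intro image_eqI[of _ _ e]) auto
    ultimately have "(l, ov, s) \<in> set (band_edge F (fst (over_loc c), d))"
      unfolding set_band_edge by blast
    then show ?thesis unfolding if_P[OF True] .
  next
    case False
    have "(c, False, sg c) \<in> set (cores F ! fst (under_loc c))"
      using core_loc(5,6)[OF *(1)] nth_mem[of "snd (under_loc c)" "cores F ! fst (under_loc c)"]
      unfolding len_def by simp
    moreover have "(l, ov, s) \<in> set (double_entry e (c, False, sg c))"
      unfolding set_double_entry * if_False using False by (intro image_eqI[of _ _ d]) auto
    ultimately have "(l, ov, s) \<in> set (band_edge F (fst (under_loc c), e))"
      unfolding set_band_edge by blast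
    then show ?thesis unfolding if_not_P[OF False] .
  qed
  ultimately show "(l, ov, s) \<in> set (boundary F)" unfolding boundary_def by auto
qed

lemma labels_boundary: "n > 0 \<Longrightarrow> labels (boundary F) = lab ` Q"
proof -
  assume n: "n > 0"
  show "labels (boundary F) = lab ` Q"
  proof
    show "labels (boundary F) \<subseteq> lab ` Q"
    proof
      fix l assume "l \<in> labels (boundary F)"
      then obtain ov s where "(l, ov, s) \<in> set (boundary F)" unfolding labels_def by auto
      then obtain c d e where "c \<in> Cs" "l = edge_label c d e" using boundary_entries[OF n] by blast
      then have "l = lab (c, d, e)" "(c, d, e) \<in> Q" by (simp_all add: lab_def Q_def)
      then show "l \<in> lab ` Q" by blast
    qed
    show "lab ` Q \<subseteq> labels (boundary F)"
    proof clarify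
      fix c d e assume "(c, d, e) \<in> Q"
      then have "(edge_label c d e, True, sg c = (d = e)) \<in> set (boundary F)"
        using boundary_entries[OF n] unfolding Q_def by blast
      then show "lab (c, d, e) \<in> labels (boundary F)"
        unfolding labels_def lab_def prod.case by (metis fst_conv image_eqI)
    qed
  qed
qed

lemma sign_boundary:
  assumes "n > 0" "(c, d, e) \<in> Q"
  shows "crossing_sign (boundary F) (edge_label c d e) = (sg c = (d = e))"
proof -
  have "(edge_label c d e, True, sg c = (d = e)) \<in> set (boundary F)"
    using boundary_entries[OF assms(1)] assms(2) unfolding Q_def by blast
  then show ?thesis
    using matched_iff_sign[OF boundary_matched, of "edge_label c d e" True "sg c = (d = e)"] by simp
qed

text \<open>A check of all 16 cases; pairs are compared up to order, since joining two ends has no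
  direction.\<close>

lemma smoothing_boundary:
  fixes a :: bool
  assumes "n > 0" "z \<in> Q"
  defines "R \<equiv> smoothing a (entry_crossing entry_in entry_out (crossing_sign (boundary F) (lab z)) (lab z))"
    and "R' \<equiv> (if a = type_A z then merging z else separating z)"
  shows "(x, y) \<in> R \<or> (y, x) \<in> R \<longleftrightarrow> (x, y) \<in> R' \<or> (y, x) \<in> R'"
proof -
  obtain c d e where z: "z = (c, d, e)" by (cases z) auto
  have s: "crossing_sign (boundary F) (edge_label c d e) = (sg c = (d = e))"
    using sign_boundary assms z by simp
  show ?thesis
    unfolding R_def R'_def z lab_def prod.case s
    by (cases "sg c"; cases d; cases e; cases a;
      simp add: smoothing_def entry_crossing_def mk_crossing_def A_smoothing_def B_smoothing_def
        joins_left_right_def joins_top_bottom_def entry_in_def entry_out_def Let_def type_A_def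
        merging_def separating_def outer_over_def outer_under_def mid_over_def mid_under_def
        arm_over_def arm_under_def; blast)
qed

text \<open>The A-smoothed crossings of the state that merges exactly at \<open>T\<close> are those
  of type A in \<open>T\<close> and those of the other type outside \<open>T\<close>.\<close>

theorem loops_boundary:
  assumes "n > 0"
  shows "loops (boundary F) (lab ` {z \<in> Q. (z \<in> T) = type_A z}) = num_classes X (smoothed T)"
proof -
  let ?S = "lab ` {z \<in> Q. (z \<in> T) = type_A z}"
  let ?nm = "\<lambda>j. edge_name (boundary_feet F ! j)"
  note len_seg = length_segments length_segments_nth and seg = segments_nth
  have "loops (concat segments) ?S = num_classes (seg_edges segments ?nm)
      (seg_joins segments ?nm \<union> state_joins entry_in entry_out (concat segments) ?S)"
  proof (rule loops_segments)
    show "matched (concat segments)" using boundary_matched by (simp add: boundary_segments)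
    show "segments \<noteq> []" using len_seg(1) assms by auto
    show "inj_on (\<lambda>(j, off). ?nm j off) {(j, off). j < length segments \<and> off \<le> length (segments ! j)}"
    proof (rule inj_onI, clarify)
      fix j off j' off' assume *: "j < length segments" "off \<le> length (segments ! j)" "j' < length segments"
        "off' \<le> length (segments ! j')" "?nm j off = ?nm j' off'"
      then have "boundary_feet F ! j = boundary_feet F ! j'" by (auto simp: edge_name_def prod_eq_iff)
      moreover have "distinct (boundary_feet F)" using F by (simp add: seifert_surface_def)
      ultimately have "j = j'"
        using * len_seg(1) length_boundary_feet by (simp add: nth_eq_iff_index_eq)
      then show "j = j' \<and> off = off'" using * len_seg by (auto simp: edge_name_def split: if_splits)
    qed
    show "entry_in (segments ! j ! off) = ?nm j off" "entry_out (segments ! j ! off) = ?nm j (Suc off)"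
      if "j < length segments" "off < length (segments ! j)" for j off
      using entry_in_band_edge[of "boundary_feet F ! j" off] boundary_foot_less[OF assms, of j] that len_seg seg
      by simp_all
  qed
  also have "\<dots> = num_classes X (disc_joins \<union> state_joins entry_in entry_out (boundary F) ?S)"
    unfolding seg_edges_segments[OF assms] seg_joins_segments[OF assms] boundary_segments ..
  also have "\<dots> = num_classes X (smoothed T)"
  proof -
    let ?R = "\<lambda>z. smoothing (lab z \<in> ?S) (entry_crossing entry_in entry_out (crossing_sign (boundary F) (lab z)) (lab z))"
    have st: "state_joins entry_in entry_out (boundary F) ?S = (\<Union>z\<in>Q. ?R z)"
      unfolding state_joins_def labels_boundary[OF assms] by simp
    have S: "((lab z \<in> ?S) = type_A z) = (z \<in> T)" if "z \<in> Q" for z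
      using that inj_lab by (auto simp: inj_image_mem_iff)
    have R: "(x, y) \<in> ?R z \<or> (y, x) \<in> ?R z \<longleftrightarrow> (x, y) \<in> (if z \<in> T then merging z else separating z) \<or>
        (y, x) \<in> (if z \<in> T then merging z else separating z)" if "z \<in> Q" for x y z
      using smoothing_boundary[OF assms that, of x y "lab z \<in> ?S"] unfolding S[OF that] .
    show ?thesis
    proof (rule num_classes_symmetric)
      fix a b assume "(a, b) \<in> disc_joins \<union> state_joins entry_in entry_out (boundary F) ?S"
      then show "(a, b) \<in> smoothed T \<or> (b, a) \<in> smoothed T"
        unfolding st smoothed_def using R[of _ a b] by blast
    next
      fix a b assume "(a, b) \<in> smoothed T"
      then show "(a, b) \<in> disc_joins \<union> state_joins entry_in entry_out (boundary F) ?S \<or>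
          (b, a) \<in> disc_joins \<union> state_joins entry_in entry_out (boundary F) ?S"
        unfolding st smoothed_def using R[of _ a b] by blast
    qed
  qed
  finally show ?thesis by (simp add: boundary_segments)
qed

end

section \<open>Loops of planar states\<close>

text \<open>A pair that is redundant over \<open>R\<close> is redundant over the larger
  \<open>R2\<close>, so it lowers the count over \<open>R\<close> at least as much: submodularity of
  graphic rank.\<close>

lemma num_classes_submodular:
  assumes "finite E" "finite A" "A \<subseteq> E \<times> E" "R \<subseteq> R2"
  shows "num_classes E (R \<union> A) + num_classes E R2 \<le> num_classes E R + num_classes E (R2 \<union> A)"
  using assms(2,3)
proof (induction A rule: finite_induct)
  case (insert x A)
  obtain a b where x: "x = (a, b)" by (cases x) blast
  have ab: "a \<in> E" "b \<in> E" using insert.prems x by auto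
  have "conn (R2 \<union> A) a b" if "conn (R \<union> A) a b"
    by (rule conn_mono[OF that]) (use assms(4) in auto)
  moreover have "R \<union> insert x A = insert (a, b) (R \<union> A)" "R2 \<union> insert x A = insert (a, b) (R2 \<union> A)"
    using x by auto
  ultimately show ?case
    using insert.IH insert.prems num_classes_insert[OF assms(1) ab, of "R \<union> A"]
      num_classes_insert[OF assms(1) ab, of "R2 \<union> A"] by (auto split: if_splits)
qed simp

lemma num_classes_two_coarsenings:
  assumes "finite E" "finite R1" "R1 \<subseteq> E \<times> E" "R \<subseteq> R1" "R \<subseteq> R2" "num_classes E (R1 \<union> R2) = 1"
  shows "num_classes E R1 + num_classes E R2 \<le> num_classes E R + 1"
  using num_classes_submodular[OF assms(1-3,5)] assms(4,6) by (simp add: Un_absorb1 Un_commute)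

context four_ends begin

lemma resolution_counts:
  assumes "c \<in> C"
  shows "num_classes E (joins C (k(c := 2))) \<le> num_classes E (joins C (k(c := 1))) + 1"
    "num_classes E (joins C (k(c := 1))) \<le> num_classes E (joins C (k(c := 2))) + 1"
    "\<not> conn (joins (C - {c}) k) (p c) (r c) \<Longrightarrow> \<not> conn (joins (C - {c}) k) (p c) (q c) \<Longrightarrow>
      num_classes E (joins C (k(c := 2))) + 1 = num_classes E (joins C (k(c := 1)))"
    "\<not> conn (joins (C - {c}) k) (p c) (s c) \<Longrightarrow> \<not> conn (joins (C - {c}) k) (p c) (q c) \<Longrightarrow>
      num_classes E (joins C (k(c := 1))) + 1 = num_classes E (joins C (k(c := 2)))"
proof -
  let ?R = "joins (C - {c}) k"
  have J: "joins C (k(c := i)) = ?R \<union> resolution i (p c) (q c) (r c) (s c)" for i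
    using assms unfolding joins_def by (auto split: if_splits)
  have e: "p c \<in> E" "q c \<in> E" "r c \<in> E" "s c \<in> E" using ends[OF assms] by auto
  have J1: "joins C (k(c := 1)) = insert (p c, s c) (insert (r c, q c) ?R)"
    and J2: "joins C (k(c := 2)) = insert (p c, r c) (insert (q c, s c) ?R)"
    unfolding J resolution_def by auto
  note n1 = num_classes_insert2[OF finE e(1,4,3,2), of ?R, folded J1]
  note n2 = num_classes_insert2[OF finE e(1,3,2,4), of ?R, folded J2]
  have sy: "conn ?R x y = conn ?R y x" for x y using conn_sym by metis
  have tr: "conn ?R x z" if "conn ?R x y" "conn ?R y z" for x y z using that by (rule conn_trans)
  consider (0) "conn ?R (p c) (q c)" "conn ?R (r c) (s c)" "\<not> conn ?R (p c) (r c)"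
    | (2) "conn ?R (p c) (r c)" "conn ?R (q c) (s c)" "\<not> conn ?R (p c) (q c)"
    | (1) "conn ?R (p c) (s c)" "conn ?R (q c) (r c)" "\<not> conn ?R (p c) (q c)"
    using arcs[OF assms] by blast
  then have "(num_classes E (joins C (k(c := 1))) = num_classes E (joins C (k(c := 2))) \<and> conn ?R (p c) (q c)) \<or>
      (num_classes E (joins C (k(c := 1))) = num_classes E (joins C (k(c := 2))) + 1 \<and> conn ?R (p c) (s c)) \<or>
      (num_classes E (joins C (k(c := 2))) = num_classes E (joins C (k(c := 1))) + 1 \<and> conn ?R (p c) (r c))"
  proof cases
    case 0
    have "\<not> conn ?R (r c) (q c)" "\<not> conn ?R (q c) (s c)" "\<not> conn ?R (p c) (s c)" using 0 sy tr by metis+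
    then show ?thesis using 0 n1 n2 sy by (auto simp: conn_insert)
  next
    case 2
    have "\<not> conn ?R (r c) (q c)" "\<not> conn ?R (r c) (s c)" "\<not> conn ?R (p c) (s c)" using 2 sy tr by metis+
    then show ?thesis using 2 n1 n2 sy by (auto simp: conn_insert)
  next
    case 1
    have "\<not> conn ?R (q c) (s c)" "\<not> conn ?R (r c) (s c)" "\<not> conn ?R (p c) (r c)" using 1 sy tr by metis+
    then show ?thesis using 1 n1 n2 sy by (auto simp: conn_insert)
  qed
  then show "num_classes E (joins C (k(c := 2))) \<le> num_classes E (joins C (k(c := 1))) + 1"
    "num_classes E (joins C (k(c := 1))) \<le> num_classes E (joins C (k(c := 2))) + 1"
    "\<not> conn (joins (C - {c}) k) (p c) (r c) \<Longrightarrow> \<not> conn (joins (C - {c}) k) (p c) (q c) \<Longrightarrow>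
      num_classes E (joins C (k(c := 2))) + 1 = num_classes E (joins C (k(c := 1)))"
    "\<not> conn (joins (C - {c}) k) (p c) (s c) \<Longrightarrow> \<not> conn (joins (C - {c}) k) (p c) (q c) \<Longrightarrow>
      num_classes E (joins C (k(c := 1))) + 1 = num_classes E (joins C (k(c := 2)))"
    by linarith+
qed

text \<open>For \<open>{a, b} = {1, 2}\<close>, the regions of the state in which all crossings are resolved by \<open>a\<close>,
  merged at the crossings in \<open>D\<close>.\<close>

definition region_joins :: "nat \<Rightarrow> nat \<Rightarrow> 'c set \<Rightarrow> ('e \<times> 'e) set" where
  "region_joins a b D = joins C (\<lambda>_. a) \<union> joins D (\<lambda>_. b)"

lemma region_joins_subset: "D \<subseteq> C \<Longrightarrow> region_joins a b D \<subseteq> E \<times> E"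
  using joins_subset by (auto simp: region_joins_def)

lemma joins_region: "joins C (\<lambda>c. if c \<in> D then b else a) \<subseteq> region_joins a b (D \<inter> C)"
  unfolding joins_def region_joins_def by (auto split: if_splits)

text \<open>Merge at one more crossing \<open>c\<close>. If the regions meeting there are already
  connected, their number stays and the loops grow by at most one. Otherwise two different loops
  meet at \<open>c\<close>, so the loops drop by exactly one while the regions drop by at most
  one.\<close>

lemma loops_le_regions:
  assumes "finite D" "D \<subseteq> C" "(a, b) = (1, 2) \<or> (a, b) = (2, 1)"
  shows "num_classes E (joins C (\<lambda>c. if c \<in> D then b else a)) + num_classes E (joins C (\<lambda>_. a))
    \<le> 2 * num_classes E (region_joins a b D) + card D"
  using assms(1,2)
proof (induction D rule: finite_induct)
  case empty
  then show ?case by (simp add: region_joins_def) (simp add: joins_def Un_absorb2)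
next
  case (insert c D)
  have c: "c \<in> C" "c \<notin> D" using insert by auto
  let ?k = "\<lambda>c. if c \<in> D then b else a"
  let ?K = "region_joins a b D" and ?R = "joins (C - {c}) ?k"
  let ?n = "num_classes E ?K"
  have e: "p c \<in> E" "q c \<in> E" "r c \<in> E" "s c \<in> E" using ends[OF c(1)] by auto
  have k1: "(\<lambda>c'. if c' \<in> insert c D then b else a) = ?k(c := b)" and k2: "?k = ?k(c := a)" using c by auto
  have RK: "?R \<subseteq> ?K" using joins_region[of D b a] insert.prems
    unfolding joins_def region_joins_def by (auto split: if_splits)
  have mono: "conn ?R x y \<Longrightarrow> conn ?K x y" for x y by (rule conn_mono[OF _ RK])
  have Ka: "resolution a (p c) (q c) (r c) (s c) \<subseteq> ?K"
    using c unfolding region_joins_def joins_def by blast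
  have Ki: "region_joins a b (insert c D) = ?K \<union> resolution b (p c) (q c) (r c) (s c)"
    unfolding region_joins_def joins_insert by auto
  note counts = resolution_counts[OF c(1), of ?k]
  show ?case
  proof (cases "(a, b) = (1, 2)")
    case True
    then have ab: "a = 1" "b = 2" by auto
    have base: "conn ?K (p c) (s c)" "conn ?K (r c) (q c)"
      using Ka ab by (auto simp: resolution_def intro!: conn_base)
    have Ki': "region_joins a b (insert c D) = insert (p c, r c) (insert (q c, s c) ?K)"
      using Ki unfolding ab resolution_def by simp
    have n: "?n = num_classes E (region_joins a b (insert c D)) + of_bool (\<not> conn ?K (q c) (s c)) +
        of_bool (\<not> conn (insert (q c, s c) ?K) (p c) (r c))"
      unfolding Ki' by (rule num_classes_insert2[OF finE e(1,3,2,4)])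
    show ?thesis
    proof (cases "conn ?K (p c) (r c)")
      case True
      have "conn ?K (q c) (s c)"
        by (rule conn_trans[OF conn_sym[OF base(2)] conn_trans[OF conn_sym[OF True] base(1)]])
      moreover have "conn (insert (q c, s c) ?K) (p c) (r c)" using True by (rule conn_mono) auto
      ultimately have "num_classes E (region_joins a b (insert c D)) = ?n" using n by simp
      moreover have "num_classes E (joins C (?k(c := b))) \<le> num_classes E (joins C ?k) + 1"
        using counts(1) k2 unfolding ab by metis
      ultimately show ?thesis using insert unfolding k1 by simp
    next
      case False
      have "\<not> conn ?R (p c) (r c)" using False mono by blast
      moreover have "\<not> conn ?R (p c) (q c)"
      proof
        assume "conn ?R (p c) (q c)"
        then have "conn ?K (p c) (r c)" using conn_trans[OF mono conn_sym[OF base(2)]] by blast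
        then show False using False by blast
      qed
      ultimately have "num_classes E (joins C (?k(c := b))) + 1 = num_classes E (joins C ?k)"
        using counts(3) k2 unfolding ab by metis
      moreover have "conn (insert (q c, s c) ?K) (p c) (r c)"
        unfolding conn_insert using base conn_sym[OF base(2)] conn_sym[OF base(1)] by blast
      then have "?n \<le> num_classes E (region_joins a b (insert c D)) + 1" using n by simp
      ultimately show ?thesis using insert unfolding k1 by simp
    qed
  next
    case False
    then have ab: "a = 2" "b = 1" using assms(3) by auto
    have base: "conn ?K (p c) (r c)" "conn ?K (q c) (s c)"
      using Ka ab by (auto simp: resolution_def intro!: conn_base)
    have Ki': "region_joins a b (insert c D) = insert (p c, s c) (insert (r c, q c) ?K)"
      using Ki unfolding ab resolution_def by simp
    have n: "?n = num_classes E (region_joins a b (insert c D)) + of_bool (\<not> conn ?K (r c) (q c)) +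
        of_bool (\<not> conn (insert (r c, q c) ?K) (p c) (s c))"
      unfolding Ki' by (rule num_classes_insert2[OF finE e(1,4,3,2)])
    show ?thesis
    proof (cases "conn ?K (p c) (s c)")
      case True
      have "conn ?K (r c) (q c)"
        by (rule conn_trans[OF conn_sym[OF base(1)] conn_trans[OF True conn_sym[OF base(2)]]])
      moreover have "conn (insert (r c, q c) ?K) (p c) (s c)" using True by (rule conn_mono) auto
      ultimately have "num_classes E (region_joins a b (insert c D)) = ?n" using n by simp
      moreover have "num_classes E (joins C (?k(c := b))) \<le> num_classes E (joins C ?k) + 1"
        using counts(2) k2 unfolding ab by metis
      ultimately show ?thesis using insert unfolding k1 by simp
    next
      case False
      have "\<not> conn ?R (p c) (s c)" using False mono by blast
      moreover have "\<not> conn ?R (p c) (q c)"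
      proof
        assume "conn ?R (p c) (q c)"
        then have "conn ?K (p c) (s c)" using conn_trans[OF mono base(2)] by blast
        then show False using False by blast
      qed
      ultimately have "num_classes E (joins C (?k(c := b))) + 1 = num_classes E (joins C ?k)"
        using counts(4) k2 unfolding ab by metis
      moreover have "conn (insert (r c, q c) ?K) (p c) (s c)"
        unfolding conn_insert using base conn_sym[OF base(2)] conn_sym[OF base(1)] by blast
      then have "?n \<le> num_classes E (region_joins a b (insert c D)) + 1" using n by simp
      ultimately show ?thesis using insert unfolding k1 by simp
    qed
  qed
qed

text \<open>On a sphere the number of loops of a state is determined by the connectivity of the shaded
  regions: the bounds for the shaded and for the unshaded regions add up to an equality.\<close>

theorem loops_planar:
  assumes "D \<subseteq> C" "E \<noteq> {}"
    and connected: "num_classes E (joins C (\<lambda>_. 1) \<union> joins C (\<lambda>_. 2)) = 1"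
    and planar: "num_classes E (joins C (\<lambda>_. 1)) + num_classes E (joins C (\<lambda>_. 2)) \<ge> card C + 2"
  shows "num_classes E (joins C (\<lambda>c. if c \<in> D then 2 else 1)) + num_classes E (joins C (\<lambda>_. 1)) =
      2 * num_classes E (region_joins 1 2 D) + card D"
    and "num_classes E (joins C (\<lambda>_. 1)) + num_classes E (joins C (\<lambda>_. 2)) = card C + 2"
proof -
  let ?L = "num_classes E (joins C (\<lambda>c. if c \<in> D then 2 else 1))"
  have fD: "finite D" "finite (C - D)" using assms(1) finC finite_subset by auto
  have k: "(\<lambda>c. if c \<in> C - D then 1 else 2 :: nat) c = (\<lambda>c. if c \<in> D then 2 else 1) c" if "c \<in> C" for c
    using that by auto
  have j: "joins C (\<lambda>c. if c \<in> C - D then 1 else 2) = joins C (\<lambda>c. if c \<in> D then 2 else 1)"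
    unfolding joins_def using k by (auto split: if_splits)
  have 1: "?L + num_classes E (joins C (\<lambda>_. 1)) \<le> 2 * num_classes E (region_joins 1 2 D) + card D"
    by (rule loops_le_regions) (use fD assms in auto)
  have 2: "?L + num_classes E (joins C (\<lambda>_. 2)) \<le> 2 * num_classes E (region_joins 2 1 (C - D)) + card (C - D)"
    using loops_le_regions[OF fD(2), of 2 1] j by simp
  have 3: "num_classes E (region_joins 1 2 D) + num_classes E (region_joins 2 1 (C - D)) \<le> ?L + 1"
  proof (rule num_classes_two_coarsenings[OF finE])
    show sub: "region_joins 1 2 D \<subseteq> E \<times> E" by (rule region_joins_subset[OF assms(1)])
    show "finite (region_joins 1 2 D)" using finite_subset[OF sub] finE by simp
    show "joins C (\<lambda>c. if c \<in> D then 2 else 1) \<subseteq> region_joins 1 2 D"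
      using joins_region[of D 2 1] assms(1) by (simp add: Int_absorb2)
    show "joins C (\<lambda>c. if c \<in> D then 2 else 1) \<subseteq> region_joins 2 1 (C - D)"
      using joins_region[of "C - D" 1 2] j by (simp add: Int_absorb2)
    have "joins C (\<lambda>_. 1) \<union> joins C (\<lambda>_. 2) \<subseteq> region_joins 1 2 D \<union> region_joins 2 1 (C - D)"
      by (auto simp: region_joins_def)
    then have "num_classes E (region_joins 1 2 D \<union> region_joins 2 1 (C - D)) \<le> 1"
      using num_classes_antimono[OF finE] connected by metis
    moreover have "num_classes E (region_joins 1 2 D \<union> region_joins 2 1 (C - D)) > 0"
      by (rule num_classes_pos[OF finE assms(2)])
    ultimately show "num_classes E (region_joins 1 2 D \<union> region_joins 2 1 (C - D)) = 1" by simp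
  qed
  have "card (C - D) = card C - card D" "card D \<le> card C"
    using assms(1) finC by (auto simp: card_Diff_subset finite_subset card_mono)
  \<comment> \<open>Adding \<open>1\<close>, \<open>2\<close> and twice \<open>3\<close> cancels all
    but the loops of the two extreme states and gives the reverse of the inequality
    \<open>planar\<close>. So each of the three is an equality.\<close>
  then show "?L + num_classes E (joins C (\<lambda>_. 1)) = 2 * num_classes E (region_joins 1 2 D) + card D"
    "num_classes E (joins C (\<lambda>_. 1)) + num_classes E (joins C (\<lambda>_. 2)) = card C + 2"
    using 1 2 3 planar by linarith+
qed

end

lemma conn_symmetric:
  assumes "\<And>a b. (a, b) \<in> R \<Longrightarrow> (a, b) \<in> R' \<or> (b, a) \<in> R'"
    "\<And>a b. (a, b) \<in> R' \<Longrightarrow> (a, b) \<in> R \<or> (b, a) \<in> R"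
  shows "conn R = conn R'"
proof (rule conn_cong_sets)
  show "conn R' a b" if "(a, b) \<in> R" for a b
    using assms(1)[OF that] conn_base[of a b R'] conn_base'[of b a R'] by blast
  show "conn R a b" if "(a, b) \<in> R'" for a b
    using assms(2)[OF that] conn_base[of a b R] conn_base'[of b a R] by blast
qed

lemma num_classes_Plus:
  assumes "finite A" "finite B"
  shows "num_classes (Inl ` A \<union> Inr ` B) (map_prod Inr Inr ` R) = card A + num_classes B R"
proof -
  let ?R = "map_prod Inr Inr ` R :: (('a + 'b) \<times> ('a + 'b)) set"
  have l: "y = Inl a" if "conn ?R (Inl a) y" for a y
    using conn_isolated[OF that] by (force simp: touching_def)
  have r: "\<exists>b'. y = Inr b' \<and> conn R b b'" if "conn ?R (Inr b) y" for b y
    using that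
  proof (induction rule: conn_induct)
    case (step y z)
    then obtain b' where b': "y = Inr b'" "conn R b b'" by blast
    obtain b'' where b'': "z = Inr b''" "(b', b'') \<in> R \<or> (b'', b') \<in> R" using step(2) b'(1) by auto
    then have "conn R b' b''" by (auto intro: conn_base conn_base')
    then show ?case using conn_trans[OF b'(2)] b''(1) by blast
  qed simp
  have r': "conn ?R (Inr b) (Inr b')" if "conn R b b'" for b b'
    by (rule conn_map[OF that]) (auto intro!: conn_base)
  have 1: "inj_on (cls ?R) (Inl ` A)"
    using l by (auto simp: inj_on_def cls_eq_iff)
  have 2: "cls ?R ` Inl ` A \<inter> cls ?R ` Inr ` B = {}"
    by (auto simp: cls_eq_iff dest: l)
  have 3: "card (cls ?R ` Inr ` B) = num_classes B R"
  proof -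
    have "num_classes B R = num_classes (Inr ` B) ?R"
    proof (rule num_classes_inj_transfer[where h = Inr])
      show "conn R x x' = conn ?R (Inr x) (Inr x')" for x x' using r r' by blast
    qed auto
    then show ?thesis by (simp add: num_classes_cls)
  qed
  have "num_classes (Inl ` A \<union> Inr ` B) ?R = card (cls ?R ` Inl ` A) + card (cls ?R ` Inr ` B)"
    unfolding num_classes_cls image_Un using assms 2 by (intro card_Un_disjoint) auto
  also have "card (cls ?R ` Inl ` A) = card A"
    using 1 by (simp add: card_image)
  finally show ?thesis using 3 by simp
qed

section \<open>Counting edges of the boundary diagram\<close>

context surface begin

text \<open>Each entry of a core is the over-passage or the under-passage of exactly one
  crossing.\<close>

lemma sum_core_entries: "(\<Sum>c\<in>Cs. f (over_loc c) + f (under_loc c)) = (\<Sum>i<n. \<Sum>k<len i. f (i, k))"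
proof -
  let ?w = "concat (cores F)" and ?Ent = "SIGMA i:{..<n}. {..<len i}"
  have "bij_betw (entry_loc (cores F)) (set ?w) ?Ent"
  proof (rule bij_betw_byWitness[where f' = "\<lambda>(i, k). cores F ! i ! k"])
    have w: "\<exists>i k. i < n \<and> k < len i \<and> e = cores F ! i ! k" if "e \<in> set ?w" for e
      using that by (auto simp: in_set_conv_nth length_cores len_def set_conv_nth[of "cores F"])
    have loc: "entry_loc (cores F) (cores F ! i ! k) = (i, k)" if "i < n" "k < len i" for i k
      using entry_loc_nth[OF matched_cores, of i k] that by (simp add: length_cores len_def)
    show "\<forall>e\<in>set ?w. (case entry_loc (cores F) e of (i, k) \<Rightarrow> cores F ! i ! k) = e"
    proof
      fix e assume "e \<in> set ?w"
      then obtain i k where "i < n" "k < len i" "e = cores F ! i ! k" using w by metis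
      then show "(case entry_loc (cores F) e of (i, k) \<Rightarrow> cores F ! i ! k) = e" using loc by simp
    qed
    show "\<forall>x\<in>?Ent. entry_loc (cores F) (case x of (i, k) \<Rightarrow> cores F ! i ! k) = x"
      using loc by auto
    show "entry_loc (cores F) ` set ?w \<subseteq> ?Ent"
    proof (rule image_subsetI)
      fix e assume "e \<in> set ?w"
      then obtain i k where "i < n" "k < len i" "e = cores F ! i ! k" using w by metis
      then show "entry_loc (cores F) e \<in> ?Ent" using loc by simp
    qed
    show "(\<lambda>(i, k). cores F ! i ! k) ` ?Ent \<subseteq> set ?w"
    proof (rule image_subsetI)
      fix x assume "x \<in> ?Ent"
      then obtain i k where ik: "x = (i, k)" "i < n" "k < len i" by auto
      then have "cores F ! i ! k \<in> set (cores F ! i)" "cores F ! i \<in> set (cores F)"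
        by (simp_all add: len_def length_cores)
      then show "(case x of (i, k) \<Rightarrow> cores F ! i ! k) \<in> set ?w" using ik by auto
    qed
  qed
  then have "(\<Sum>e\<in>set ?w. f (entry_loc (cores F) e)) = (\<Sum>x\<in>?Ent. f x)"
    by (rule sum.reindex_bij_betw)
  then have "(\<Sum>c\<in>Cs. f (over_loc c) + f (under_loc c)) = (\<Sum>x\<in>?Ent. f x)"
    unfolding sum_entries[OF matched_cores] by (simp add: Cs_def sg_def over_loc_def under_loc_def)
  also have "\<dots> = (\<Sum>i<n. \<Sum>k<len i. f (i, k))"
    by (subst sum.Sigma) auto
  finally show ?thesis .
qed

lemma card_Cs: "2 * card Cs = (\<Sum>i<n. len i)"
  using sum_core_entries[of "\<lambda>_. 1 :: nat"] by simp

lemma finite_Q [simp]: "finite Q"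
  by (simp add: Q_def)

lemma card_Q: "card Q = 4 * card Cs"
proof -
  have "(UNIV :: (bool \<times> bool) set) = {(True, True), (True, False), (False, True), (False, False)}" by auto
  then have "card (UNIV :: (bool \<times> bool) set) = card {(True, True), (True, False), (False, True), (False, False)}"
    by (rule arg_cong)
  then have "card (UNIV :: (bool \<times> bool) set) = 4" by simp
  then show ?thesis by (simp add: Q_def card_cartesian_product)
qed

lemma right_end_inj: "right_end p = right_end q \<longleftrightarrow> p = q"
  by (cases p; cases q; auto simp: right_end_def)

lemma sum_disc_joins:
  fixes \<chi> :: "nat \<times> bool \<times> nat \<Rightarrow> nat"
  shows "(\<Sum>(a, b)\<in>disc_joins. \<chi> a + \<chi> b) =
    (\<Sum>i<n. \<Sum>d\<in>UNIV. \<chi> (i, d, 0) + \<chi> (i, d, 2 * len i))"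
proof -
  let ?fs = "set (feet F)"
  have "disc_joins = (\<lambda>p. (left_end (foot_flip p), right_end (next_foot F p))) ` ?fs"
    unfolding disc_joins_def disc_pairs_eq by (simp add: image_image)
  moreover have "inj_on (\<lambda>p. (left_end (foot_flip p), right_end (next_foot F p))) ?fs"
    using next_foot_inj by (auto simp: inj_on_def right_end_inj)
  ultimately have "(\<Sum>(a, b)\<in>disc_joins. \<chi> a + \<chi> b) =
      (\<Sum>p\<in>?fs. \<chi> (left_end (foot_flip p)) + \<chi> (right_end (next_foot F p)))"
    by (simp add: sum.reindex o_def)
  also have "\<dots> = (\<Sum>p\<in>?fs. \<chi> (left_end (foot_flip p))) + (\<Sum>p\<in>?fs. \<chi> (right_end (next_foot F p)))"
    by (rule sum.distrib)
  also have "(\<Sum>p\<in>?fs. \<chi> (right_end (next_foot F p))) = (\<Sum>p\<in>?fs. \<chi> (right_end p))"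
  proof -
    have "inj_on (next_foot F) ?fs" using next_foot_inj by (auto simp: inj_on_def)
    moreover from this have "next_foot F ` ?fs = ?fs"
      using next_foot_feet by (intro endo_inj_surj) auto
    ultimately show ?thesis
      using sum.reindex[of "next_foot F" ?fs "\<lambda>p. \<chi> (right_end p)"] by (simp add: o_def)
  qed
  also have "(\<Sum>p\<in>?fs. \<chi> (left_end (foot_flip p))) + (\<Sum>p\<in>?fs. \<chi> (right_end p)) =
      (\<Sum>p\<in>?fs. \<chi> (left_end (foot_flip p)) + \<chi> (right_end p))"
    by (rule sum.distrib[symmetric])
  also have "\<dots> = (\<Sum>(i, d)\<in>{..<n} \<times> UNIV. \<chi> (i, d, 0) + \<chi> (i, d, 2 * len i))"
    unfolding feet(2) by (intro sum.cong refl) (auto simp: left_end_def right_end_def foot_flip_def)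
  also have "\<dots> = (\<Sum>i<n. \<Sum>d\<in>UNIV. \<chi> (i, d, 0) + \<chi> (i, d, 2 * len i))"
    by (simp add: sum.cartesian_product)
  finally show ?thesis .
qed

lemma sum_Q:
  fixes f :: "nat \<times> bool \<times> bool \<Rightarrow> 'a :: comm_monoid_add"
  shows "(\<Sum>z\<in>Q. f z) = (\<Sum>c\<in>Cs. \<Sum>d\<in>UNIV. \<Sum>e\<in>UNIV. f (c, d, e))"
proof -
  have "(\<Sum>c\<in>Cs. \<Sum>d\<in>UNIV. \<Sum>e\<in>UNIV. f (c, d, e)) = (\<Sum>c\<in>Cs. \<Sum>(d, e)\<in>UNIV \<times> UNIV. f (c, d, e))"
    by (simp only: sum.cartesian_product)
  also have "\<dots> = (\<Sum>z\<in>Cs \<times> (UNIV \<times> UNIV). f z)"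
    by (simp only: sum.cartesian_product case_prod_unfold prod.collapse)
  finally show ?thesis by (simp only: Q_def)
qed

lemma sum_X:
  fixes f :: "nat \<times> bool \<times> nat \<Rightarrow> 'a :: comm_monoid_add"
  shows "(\<Sum>x\<in>X. f x) = (\<Sum>i<n. \<Sum>d\<in>UNIV. \<Sum>off\<le>2 * len i. f (i, d, off))"
proof -
  have "X = (SIGMA i:{..<n}. UNIV \<times> {..2 * len i})" by (auto simp: X_def)
  then show ?thesis by (simp add: sum.Sigma sum.cartesian_product)
qed

text \<open>An entry contributes its two even neighbours once and the odd piece between them twice;
  the disc contributes the two extreme pieces. Altogether each piece is met at its two ends.\<close>

lemma sum_steps:
  fixes g :: "nat \<Rightarrow> nat"
  shows "(\<Sum>k<m. g (2 * k) + 2 * g (2 * k + 1) + g (2 * k + 2)) + g 0 + g (2 * m) = 2 * (\<Sum>off\<le>2 * m. g off)"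
  by (induction m) (simp_all add: algebra_simps)

lemma ends_in_X:
  assumes "z \<in> Q"
  shows "outer_over z \<in> X" "mid_over z \<in> X" "outer_under z \<in> X" "mid_under z \<in> X"
  using assms core_loc[of "fst z"]
  by (auto simp: Q_def X_def outer_over_def mid_over_def outer_under_def mid_under_def arm_over_def arm_under_def)

text \<open>With this order of the ends, resolution 1 is the separating smoothing and resolution 2
  the merging one, up to the order within pairs.\<close>

sublocale four_ends X disc_joins Q outer_over mid_over outer_under mid_under
proof
  show "finite X" "finite Q" by simp_all
  show "finite disc_joins" by (simp add: disc_joins_def disc_pairs_def)
  show "disc_joins \<subseteq> X \<times> X"
    using disc_pairs_feet unfolding disc_joins_def feet(2)
    by (fastforce simp: X_def left_end_def right_end_def)
  show "outer_over z \<in> X \<and> mid_over z \<in> X \<and> outer_under z \<in> X \<and> mid_under z \<in> X" if "z \<in> Q" for z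
    using ends_in_X[OF that] by blast
  fix \<chi> :: "nat \<times> bool \<times> nat \<Rightarrow> nat"
  let ?g = "\<lambda>d (i, k). \<chi> (i, d, 2 * k) + 2 * \<chi> (i, d, 2 * k + 1) + \<chi> (i, d, 2 * k + 2)"
  have "(\<Sum>z\<in>Q. \<chi> (outer_over z) + \<chi> (mid_over z) + \<chi> (outer_under z) + \<chi> (mid_under z)) =
      (\<Sum>c\<in>Cs. (\<Sum>d\<in>UNIV. ?g d (over_loc c)) + (\<Sum>d\<in>UNIV. ?g d (under_loc c)))"
    unfolding sum_Q
  proof (intro sum.cong refl)
    fix c assume "c \<in> Cs"
    show "(\<Sum>d\<in>UNIV. \<Sum>e\<in>UNIV. \<chi> (outer_over (c, d, e)) + \<chi> (mid_over (c, d, e)) +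
        \<chi> (outer_under (c, d, e)) + \<chi> (mid_under (c, d, e))) =
      (\<Sum>d\<in>UNIV. ?g d (over_loc c)) + (\<Sum>d\<in>UNIV. ?g d (under_loc c))"
      by (cases "sg c"; cases "over_loc c"; cases "under_loc c")
        (simp_all add: UNIV_bool outer_over_def mid_over_def outer_under_def mid_under_def arm_over_def arm_under_def)
  qed
  also have "\<dots> = (\<Sum>i<n. \<Sum>k<len i. \<Sum>d\<in>UNIV. ?g d (i, k))"
    by (rule sum_core_entries)
  also have "\<dots> = (\<Sum>i<n. \<Sum>d\<in>UNIV. \<Sum>k<len i. ?g d (i, k))"
    by (intro sum.cong refl sum.swap)
  finally have "(\<Sum>(a, b)\<in>disc_joins. \<chi> a + \<chi> b) +
      (\<Sum>z\<in>Q. \<chi> (outer_over z) + \<chi> (mid_over z) + \<chi> (outer_under z) + \<chi> (mid_under z)) =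
      (\<Sum>i<n. \<Sum>d\<in>UNIV. (\<Sum>k<len i. ?g d (i, k)) + \<chi> (i, d, 0) + \<chi> (i, d, 2 * len i))"
    unfolding sum_disc_joins by (simp add: sum.distrib algebra_simps)
  also have "\<dots> = (\<Sum>i<n. \<Sum>d\<in>UNIV. 2 * (\<Sum>off\<le>2 * len i. \<chi> (i, d, off)))"
    using sum_steps by (intro sum.cong refl) simp
  finally show "2 * (\<Sum>x\<in>X. \<chi> x) = (\<Sum>(a, b)\<in>disc_joins. \<chi> a + \<chi> b) +
      (\<Sum>z\<in>Q. \<chi> (outer_over z) + \<chi> (mid_over z) + \<chi> (outer_under z) + \<chi> (mid_under z))"
    unfolding sum_X by (simp add: sum_distrib_left)
qed

lemma conn_smoothed: "conn (smoothed T) = conn (joins Q (\<lambda>z. if z \<in> T then 2 else 1))"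
proof (rule conn_symmetric)
  have *: "(a, b) \<in> resolution (if z \<in> T then 2 else 1) (outer_over z) (mid_over z) (outer_under z) (mid_under z) \<or>
      (b, a) \<in> resolution (if z \<in> T then 2 else 1) (outer_over z) (mid_over z) (outer_under z) (mid_under z) \<longleftrightarrow>
      (a, b) \<in> (if z \<in> T then merging z else separating z) \<or> (b, a) \<in> (if z \<in> T then merging z else separating z)"
    for a b z by (auto simp: resolution_def merging_def separating_def)
  show "(a, b) \<in> joins Q (\<lambda>z. if z \<in> T then 2 else 1) \<or> (b, a) \<in> joins Q (\<lambda>z. if z \<in> T then 2 else 1)"
    if "(a, b) \<in> smoothed T" for a b
    using that *[of a b] unfolding smoothed_def joins_def by blast
  show "(a, b) \<in> smoothed T \<or> (b, a) \<in> smoothed T"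
    if "(a, b) \<in> joins Q (\<lambda>z. if z \<in> T then 2 else 1)" for a b
    using that *[of a b] unfolding smoothed_def joins_def by blast
qed

lemma num_classes_smoothed: "num_classes X (smoothed T) = num_classes X (joins Q (\<lambda>z. if z \<in> T then 2 else 1))"
  by (rule num_classes_cong) (simp add: conn_smoothed)

end

text \<open>The induced map of classes is onto, hence bijective when the counts agree. Equality in a
  counting bound thus yields information on connectivity.\<close>

lemma num_classes_surj:
  assumes "finite X" "\<And>a b. (a, b) \<in> R \<Longrightarrow> conn R' (h a) (h b)" "\<And>y. y \<in> Y \<Longrightarrow> \<exists>x\<in>X. conn R' y (h x)" "h ` X \<subseteq> Y"
  shows "num_classes Y R' \<le> num_classes X R"
    and "num_classes Y R' = num_classes X R \<Longrightarrow> x \<in> X \<Longrightarrow> x' \<in> X \<Longrightarrow> conn R' (h x) (h x') \<Longrightarrow> conn R x x'"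
proof -
  define f where "f c = cls R' (h (inv_into X (cls R) c))" for c
  have f: "f (cls R x) = cls R' (h x)" if "x \<in> X" for x
  proof -
    have "cls R (inv_into X (cls R) (cls R x)) = cls R x" using that by (simp add: f_inv_into_f)
    then have "conn R (inv_into X (cls R) (cls R x)) x" by (simp add: cls_eq_iff)
    from conn_map[of R _ _ R' h, OF this assms(2)] show ?thesis by (simp add: f_def cls_eq_iff)
  qed
  have img: "f ` (cls R ` X) = cls R' ` Y"
  proof
    show "f ` cls R ` X \<subseteq> cls R' ` Y" using f assms(4) by auto
    show "cls R' ` Y \<subseteq> f ` cls R ` X"
    proof
      fix d assume "d \<in> cls R' ` Y"
      then obtain y where y: "y \<in> Y" "d = cls R' y" by auto
      then obtain x where x: "x \<in> X" "conn R' y (h x)" using assms(3) by blast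
      then have "d = f (cls R x)" using f y by (simp add: cls_eq_iff)
      then show "d \<in> f ` cls R ` X" using x by blast
    qed
  qed
  then show "num_classes Y R' \<le> num_classes X R"
    unfolding num_classes_cls using assms(1) card_image_le[of "cls R ` X" f] by simp
  assume "num_classes Y R' = num_classes X R" and x: "x \<in> X" "x' \<in> X" "conn R' (h x) (h x')"
  then have "inj_on f (cls R ` X)"
    using img assms(1) by (intro eq_card_imp_inj_on) (simp_all add: num_classes_cls)
  moreover have "f (cls R x) = f (cls R x')" using f x by (simp add: cls_eq_iff)
  ultimately have "cls R x = cls R x'" using x by (auto dest: inj_onD)
  then show "conn R x x'" by (simp add: cls_eq_iff)
qed

section \<open>Shaded regions of the boundary diagram\<close>

context surface begin

text \<open>The parts into which crossings of cores divide the bands. After gluing by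
  \<open>disc_rel\<close> they are the shaded regions; the start \<open>(0, 0)\<close> of the first
  band represents the disc.\<close>

definition V :: "(nat \<times> nat) set" where "V = {(i, k). i < n \<and> k \<le> len i}"

definition disc_rel :: "((nat \<times> nat) \<times> (nat \<times> nat)) set" where
  "disc_rel = (\<lambda>i. ((i, 0), (0, 0))) ` {..<n} \<union> (\<lambda>i. ((i, len i), (0, 0))) ` {..<n}"

definition end_over :: "nat \<times> bool \<times> bool \<Rightarrow> nat \<times> nat" where
  "end_over z = (fst (over_loc (fst z)), snd (over_loc (fst z)) + arm_over z)"

definition end_under :: "nat \<times> bool \<times> bool \<Rightarrow> nat \<times> nat" where
  "end_under z = (fst (under_loc (fst z)), snd (under_loc (fst z)) + arm_under z)"

definition region_rel :: "(nat \<times> bool \<times> bool) set \<Rightarrow> ((nat \<times> nat) \<times> (nat \<times> nat)) set" where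
  "region_rel T = disc_rel \<union> (\<lambda>z. (end_over z, end_under z)) ` T"

definition regions :: "(nat \<times> bool \<times> bool) set \<Rightarrow> nat" where
  "regions T = num_classes V (region_rel T)"

lemma finite_V [simp]: "finite V" and card_V: "card V = 2 * card Cs + n"
proof -
  have V: "V = (SIGMA i:{..<n}. {..len i})" by (auto simp: V_def)
  then show "finite V" by simp
  show "card V = 2 * card Cs + n" unfolding V card_Cs by (simp add: sum.distrib sum_Suc)
qed

lemma disc_rel_V: "disc_rel \<subseteq> V \<times> V"
  by (auto simp: disc_rel_def V_def)

lemma regions_empty_ge:
  assumes "n > 0"
  shows "2 * card Cs + 1 \<le> regions {} + n"
proof -
  \<comment> \<open>One of the \<open>2 * n\<close> gluings joins \<open>(0, 0)\<close> to itself;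
    dropping it accounts for the \<open>+ 1\<close> in the bound.\<close>
  let ?R = "(\<lambda>i. ((i, 0::nat), (0::nat, 0::nat))) ` {1..<n} \<union> (\<lambda>i. ((i, len i), (0, 0))) ` {..<n}"
  have "num_classes V disc_rel = num_classes V ?R"
  proof (rule num_classes_cong_conn)
    fix a b assume "(a, b) \<in> disc_rel"
    then obtain i where i: "i < n" "(a, b) = ((i, 0), (0, 0)) \<or> (a, b) = ((i, len i), (0, 0))"
      by (auto simp: disc_rel_def)
    show "conn ?R a b"
    proof (cases "i = 0 \<and> a = (0, 0)")
      case True
      then show ?thesis using i by auto
    next
      case False
      then have "(a, b) \<in> ?R" using i by (cases "i = 0") auto
      then show ?thesis by (rule conn_base)
    qed
  next
    fix a b assume "(a, b) \<in> ?R"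
    then have "(a, b) \<in> disc_rel" by (auto simp: disc_rel_def)
    then show "conn disc_rel a b" by (rule conn_base)
  qed
  moreover have "card V \<le> num_classes V ?R + card ?R"
    by (rule num_classes_ge[OF finite_V]) (auto simp: V_def)
  moreover have "card ?R \<le> (n - 1) + n"
    using card_Un_le[of "(\<lambda>i. ((i, 0::nat), (0::nat, 0::nat))) ` {1..<n}" "(\<lambda>i. ((i, len i), (0, 0))) ` {..<n}"]
      card_image_le[of "{1..<n}" "\<lambda>i. ((i, 0::nat), (0::nat, 0::nat))"]
      card_image_le[of "{..<n}" "\<lambda>i. ((i, len i), (0::nat, 0::nat))"] by simp
  ultimately show ?thesis using card_V assms by (simp add: regions_def region_rel_def)
qed

text \<open>The shaded region on one side of an edge of the boundary diagram.\<close>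

definition region_of :: "nat \<times> bool \<times> nat \<Rightarrow> nat \<times> nat" where
  "region_of x = (case x of (i, d, off) \<Rightarrow> if even off then (i, off div 2) else
     case cores F ! i ! (off div 2) of (c, ov, s) \<Rightarrow>
       if ov then (fst (under_loc c), snd (under_loc c) + of_bool (d \<noteq> sg c))
       else (fst (over_loc c), snd (over_loc c) + of_bool (d = sg c)))"

lemma region_of_ends:
  assumes "z \<in> Q"
  shows "region_of (outer_over z) = end_over z" "region_of (mid_under z) = end_over z"
    "region_of (outer_under z) = end_under z" "region_of (mid_over z) = end_under z"
proof -
  obtain c d e where z: "z = (c, d, e)" "c \<in> Cs" using assms by (auto simp: Q_def)
  show "region_of (outer_over z) = end_over z" "region_of (mid_under z) = end_over z"
    "region_of (outer_under z) = end_under z" "region_of (mid_over z) = end_under z"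
    using core_loc[OF z(2)]
    by (simp_all add: z region_of_def outer_over_def outer_under_def mid_over_def mid_under_def
      end_over_def end_under_def arm_over_def arm_under_def)
qed

lemma ends_in_V:
  assumes "z \<in> Q"
  shows "end_over z \<in> V" "end_under z \<in> V"
  using assms core_loc[of "fst z"]
  by (auto simp: Q_def V_def end_over_def end_under_def arm_over_def arm_under_def)

lemma region_rel_V: "T \<subseteq> Q \<Longrightarrow> region_rel T \<subseteq> V \<times> V"
  using disc_rel_V ends_in_V by (auto simp: region_rel_def)

lemma region_of_V: "x \<in> X \<Longrightarrow> region_of x \<in> V"
proof -
  assume "x \<in> X"
  then obtain i d off where x: "x = (i, d, off)" "i < n" "off \<le> 2 * len i" by (auto simp: X_def)
  show "region_of x \<in> V"
  proof (cases "even off")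
    case True
    then show ?thesis using x by (auto simp: region_of_def V_def)
  next
    case False
    then have k: "off div 2 < len i" using x by presburger
    obtain c ov s where e: "cores F ! i ! (off div 2) = (c, ov, s)" by (cases "cores F ! i ! (off div 2)") auto
    have "c \<in> Cs" using core_entry(1)[OF x(2) k e] .
    then show ?thesis using False core_loc[of c] x e by (auto simp: region_of_def V_def)
  qed
qed

definition region_edge :: "nat \<times> nat \<Rightarrow> nat \<times> bool \<times> nat" where
  "region_edge v = (fst v, True, 2 * snd v)"

lemma region_of_edge: "region_of (region_edge v) = v"
  by (simp add: region_edge_def region_of_def)

lemma region_edge_X: "v \<in> V \<Longrightarrow> region_edge v \<in> X"
  by (auto simp: region_edge_def V_def X_def)

lemma conn_disc_rel: "i < n \<Longrightarrow> k = 0 \<or> k = len i \<Longrightarrow> conn disc_rel (i, k) (0, 0)"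
  by (rule conn_base) (auto simp: disc_rel_def)

lemma region_of_smoothed:
  assumes "(a, b) \<in> smoothed {}"
  shows "conn disc_rel (region_of a) (region_of b)"
proof -
  consider "(a, b) \<in> disc_joins" | z where "z \<in> Q" "(a, b) \<in> separating z"
    using assms by (auto simp: smoothed_def)
  then show ?thesis
  proof cases
    case 1
    then obtain q p where qp: "(q, p) \<in> disc_pairs" "a = left_end p" "b = right_end q"
      by (auto simp: disc_joins_def)
    then have pq: "fst p < n" "fst q < n" using disc_pairs_feet feet(2) by fastforce+
    have "conn disc_rel (region_of a) (0, 0)" "conn disc_rel (region_of b) (0, 0)"
      using conn_disc_rel[OF pq(1)] conn_disc_rel[OF pq(2)]
      by (simp_all add: qp left_end_def right_end_def region_of_def)
    then show ?thesis by (rule conn_trans[OF _ conn_sym])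
  next
    case 2
    then show ?thesis using region_of_ends[OF 2(1)] by (auto simp: separating_def)
  qed
qed

text \<open>Both smoothings together connect all four ends at each crossing, so the whole boundary
  can be followed, and it is a single closed curve.\<close>

lemma all_connected:
  assumes "n > 0"
  shows "num_classes X (joins Q (\<lambda>_. 1) \<union> joins Q (\<lambda>_. 2)) = 1"
proof -
  let ?R = "joins Q (\<lambda>_. 1) \<union> joins Q (\<lambda>_. 2)"
  have cross: "conn ?R (outer_over z) (mid_over z)" "conn ?R (outer_under z) (mid_under z)" if "z \<in> Q" for z
  proof -
    have 1: "(outer_over z, mid_under z) \<in> ?R" "(outer_under z, mid_over z) \<in> ?R"
      "(outer_over z, outer_under z) \<in> ?R"
      using that by (auto simp: joins_def resolution_def)
    show "conn ?R (outer_over z) (mid_over z)"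
      by (rule conn_trans[OF conn_base[OF 1(3)] conn_base[OF 1(2)]])
    show "conn ?R (outer_under z) (mid_under z)"
      by (rule conn_trans[OF conn_base'[OF 1(3)] conn_base[OF 1(1)]])
  qed
  have step: "conn ?R (i, d, 2 * k) (i, d, 2 * k + 1) \<and> conn ?R (i, d, 2 * k + 2) (i, d, 2 * k + 1)"
    if "i < n" "k < len i" for i d k
  proof -
    obtain c ov s where e: "cores F ! i ! k = (c, ov, s)" by (cases "cores F ! i ! k") auto
    note ce = core_entry[OF that e]
    show ?thesis
    proof (cases ov)
      case True
      then have "over_loc c = (i, k)" using ce by (simp add: over_loc_def)
      then show ?thesis
        using cross(1)[of "(c, d, \<not> sg c)"] cross(1)[of "(c, d, sg c)"] ce(1)
        by (simp add: Q_def outer_over_def mid_over_def arm_over_def)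
    next
      case False
      then have "under_loc c = (i, k)" using ce by (simp add: under_loc_def)
      then show ?thesis
        using cross(2)[of "(c, sg c, d)"] cross(2)[of "(c, \<not> sg c, d)"] ce(1)
        by (simp add: Q_def outer_under_def mid_under_def arm_under_def)
    qed
  qed
  have strand: "conn ?R (i, d, 0) (i, d, off)" if "i < n" "off \<le> 2 * len i" for i d off
    using that(2)
  proof (induction off)
    case (Suc off)
    have k: "off div 2 < len i" using Suc.prems by simp
    have "conn ?R (i, d, off) (i, d, Suc off)"
    proof (cases "even off")
      case True
      then have "off = 2 * (off div 2)" "Suc off = 2 * (off div 2) + 1" by simp_all
      then show ?thesis using step[OF that(1) k, of d] by metis
    next
      case False
      then have "off = 2 * (off div 2) + 1" "Suc off = 2 * (off div 2) + 2" by presburger+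
      then show ?thesis using step[OF that(1) k, of d] conn_sym by metis
    qed
    moreover have "conn ?R (i, d, 0) (i, d, off)" using Suc by simp
    ultimately show ?case by (rule conn_trans[rotated])
  qed simp
  let ?b = "\<lambda>p. (fst p, snd p, 0 :: nat)"
  have next': "conn ?R (?b p) (?b (next_foot F p))" if p: "p \<in> set (feet F)" for p
  proof -
    have "(left_end (foot_flip p), right_end (next_foot F p)) \<in> disc_joins"
      unfolding disc_joins_def disc_pairs_eq using p by (auto simp: image_image)
    then have "(left_end (foot_flip p), right_end (next_foot F p)) \<in> ?R" by (simp add: joins_def)
    then have 1: "conn ?R (left_end (foot_flip p)) (right_end (next_foot F p))" by (rule conn_base)
    have n: "fst p < n" "fst (next_foot F p) < n"
      using p next_foot_feet[OF p] unfolding feet(2) by (simp_all add: mem_Times_iff)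
    have 2: "conn ?R (?b p) (left_end (foot_flip p))"
      using strand[OF n(1), of _ "snd p"] by (simp add: left_end_def foot_flip_def)
    have 3: "conn ?R (?b (next_foot F p)) (right_end (next_foot F p))"
      using strand[OF n(2), of _ "snd (next_foot F p)"] by (simp add: right_end_def)
    show ?thesis by (rule conn_trans[OF 2 conn_trans[OF 1 conn_sym[OF 3]]])
  qed
  let ?h = "?b (hd (feet F))"
  have iter: "conn ?R ?h (?b ((next_foot F ^^ j) (hd (feet F))))" for j
  proof (induction j)
    case (Suc j)
    have "conn ?R (?b ((next_foot F ^^ j) (hd (feet F)))) (?b ((next_foot F ^^ Suc j) (hd (feet F))))"
      using next'[OF boundary_feet_in[OF assms]] by simp
    with Suc show ?case by (rule conn_trans)
  qed simp
  have hx: "conn ?R ?h x" if "x \<in> X" for x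
  proof -
    obtain i d off where x: "x = (i, d, off)" "i < n" "off \<le> 2 * len i" using \<open>x \<in> X\<close> by (auto simp: X_def)
    then have "(i, d) \<in> set (boundary_feet F)" using set_boundary_feet[OF assms] feet(2) by simp
    then obtain j where "(i, d) = (next_foot F ^^ j) (hd (feet F))" by (auto simp: boundary_feet_def)
    then have "conn ?R ?h (i, d, 0)" using iter[of j] by (metis fst_conv snd_conv)
    then show ?thesis using strand[OF x(2,3), of d] unfolding x(1) by (rule conn_trans)
  qed
  have "X \<noteq> {}" using assms by (auto simp: X_def)
  moreover have "conn ?R x y" if "x \<in> X" "y \<in> X" for x y
    by (rule conn_trans[OF conn_sym[OF hx[OF that(1)]] hx[OF that(2)]])
  ultimately show ?thesis using num_classes_one_iff[OF finite_X, of ?R] by blast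
qed

definition core_crossing :: "nat \<Rightarrow> (nat \<times> nat) crossing" where
  "core_crossing c = mk_crossing (sg c) (over_loc c) (fst (over_loc c), Suc (snd (over_loc c)))
     (under_loc c) (fst (under_loc c), Suc (snd (under_loc c)))"

lemma core_crossings_eq: "core_crossings F = core_crossing ` Cs"
proof
  show "core_crossings F \<subseteq> core_crossing ` Cs"
  proof
    fix x assume "x \<in> core_crossings F"
    then obtain c s i k j l where *: "x = mk_crossing s (i, k) (i, Suc k) (j, l) (j, Suc l)"
      "i < n" "k < len i" "cores F ! i ! k = (c, True, s)" "j < n" "l < len j" "cores F ! j ! l = (c, False, s)"
      unfolding core_crossings_def by (auto simp: n_def len_def)
    note 1 = core_entry[OF *(2-4)] core_entry[OF *(5-7)]
    then have "x = core_crossing c" using *(1) by (simp add: core_crossing_def over_loc_def under_loc_def)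
    then show "x \<in> core_crossing ` Cs" using 1 by blast
  qed
  show "core_crossing ` Cs \<subseteq> core_crossings F"
  proof (rule image_subsetI)
    fix c assume c: "c \<in> Cs"
    show "core_crossing c \<in> core_crossings F"
      unfolding core_crossings_def core_crossing_def mem_Collect_eq
      by (rule exI[of _ c], rule exI[of _ "sg c"], rule exI[of _ "fst (over_loc c)"], rule exI[of _ "snd (over_loc c)"],
          rule exI[of _ "fst (under_loc c)"], rule exI[of _ "snd (under_loc c)"])
        (use core_loc[OF c] in \<open>simp add: n_def len_def\<close>)
  qed
qed

lemma card_core_crossings: "card (core_crossings F) = card Cs"
proof -
  have "inj_on core_crossing Cs"
  proof (rule inj_onI)
    fix c c' assume c: "c \<in> Cs" "c' \<in> Cs" "core_crossing c = core_crossing c'"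
    have sel: "(if positive (core_crossing c) then sw else se) (core_crossing c) = over_loc c" for c
      by (simp add: core_crossing_def mk_crossing_def)
    have "over_loc c = over_loc c'" using sel[of c] sel[of c'] c(3) by simp
    then have "(c, True, sg c) = (c', True, sg c')" using core_loc(3)[OF c(1)] core_loc(3)[OF c(2)] by metis
    then show "c = c'" by simp
  qed
  then show ?thesis by (simp add: core_crossings_eq card_image)
qed

text \<open>If all crossings are merged, the middle pieces at each crossing of cores close up to one
  small loop. The other pieces run along the sides of the cores and bound the faces of the core
  graph, whose number is given by \<open>planar_cores\<close>.\<close>

lemma loops_all_merged:
  assumes "n > 0"
  shows "num_classes X (smoothed Q) = 2 * card Cs + n + 1"
proof -
  let ?B = "core_edges F \<times> (UNIV :: side set)"
  let ?R = "(\<Union>x\<in>core_crossings F. corners x) \<union> disc_corners F"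
  let ?Y = "Inl ` Cs \<union> Inr ` ?B" and ?S = "map_prod Inr Inr ` ?R :: ((nat + (nat \<times> nat) \<times> side) \<times> (nat + (nat \<times> nat) \<times> side)) set"
  let ?side = "\<lambda>d. if d then Right_Side else Left_Side"
  \<comment> \<open>\<open>Inl c\<close> collects the middle pieces at the crossing \<open>c\<close>
    of cores; \<open>Inr\<close> records a part of a core and a side of it.\<close>
  define h where "h x = (case x of (i, d, off) \<Rightarrow> if even off then Inr ((i, off div 2), ?side d)
      else Inl (fst (cores F ! i ! (off div 2))))" for x :: "nat \<times> bool \<times> nat"
  define g where "g y = (case y of Inl c \<Rightarrow> mid_over (c, True, True)
      | Inr ((i, k), sd) \<Rightarrow> (i, sd = Right_Side, 2 * k))" for y :: "nat + (nat \<times> nat) \<times> side"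
  have side: "(?side d = Right_Side) = d" "?side (sd = Right_Side) = sd" for d sd by (cases sd; auto)+
  have B: "core_edges F = V" by (auto simp: core_edges_def V_def n_def len_def)
  have mids: "conn (smoothed Q) (mid_over (c, d, e)) (mid_under (c, d', e'))" if "c \<in> Cs" for c d e d' e'
  proof -
    have "(mid_over (c, d, e'), mid_under (c, d, e')) \<in> smoothed Q"
      using that by (force simp: smoothed_def merging_def Q_def)
    moreover have "mid_over (c, d, e') = mid_over (c, d, e)" "mid_under (c, d, e') = mid_under (c, d', e')"
      by (simp_all add: mid_over_def mid_under_def)
    ultimately have "(mid_over (c, d, e), mid_under (c, d', e')) \<in> smoothed Q" by simp
    then show ?thesis by (rule conn_base)
  qed
  have outer: "(outer_over z, outer_under z) \<in> smoothed Q" if "z \<in> Q" for z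
    using that by (force simp: smoothed_def merging_def)
  have hz: "h (outer_over (c, d, e)) = Inr ((fst (over_loc c), snd (over_loc c) + of_bool (e = sg c)), ?side d)"
    "h (outer_under (c, d, e)) = Inr ((fst (under_loc c), snd (under_loc c) + of_bool (d \<noteq> sg c)), ?side e)"
    "h (mid_over (c, d, e)) = Inl c" "h (mid_under (c, d, e)) = Inl c" if "c \<in> Cs" for c d e
    using core_loc[OF that] by (simp_all add: h_def outer_over_def outer_under_def arm_over_def arm_under_def
        mid_over_def mid_under_def)
  have corner: "(h (outer_over (c, d, e)), h (outer_under (c, d, e))) \<in> map_prod Inr Inr ` corners (core_crossing c) \<or>
      (h (outer_under (c, d, e)), h (outer_over (c, d, e))) \<in> map_prod Inr Inr ` corners (core_crossing c)"
    if "c \<in> Cs" for c d e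
    unfolding hz[OF that]
    by (cases "sg c"; cases d; cases e; cases "over_loc c"; cases "under_loc c")
      (auto simp: corners_def core_crossing_def mk_crossing_def)
  have foot: "h (right_end p) = Inr (foot_right F p)" "h (left_end p) = Inr (foot_left F p)" for p
    by (cases p; auto simp: h_def right_end_def left_end_def len_def)+
  have gfoot: "g (Inr (foot_right F p)) = right_end p" "g (Inr (foot_left F p)) = left_end p" for p
    by (cases p; auto simp: g_def right_end_def left_end_def len_def)+
  have disc: "disc_corners F = (\<lambda>(p, q). (foot_right F p, foot_left F q)) ` disc_pairs"
  proof
    show "disc_corners F \<subseteq> (\<lambda>(p, q). (foot_right F p, foot_left F q)) ` disc_pairs"
    proof
      fix x assume "x \<in> disc_corners F"
      then obtain p q where "x = (foot_right F p, foot_left F q)" "(p, q) \<in> disc_pairs"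
        unfolding disc_corners_def disc_pairs_def by blast
      then show "x \<in> (\<lambda>(p, q). (foot_right F p, foot_left F q)) ` disc_pairs"
        by (intro image_eqI[of _ _ "(p, q)"]) simp_all
    qed
    show "(\<lambda>(p, q). (foot_right F p, foot_left F q)) ` disc_pairs \<subseteq> disc_corners F"
    proof (rule image_subsetI)
      fix x assume x: "x \<in> disc_pairs"
      obtain p q where "x = (p, q)" by (cases x) blast
      then show "(case x of (p, q) \<Rightarrow> (foot_right F p, foot_left F q)) \<in> disc_corners F"
        using x unfolding disc_corners_def disc_pairs_def by (simp only: prod.case) blast
    qed
  qed
  have "num_classes X (smoothed Q) = num_classes ?Y ?S"
  proof (rule num_classes_transfer[where h = h and g = g])
    fix a b assume "(a, b) \<in> smoothed Q"
    then consider "(a, b) \<in> disc_joins" | z where "z \<in> Q" "(a, b) \<in> merging z"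
      by (auto simp: smoothed_def)
    then show "conn ?S (h a) (h b)"
    proof cases
      case 1
      then obtain q p where "(q, p) \<in> disc_pairs" "a = left_end p" "b = right_end q"
        by (auto simp: disc_joins_def)
      then have "(h b, h a) \<in> ?S" unfolding disc by (auto simp: foot)
      then show ?thesis by (rule conn_base')
    next
      case (2 z)
      then obtain c d e where z: "z = (c, d, e)" "c \<in> Cs" by (auto simp: Q_def)
      have "corners (core_crossing c) \<subseteq> ?R" unfolding core_crossings_eq using z(2) by blast
      then have sub: "map_prod Inr Inr ` corners (core_crossing c) \<subseteq> ?S" by (rule image_mono)
      from corner[OF z(2), of d e] have "(h (outer_over z), h (outer_under z)) \<in> ?S \<or> (h (outer_under z), h (outer_over z)) \<in> ?S"
        unfolding z(1) by (elim disjE) (drule subsetD[OF sub], simp only: simp_thms)+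
      then have "conn ?S (h (outer_over z)) (h (outer_under z))"
        by (elim disjE) (rule conn_base conn_base', assumption)+
      moreover have "h (mid_over z) = h (mid_under z)" using hz(3,4)[OF z(2)] z(1) by simp
      ultimately show ?thesis using 2(2) by (auto simp: merging_def)
    qed
  next
    fix a b assume "(a, b) \<in> ?S"
    then obtain w where w: "(a, b) = map_prod Inr Inr w" "w \<in> ?R" by (rule imageE)
    obtain u v where "w = (u, v)" by (cases w)
    then have uv: "a = Inr u" "b = Inr v" "(u, v) \<in> ?R" using w by simp_all
    consider c where "c \<in> Cs" "(u, v) \<in> corners (core_crossing c)" | q p where "(q, p) \<in> disc_pairs" "u = foot_right F q" "v = foot_left F p"
      using uv(3) unfolding core_crossings_eq disc by auto
    then show "conn (smoothed Q) (g a) (g b)"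
    proof cases
      case (1 c)
      have "\<exists>z\<in>Q. (g a = outer_over z \<and> g b = outer_under z) \<or> (g b = outer_over z \<and> g a = outer_under z)"
      proof -
        define i k j l where "i = fst (over_loc c)" and "k = snd (over_loc c)" and "j = fst (under_loc c)" and "l = snd (under_loc c)"
        have loc: "over_loc c = (i, k)" "under_loc c = (j, l)" by (simp_all add: i_def k_def j_def l_def)
        have oo: "outer_over (c, d, e) = (i, d, 2 * k + 2 * of_bool (e = sg c))"
          and ou: "outer_under (c, d, e) = (j, e, 2 * l + 2 * of_bool (d \<noteq> sg c))" for d e
          by (simp_all add: outer_over_def outer_under_def arm_over_def arm_under_def loc)
        have gI: "g (Inr ((i, k), sd)) = (i, sd = Right_Side, 2 * k)" for i k sd by (simp add: g_def)
        have pos: "(u, v) = (((i, k), Left_Side), ((j, Suc l), Left_Side)) \<or> (u, v) = (((j, l), Right_Side), ((i, Suc k), Right_Side)) \<or>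
            (u, v) = (((i, k), Right_Side), ((j, l), Left_Side)) \<or> (u, v) = (((j, Suc l), Right_Side), ((i, Suc k), Left_Side))"
          if "sg c"
          using 1(2) that by (simp add: corners_def core_crossing_def mk_crossing_def loc)
        have neg: "(u, v) = (((j, l), Left_Side), ((i, Suc k), Left_Side)) \<or> (u, v) = (((i, k), Right_Side), ((j, Suc l), Right_Side)) \<or>
            (u, v) = (((j, l), Right_Side), ((i, k), Left_Side)) \<or> (u, v) = (((i, Suc k), Right_Side), ((j, Suc l), Left_Side))"
          if "\<not> sg c"
          using 1(2) that by (simp add: corners_def core_crossing_def mk_crossing_def loc)
        let ?P = "\<lambda>d e. (g a = outer_over (c, d, e) \<and> g b = outer_under (c, d, e)) \<or>
            (g b = outer_over (c, d, e) \<and> g a = outer_under (c, d, e))"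
        have "?P False False \<or> ?P True True \<or> ?P True False \<or> ?P False True"
        proof (cases "sg c")
          case True
          from pos[OF True] show ?thesis
            by (elim disjE) (simp_all add: uv gI oo ou True)
        next
          case False
          from neg[OF False] show ?thesis
            by (elim disjE) (simp_all add: uv gI oo ou False)
        qed
        then have "\<exists>d e. ?P d e" by blast
        then obtain d e where de: "(g a = outer_over (c, d, e) \<and> g b = outer_under (c, d, e)) \<or>
            (g b = outer_over (c, d, e) \<and> g a = outer_under (c, d, e))" by (elim exE)
        show ?thesis by (rule bexI[of _ "(c, d, e)"], rule de) (use 1(1) in \<open>simp add: Q_def\<close>)
      qed
      then obtain z where z: "z \<in> Q" "(g a = outer_over z \<and> g b = outer_under z) \<or> (g b = outer_over z \<and> g a = outer_under z)"
        by blast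
      have "conn (smoothed Q) (outer_over z) (outer_under z)" using outer[OF z(1)] by (rule conn_base)
      then show ?thesis using z(2) conn_sym by auto
    next
      case (2 q p)
      then have "(g b, g a) \<in> disc_joins"
        unfolding uv disc_joins_def by (auto simp: gfoot)
      then have "(g b, g a) \<in> smoothed Q" by (simp add: smoothed_def)
      then show ?thesis by (rule conn_base')
    qed
  next
    fix x assume "x \<in> X"
    then obtain i d off where x: "x = (i, d, off)" "i < n" "off \<le> 2 * len i" by (auto simp: X_def)
    show "conn (smoothed Q) x (g (h x))"
    proof (cases "even off")
      case True
      then show ?thesis using x by (auto simp: g_def h_def)
    next
      case False
      then have k: "off div 2 < len i" "off = 2 * (off div 2) + 1" using x by presburger+
      obtain c ov s where e: "cores F ! i ! (off div 2) = (c, ov, s)" by (cases "cores F ! i ! (off div 2)") auto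
      note ce = core_entry[OF x(2) k(1) e]
      have gh: "g (h x) = mid_over (c, True, True)" using x False e by (simp add: g_def h_def)
      show ?thesis
      proof (cases ov)
        case True
        then have "x = mid_over (c, d, True)" using ce(3) x k(2) by (simp add: mid_over_def over_loc_def ce(2))
        then show ?thesis
          unfolding gh by (simp only: conn_trans[OF mids[OF ce(1)] conn_sym[OF mids[OF ce(1)]]])
      next
        case False
        then have "x = mid_under (c, True, d)" using ce(3) x k(2) by (simp add: mid_under_def under_loc_def ce(2))
        then show ?thesis
          unfolding gh by (simp only: conn_sym[OF mids[OF ce(1)]])
      qed
    qed
  next
    fix y assume "y \<in> ?Y"
    then consider c where "c \<in> Cs" "y = Inl c" | i k sd where "y = Inr ((i, k), sd)" "(i, k) \<in> V"
      unfolding B by auto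
    then show "conn ?S y (h (g y))"
    proof cases
      case (1 c)
      then show ?thesis using hz(3)[OF 1(1)] by (simp add: g_def)
    next
      case (2 i k sd)
      then show ?thesis using side(2)[of sd] by (simp add: g_def h_def)
    qed
  next
    show "h ` X \<subseteq> ?Y"
    proof (rule image_subsetI)
      fix x assume "x \<in> X"
      then obtain i d off where x: "x = (i, d, off)" "i < n" "off \<le> 2 * len i" by (auto simp: X_def)
      show "h x \<in> ?Y"
      proof (cases "even off")
        case True
        then have "(i, off div 2) \<in> V" using x by (auto simp: V_def)
        then show ?thesis using x True unfolding B by (auto simp: h_def)
      next
        case False
        then have k: "off div 2 < len i" using x by presburger
        obtain c ov s where e: "cores F ! i ! (off div 2) = (c, ov, s)" by (cases "cores F ! i ! (off div 2)") auto
        then show ?thesis using core_entry(1)[OF x(2) k e] x False by (simp add: h_def)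
      qed
    qed
    show "g ` ?Y \<subseteq> X"
    proof (rule image_subsetI)
      fix y assume "y \<in> ?Y"
      then consider c where "c \<in> Cs" "y = Inl c" | i k sd where "y = Inr ((i, k), sd)" "(i, k) \<in> V"
        unfolding B by auto
      then show "g y \<in> X"
      proof cases
        case (1 c)
        then show ?thesis using ends_in_X(2)[of "(c, True, True)"] by (simp add: g_def Q_def)
      next
        case (2 i k sd)
        then show ?thesis by (auto simp: g_def V_def X_def)
      qed
    qed
  qed
  also have "\<dots> = card Cs + num_classes ?B ?R"
  proof (rule num_classes_Plus)
    have "(UNIV :: side set) = {Left_Side, Right_Side}" using side.exhaust by auto
    then show "finite ?B" unfolding B by (metis finite.emptyI finite.insertI finite_SigmaI finite_V)
  qed simp
  also have "num_classes ?B ?R = card Cs + n + 1"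
    using F assms card_core_crossings by (auto simp: seifert_surface_def planar_cores_def n_def)
  finally show ?thesis by simp
qed

text \<open>Each piece of the boundary is sent to an adjacent shaded region. In the fully separated
  state this is onto; the second part is for the planar case, in which the counts agree and every
  region is bounded by a single loop.\<close>

lemma regions_le_loops:
  assumes "n > 0"
  shows "regions {} \<le> num_classes X (smoothed {})"
    and "regions {} = num_classes X (smoothed {}) \<Longrightarrow> x \<in> X \<Longrightarrow> x' \<in> X \<Longrightarrow>
      conn disc_rel (region_of x) (region_of x') \<Longrightarrow> conn (smoothed {}) x x'"
proof -
  have r: "regions {} = num_classes V disc_rel" by (simp add: regions_def region_rel_def)
  have surj: "\<exists>x\<in>X. conn disc_rel v (region_of x)" if "v \<in> V" for v
    using region_of_edge[of v] region_edge_X[OF that] by (intro bexI[of _ "region_edge v"]) simp_all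
  have img: "region_of ` X \<subseteq> V" using region_of_V by auto
  note * = num_classes_surj[OF finite_X, of "smoothed {}" disc_rel region_of V, OF region_of_smoothed surj img]
  show "regions {} \<le> num_classes X (smoothed {})"
    unfolding r by (rule *(1))
  show "regions {} = num_classes X (smoothed {}) \<Longrightarrow> x \<in> X \<Longrightarrow> x' \<in> X \<Longrightarrow>
      conn disc_rel (region_of x) (region_of x') \<Longrightarrow> conn (smoothed {}) x x'"
    unfolding r by (rule *(2))
qed

lemma region_of_joined:
  assumes "T \<subseteq> Q" "(a, b) \<in> smoothed {} \<union> (\<Union>z\<in>T. merging z)"
  shows "conn (region_rel T) (region_of a) (region_of b)"
proof -
  consider "(a, b) \<in> smoothed {}" | z where "z \<in> T" "(a, b) \<in> merging z" using assms(2) by blast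
  then show ?thesis
  proof cases
    case 1
    from conn_mono[OF region_of_smoothed[OF this], of "region_rel T"] show ?thesis
      by (simp add: region_rel_def)
  next
    case (2 z)
    then have z: "z \<in> Q" using assms(1) by blast
    have "conn (region_rel T) (end_over z) (end_under z)"
      using 2(1) by (intro conn_base) (simp add: region_rel_def)
    then show ?thesis using 2(2) region_of_ends[OF z] conn_sym by (auto simp: merging_def)
  qed
qed

theorem loops_regions:
  assumes "n > 0" "T \<subseteq> Q"
  shows "num_classes X (smoothed T) + (2 * card Cs + 1) = 2 * regions T + card T + n"
    and "regions {} + n = 2 * card Cs + 1"
proof -
  have X0: "X \<noteq> {}" using assms(1) by (auto simp: X_def)
  have j: "num_classes X (smoothed {}) = num_classes X (joins Q (\<lambda>_. 1))"
    "num_classes X (smoothed Q) = num_classes X (joins Q (\<lambda>_. 2))"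
    using num_classes_smoothed[of "{}"] num_classes_smoothed[of Q] by (simp_all add: joins_def)
  \<comment> \<open>With \<open>c\<close> crossings of cores, the two extreme states have at least
    \<open>2 * c + 1 - n\<close> and exactly \<open>2 * c + 1 + n\<close> loops. The total
    \<open>4 * c + 2\<close> is the maximum possible for \<open>card Q = 4 * c\<close>.\<close>
  have "num_classes X (joins Q (\<lambda>_. 1)) + num_classes X (joins Q (\<lambda>_. 2)) \<ge> card Q + 2"
    using regions_empty_ge[OF assms(1)] regions_le_loops(1)[OF assms(1)] loops_all_merged[OF assms(1)]
    unfolding j card_Q by linarith
  note planar = loops_planar[OF assms(2) X0 all_connected[OF assms(1)] this]
  have L0: "num_classes X (smoothed {}) + n = 2 * card Cs + 1" and eq: "regions {} = num_classes X (smoothed {})"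
    using planar(2) regions_empty_ge[OF assms(1)] regions_le_loops(1)[OF assms(1)] loops_all_merged[OF assms(1)]
    unfolding j card_Q by linarith+
  show "regions {} + n = 2 * card Cs + 1" using L0 eq by simp
  note inj = regions_le_loops(2)[OF assms(1) eq]
  let ?R = "smoothed {} \<union> (\<Union>z\<in>T. merging z)"
  have "num_classes X (region_joins 1 2 T) = num_classes X ?R"
  proof (rule num_classes_symmetric)
    have sep: "(a, b) \<in> resolution 1 (outer_over z) (mid_over z) (outer_under z) (mid_under z) \<or>
        (b, a) \<in> resolution 1 (outer_over z) (mid_over z) (outer_under z) (mid_under z) \<longleftrightarrow>
        (a, b) \<in> separating z \<or> (b, a) \<in> separating z" for a b z
      by (auto simp: resolution_def separating_def)
    have mer: "resolution 2 (outer_over z) (mid_over z) (outer_under z) (mid_under z) = merging z" for z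
      by (auto simp: resolution_def merging_def)
    let ?res = "\<lambda>z. resolution 1 (outer_over z) (mid_over z) (outer_under z) (mid_under z)"
    have un: "(J \<union> A) \<union> (J \<union> B) = J \<union> A \<union> B" for J A B :: "'x set" by blast
    have rj: "region_joins 1 2 T = disc_joins \<union> (\<Union>z\<in>Q. ?res z) \<union> (\<Union>z\<in>T. merging z)"
      unfolding region_joins_def joins_def mer by (rule un)
    have R: "?R = disc_joins \<union> (\<Union>z\<in>Q. separating z) \<union> (\<Union>z\<in>T. merging z)"
      unfolding smoothed_def empty_iff if_False ..
    show "(a, b) \<in> ?R \<or> (b, a) \<in> ?R" if ab: "(a, b) \<in> region_joins 1 2 T" for a b
    proof -
      consider "(a, b) \<in> disc_joins \<union> (\<Union>z\<in>T. merging z)" | z where "z \<in> Q" "(a, b) \<in> ?res z"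
        using ab unfolding rj by blast
      then show ?thesis
      proof cases
        case (2 z)
        then show ?thesis using sep[of a b z] unfolding R by blast
      next
        case 1
        then show ?thesis unfolding R by blast
      qed
    qed
    show "(a, b) \<in> region_joins 1 2 T \<or> (b, a) \<in> region_joins 1 2 T" if ab: "(a, b) \<in> ?R" for a b
    proof -
      consider "(a, b) \<in> disc_joins \<union> (\<Union>z\<in>T. merging z)" | z where "z \<in> Q" "(a, b) \<in> separating z"
        using ab unfolding R by blast
      then show ?thesis
      proof cases
        case (2 z)
        then show ?thesis using sep[of a b z] unfolding rj by blast
      next
        case 1
        then show ?thesis unfolding rj by blast
      qed
    qed
  qed
  also have "\<dots> = num_classes V (region_rel T)"
  proof (rule num_classes_transfer[where h = region_of and g = region_edge])
    show "conn (region_rel T) (region_of a) (region_of b)" if "(a, b) \<in> ?R" for a b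
      using assms(2) that by (rule region_of_joined)
  next
    fix a b assume "(a, b) \<in> region_rel T"
    then consider "(a, b) \<in> disc_rel" | z where "z \<in> T" "a = end_over z" "b = end_under z"
      unfolding region_rel_def by blast
    then show "conn ?R (region_edge a) (region_edge b)"
    proof cases
      case 1
      then have "region_edge a \<in> X" "region_edge b \<in> X" using disc_rel_V region_edge_X by blast+
      moreover have "conn disc_rel (region_of (region_edge a)) (region_of (region_edge b))"
        unfolding region_of_edge using 1 by (rule conn_base)
      ultimately have "conn (smoothed {}) (region_edge a) (region_edge b)" by (rule inj)
      then show ?thesis by (rule conn_mono) auto
    next
      case (2 z)
      then have z: "z \<in> Q" using assms(2) by blast
      have in_X: "region_edge a \<in> X" "region_edge b \<in> X" using 2 region_edge_X ends_in_V[OF z] by auto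
      have "conn (smoothed {}) (region_edge a) (outer_over z)"
        using in_X ends_in_X[OF z] region_of_ends[OF z] 2 by (intro inj) (simp_all add: region_of_edge)
      then have 1: "conn ?R (region_edge a) (outer_over z)" by (rule conn_mono) auto
      have "conn (smoothed {}) (region_edge b) (outer_under z)"
        using in_X ends_in_X[OF z] region_of_ends[OF z] 2 by (intro inj) (simp_all add: region_of_edge)
      then have 3: "conn ?R (region_edge b) (outer_under z)" by (rule conn_mono) auto
      have "(outer_over z, outer_under z) \<in> ?R" using 2(1) by (auto simp: merging_def)
      then have "conn ?R (outer_over z) (outer_under z)" by (rule conn_base)
      from conn_trans[OF 1 conn_trans[OF this conn_sym[OF 3]]] show ?thesis .
    qed
  next
    fix x assume x: "x \<in> X"
    have "conn (smoothed {}) x (region_edge (region_of x))"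
      by (rule inj) (use x region_edge_X region_of_V in \<open>simp_all add: region_of_edge\<close>)
    then show "conn ?R x (region_edge (region_of x))" by (rule conn_mono) auto
  qed (use region_of_edge region_of_V region_edge_X in auto)
  finally have "num_classes X (region_joins 1 2 T) = regions T" by (simp add: regions_def)
  then show "num_classes X (smoothed T) + (2 * card Cs + 1) = 2 * regions T + card T + n"
    using planar(1) L0 unfolding num_classes_smoothed[of T] j by linarith
qed

end

section \<open>Gauss sums of Seifert matrices\<close>

lemma prod_one_plus:
  fixes f :: "'a \<Rightarrow> 'b :: comm_ring_1"
  assumes "finite A"
  shows "(\<Prod>x\<in>A. 1 + f x) = (\<Sum>T\<in>Pow A. \<Prod>x\<in>T. f x)"
  using assms
proof (induction A rule: finite_induct)
  case (insert x A)
  have "(\<Prod>y\<in>insert x T. f y) = f x * (\<Prod>y\<in>T. f y)" if "T \<in> Pow A" for T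
    using that insert finite_subset by (intro prod.insert) auto
  then have "(\<Sum>T\<in>Pow (insert x A). \<Prod>y\<in>T. f y) = f x * (\<Sum>T\<in>Pow A. \<Prod>y\<in>T. f y) + (\<Sum>T\<in>Pow A. \<Prod>y\<in>T. f y)"
    unfolding sum_Pow_insert[OF insert(1,2)] sum_distrib_left by (intro arg_cong2[of _ _ _ _ "(+)"] sum.cong refl)
  then show ?case using insert by (simp add: algebra_simps)
qed simp

lemma const_conn_iff:
  assumes "R \<subseteq> V \<times> V"
  shows "(\<forall>x\<in>V. \<forall>y\<in>V. conn R x y \<longrightarrow> s x = s y) \<longleftrightarrow> (\<forall>(x, y)\<in>R. s x = s y)"
proof
  assume "\<forall>x\<in>V. \<forall>y\<in>V. conn R x y \<longrightarrow> s x = s y"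
  then show "\<forall>(x, y)\<in>R. s x = s y" using assms conn_base by fast
next
  assume "\<forall>(x, y)\<in>R. s x = s y"
  then show "\<forall>x\<in>V. \<forall>y\<in>V. conn R x y \<longrightarrow> s x = s y" using conn_invariant[of R _ _ s] by blast
qed

section \<open>The Potts model on the shaded regions\<close>

context surface begin

text \<open>The value of \<open>f_poly\<close> at \<open>A\<^sup>2 = y\<close>; the writhe of the boundary vanishes.\<close>

definition spin_bracket :: "complex \<Rightarrow> complex" where
  "spin_bracket y = (\<Sum>T\<in>Pow Q. (\<Prod>z\<in>T. if type_A z then y else inverse y) *
     (- (y + inverse y)) ^ (num_classes X (smoothed T) - 1))"

definition colourings :: "nat \<Rightarrow> ((nat \<times> nat) \<Rightarrow> nat) set" where
  "colourings q = {s \<in> V \<rightarrow>\<^sub>E {..<q}. \<forall>(x, y)\<in>disc_rel. s x = s y}"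

lemma finite_colourings [simp]: "finite (colourings q)"
  unfolding colourings_def by (rule finite_subset[of _ "V \<rightarrow>\<^sub>E {..<q}"]) (auto intro: finite_PiE)

lemma power_regions:
  assumes "T \<subseteq> Q"
  shows "q ^ regions T = card {s \<in> colourings q. \<forall>z\<in>T. s (end_over z) = s (end_under z)}"
proof -
  have 1: "q ^ regions T = card {s \<in> V \<rightarrow>\<^sub>E {..<q}. \<forall>x\<in>V. \<forall>y\<in>V. conn (region_rel T) x y \<longrightarrow> s x = s y}"
    using card_const_functions[OF finite_V, of "{..<q}" "region_rel T"] by (simp only: regions_def card_lessThan)
  have eq: "(\<forall>x\<in>V. \<forall>y\<in>V. conn (region_rel T) x y \<longrightarrow> s x = s y) \<longleftrightarrow> (\<forall>(x, y)\<in>region_rel T. s x = s y)" for s :: "nat \<times> nat \<Rightarrow> nat"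
    by (rule const_conn_iff[OF region_rel_V[OF assms]])
  have "{s \<in> V \<rightarrow>\<^sub>E {..<q}. \<forall>x\<in>V. \<forall>y\<in>V. conn (region_rel T) x y \<longrightarrow> s x = s y} =
      {s \<in> colourings q. \<forall>z\<in>T. s (end_over z) = s (end_under z)}"
    unfolding eq colourings_def by (auto simp: region_rel_def)
  then show ?thesis using 1 by (simp only:)
qed

text \<open>By \<open>loops_regions\<close> the loop exponent is twice the number of regions plus
  \<open>card T\<close>, up to a constant. So \<open>q ^ regions T\<close> appears, which counts
  colourings agreeing across \<open>T\<close>; exchanging the sums leaves a product over crossings.
  Multiplying by \<open>d ^ (2 * card Cs + 2)\<close> avoids negative exponents.\<close>

theorem spin_bracket_potts:
  assumes "n > 0" and y: "y \<noteq> 0" and d: "d = - (y + inverse y)" "d ^ 2 = of_nat q" and q: "q > 0"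
  shows "spin_bracket y * d ^ (2 * card Cs + 2) =
    d ^ n * (\<Sum>s\<in>colourings q. \<Prod>z\<in>Q. if s (end_over z) = s (end_under z)
       then if type_A z then - (y ^ 2) else - (inverse y ^ 2) else 1)"
proof -
  let ?w = "\<lambda>z. if type_A z then y else inverse y"
  let ?eq = "\<lambda>s z. s (end_over z) = s (end_under z)"
  have X0: "X \<noteq> {}" using assms(1) by (auto simp: X_def)
  have step: "(\<Prod>z\<in>T. ?w z) * d ^ (num_classes X (smoothed T) - 1) * d ^ (2 * card Cs + 2) =
      d ^ n * (\<Sum>s\<in>colourings q. \<Prod>z\<in>T. of_bool (?eq s z) * (?w z * d))" if T: "T \<in> Pow Q" for T
  proof -
    have TQ: "T \<subseteq> Q" using T by simp
    then have fT: "finite T" by (rule finite_subset) simp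
    have pos: "num_classes X (smoothed T) > 0" by (rule num_classes_pos[OF finite_X X0])
    have "d ^ (num_classes X (smoothed T) - 1) * d ^ (2 * card Cs + 2) =
        d ^ (num_classes X (smoothed T) + (2 * card Cs + 1))"
      using pos by (simp flip: power_add power_Suc)
    also have "\<dots> = d ^ n * (d ^ card T * of_nat (q ^ regions T))"
      unfolding loops_regions(1)[OF assms(1) TQ] by (simp add: power_add power_mult d(2) mult_ac)
    finally have 1: "d ^ (num_classes X (smoothed T) - 1) * d ^ (2 * card Cs + 2) =
        d ^ n * (d ^ card T * of_nat (q ^ regions T))" .
    have "of_nat (q ^ regions T) = (\<Sum>s\<in>colourings q. of_bool (\<forall>z\<in>T. ?eq s z) :: complex)"
      unfolding power_regions[OF TQ] by (simp add: of_bool_def sum.If_cases Int_def)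
    also have "\<dots> = (\<Sum>s\<in>colourings q. \<Prod>z\<in>T. of_bool (?eq s z))"
    proof (intro sum.cong refl)
      fix s show "of_bool (\<forall>z\<in>T. ?eq s z) = (\<Prod>z\<in>T. of_bool (?eq s z) :: complex)"
        using fT by (induction T rule: finite_induct) auto
    qed
    finally have 2: "of_nat (q ^ regions T) = (\<Sum>s\<in>colourings q. \<Prod>z\<in>T. of_bool (?eq s z) :: complex)" .
    have "(\<Prod>z\<in>T. ?w z) * d ^ (num_classes X (smoothed T) - 1) * d ^ (2 * card Cs + 2) =
        d ^ n * ((\<Prod>z\<in>T. ?w z) * d ^ card T * (\<Sum>s\<in>colourings q. \<Prod>z\<in>T. of_bool (?eq s z)))"
      using 1 2 by (simp add: mult_ac)
    also have "(\<Prod>z\<in>T. ?w z) * d ^ card T = (\<Prod>z\<in>T. ?w z * d)" by (simp add: prod.distrib)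
    finally show ?thesis by (simp add: sum_distrib_left prod.distrib mult_ac)
  qed
  have "spin_bracket y * d ^ (2 * card Cs + 2) =
      (\<Sum>T\<in>Pow Q. d ^ n * (\<Sum>s\<in>colourings q. \<Prod>z\<in>T. of_bool (?eq s z) * (?w z * d)))"
    unfolding spin_bracket_def sum_distrib_right d(1)[symmetric] by (intro sum.cong refl step)
  also have "\<dots> = d ^ n * (\<Sum>s\<in>colourings q. \<Sum>T\<in>Pow Q. \<Prod>z\<in>T. of_bool (?eq s z) * (?w z * d))"
    by (subst sum.swap) (simp add: sum_distrib_left)
  also have "\<dots> = d ^ n * (\<Sum>s\<in>colourings q. \<Prod>z\<in>Q. 1 + of_bool (?eq s z) * (?w z * d))"
    by (simp add: prod_one_plus)
  \<comment> \<open>Between equal colours the factor is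
    \<open>1 - y * (y + inverse y) = - y ^ 2\<close>, and likewise with
    \<open>inverse y\<close>.\<close>
  also have "(\<lambda>s z. 1 + of_bool (?eq s z) * (?w z * d)) =
     (\<lambda>s z. if ?eq s z then if type_A z then - (y ^ 2) else - (inverse y ^ 2) else 1)"
    using y by (auto simp: fun_eq_iff d(1) power2_eq_square field_simps)
  finally show ?thesis .
qed

end

text \<open>For \<open>Y\<close> of order dividing \<open>q\<^sup>2\<close> as below, \<open>Y\<close> to the indicator of \<open>d = 0\<close> is \<open>Y\<close> times a Gaussian in
  \<open>d\<close>, and the four Gaussian weights at a crossing of two bands combine to a bilinear one.\<close>

lemma crossing_weight:
  fixes Y :: complex and a a' b b' :: nat
  assumes "Y \<noteq> 0" "q = 1 \<and> e = 1 \<or> q = 2 \<and> Y ^ 4 = 1 \<and> e = Y powi (-2) \<or> q = 3 \<and> Y ^ 3 = 1 \<and> e = Y powi (-2)"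
    and "a < q" "a' < q" "b < q" "b' < q"
  shows "(if a = b' then Y else 1) * (if a' = b then Y else 1) *
      (if a = b then inverse Y else 1) * (if a' = b' then inverse Y else 1) =
    e powi ((int a' - int a) * (int b' - int b))"
proof (cases "q = 1")
  case True
  then show ?thesis using assms by (auto simp: field_simps)
next
  case False
  then have e: "e = Y powi (-2)" and q: "q = 2 \<and> Y ^ 4 = 1 \<or> q = 3 \<and> Y ^ 3 = 1" using assms by auto
  \<comment> \<open>The difference has square 0 or 1, or 4 if \<open>q = 3\<close>; in the last case
    \<open>Y ^ 4 = Y\<close> makes 4 act like 1.\<close>
  have ind: "(if i = j then Y else 1) = Y * Y powi (- ((int i - int j) ^ 2))"
    "(if i = j then inverse Y else 1) = inverse Y * Y powi ((int i - int j) ^ 2)"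
    if "i < q" "j < q" for i j
  proof -
    have "int i - int j = 0 \<or> int i - int j = 1 \<or> int i - int j = -1 \<or>
        (q = 3 \<and> (int i - int j = 2 \<or> int i - int j = -2))"
      using that q by auto
    moreover have "Y * Y powi (-4) = 1" "inverse Y * Y powi 4 = 1" if "q = 3"
    proof -
      have "Y ^ 4 = Y" using that q by (simp add: power4_eq_xxxx power3_eq_cube)
      then show "Y * Y powi (-4) = 1" "inverse Y * Y powi 4 = 1"
        using assms(1) by (simp_all add: power_int_minus power_int_numeral)
    qed
    ultimately show "(if i = j then Y else 1) = Y * Y powi (- ((int i - int j) ^ 2))"
      "(if i = j then inverse Y else 1) = inverse Y * Y powi ((int i - int j) ^ 2)"
      using assms(1) by (auto simp: power_int_minus)
  qed
  have "(if a = b' then Y else 1) * (if a' = b then Y else 1) *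
      (if a = b then inverse Y else 1) * (if a' = b' then inverse Y else 1) =
      Y powi (- ((int a - int b') ^ 2)) * Y powi (- ((int a' - int b) ^ 2)) *
      Y powi ((int a - int b) ^ 2) * Y powi ((int a' - int b') ^ 2)"
    unfolding ind(1)[OF assms(3,6)] ind(1)[OF assms(4,5)] ind(2)[OF assms(3,5)] ind(2)[OF assms(4,6)]
    using assms(1) by (simp add: field_simps)
  also have "\<dots> = Y powi (- ((int a - int b') ^ 2) + (- ((int a' - int b) ^ 2)) + (int a - int b) ^ 2 + (int a' - int b') ^ 2)"
    by (simp only: power_int_add[OF disjI1[OF assms(1)]])
  \<comment> \<open>All squares of single colours cancel, and only the mixed terms remain.\<close>
  also have "- ((int a - int b') ^ 2) + (- ((int a' - int b) ^ 2)) + (int a - int b) ^ 2 + (int a' - int b') ^ 2 =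
      -2 * ((int a' - int a) * (int b' - int b))"
    by (simp add: power2_eq_square algebra_simps)
  also have "Y powi (-2 * ((int a' - int a) * (int b' - int b))) = e powi ((int a' - int a) * (int b' - int b))"
    unfolding e by (rule power_int_mult)
  finally show ?thesis .
qed

context surface begin

lemma prod_Q:
  fixes f :: "nat \<times> bool \<times> bool \<Rightarrow> 'a :: comm_monoid_mult"
  shows "(\<Prod>z\<in>Q. f z) = (\<Prod>c\<in>Cs. f (c, True, True) * f (c, True, False) * f (c, False, True) * f (c, False, False))"
proof -
  have "(\<Prod>z\<in>Q. f z) = (\<Prod>c\<in>Cs. \<Prod>z\<in>UNIV. f (c, z))"
    unfolding Q_def UNIV_Times_UNIV by (simp add: prod.cartesian_product)
  also have "(UNIV :: (bool \<times> bool) set) = {(True, True), (True, False), (False, True), (False, False)}" by auto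
  finally show ?thesis by (simp add: mult.assoc)
qed

definition jump :: "((nat \<times> nat) \<Rightarrow> nat) \<Rightarrow> nat \<times> nat \<Rightarrow> int" where
  "jump s p = int (s (fst p, Suc (snd p))) - int (s p)"

text \<open>With \<open>Y = - (y ^ 2)\<close>, type A corners have weight \<open>Y\<close> and the
  others its inverse. At a negative crossing \<open>b\<close> and \<open>b'\<close> exchange roles,
  which inverts the combined weight.\<close>

lemma potts_weight:
  fixes y e :: complex
  assumes "y \<noteq> 0" and q: "q = 1 \<and> e = 1 \<or> q = 2 \<and> y ^ 8 = 1 \<and> e = y powi (-4) \<or> q = 3 \<and> y ^ 6 = -1 \<and> e = y powi (-4)"
    and s: "s \<in> colourings q"
  shows "(\<Prod>z\<in>Q. if s (end_over z) = s (end_under z)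
       then if type_A z then - (y ^ 2) else - (inverse y ^ 2) else 1) =
    (\<Prod>c\<in>Cs. e powi (sign (sg c) * (jump s (over_loc c) * jump s (under_loc c))))"
proof -
  let ?f = "\<lambda>z. if s (end_over z) = s (end_under z) then if type_A z then - (y ^ 2) else - (inverse y ^ 2) else 1"
  have "?f (c, True, True) * ?f (c, True, False) * ?f (c, False, True) * ?f (c, False, False) =
      e powi (sign (sg c) * (jump s (over_loc c) * jump s (under_loc c)))" if c: "c \<in> Cs" for c
  proof -
  let ?Y = "- (y ^ 2)"
  have inv: "- (inverse y ^ 2) = inverse ?Y" by (simp add: power2_eq_square inverse_minus_eq inverse_mult_distrib)
  have in_V: "(fst p, snd p) \<in> V \<and> (fst p, Suc (snd p)) \<in> V" if "p = over_loc c \<or> p = under_loc c" for p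
    using that core_loc[OF c] by (auto simp: V_def)
  have s_less: "s p < q" if "p \<in> V" for p using s that by (auto simp: colourings_def)
  let ?a = "s (over_loc c)" and ?a' = "s (fst (over_loc c), Suc (snd (over_loc c)))"
  let ?b = "s (under_loc c)" and ?b' = "s (fst (under_loc c), Suc (snd (under_loc c)))"
  have less: "?a < q" "?a' < q" "?b < q" "?b' < q" using s_less in_V by (metis prod.collapse)+
  have Y0: "?Y \<noteq> 0" using assms(1) by simp
  have "?Y powi (-2) = y powi (-4)"
    by (simp add: power_int_minus power_int_numeral flip: power_mult)
  moreover have "?Y ^ 4 = y ^ 8" "?Y ^ 3 = - (y ^ 6)" by (simp_all flip: power_mult)
  ultimately have qq: "q = 1 \<and> e = 1 \<or> q = 2 \<and> ?Y ^ 4 = 1 \<and> e = ?Y powi (-2) \<or> q = 3 \<and> ?Y ^ 3 = 1 \<and> e = ?Y powi (-2)"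
    using q by auto
  note w = crossing_weight[OF Y0 qq]
  let ?P = "(if ?a = ?b' then ?Y else 1) * (if ?a' = ?b then ?Y else 1) *
      (if ?a = ?b then inverse ?Y else 1) * (if ?a' = ?b' then inverse ?Y else 1)"
  let ?N = "(if ?a = ?b then ?Y else 1) * (if ?a' = ?b' then ?Y else 1) *
      (if ?a = ?b' then inverse ?Y else 1) * (if ?a' = ?b then inverse ?Y else 1)"
  have P: "?P = e powi (jump s (over_loc c) * jump s (under_loc c))"
    using w[OF less(1,2,3,4)] by (simp add: jump_def)
  have N: "?N = e powi (- (jump s (over_loc c) * jump s (under_loc c)))"
    using w[OF less(1,2,4,3)] by (simp add: jump_def algebra_simps)
  show ?thesis
  proof (cases "sg c")
    case True
    have "?f (c, True, True) = (if ?a' = ?b then ?Y else 1)" "?f (c, True, False) = (if ?a = ?b then inverse ?Y else 1)"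
      "?f (c, False, True) = (if ?a' = ?b' then inverse ?Y else 1)" "?f (c, False, False) = (if ?a = ?b' then ?Y else 1)"
      unfolding inv using True by (simp_all add: end_over_def end_under_def arm_over_def arm_under_def type_A_def)
    then have "?f (c, True, True) * ?f (c, True, False) * ?f (c, False, True) * ?f (c, False, False) = ?P"
      by (simp only: mult_ac)
    then show ?thesis using P True by (simp only: sign_def if_True mult_1)
  next
    case False
    have "?f (c, True, True) = (if ?a = ?b' then inverse ?Y else 1)" "?f (c, True, False) = (if ?a' = ?b' then ?Y else 1)"
      "?f (c, False, True) = (if ?a = ?b then ?Y else 1)" "?f (c, False, False) = (if ?a' = ?b then inverse ?Y else 1)"
      unfolding inv using False by (simp_all add: end_over_def end_under_def arm_over_def arm_under_def type_A_def)
    then have "?f (c, True, True) * ?f (c, True, False) * ?f (c, False, True) * ?f (c, False, False) = ?N"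
      by (simp only: mult_ac)
    then show ?thesis using N False by (simp only: sign_def if_False mult_minus1)
  qed
  qed
  then show ?thesis unfolding prod_Q by (intro prod.cong refl)
qed

end

text \<open>Primitivity is expressed by orthogonality of characters, the form in which Fourier
  transforms use it; \<open>q = 1\<close> with \<open>e = 1\<close> is included.\<close>

definition primitive_root :: "nat \<Rightarrow> complex \<Rightarrow> bool" where
  "primitive_root q e \<longleftrightarrow> q > 0 \<and> e ^ q = 1 \<and>
     (\<forall>m :: int. (\<Sum>t<q. e powi (int t * m)) = (if int q dvd m then of_nat q else 0))"

lemma primitive_root_nonzero: "primitive_root q e \<Longrightarrow> e \<noteq> 0"
  by (auto simp: primitive_root_def power_0_left)

lemma primitive_root_cong:
  assumes "primitive_root q e" "m mod int q = m' mod int q"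
  shows "e powi m = e powi m'"
proof -
  have e: "e \<noteq> 0" "e powi int q = 1"
    using primitive_root_nonzero[OF assms(1)] assms(1) by (auto simp: primitive_root_def)
  have "e powi m = e powi (m mod int q)" for m
  proof -
    have "e powi m = e powi (int q * (m div int q) + m mod int q)" by simp
    also have "\<dots> = (e powi int q) powi (m div int q) * e powi (m mod int q)"
      by (simp only: power_int_add[OF disjI1, OF e(1)] power_int_mult)
    finally show ?thesis using e(2) by simp
  qed
  then show ?thesis using assms(2) by metis
qed

lemma power_int_sum:
  fixes e :: complex
  assumes "e \<noteq> 0"
  shows "e powi (\<Sum>i\<in>A. f i) = (\<Prod>i\<in>A. e powi f i)"
  by (induction A rule: infinite_finite_induct) (simp_all add: power_int_add assms)

text \<open>The sum over \<open>\<beta>\<close> is a character sum that vanishes except at one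
  \<open>\<alpha>\<close>. This is the Fourier transform of a hyperbolic form.\<close>

lemma gauss_pair_sum:
  assumes "primitive_root q e" "\<epsilon> = 1 \<or> \<epsilon> = -1"
  shows "(\<Sum>(\<alpha>, \<beta>)\<in>{..<q} \<times> {..<q}. e powi (\<epsilon> * (int \<alpha> * int \<beta>) + x * int \<alpha> + x' * int \<beta>)) =
    of_nat q * e powi (- (\<epsilon> * (x * x')))"
proof -
  note e0 = primitive_root_nonzero[OF assms(1)]
  have q: "q > 0" and orth: "(\<Sum>t<q. e powi (int t * m)) = (if int q dvd m then of_nat q else 0)" for m
    using assms(1) by (auto simp: primitive_root_def)
  \<comment> \<open>The solution of \<open>\<epsilon> * \<alpha> + x' = 0\<close> modulo
    \<open>q\<close>, as \<open>\<epsilon>\<close> is its own inverse.\<close>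
  define \<alpha>0 where "\<alpha>0 = nat (- (\<epsilon> * x') mod int q)"
  have a0: "int \<alpha>0 = - (\<epsilon> * x') mod int q" "\<alpha>0 < q"
    using q by (auto simp: \<alpha>0_def nat_less_iff)
  have ee: "\<epsilon> * \<epsilon> = 1" using assms(2) by auto
  have dvd_iff: "int q dvd (\<epsilon> * int \<alpha> + x') \<longleftrightarrow> \<alpha> = \<alpha>0" if "\<alpha> < q" for \<alpha>
  proof -
    have "int q dvd (\<epsilon> * int \<alpha> + x') \<longleftrightarrow> int q dvd (\<epsilon> * (\<epsilon> * int \<alpha> + x'))"
      using assms(2) by (auto simp: dvd_diff_commute)
    also have "\<epsilon> * (\<epsilon> * int \<alpha> + x') = int \<alpha> - (- (\<epsilon> * x'))" using ee by (simp add: algebra_simps flip: mult.assoc)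
    also have "int q dvd \<dots> \<longleftrightarrow> int \<alpha> mod int q = - (\<epsilon> * x') mod int q" by (rule mod_eq_dvd_iff[symmetric])
    also have "\<dots> \<longleftrightarrow> \<alpha> = \<alpha>0" using that a0 by (simp flip: a0(1) of_nat_mod)
    finally show ?thesis .
  qed
  have "(\<Sum>(\<alpha>, \<beta>)\<in>{..<q} \<times> {..<q}. e powi (\<epsilon> * (int \<alpha> * int \<beta>) + x * int \<alpha> + x' * int \<beta>)) =
      (\<Sum>\<alpha><q. \<Sum>\<beta><q. e powi (x * int \<alpha>) * e powi (int \<beta> * (\<epsilon> * int \<alpha> + x')))"
    unfolding sum.cartesian_product[symmetric]
    by (intro sum.cong refl) (simp add: e0 flip: power_int_add, simp add: algebra_simps)
  also have "\<dots> = (\<Sum>\<alpha><q. if \<alpha> = \<alpha>0 then e powi (x * int \<alpha>) * of_nat q else 0)"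
    by (intro sum.cong refl) (simp add: orth dvd_iff flip: sum_distrib_left)
  also have "\<dots> = e powi (x * int \<alpha>0) * of_nat q" using a0(2) by simp
  also have "e powi (x * int \<alpha>0) = e powi (- (\<epsilon> * (x * x')))"
  proof (rule primitive_root_cong[OF assms(1)])
    have "x * int \<alpha>0 mod int q = x * (- (\<epsilon> * x')) mod int q" unfolding a0(1) by (rule mod_mult_right_eq)
    then show "x * int \<alpha>0 mod int q = - (\<epsilon> * (x * x')) mod int q" by (simp add: mult_ac)
  qed
  finally show ?thesis by (simp add: mult.commute)
qed

text \<open>The minus sign is the one produced by the Fourier transform in
  \<open>gauss_pair_sum\<close>.\<close>

definition gauss_sum :: "nat \<Rightarrow> complex \<Rightarrow> nat \<Rightarrow> int mat \<Rightarrow> complex" where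
  "gauss_sum q e m W = (\<Sum>x\<in>{..<m} \<rightarrow>\<^sub>E {..<q}.
     e powi (- (\<Sum>i<m. \<Sum>j<m. W $$ (i, j) * (int (x i) * int (x j)))))"

section \<open>Fourier transform from colourings to the Seifert form\<close>

context surface begin

definition Ent :: "(nat \<times> nat) set" where "Ent = (SIGMA i:{..<n}. {..<len i})"

lemma finite_Ent [simp]: "finite Ent"
  by (simp add: Ent_def)

lemma mem_Sigma_iff_fst: "p \<in> Sigma A B \<longleftrightarrow> fst p \<in> A \<and> snd p \<in> B (fst p)"
  by (cases p) auto

lemma loc_Ent: "c \<in> Cs \<Longrightarrow> over_loc c \<in> Ent" "c \<in> Cs \<Longrightarrow> under_loc c \<in> Ent"
  using core_loc[of c] by (simp_all add: Ent_def mem_Sigma_iff_fst)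

text \<open>Jumps modulo \<open>q\<close> of colourings: both ends of a core have the colour of the
  disc, so the jumps along it add up to 0.\<close>

definition flows :: "nat \<Rightarrow> ((nat \<times> nat) \<Rightarrow> nat) set" where
  "flows q = {a \<in> Ent \<rightarrow>\<^sub>E {..<q}. \<forall>i<n. int q dvd (\<Sum>k<len i. int (a (i, k)))}"

text \<open>A colouring is recovered from the colour of the disc and its jumps by partial sums. The
  weights see only the jumps, so the colour of the disc contributes the factor
  \<open>q\<close>.\<close>

lemma sum_colourings:
  assumes "n > 0" and e: "primitive_root q e"
  shows "(\<Sum>s\<in>colourings q. \<Prod>c\<in>Cs. e powi (sign (sg c) * (jump s (over_loc c) * jump s (under_loc c)))) =
    of_nat q * (\<Sum>a\<in>flows q. \<Prod>c\<in>Cs. e powi (sign (sg c) * (int (a (over_loc c)) * int (a (under_loc c)))))"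
proof -
  have q: "q > 0" using e by (simp add: primitive_root_def)
  define I where "I s = (s (0, 0), restrict (\<lambda>p. nat (jump s p mod int q)) Ent)" for s :: "nat \<times> nat \<Rightarrow> nat"
  define J where "J ta = restrict (\<lambda>(i, k). (fst ta + (\<Sum>k'<k. snd ta (i, k'))) mod q) V" for ta :: "nat \<times> (nat \<times> nat \<Rightarrow> nat)"
  have V0: "(0, 0) \<in> V" using assms(1) by (simp add: V_def)
  have disc: "s (i, 0) = s (0, 0)" "s (i, len i) = s (0, 0)" if "s \<in> colourings q" "i < n" for s i
    using that by (auto simp: colourings_def disc_rel_def)
  have less: "s p < q" if "s \<in> colourings q" "p \<in> V" for s p using that by (auto simp: colourings_def)
  have tele: "(\<Sum>k'<k. jump s (i, k')) = int (s (i, k)) - int (s (i, 0))" for s i k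
    by (induction k) (simp_all add: jump_def)
  have Ival: "int (snd (I s) p) = jump s p mod int q" if "p \<in> Ent" for s p
    using that q by (simp add: I_def)
  have Isum: "(\<Sum>k'<k. int (snd (I s) (i, k'))) mod int q = (int (s (i, k)) - int (s (i, 0))) mod int q"
    if "i < n" "k \<le> len i" for s i k
  proof -
    have "(\<Sum>k'<k. int (snd (I s) (i, k'))) = (\<Sum>k'<k. jump s (i, k') mod int q)"
      using that by (intro sum.cong refl Ival) (auto simp: Ent_def)
    then show ?thesis by (simp add: mod_sum_eq tele)
  qed
  have JI: "J (I s) = s" if s: "s \<in> colourings q" for s
  proof
    fix v show "J (I s) v = s v"
    proof (cases "v \<in> V")
      case True
      then obtain i k where v: "v = (i, k)" "i < n" "k \<le> len i" by (auto simp: V_def)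
      have "int (J (I s) v) = (int (s (0, 0)) + (\<Sum>k'<k. int (snd (I s) (i, k')))) mod int q"
        using True v by (simp add: J_def zmod_int) (simp add: I_def)
      also have "\<dots> = (int (s (0, 0)) + (\<Sum>k'<k. int (snd (I s) (i, k'))) mod int q) mod int q"
        by (simp add: mod_add_right_eq)
      also have "\<dots> = int (s (i, k)) mod int q"
        unfolding Isum[OF v(2,3)] mod_add_right_eq using disc[OF s v(2)] by simp
      finally show ?thesis using less[OF s True] v by simp
    next
      case False
      then have "s v = undefined" using s by (cases v) (auto simp: colourings_def PiE_def extensional_def)
      then show ?thesis using False by (simp add: J_def)
    qed
  qed
  have Jval: "J (t, a) (i, k) = (t + (\<Sum>k'<k. a (i, k'))) mod q" if "i < n" "k \<le> len i" for t a i k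
    using that by (simp add: J_def V_def)
  have jumpJ: "jump (J (t, a)) p mod int q = int (a p) mod int q" if "p \<in> Ent" for t a p
  proof -
    obtain i k where p: "p = (i, k)" "i < n" "k < len i" using \<open>p \<in> Ent\<close> by (auto simp: Ent_def)
    have "jump (J (t, a)) p mod int q = ((int t + (\<Sum>k'<Suc k. int (a (i, k')))) mod int q -
        (int t + (\<Sum>k'<k. int (a (i, k')))) mod int q) mod int q"
      using p by (simp add: jump_def Jval zmod_int del: sum.lessThan_Suc)
    also have "\<dots> = int (a p) mod int q" unfolding mod_diff_eq using p by simp
    finally show ?thesis .
  qed
  have "(\<Sum>s\<in>colourings q. \<Prod>c\<in>Cs. e powi (sign (sg c) * (jump s (over_loc c) * jump s (under_loc c)))) =
    (\<Sum>ta\<in>{..<q} \<times> flows q. \<Prod>c\<in>Cs. e powi (sign (sg c) * (int (snd ta (over_loc c)) * int (snd ta (under_loc c)))))"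
  proof (rule sum.reindex_bij_witness[of _ J I])
    fix s assume s: "s \<in> colourings q"
    show "J (I s) = s" by (rule JI[OF s])
    have "snd (I s) \<in> Ent \<rightarrow>\<^sub>E {..<q}" using q by (auto simp: I_def nat_less_iff)
    moreover have "int q dvd (\<Sum>k<len i. int (snd (I s) (i, k)))" if "i < n" for i
      using Isum[OF that, of "len i" s] disc[OF s that] by (simp add: mod_0_imp_dvd)
    moreover have "fst (I s) < q" using less[OF s V0] by (simp add: I_def)
    ultimately have "fst (I s) \<in> {..<q} \<and> snd (I s) \<in> flows q" by (simp add: flows_def)
    then show "I s \<in> {..<q} \<times> flows q" by (simp add: mem_Times_iff)
    show "(\<Prod>c\<in>Cs. e powi (sign (sg c) * (int (snd (I s) (over_loc c)) * int (snd (I s) (under_loc c))))) =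
        (\<Prod>c\<in>Cs. e powi (sign (sg c) * (jump s (over_loc c) * jump s (under_loc c))))"
    proof (intro prod.cong refl primitive_root_cong[OF e])
      fix c assume c: "c \<in> Cs"
      show "sign (sg c) * (int (snd (I s) (over_loc c)) * int (snd (I s) (under_loc c))) mod int q =
          sign (sg c) * (jump s (over_loc c) * jump s (under_loc c)) mod int q"
        unfolding Ival[OF loc_Ent(1)[OF c]] Ival[OF loc_Ent(2)[OF c]]
        by (intro mod_mult_cong refl) simp_all
    qed
  next
    fix ta assume ta': "ta \<in> {..<q} \<times> flows q"
    obtain t a where ta: "ta = (t, a)" by (cases ta)
    have t: "t < q" and a: "a \<in> flows q" using ta' ta by auto
    have "I (J (t, a)) = (t, a)"
    proof -
      have "J (t, a) (0, 0) = t" using Jval[of 0 0] assms(1) t by simp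
      moreover have "restrict (\<lambda>p. nat (jump (J (t, a)) p mod int q)) Ent = a"
      proof
        fix p show "restrict (\<lambda>p. nat (jump (J (t, a)) p mod int q)) Ent p = a p"
        proof (cases "p \<in> Ent")
          case True
          then have "a p < q" using a by (auto simp: flows_def)
          then show ?thesis using jumpJ[OF True, of t a] True by simp
        next
          case False
          then have "a p = undefined" using a by (cases p) (auto simp: flows_def PiE_def extensional_def)
          then show ?thesis using False by simp
        qed
      qed
      ultimately show ?thesis by (simp add: I_def)
    qed
    then show "I (J ta) = ta" by (simp add: ta)
    show "J ta \<in> colourings q"
    proof -
      have "J (t, a) \<in> V \<rightarrow>\<^sub>E {..<q}" using q by (auto simp: J_def)
      moreover have "J (t, a) (i, 0) = J (t, a) (0, 0) \<and> J (t, a) (i, len i) = J (t, a) (0, 0)" if "i < n" for i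
      proof -
        have "int q dvd int (\<Sum>k<len i. a (i, k))" using a that by (simp add: flows_def)
        then have "q dvd (\<Sum>k<len i. a (i, k))" by (simp only: int_dvd_int_iff)
        then have "(t + (\<Sum>k<len i. a (i, k))) mod q = t mod q" by (auto elim!: dvdE)
        then show ?thesis using that assms(1) by (simp add: Jval)
      qed
      ultimately show ?thesis unfolding colourings_def ta by (auto simp: disc_rel_def)
    qed
  qed
  also have "\<dots> = (\<Sum>t<q. \<Sum>a\<in>flows q. \<Prod>c\<in>Cs. e powi (sign (sg c) * (int (a (over_loc c)) * int (a (under_loc c)))))"
    unfolding sum.cartesian_product by (intro sum.cong refl) auto
  finally show ?thesis by simp
qed

text \<open>The entries are the over-passages and the under-passages of the crossings, so a function
  on entries is an independent choice of a pair at each crossing.\<close>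

lemma sum_Ent_functions:
  fixes f :: "nat \<Rightarrow> nat \<Rightarrow> nat \<Rightarrow> complex"
  shows "(\<Sum>a\<in>Ent \<rightarrow>\<^sub>E {..<q}. \<Prod>c\<in>Cs. f c (a (over_loc c)) (a (under_loc c))) =
    (\<Prod>c\<in>Cs. \<Sum>(\<alpha>, \<beta>)\<in>{..<q} \<times> {..<q}. f c \<alpha> \<beta>)"
proof -
  define I where "I a = restrict (\<lambda>c. (a (over_loc c), a (under_loc c))) Cs" for a :: "nat \<times> nat \<Rightarrow> nat"
  define J where "J h = restrict (\<lambda>(i, k). case cores F ! i ! k of (c, ov, s) \<Rightarrow> if ov then fst (h c) else snd (h c)) Ent"
    for h :: "nat \<Rightarrow> nat \<times> nat"
  have "(\<Prod>c\<in>Cs. \<Sum>(\<alpha>, \<beta>)\<in>{..<q} \<times> {..<q}. f c \<alpha> \<beta>) =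
      (\<Sum>h\<in>Cs \<rightarrow>\<^sub>E ({..<q} \<times> {..<q}). \<Prod>c\<in>Cs. f c (fst (h c)) (snd (h c)))"
    by (subst prod_sum_PiE) (simp_all add: case_prod_unfold)
  also have "\<dots> = (\<Sum>a\<in>Ent \<rightarrow>\<^sub>E {..<q}. \<Prod>c\<in>Cs. f c (a (over_loc c)) (a (under_loc c)))"
  proof (rule sum.reindex_bij_witness[of _ I J])
    fix h assume h: "h \<in> Cs \<rightarrow>\<^sub>E ({..<q} \<times> {..<q})"
    have Jover: "J h (over_loc c) = fst (h c)" "J h (under_loc c) = snd (h c)" if "c \<in> Cs" for c
      using core_loc[OF that] loc_Ent[OF that] by (simp_all add: J_def split_beta)
    show "I (J h) = h"
      using Jover h by (auto simp: I_def fun_eq_iff PiE_def extensional_def)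
    show "J h \<in> Ent \<rightarrow>\<^sub>E {..<q}"
    proof (rule PiE_I)
      fix p assume "p \<in> Ent"
      then obtain i k where p: "p = (i, k)" "i < n" "k < len i" by (auto simp: Ent_def)
      obtain c ov s where x: "cores F ! i ! k = (c, ov, s)" by (cases "cores F ! i ! k") auto
      then have "h c \<in> {..<q} \<times> {..<q}" using core_entry(1)[OF p(2,3) x] h by auto
      then show "J h p \<in> {..<q}" using \<open>p \<in> Ent\<close> p x by (auto simp: J_def mem_Times_iff)
    qed (simp add: J_def)
    show "(\<Prod>c\<in>Cs. f c (J h (over_loc c)) (J h (under_loc c))) = (\<Prod>c\<in>Cs. f c (fst (h c)) (snd (h c)))"
      using Jover by (intro prod.cong refl) simp
  next
    fix a assume a: "a \<in> Ent \<rightarrow>\<^sub>E {..<q}"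
    show "I a \<in> Cs \<rightarrow>\<^sub>E ({..<q} \<times> {..<q})" using a loc_Ent by (auto simp: I_def)
    show "J (I a) = a"
    proof
      fix p show "J (I a) p = a p"
      proof (cases "p \<in> Ent")
        case True
        then obtain i k where p: "p = (i, k)" "i < n" "k < len i" by (auto simp: Ent_def)
        obtain c ov s where x: "cores F ! i ! k = (c, ov, s)" by (cases "cores F ! i ! k") auto
        note ce = core_entry[OF p(2,3) x]
        have loc: "(if ov then over_loc c else under_loc c) = p"
          using ce(3) unfolding ce(2) over_loc_def under_loc_def p by (cases ov) simp_all
        have "J (I a) p = (if ov then fst (I a c) else snd (I a c))"
          unfolding J_def restrict_apply'[OF True] by (simp add: p x)
        also have "\<dots> = a (if ov then over_loc c else under_loc c)" using ce(1) by (simp add: I_def)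
        finally show ?thesis unfolding loc .
      next
        case False
        then show ?thesis using a by (cases p) (auto simp: J_def PiE_def extensional_def)
      qed
    qed
  qed
  finally show ?thesis by simp
qed

lemma seifert_matrix_entry:
  assumes "i < n" "j < n"
  shows "core_seifert_matrix F $$ (i, j) = (\<Sum>c\<in>Cs. if fst (over_loc c) = i \<and> fst (under_loc c) = j then sign (sg c) else 0)"
proof -
  define g where "g p = (if fst p = i then case cores F ! fst p ! snd p of (c, ov, s) \<Rightarrow>
      if ov \<and> (c, False, s) \<in> set (cores F ! j) then sign s else 0 else 0)" for p
  have "core_seifert_matrix F $$ (i, j) = (\<Sum>k<len i. g (i, k))"
    using assms unfolding core_seifert_matrix_def n_def
    by (simp add: sum_list_sum_nth g_def len_def atLeast0LessThan)
  also have "\<dots> = (\<Sum>i'<n. \<Sum>k<len i'. g (i', k))"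
  proof -
    have 0: "g (i', k) = 0" if "i' \<noteq> i" for i' k using that unfolding g_def by simp
    have "(\<Sum>k<len i'. g (i', k)) = (if i' = i then \<Sum>k<len i. g (i, k) else 0)" for i'
      by (cases "i' = i") (simp_all add: 0)
    then have "(\<Sum>i'<n. \<Sum>k<len i'. g (i', k)) = (\<Sum>i'<n. if i' = i then \<Sum>k<len i. g (i, k) else 0)"
      by (rule sum.cong[OF refl])
    also have "\<dots> = (\<Sum>k<len i. g (i, k))" by (subst sum.delta) (use assms(1) in simp_all)
    finally show ?thesis by (rule sym)
  qed
  also have "\<dots> = (\<Sum>c\<in>Cs. g (over_loc c) + g (under_loc c))" by (rule sum_core_entries[symmetric])
  also have "\<dots> = (\<Sum>c\<in>Cs. if fst (over_loc c) = i \<and> fst (under_loc c) = j then sign (sg c) else 0)"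
  proof (intro sum.cong refl)
    fix c assume c: "c \<in> Cs"
    have "(c, False, sg c) \<in> set (cores F ! j) \<longleftrightarrow> fst (under_loc c) = j"
    proof
      assume "(c, False, sg c) \<in> set (cores F ! j)"
      then obtain k where "k < len j" "cores F ! j ! k = (c, False, sg c)" by (auto simp: in_set_conv_nth len_def)
      then show "fst (under_loc c) = j" using core_entry(3)[OF assms(2)] by (simp add: under_loc_def)
    next
      assume "fst (under_loc c) = j"
      then show "(c, False, sg c) \<in> set (cores F ! j)"
        using core_loc(5,6)[OF c] nth_mem unfolding len_def by metis
    qed
    moreover have "g (over_loc c) = (if fst (over_loc c) = i \<and> (c, False, sg c) \<in> set (cores F ! j) then sign (sg c) else 0)"
      unfolding g_def core_loc(3)[OF c] by simp
    moreover have "g (under_loc c) = 0" unfolding g_def core_loc(6)[OF c] by simp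
    ultimately show "g (over_loc c) + g (under_loc c) =
        (if fst (over_loc c) = i \<and> fst (under_loc c) = j then sign (sg c) else 0)"
      by simp
  qed
  finally show ?thesis .
qed

lemma seifert_form:
  fixes x :: "nat \<Rightarrow> int"
  shows "(\<Sum>i<n. \<Sum>j<n. core_seifert_matrix F $$ (i, j) * (x i * x j)) =
    (\<Sum>c\<in>Cs. sign (sg c) * (x (fst (over_loc c)) * x (fst (under_loc c))))"
proof -
  have "(\<Sum>i<n. \<Sum>j<n. core_seifert_matrix F $$ (i, j) * (x i * x j)) =
      (\<Sum>i<n. \<Sum>j<n. \<Sum>c\<in>Cs. if fst (over_loc c) = i \<and> fst (under_loc c) = j then sign (sg c) * (x i * x j) else 0)"
    by (intro sum.cong refl) (auto simp: seifert_matrix_entry sum_distrib_right intro!: sum.cong)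
  also have "\<dots> = (\<Sum>i<n. \<Sum>c\<in>Cs. \<Sum>j<n. if fst (over_loc c) = i \<and> fst (under_loc c) = j then sign (sg c) * (x i * x j) else 0)"
    by (intro sum.cong refl sum.swap)
  also have "\<dots> = (\<Sum>c\<in>Cs. \<Sum>i<n. \<Sum>j<n. if fst (over_loc c) = i \<and> fst (under_loc c) = j then sign (sg c) * (x i * x j) else 0)"
    by (rule sum.swap)
  also have "\<dots> = (\<Sum>c\<in>Cs. sign (sg c) * (x (fst (over_loc c)) * x (fst (under_loc c))))"
  proof (intro sum.cong refl)
    fix c assume c: "c \<in> Cs"
    have "(\<Sum>j<n. if fst (over_loc c) = i \<and> fst (under_loc c) = j then sign (sg c) * (x i * x j) else 0) =
        (if fst (over_loc c) = i then sign (sg c) * (x i * x (fst (under_loc c))) else 0)" for i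
      using core_loc(4)[OF c] by (simp add: sum.delta')
    then show "(\<Sum>i<n. \<Sum>j<n. if fst (over_loc c) = i \<and> fst (under_loc c) = j then sign (sg c) * (x i * x j) else 0) =
        sign (sg c) * (x (fst (over_loc c)) * x (fst (under_loc c)))"
      using core_loc(1)[OF c] by (simp add: sum.delta')
  qed
  finally show ?thesis .
qed

text \<open>Once the closing conditions are replaced by character sums, nothing couples different
  crossings, and \<open>gauss_pair_sum\<close> applies at each. The exponents add up to minus the
  Seifert form in the dual variables.\<close>

lemma sum_flows:
  assumes e: "primitive_root q e"
  shows "of_nat q ^ n * (\<Sum>a\<in>flows q. \<Prod>c\<in>Cs. e powi (sign (sg c) * (int (a (over_loc c)) * int (a (under_loc c))))) =
    of_nat q ^ card Cs * gauss_sum q e n (core_seifert_matrix F)"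
proof -
  have q: "q > 0" and orth: "(\<Sum>t<q. e powi (int t * m)) = (if int q dvd m then of_nat q else 0)" for m
    using e by (auto simp: primitive_root_def)
  note e0 = primitive_root_nonzero[OF e]
  let ?w = "\<lambda>a. \<Prod>c\<in>Cs. e powi (sign (sg c) * (int (a (over_loc c)) * int (a (under_loc c))))"
  let ?G = "{..<n} \<rightarrow>\<^sub>E {..<q}"
  \<comment> \<open>Each band has one closing condition, detected by a sum over one dual variable
    \<open>x i\<close>.\<close>
  have flow: "of_nat q ^ n * of_bool (\<forall>i<n. int q dvd (\<Sum>k<len i. int (a (i, k)))) =
      (\<Sum>x\<in>?G. \<Prod>c\<in>Cs. e powi (int (x (fst (over_loc c))) * int (a (over_loc c)) + int (x (fst (under_loc c))) * int (a (under_loc c))))"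
    for a
  proof -
    have "of_nat q ^ n * of_bool (\<forall>i<n. int q dvd (\<Sum>k<len i. int (a (i, k)))) =
        (\<Prod>i<n. if int q dvd (\<Sum>k<len i. int (a (i, k))) then of_nat q else 0 :: complex)"
    proof (cases "\<forall>i<n. int q dvd (\<Sum>k<len i. int (a (i, k)))")
      case True
      then have "(\<Prod>i<n. if int q dvd (\<Sum>k<len i. int (a (i, k))) then of_nat q else 0 :: complex) = (\<Prod>i<n. of_nat q)"
        by (intro prod.cong refl) auto
      then show ?thesis using True by simp
    next
      case False
      then have "(\<Prod>i<n. if int q dvd (\<Sum>k<len i. int (a (i, k))) then of_nat q else 0 :: complex) = 0"
        by (intro prod_zero) auto
      then show ?thesis using False by simp
    qed
    also have "\<dots> = (\<Prod>i<n. \<Sum>t<q. e powi (int t * (\<Sum>k<len i. int (a (i, k)))))"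
      by (simp only: orth)
    also have "\<dots> = (\<Sum>x\<in>?G. \<Prod>i<n. e powi (int (x i) * (\<Sum>k<len i. int (a (i, k)))))"
      by (rule prod_sum_PiE) auto
    also have "\<dots> = (\<Sum>x\<in>?G. e powi (\<Sum>i<n. \<Sum>k<len i. int (x i) * int (a (i, k))))"
      by (simp only: power_int_sum[OF e0] sum_distrib_left)
    also have "\<dots> = (\<Sum>x\<in>?G. e powi (\<Sum>c\<in>Cs. int (x (fst (over_loc c))) * int (a (over_loc c)) + int (x (fst (under_loc c))) * int (a (under_loc c))))"
      using sum_core_entries[of "\<lambda>p. int (x (fst p)) * int (a p)" for x] by simp
    finally show ?thesis by (simp only: power_int_sum[OF e0])
  qed
  have "of_nat q ^ n * (\<Sum>a\<in>flows q. ?w a) =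
      (\<Sum>a\<in>Ent \<rightarrow>\<^sub>E {..<q}. (of_nat q ^ n * of_bool (\<forall>i<n. int q dvd (\<Sum>k<len i. int (a (i, k))))) * ?w a)"
  proof -
    have fin: "finite (Ent \<rightarrow>\<^sub>E {..<q})" by (intro finite_PiE) auto
    have "(\<Sum>a\<in>flows q. ?w a) = (\<Sum>a\<in>Ent \<rightarrow>\<^sub>E {..<q}. if \<forall>i<n. int q dvd (\<Sum>k<len i. int (a (i, k))) then ?w a else 0)"
      unfolding flows_def by (rule sum.inter_filter[OF fin])
    also have "\<dots> = (\<Sum>a\<in>Ent \<rightarrow>\<^sub>E {..<q}. of_bool (\<forall>i<n. int q dvd (\<Sum>k<len i. int (a (i, k)))) * ?w a)"
      by (intro sum.cong refl) simp
    finally show ?thesis by (simp add: sum_distrib_left mult.assoc)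
  qed
  also have "\<dots> = (\<Sum>a\<in>Ent \<rightarrow>\<^sub>E {..<q}. \<Sum>x\<in>?G. \<Prod>c\<in>Cs.
      e powi (sign (sg c) * (int (a (over_loc c)) * int (a (under_loc c))) +
        int (x (fst (over_loc c))) * int (a (over_loc c)) + int (x (fst (under_loc c))) * int (a (under_loc c))))"
    unfolding flow sum_distrib_right
    by (intro sum.cong refl) (simp add: power_int_add e0 mult_ac flip: prod.distrib)
  also have "\<dots> = (\<Sum>x\<in>?G. \<Sum>a\<in>Ent \<rightarrow>\<^sub>E {..<q}. \<Prod>c\<in>Cs.
      e powi (sign (sg c) * (int (a (over_loc c)) * int (a (under_loc c))) +
        int (x (fst (over_loc c))) * int (a (over_loc c)) + int (x (fst (under_loc c))) * int (a (under_loc c))))"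
    by (rule sum.swap)
  also have "\<dots> = (\<Sum>x\<in>?G. \<Prod>c\<in>Cs. \<Sum>(\<alpha>, \<beta>)\<in>{..<q} \<times> {..<q}.
      e powi (sign (sg c) * (int \<alpha> * int \<beta>) + int (x (fst (over_loc c))) * int \<alpha> + int (x (fst (under_loc c))) * int \<beta>))"
    by (intro sum.cong refl sum_Ent_functions)
  also have "\<dots> = (\<Sum>x\<in>?G. \<Prod>c\<in>Cs. of_nat q * e powi (- (sign (sg c) * (int (x (fst (over_loc c))) * int (x (fst (under_loc c)))))))"
    by (intro sum.cong prod.cong refl gauss_pair_sum[OF e]) (simp add: sign_def)
  also have "\<dots> = (\<Sum>x\<in>?G. of_nat q ^ card Cs * e powi (- (\<Sum>c\<in>Cs. sign (sg c) * (int (x (fst (over_loc c))) * int (x (fst (under_loc c)))))))"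
    by (simp add: prod.distrib power_int_sum[OF e0] flip: sum_negf)
  also have "\<dots> = of_nat q ^ card Cs * gauss_sum q e n (core_seifert_matrix F)"
    unfolding gauss_sum_def sum_distrib_left
    using seifert_form[of "\<lambda>i. int (x i)" for x] by (intro sum.cong refl) simp
  finally show ?thesis .
qed

text \<open>As \<open>d ^ 2 = q\<close>, the factors from the Potts model and from the Fourier
  transform are all powers of \<open>q\<close> once both sides are multiplied by
  \<open>d ^ n\<close>, and they cancel.\<close>

theorem spin_bracket_gauss:
  assumes "n > 0" and y: "y \<noteq> 0" and d: "d = - (y + inverse y)" "d ^ 2 = of_nat q"
    and q: "q = 1 \<and> e = 1 \<or> q = 2 \<and> y ^ 8 = 1 \<and> e = y powi (-4) \<or> q = 3 \<and> y ^ 6 = -1 \<and> e = y powi (-4)"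
    and e: "primitive_root q e"
  shows "spin_bracket y * d ^ n = gauss_sum q e n (core_seifert_matrix F)"
proof -
  have q0: "q > 0" using q by auto
  then have d0: "d \<noteq> 0" using d(2) by auto
  let ?c = "card Cs" and ?G = "gauss_sum q e n (core_seifert_matrix F)"
  let ?S = "\<Sum>a\<in>flows q. \<Prod>c\<in>Cs. e powi (sign (sg c) * (int (a (over_loc c)) * int (a (under_loc c))))"
  have "spin_bracket y * d ^ (2 * ?c + 2) = d ^ n * (of_nat q * ?S)"
    unfolding spin_bracket_potts[OF assms(1) y d q0] sum_colourings[OF assms(1) e, symmetric]
    by (simp only: potts_weight[OF y q] cong: sum.cong)
  moreover have "d ^ (2 * ?c + 2) = of_nat q ^ ?c * of_nat q"
    by (simp add: power_add power_mult d(2) flip: power2_eq_square)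
  moreover have "d ^ n * d ^ n = of_nat q ^ n"
    by (simp add: d(2)[symmetric] power_mult_distrib[symmetric] power2_eq_square)
  ultimately have "spin_bracket y * d ^ n * (of_nat q ^ ?c * of_nat q) = of_nat q * (of_nat q ^ n * ?S)"
    by (metis (no_types, lifting) mult.assoc mult.commute)
  also have "\<dots> = ?G * (of_nat q ^ ?c * of_nat q)"
    unfolding sum_flows[OF e] by simp
  finally show ?thesis using q0 by simp
qed

end

section \<open>The matrix-tree theorem\<close>

text \<open>\<open>M\<close> in the upper left corner, the rows \<open>B\<close> below it and
  transposed to its right, and a zero block. For a weighted Laplacian \<open>M\<close>, bordering by
  the incidence vector of an edge plays the part of contracting the edge.\<close>

definition bordered :: "nat \<Rightarrow> (nat \<Rightarrow> nat \<Rightarrow> int) \<Rightarrow> (nat \<Rightarrow> int) list \<Rightarrow> int mat" where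
  "bordered m M B = mat (m + length B) (m + length B) (\<lambda>(i, j).
     if i < m then if j < m then M i j else (B ! (j - m)) i else if j < m then (B ! (i - m)) j else 0)"

definition bordered1 :: "int mat \<Rightarrow> (nat \<Rightarrow> int) \<Rightarrow> (nat \<Rightarrow> int) \<Rightarrow> int \<Rightarrow> int mat" where
  "bordered1 E w a x = mat (Suc (dim_row E)) (Suc (dim_row E)) (\<lambda>(i, j).
     if i < dim_row E then if j < dim_row E then E $$ (i, j) else a i else if j < dim_row E then w j else x)"

lemma bordered1_carrier: "E \<in> carrier_mat N N \<Longrightarrow> bordered1 E w a x \<in> carrier_mat (Suc N) (Suc N)"
  by (simp add: bordered1_def)

text \<open>In the expansion along the last column the cofactors do not involve that column, so one
  \<open>C\<close> serves all \<open>a\<close> and \<open>x\<close>.\<close>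

lemma det_bordered1:
  assumes "E \<in> carrier_mat N N"
  obtains C where "\<And>a x. det (bordered1 E w a x) = (\<Sum>i<N. a i * C i) + x * det E"
proof
  fix a x
  have d: "dim_row E = N" "dim_col E = N" using assms by auto
  have del: "mat_delete (bordered1 E w a x) i N = mat_delete (bordered1 E w (\<lambda>_. 0) 0) i N" if "i \<le> N" for i a x
    by (rule eq_matI) (use that in \<open>auto simp: mat_delete_def bordered1_def d\<close>)
  have last: "mat_delete (bordered1 E w a x) N N = E"
    by (rule eq_matI) (auto simp: mat_delete_def bordered1_def d)
  have "det (bordered1 E w a x) = (\<Sum>i<Suc N. bordered1 E w a x $$ (i, N) * cofactor (bordered1 E w a x) i N)"
    by (rule laplace_expansion_column[OF bordered1_carrier[OF assms]]) simp
  also have "\<dots> = (\<Sum>i<N. a i * ((- 1) ^ (i + N) * det (mat_delete (bordered1 E w (\<lambda>_. 0) 0) i N))) + x * det E"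
  proof -
    have "(\<Sum>i<N. bordered1 E w a x $$ (i, N) * cofactor (bordered1 E w a x) i N) =
        (\<Sum>i<N. a i * ((- 1) ^ (i + N) * det (mat_delete (bordered1 E w (\<lambda>_. 0) 0) i N)))"
    proof (intro sum.cong refl)
      fix i assume "i \<in> {..<N}"
      then have i: "i < N" by simp
      show "bordered1 E w a x $$ (i, N) * cofactor (bordered1 E w a x) i N =
          a i * ((- 1) ^ (i + N) * det (mat_delete (bordered1 E w (\<lambda>_. 0) 0) i N))"
        unfolding cofactor_def del[of i a x, OF less_imp_le[OF i]] using i by (simp add: bordered1_def d)
    qed
    moreover have "bordered1 E w a x $$ (N, N) * cofactor (bordered1 E w a x) N N = x * det E"
      unfolding cofactor_def last by (simp add: bordered1_def d)
    ultimately show ?thesis by simp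
  qed
  finally show "det (bordered1 E w a x) = (\<Sum>i<N. a i * ((- 1) ^ (i + N) * det (mat_delete (bordered1 E w (\<lambda>_. 0) 0) i N))) + x * det E" .
qed

lemma det_rank_one:
  assumes "E \<in> carrier_mat N N"
  shows "det (mat N N (\<lambda>(i, j). E $$ (i, j) + c * w i * w j)) = det E - c * det (bordered1 E w w 0)"
proof -
  have d: "dim_row E = N" "dim_col E = N" using assms by auto
  obtain C where C: "\<And>a x. det (bordered1 E w a x) = (\<Sum>i<N. a i * C i) + x * det E"
    using det_bordered1[OF assms] by metis
  let ?E' = "mat N N (\<lambda>(i, j). E $$ (i, j) + c * w i * w j)"
  \<comment> \<open>Its transpose adds \<open>c * w i\<close> times the last row to row
    \<open>i\<close>. This turns \<open>E\<close> into \<open>?E'\<close> and clears the last column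
    above the corner.\<close>
  let ?U = "bordered1 (1\<^sub>m N) (\<lambda>i. c * w i) (\<lambda>_. 0) 1"
  have z: "det (bordered1 E w (\<lambda>_. 0) 1) = det E" if "E \<in> carrier_mat N N" for E w
    using det_bordered1[OF that, of w] by (metis (no_types, lifting) add_0 mult_1 mult_zero_left sum.neutral)
  have "transpose_mat ?U * bordered1 E w (\<lambda>i. - c * w i) 1 = bordered1 ?E' w (\<lambda>_. 0) 1"
    by (rule eq_matI)
      (auto simp: bordered1_def d scalar_prod_def sum.atLeast0_lessThan_Suc if_distrib[of "\<lambda>x. x * _"] cong: if_cong)
  then have "det ?U * det (bordered1 E w (\<lambda>i. - c * w i) 1) = det ?E'"
    using det_mult[OF transpose_carrier_mat[THEN iffD2, OF bordered1_carrier] bordered1_carrier[OF assms], of "1\<^sub>m N" "\<lambda>i. c * w i" "\<lambda>_. 0" 1 w "\<lambda>i. - c * w i" 1]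
      det_transpose[OF bordered1_carrier, of "1\<^sub>m N" N] z[of ?E'] by simp
  then have "det ?E' = det (bordered1 E w (\<lambda>i. - c * w i) 1)" using z[of "1\<^sub>m N"] by simp
  also have "\<dots> = det E - c * det (bordered1 E w w 0)"
    unfolding C by (simp add: sum_distrib_left sum_negf mult.assoc)
  finally show ?thesis .
qed

lemma bordered_carrier: "bordered m M B \<in> carrier_mat (m + length B) (m + length B)"
  by (simp add: bordered_def)

text \<open>Deletion and contraction: changing the weight of an edge by \<open>c\<close> adds a
  multiple of the determinant in which this edge is contracted.\<close>

lemma det_bordered_rank_one:
  "det (bordered m (\<lambda>i j. M i j + c * v i * v j) B) = det (bordered m M B) - c * det (bordered m M (B @ [v]))"
proof -
  let ?w = "\<lambda>i. if i < m then v i else 0"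
  have "bordered m (\<lambda>i j. M i j + c * v i * v j) B =
      mat (m + length B) (m + length B) (\<lambda>(i, j). bordered m M B $$ (i, j) + c * ?w i * ?w j)"
    by (rule eq_matI) (auto simp: bordered_def)
  moreover have "bordered1 (bordered m M B) ?w ?w 0 = bordered m M (B @ [v])"
    by (rule eq_matI) (auto simp: bordered_def bordered1_def nth_append less_Suc_eq)
  ultimately show ?thesis using det_rank_one[OF bordered_carrier[of m M B], of c ?w] by simp
qed

text \<open>In a nonzero term of the Leibniz formula the permutation would exchange the first
  \<open>m\<close> indices with the border indices.\<close>

lemma det_bordered_zero_neq:
  assumes "length B \<noteq> m"
  shows "det (bordered m (\<lambda>_ _. 0) B) = 0"
proof -
  let ?N = "m + length B" and ?A = "bordered m (\<lambda>_ _. 0) B"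
  have "(\<Prod>i = 0..<?N. ?A $$ (i, p i)) = 0" if p: "p permutes {0..<?N}" for p
  proof (rule ccontr)
    assume "(\<Prod>i = 0..<?N. ?A $$ (i, p i)) \<noteq> 0"
    then have nz: "?A $$ (i, p i) \<noteq> 0" if "i < ?N" for i using that by auto
    have pN: "p i < ?N" if "i < ?N" for i using permutes_in_image[OF p] that by auto
    have "p ` {0..<m} \<subseteq> {m..<?N}"
    proof (rule image_subsetI)
      fix i assume "i \<in> {0..<m}"
      then show "p i \<in> {m..<?N}" using nz[of i] pN[of i] by (auto simp: bordered_def split: if_splits)
    qed
    moreover have "p ` {m..<?N} \<subseteq> {0..<m}"
    proof (rule image_subsetI)
      fix i assume "i \<in> {m..<?N}"
      then show "p i \<in> {0..<m}" using nz[of i] pN[of i] by (auto simp: bordered_def split: if_splits)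
    qed
    moreover have "inj_on p S" for S using permutes_inj[OF p] by (rule inj_on_subset) simp
    ultimately have "card {0..<m} \<le> card {m..<?N}" "card {m..<?N} \<le> card {0..<m}"
      by (metis card_inj_on_le finite_atLeastLessThan)+
    then show False using assms by simp
  qed
  then show ?thesis unfolding det_def'[OF bordered_carrier] by (intro sum.neutral ballI) (simp only: mem_Collect_eq mult_zero_right)
qed

definition coeff_rows :: "nat \<Rightarrow> (nat \<Rightarrow> int) list \<Rightarrow> int mat" where
  "coeff_rows m B = mat (length B) m (\<lambda>(i, j). (B ! i) j)"

lemma coeff_rows_carrier: "coeff_rows m B \<in> carrier_mat (length B) m"
  by (simp add: coeff_rows_def)

lemma bordered_four_block:
  "bordered m M B = four_block_mat (mat m m (\<lambda>(i, j). M i j)) (transpose_mat (coeff_rows m B)) (coeff_rows m B) (0\<^sub>m (length B) (length B))"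
  by (rule eq_matI) (auto simp: bordered_def coeff_rows_def)

text \<open>With an empty core block the matrix is block diagonal, with
  \<open>coeff_rows m B\<close> and its transpose as blocks, times the exchange of the two halves.
  So the sign \<open>\<kappa>\<close> depends on \<open>m\<close> only and is common to all
  trees.\<close>

lemma det_bordered_zero:
  obtains \<kappa> :: int where "\<kappa> ^ 2 = 1"
    "\<And>B. length B = m \<Longrightarrow> det (bordered m (\<lambda>_ _. 0) B) = \<kappa> * det (coeff_rows m B) ^ 2"
proof
  let ?J = "four_block_mat (0\<^sub>m m m) (1\<^sub>m m) (1\<^sub>m m) (0\<^sub>m m m) :: int mat"
  have J: "?J \<in> carrier_mat (m + m) (m + m)" by simp
  have "?J * ?J = four_block_mat (1\<^sub>m m) (0\<^sub>m m m) (0\<^sub>m m m) (1\<^sub>m m)"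
    by (subst mult_four_block_mat[of _ m m _ m _ m _ _ m _ m]) auto
  also have "\<dots> = 1\<^sub>m (m + m)" by (rule eq_matI) auto
  finally show "det ?J ^ 2 = 1" using det_mult[OF J J] by (simp add: power2_eq_square)
  fix B :: "(nat \<Rightarrow> int) list" assume B: "length B = m"
  let ?C = "coeff_rows m B"
  have C: "?C \<in> carrier_mat m m" using coeff_rows_carrier[of m B] B by simp
  have Z: "mat m m (\<lambda>(i, j). 0) = (0\<^sub>m m m :: int mat)" by (rule eq_matI) auto
  let ?D = "four_block_mat (transpose_mat ?C) (0\<^sub>m m m) (0\<^sub>m m m) ?C"
  have D: "?D \<in> carrier_mat (m + m) (m + m)" using C by simp
  have "bordered m (\<lambda>_ _. 0) B = ?D * ?J"
    unfolding bordered_four_block B Z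
    by (subst mult_four_block_mat[of _ m m _ m _ m _ _ m _ m]) (use C in auto)
  then have "det (bordered m (\<lambda>_ _. 0) B) = det ?D * det ?J" using det_mult[OF D J] by simp
  also have "det ?D = det ?C ^ 2"
    using det_four_block_mat_upper_right_zero[of "transpose_mat ?C" m "0\<^sub>m m m" m "0\<^sub>m m m" ?C] C det_transpose[OF C]
    by (simp add: power2_eq_square)
  finally show "det (bordered m (\<lambda>_ _. 0) B) = det ?J * det ?C ^ 2" by simp
qed

text \<open>The signed incidence vector of an edge, 0 for a loop. Evaluated at \<open>j < m\<close>
  with root \<open>m\<close>, it gives a row of the reduced incidence matrix.\<close>

definition inc :: "nat \<times> nat \<Rightarrow> nat \<Rightarrow> int" where
  "inc e j = of_bool (fst e = j) - of_bool (snd e = j)"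

lemma num_classes_1_iff_root:
  assumes "finite X" "r \<in> X"
  shows "num_classes X R = 1 \<longleftrightarrow> (\<forall>x\<in>X. conn R x r)"
proof -
  have "num_classes X R = 1 \<longleftrightarrow> (\<forall>x\<in>X. \<forall>y\<in>X. conn R x y)"
    using assms by (intro num_classes_one_iff) auto
  also have "\<dots> \<longleftrightarrow> (\<forall>x\<in>X. conn R x r)"
    using assms(2) by (meson conn_sym conn_trans)
  finally show ?thesis .
qed

text \<open>In a connected graph a path from \<open>x\<close> to the root writes each unit vector as
  an integral combination of rows, so the matrix is invertible over the integers. Otherwise a
  component without the root gives a kernel vector.\<close>

lemma det_incidence:
  assumes "length es = m" "set es \<subseteq> {..m} \<times> {..m}"
  shows "det (coeff_rows m (map inc es)) ^ 2 = of_bool (num_classes {..m} (set es) = 1)"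
proof -
  let ?R = "set es" and ?C = "coeff_rows m (map inc es)"
  have C: "?C \<in> carrier_mat m m" using coeff_rows_carrier[of m "map inc es"] assms(1) by simp
  have Cij: "?C $$ (i, j) = inc (es ! i) j" if "i < m" "j < m" for i j
    using that assms(1) by (simp add: coeff_rows_def)
  have iff: "num_classes {..m} ?R = 1 \<longleftrightarrow> (\<forall>x\<in>{..m}. conn ?R x m)"
    by (rule num_classes_1_iff_root) auto
  show ?thesis
  proof (cases "num_classes {..m} ?R = 1")
    case True
    \<comment> \<open>The coefficients are the signed multiplicities of edges along a path from
      \<open>x\<close> to \<open>y\<close>.\<close>
    have comb: "\<exists>c. \<forall>j<m. (\<Sum>i<m. c i * inc (es ! i) j) = inc (x, y) j" if "conn ?R x y" for x y
      using that
    proof (induction rule: conn_induct)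
      case refl
      show ?case by (rule exI[of _ "\<lambda>_. 0"]) (simp add: inc_def)
    next
      case (step y z)
      obtain c where c: "\<forall>j<m. (\<Sum>i<m. c i * inc (es ! i) j) = inc (x, y) j" using step by blast
      obtain i0 where i0: "i0 < m" "es ! i0 = (y, z) \<or> es ! i0 = (z, y)"
        using step(2) assms(1) by (auto simp: in_set_conv_nth)
      define \<epsilon> :: int where "\<epsilon> = (if es ! i0 = (y, z) then 1 else -1)"
      have e: "\<epsilon> * inc (es ! i0) j = inc (y, z) j" for j
        using i0(2) by (cases "es ! i0 = (y, z)") (auto simp: \<epsilon>_def inc_def)
      have "(\<Sum>i<m. (c i + (if i = i0 then \<epsilon> else 0)) * inc (es ! i) j) = inc (x, z) j" if "j < m" for j
      proof -
        have "(\<Sum>i<m. (c i + (if i = i0 then \<epsilon> else 0)) * inc (es ! i) j) =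
            (\<Sum>i<m. c i * inc (es ! i) j) + (\<Sum>i<m. if i = i0 then \<epsilon> * inc (es ! i0) j else 0)"
          by (simp add: distrib_right sum.distrib if_distrib[of "\<lambda>x. x * _"] cong: if_cong)
        then show ?thesis using c that i0(1) e by (simp add: inc_def)
      qed
      then show ?case by (intro exI[of _ "\<lambda>i. c i + (if i = i0 then \<epsilon> else 0)"]) blast
    qed
    then have "\<forall>x. \<exists>c. x \<le> m \<longrightarrow> (\<forall>j<m. (\<Sum>i<m. c i * inc (es ! i) j) = inc (x, m) j)"
      using True iff by (metis atMost_iff)
    then obtain c where c: "\<And>x j. x \<le> m \<Longrightarrow> j < m \<Longrightarrow> (\<Sum>i<m. c x i * inc (es ! i) j) = inc (x, m) j"
      by metis
    let ?L = "mat m m (\<lambda>(x, i). c x i)"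
    have "?L * ?C = 1\<^sub>m m"
    proof (rule eq_matI)
      fix x j assume "x < dim_row (1\<^sub>m m :: int mat)" "j < dim_col (1\<^sub>m m :: int mat)"
      then have xj: "x < m" "j < m" by simp_all
      then have "(?L * ?C) $$ (x, j) = (\<Sum>i<m. c x i * inc (es ! i) j)"
        using C by (auto simp: scalar_prod_def Cij atLeast0LessThan intro!: sum.cong)
      then show "(?L * ?C) $$ (x, j) = 1\<^sub>m m $$ (x, j)" using c[of x j] xj by (simp add: inc_def)
    qed (use C in auto)
    then have "det ?L * det ?C = 1" using det_mult[of ?L m ?C] C by simp
    then have "det ?C dvd 1" by (metis dvd_triv_right)
    then have "\<bar>det ?C\<bar> = 1" by simp
    then have "det ?C ^ 2 = 1" by (metis power2_abs one_power2)
    then show ?thesis using True by simp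
  next
    case False
    then obtain x where x: "x \<le> m" "\<not> conn ?R x m" using iff by auto
    then have "x \<noteq> m" by auto
    \<comment> \<open>The indicator of a component away from the root: both ends of any edge have
      the same value.\<close>
    let ?v = "vec m (\<lambda>j. of_bool (conn ?R x j)) :: int vec"
    have "?v \<noteq> 0\<^sub>v m"
    proof
      assume "?v = 0\<^sub>v m"
      then have "?v $ x = 0\<^sub>v m $ x" by simp
      then show False using x \<open>x \<noteq> m\<close> by simp
    qed
    moreover have "?C *\<^sub>v ?v = 0\<^sub>v m"
    proof (rule eq_vecI)
      fix i assume "i < dim_vec (0\<^sub>v m :: int vec)"
      then have i: "i < m" by simp
      obtain a b where ab: "es ! i = (a, b)" by force
      have abR: "(a, b) \<in> ?R" using ab i assms(1) by (metis nth_mem)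
      then have le: "a \<le> m" "b \<le> m" using assms(2) by auto
      have same: "conn ?R x a \<longleftrightarrow> conn ?R x b" using abR conn_base conn_base' conn_trans by metis
      have "(?C *\<^sub>v ?v) $ i = (\<Sum>j<m. inc (a, b) j * of_bool (conn ?R x j))"
        using i C by (auto simp: scalar_prod_def Cij ab atLeast0LessThan intro!: sum.cong)
      also have "\<dots> = (\<Sum>j<m. if j = a then of_bool (conn ?R x a) else 0) - (\<Sum>j<m. if j = b then of_bool (conn ?R x b) else 0)"
        unfolding sum_subtractf[symmetric] by (intro sum.cong refl) (auto simp: inc_def)
      also have "\<dots> = 0"
        using le same x(2) by (auto simp: le_less)
      finally show "(?C *\<^sub>v ?v) $ i = 0\<^sub>v m $ i" using i by simp
    qed (use C in auto)
    moreover have "?v \<in> carrier_vec m" by simp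
    ultimately have "det ?C = 0" using det_0_iff_vec_prod_zero[OF C] by blast
    then show ?thesis using False by simp
  qed
qed

text \<open>The matrix-tree theorem: edges in \<open>es\<close> are contracted, and \<open>m\<close> is the root.\<close>

theorem matrix_tree:
  obtains \<kappa> :: int where "\<kappa> ^ 2 = 1" "\<And>A es. \<lbrakk>finite A; set es \<subseteq> {..m} \<times> {..m}; e ` A \<subseteq> {..m} \<times> {..m}\<rbrakk> \<Longrightarrow>
    det (bordered m (\<lambda>i j. \<Sum>z\<in>A. t z * inc (e z) i * inc (e z) j) (map inc es)) =
    \<kappa> * (\<Sum>T\<in>Pow A. (\<Prod>z\<in>T. - t z) * of_bool (length es + card T = m \<and> num_classes {..m} (set es \<union> e ` T) = 1))"
proof -
  obtain \<kappa> :: int where \<kappa>: "\<kappa> ^ 2 = 1"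
    "\<And>B. length B = m \<Longrightarrow> det (bordered m (\<lambda>_ _. 0) B) = \<kappa> * det (coeff_rows m B) ^ 2"
    using det_bordered_zero[of m] by metis
  let ?D = "\<lambda>A es. det (bordered m (\<lambda>i j. \<Sum>z\<in>A. t z * inc (e z) i * inc (e z) j) (map inc es))"
  let ?f = "\<lambda>es T. (\<Prod>z\<in>T. - t z) * of_bool (length es + card T = m \<and> num_classes {..m} (set es \<union> e ` T) = 1)"
  have "?D A es = \<kappa> * (\<Sum>T\<in>Pow A. ?f es T)"
    if "finite A" "set es \<subseteq> {..m} \<times> {..m}" "e ` A \<subseteq> {..m} \<times> {..m}" for A es
    using that
  proof (induction A arbitrary: es rule: finite_induct)
    case empty
    have "det (bordered m (\<lambda>_ _. 0) (map inc es)) = \<kappa> * of_bool (length es = m \<and> num_classes {..m} (set es) = 1)"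
    proof (cases "length es = m")
      case True
      then show ?thesis using \<kappa>(2)[of "map inc es"] det_incidence[OF True empty(1)] by simp
    next
      case False
      then show ?thesis using det_bordered_zero_neq[of "map inc es" m] by simp
    qed
    then show ?case by simp
  next
    case (insert z A)
    have "?D (insert z A) es = det (bordered m (\<lambda>i j. (\<Sum>z\<in>A. t z * inc (e z) i * inc (e z) j) + t z * inc (e z) i * inc (e z) j) (map inc es))"
      using insert(1,2) by (simp add: add.commute)
    \<comment> \<open>The first term collects the edge sets without \<open>z\<close>, the second,
      where \<open>z\<close> is contracted, those containing it.\<close>
    also have "\<dots> = ?D A es - t z * ?D A (es @ [e z])"
      unfolding det_bordered_rank_one by simp
    also have "\<dots> = \<kappa> * (\<Sum>T\<in>Pow A. ?f es T) - t z * (\<kappa> * (\<Sum>T\<in>Pow A. ?f (es @ [e z]) T))"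
      using insert.IH[of es] insert.IH[of "es @ [e z]"] insert.prems by simp
    also have "\<dots> = \<kappa> * ((\<Sum>T\<in>Pow A. ?f es T) + (\<Sum>T\<in>Pow A. - t z * ?f (es @ [e z]) T))"
      by (simp add: sum_distrib_left algebra_simps sum_negf)
    also have "(\<Sum>T\<in>Pow A. - t z * ?f (es @ [e z]) T) = (\<Sum>T\<in>Pow A. ?f es (insert z T))"
    proof (intro sum.cong refl)
      fix T assume "T \<in> Pow A"
      then have T: "finite T" "z \<notin> T" using insert(1,2) finite_subset by auto
      then show "- t z * ?f (es @ [e z]) T = ?f es (insert z T)" by simp
    qed
    also have "(\<Sum>T\<in>Pow A. ?f es T) + (\<Sum>T\<in>Pow A. ?f es (insert z T)) = (\<Sum>T\<in>Pow (insert z A). ?f es T)"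
      unfolding sum_Pow_insert[OF insert(1,2)] by (rule add.commute)
    finally show ?case .
  qed
  with \<kappa>(1) show thesis by (rule that)
qed

section \<open>Change of coordinates and Schur complement for bordered determinants\<close>

lemma congruent_entry:
  assumes "V \<in> carrier_mat n n" "P \<in> carrier_mat n n" "i < n" "j < n"
  shows "(transpose_mat P * V * P) $$ (i, j) = (\<Sum>a<n. \<Sum>b<n. P $$ (a, i) * V $$ (a, b) * P $$ (b, j))"
proof -
  have "(transpose_mat P * V * P) $$ (i, j) = (\<Sum>a<n. P $$ (a, i) * (\<Sum>b<n. V $$ (a, b) * P $$ (b, j)))"
    using assms by (auto simp: scalar_prod_def atLeast0LessThan intro!: sum.cong)
  also have "\<dots> = (\<Sum>a<n. \<Sum>b<n. P $$ (a, i) * V $$ (a, b) * P $$ (b, j))"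
    unfolding sum_distrib_left mult.assoc ..
  finally show ?thesis .
qed

text \<open>Congruence by the block diagonal matrix with blocks \<open>P\<close> and
  identity.\<close>

lemma det_bordered_change:
  assumes "P \<in> carrier_mat m m"
    and "\<And>i j. i < m \<Longrightarrow> j < m \<Longrightarrow> M i j = (\<Sum>a<m. \<Sum>b<m. P $$ (a, i) * U a b * P $$ (b, j))"
    and "length B = length N"
    and "\<And>r j. r < length N \<Longrightarrow> j < m \<Longrightarrow> (B ! r) j = (\<Sum>a<m. (N ! r) a * P $$ (a, j))"
  shows "det (bordered m M B) = det P ^ 2 * det (bordered m U N)"
proof -
  let ?k = "length N"
  let ?U = "mat m m (\<lambda>(i, j). U i j)" and ?N = "coeff_rows m N"
  let ?D = "four_block_mat P (0\<^sub>m m ?k) (0\<^sub>m ?k m) (1\<^sub>m ?k)"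
  have P: "P \<in> carrier_mat m m" by fact
  have N: "?N \<in> carrier_mat ?k m" by (rule coeff_rows_carrier)
  have D: "?D \<in> carrier_mat (m + ?k) (m + ?k)" using P by simp
  have M: "mat m m (\<lambda>(i, j). M i j) = transpose_mat P * ?U * P"
  proof (rule eq_matI)
    fix i j assume "i < dim_row (transpose_mat P * ?U * P)" "j < dim_col (transpose_mat P * ?U * P)"
    then have ij: "i < m" "j < m" using P by auto
    show "mat m m (\<lambda>(i, j). M i j) $$ (i, j) = (transpose_mat P * ?U * P) $$ (i, j)"
      unfolding congruent_entry[OF mat_carrier P ij] using ij by (simp add: assms(2))
  qed (use P in auto)
  have B: "coeff_rows m B = ?N * P"
  proof (rule eq_matI)
    fix i j assume "i < dim_row (?N * P)" "j < dim_col (?N * P)"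
    then have ij: "i < ?k" "j < m" using P N by auto
    then show "coeff_rows m B $$ (i, j) = (?N * P) $$ (i, j)"
      using P assms(3) assms(4)[OF ij] by (simp add: coeff_rows_def scalar_prod_def atLeast0LessThan)
  qed (use P N assms(3) in \<open>auto simp: coeff_rows_def\<close>)
  have DT: "transpose_mat ?D = four_block_mat (transpose_mat P) (0\<^sub>m m ?k) (0\<^sub>m ?k m) (1\<^sub>m ?k)"
    by (subst transpose_four_block_mat[of _ m m _ ?k _ ?k]) (use P in auto)
  have PUP: "transpose_mat P * ?U * P \<in> carrier_mat m m" using P by (intro carrier_matI) auto
  have "transpose_mat ?D * bordered m U N * ?D = bordered m M B"
    unfolding DT bordered_four_block M B assms(3)
    apply (subst mult_four_block_mat[of _ m m _ ?k _ ?k _ _ m _ ?k])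
    using P N apply auto[8]
    apply (subst mult_four_block_mat[of _ m m _ ?k _ ?k _ _ m _ ?k])
    using P N apply auto[8]
    using P N by (simp add: transpose_mult[OF N P] right_add_zero_mat[OF PUP])
  moreover have TD: "transpose_mat ?D \<in> carrier_mat (m + ?k) (m + ?k)"
    using D by (simp only: transpose_carrier_mat)
  moreover note mult_carrier_mat[OF TD bordered_carrier]
  ultimately have "det (bordered m M B) = det (transpose_mat ?D) * det (bordered m U N) * det ?D"
    using det_mult[OF _ D] det_mult[OF TD bordered_carrier] by metis
  moreover have "det ?D = det P"
    using det_four_block_mat_upper_right_zero[OF P refl _ one_carrier_mat, of "0\<^sub>m ?k m"] by simp
  ultimately show ?thesis using det_transpose[OF D] by (simp add: power2_eq_square)
qed

text \<open>Since \<open>U\<close> is its own inverse, the Schur complement of the border block is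
  the integer matrix \<open>- N U N^T\<close>, obtained by clearing the upper right block.\<close>

lemma det_bordered_schur:
  assumes "\<And>i j. i < m \<Longrightarrow> j < m \<Longrightarrow> (\<Sum>a<m. U i a * U a j) = of_bool (i = j)"
  shows "\<bar>det (bordered m U N)\<bar> =
    \<bar>det (mat (length N) (length N) (\<lambda>(i, j). \<Sum>a<m. \<Sum>b<m. (N ! i) a * U a b * (N ! j) b))\<bar>"
proof -
  let ?k = "length N"
  let ?U = "mat m m (\<lambda>(i, j). U i j)" and ?N = "coeff_rows m N"
  let ?S = "mat ?k ?k (\<lambda>(i, j). \<Sum>a<m. \<Sum>b<m. (N ! i) a * U a b * (N ! j) b)"
  have U: "?U \<in> carrier_mat m m" and N: "?N \<in> carrier_mat ?k m" by (simp_all add: coeff_rows_carrier)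
  have UU: "?U * ?U = 1\<^sub>m m"
    by (rule eq_matI) (simp_all add: scalar_prod_def atLeast0LessThan assms)
  have S: "?N * (?U * transpose_mat ?N) = ?S"
    by (rule eq_matI)
      (auto simp: scalar_prod_def atLeast0LessThan coeff_rows_def sum_distrib_left mult.assoc intro!: sum.cong)
  let ?E = "four_block_mat ?U (- (?U * transpose_mat ?N)) (0\<^sub>m ?k m) (1\<^sub>m ?k)"
  have E: "?E \<in> carrier_mat (m + ?k) (m + ?k)" by simp
  have "bordered m U N * ?E = four_block_mat (1\<^sub>m m) (0\<^sub>m m ?k) (?N * ?U) (- ?S)"
  proof -
    have "?U * - (?U * transpose_mat ?N) + transpose_mat ?N * 1\<^sub>m ?k = 0\<^sub>m m ?k"
    proof -
      have "?U * - (?U * transpose_mat ?N) = - (?U * ?U * transpose_mat ?N)"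
        using U N by (simp add: assoc_mult_mat[of _ m m _ m _ ?k])
      then show ?thesis using N unfolding UU by (simp add: uminus_l_inv_mat)
    qed
    moreover have "?N * - (?U * transpose_mat ?N) + 0\<^sub>m ?k ?k * 1\<^sub>m ?k = - ?S"
      using U N S by simp
    moreover have "?U * ?U + transpose_mat ?N * 0\<^sub>m ?k m = 1\<^sub>m m" using N UU by simp
    moreover have "?N * ?U + 0\<^sub>m ?k ?k * 0\<^sub>m ?k m = ?N * ?U" using U N by simp
    ultimately show ?thesis unfolding bordered_four_block
      by (subst mult_four_block_mat[of _ m m _ ?k _ ?k _ _ m _ ?k]) (use U N in auto)
  qed
  then have "det (bordered m U N) * det ?E = det (four_block_mat (1\<^sub>m m) (0\<^sub>m m ?k) (?N * ?U) (- ?S))"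
    using det_mult[OF bordered_carrier E] by metis
  also have "\<dots> = det (- ?S)"
    using det_four_block_mat_upper_right_zero[OF one_carrier_mat refl, of "?N * ?U" ?k m "- ?S"] U N by simp
  also have "\<dots> = (- 1) ^ ?k * det ?S"
  proof -
    have "- ?S = (- 1) \<cdot>\<^sub>m ?S" by (rule eq_matI) auto
    then show ?thesis by (simp add: det_smult)
  qed
  finally have "\<bar>det (bordered m U N)\<bar> * \<bar>det ?E\<bar> = \<bar>det ?S\<bar>" unfolding abs_mult[symmetric] by (simp add: abs_mult power_abs)
  moreover have "det ?E = det ?U"
  proof -
    have "- (?U * transpose_mat ?N) \<in> carrier_mat m ?k" using N by (intro carrier_matI) auto
    then show ?thesis using det_four_block_mat_lower_left_zero[OF U _ refl one_carrier_mat, of "- (?U * transpose_mat ?N)" ?k] by simp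
  qed
  moreover have "\<bar>det ?U\<bar> = 1"
  proof -
    have "det ?U * det ?U = 1" using det_mult[OF U U] UU by simp
    then have "det ?U = 1 \<or> det ?U = - 1" by (auto simp: zmult_eq_1_iff)
    then show ?thesis by auto
  qed
  ultimately show ?thesis by simp
qed

section \<open>The determinant of a Seifert matrix\<close>

context surface begin

definition entry_at :: "nat \<Rightarrow> nat \<times> nat" where
  "entry_at = (SOME g. bij_betw g {..<card Ent} Ent)"

definition position :: "nat \<times> nat \<Rightarrow> nat" where
  "position = inv_into {..<card Ent} entry_at"

lemma bij_entry_at: "bij_betw entry_at {..<card Ent} Ent"
  unfolding entry_at_def
  using someI_ex[OF ex_bij_betw_nat_finite[OF finite_Ent]] by (simp only: atLeast0LessThan)

lemma entry_at_Ent: "a < card Ent \<Longrightarrow> entry_at a \<in> Ent"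
  using bij_betwE[OF bij_entry_at] by simp

lemma position_entry_at [simp]: "a < card Ent \<Longrightarrow> position (entry_at a) = a"
  unfolding position_def using bij_betw_imp_inj_on[OF bij_entry_at] by (rule inv_into_f_f) simp

lemma position_Ent [simp]:
  assumes "p \<in> Ent" shows "position p < card Ent" "entry_at (position p) = p"
proof -
  have p: "p \<in> entry_at ` {..<card Ent}" using assms bij_betw_imp_surj_on[OF bij_entry_at] by simp
  show "position p < card Ent" using inv_into_into[OF p] by (simp add: position_def)
  show "entry_at (position p) = p" unfolding position_def by (rule f_inv_into_f[OF p])
qed

lemma position_inj: "p \<in> Ent \<Longrightarrow> p' \<in> Ent \<Longrightarrow> position p = position p' \<longleftrightarrow> p = p'"
  by (metis position_Ent(2))

lemma sum_entry_at: "(\<Sum>a<card Ent. f (entry_at a)) = (\<Sum>i<n. \<Sum>k<len i. f (i, k))"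
proof -
  have "(\<Sum>a<card Ent. f (entry_at a)) = (\<Sum>p\<in>Ent. f p)" by (rule sum.reindex_bij_betw[OF bij_entry_at])
  then show ?thesis by (simp add: Ent_def sum.Sigma)
qed

lemma card_Ent: "card Ent = 2 * card Cs"
  unfolding card_Cs by (simp add: Ent_def)

text \<open>The corners \<open>(i, Suc k)\<close> are numbered by the entries before them; all \<open>(i, 0)\<close> belong to the disc
  and are represented by the root \<open>card Ent\<close>.\<close>

definition vertex :: "nat \<times> nat \<Rightarrow> nat" where
  "vertex v = (if snd v = 0 then card Ent else position (fst v, snd v - 1))"

definition disc_edges :: "(nat \<times> nat) list" where
  "disc_edges = map (\<lambda>i. (vertex (i, len i), card Ent)) [0..<n]"

definition corner_edge :: "nat \<times> bool \<times> bool \<Rightarrow> nat \<times> nat" where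
  "corner_edge z = (vertex (end_over z), vertex (end_under z))"

lemma pred_Ent: "v \<in> V \<Longrightarrow> snd v \<noteq> 0 \<Longrightarrow> (fst v, snd v - 1) \<in> Ent"
  by (auto simp: V_def Ent_def)

lemma vertex_le: "v \<in> V \<Longrightarrow> vertex v \<le> card Ent"
  using position_Ent(1)[OF pred_Ent] by (auto simp: vertex_def intro: less_imp_le)

lemma vertex_root: "v \<in> V \<Longrightarrow> vertex v = card Ent \<longleftrightarrow> snd v = 0"
  using position_Ent(1)[OF pred_Ent, of v] by (auto simp: vertex_def)

lemma vertex_inj:
  assumes "v \<in> V" "v' \<in> V" "vertex v = vertex v'"
  shows "v = v' \<or> snd v = 0 \<and> snd v' = 0"
proof (cases "snd v = 0")
  case True
  then show ?thesis using vertex_root assms by metis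
next
  case False
  then have "snd v' \<noteq> 0" using vertex_root assms by metis
  then have "(fst v, snd v - 1) = (fst v', snd v' - 1)"
    using assms False position_inj[OF pred_Ent pred_Ent] by (simp add: vertex_def)
  then show ?thesis using False \<open>snd v' \<noteq> 0\<close> by (auto simp: prod_eq_iff)
qed

lemma num_classes_vertices:
  assumes "n > 0" "T \<subseteq> Q"
  shows "num_classes {..card Ent} (set disc_edges \<union> corner_edge ` T) = regions T"
proof -
  have img: "vertex ` V = {..card Ent}"
  proof
    show "vertex ` V \<subseteq> {..card Ent}" using vertex_le by auto
    show "{..card Ent} \<subseteq> vertex ` V"
    proof
      fix x assume "x \<in> {..card Ent}"
      then consider "x = card Ent" | "x < card Ent" by fastforce
      then show "x \<in> vertex ` V"
      proof cases
        case 1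
        then show ?thesis using assms(1) by (intro image_eqI[of _ _ "(0, 0)"]) (auto simp: vertex_def V_def)
      next
        case 2
        obtain i k where ik: "entry_at x = (i, k)" by force
        then have "(i, k) \<in> Ent" using entry_at_Ent[OF 2] by simp
        then show ?thesis using position_entry_at[OF 2] ik
          by (intro image_eqI[of _ _ "(i, Suc k)"]) (auto simp: vertex_def V_def Ent_def)
      qed
    qed
  qed
  have "regions T = num_classes (vertex ` V) (map_prod vertex vertex ` region_rel T)"
    unfolding regions_def
  proof (rule num_classes_collapse)
    fix x y assume xy: "x \<in> V" "y \<in> V" "vertex x = vertex y"
    from vertex_inj[OF xy] show "conn (region_rel T) x y"
    proof (elim disjE conjE)
      assume 0: "snd x = 0" "snd y = 0"
      have "conn (region_rel T) v (0, 0)" if "v \<in> V" "snd v = 0" for v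
        using that by (intro conn_base) (auto simp: region_rel_def disc_rel_def V_def)
      from conn_trans[OF this[OF xy(1) 0(1)] conn_sym[OF this[OF xy(2) 0(2)]]]
      show ?thesis .
    qed simp
  qed (rule region_rel_V[OF assms(2)])
  also have "\<dots> = num_classes {..card Ent} (set disc_edges \<union> corner_edge ` T)"
    unfolding img
  proof (rule num_classes_cong_conn)
    fix a b assume "(a, b) \<in> map_prod vertex vertex ` region_rel T"
    then obtain x y where xy: "(x, y) \<in> region_rel T" "a = vertex x" "b = vertex y" by auto
    then consider i where "i < n" "x = (i, 0)" "y = (0, 0)" | i where "i < n" "x = (i, len i)" "y = (0, 0)"
      | z where "z \<in> T" "x = end_over z" "y = end_under z"
      by (auto simp: region_rel_def disc_rel_def)
    then show "conn (set disc_edges \<union> corner_edge ` T) a b"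
    proof cases
      case (1 i)
      then show ?thesis using xy by (simp add: vertex_def)
    next
      case (2 i)
      then show ?thesis using xy by (intro conn_base) (auto simp: disc_edges_def vertex_def)
    next
      case (3 z)
      then show ?thesis using xy by (intro conn_base) (auto simp: corner_edge_def)
    qed
  next
    fix a b assume "(a, b) \<in> set disc_edges \<union> corner_edge ` T"
    then consider i where "i < n" "a = vertex (i, len i)" "b = vertex (0, 0)"
      | z where "z \<in> T" "a = vertex (end_over z)" "b = vertex (end_under z)"
      by (auto simp: disc_edges_def corner_edge_def vertex_def)
    then show "conn (map_prod vertex vertex ` region_rel T) a b"
    proof cases
      case (1 i)
      then have "((i, len i), (0, 0)) \<in> region_rel T" by (auto simp: region_rel_def disc_rel_def)
      then show ?thesis unfolding 1 by (intro conn_base) (metis image_eqI map_prod_simp)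
    next
      case (2 z)
      then have "(end_over z, end_under z) \<in> region_rel T" by (auto simp: region_rel_def)
      then show ?thesis unfolding 2 by (intro conn_base) (metis image_eqI map_prod_simp)
    qed
  qed
  finally show ?thesis by simp
qed

definition jump_edge :: "nat \<times> nat \<Rightarrow> nat \<times> nat" where
  "jump_edge p = (vertex (fst p, Suc (snd p)), vertex p)"

definition jump_matrix :: "int mat" where
  "jump_matrix = coeff_rows (card Ent) (map inc (map (\<lambda>a. jump_edge (entry_at a)) [0..<card Ent]))"

lemma jump_matrix_carrier: "jump_matrix \<in> carrier_mat (card Ent) (card Ent)"
  using coeff_rows_carrier[of "card Ent" "map inc (map (\<lambda>a. jump_edge (entry_at a)) [0..<card Ent])"]
  by (simp add: jump_matrix_def)

lemma jump_matrix_entry: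
  "a < card Ent \<Longrightarrow> j < card Ent \<Longrightarrow> jump_matrix $$ (a, j) = inc (jump_edge (entry_at a)) j"
  by (simp add: jump_matrix_def coeff_rows_def)

lemma jump_edge_le:
  assumes "p \<in> Ent" shows "jump_edge p \<in> {..card Ent} \<times> {..card Ent}"
proof -
  have "(fst p, Suc (snd p)) \<in> V" "p \<in> V" using assms by (auto simp: Ent_def V_def)
  then show ?thesis using vertex_le by (auto simp: jump_edge_def)
qed

text \<open>The jumps along the cores are paths starting at the root and together form a spanning
  tree, so passing from vertex to jump coordinates is unimodular.\<close>

lemma det_jump_matrix: "det jump_matrix ^ 2 = 1"
proof -
  let ?es = "map (\<lambda>a. jump_edge (entry_at a)) [0..<card Ent]"
  have es: "set ?es = jump_edge ` Ent"
    using bij_betw_imp_surj_on[OF bij_entry_at] by (simp add: atLeast0LessThan image_image[of jump_edge entry_at, symmetric])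
  have c: "k \<le> len i \<Longrightarrow> conn (jump_edge ` Ent) (vertex (i, k)) (card Ent)" if "i < n" for i k
  proof (induction k)
    case (Suc k)
    have "(vertex (i, Suc k), vertex (i, k)) \<in> jump_edge ` Ent"
      by (rule image_eqI[of _ _ "(i, k)"]) (use Suc.prems that in \<open>auto simp: jump_edge_def Ent_def\<close>)
    then have "conn (jump_edge ` Ent) (vertex (i, Suc k)) (vertex (i, k))" by (rule conn_base)
    moreover have "conn (jump_edge ` Ent) (vertex (i, k)) (card Ent)" using Suc.prems by (intro Suc.IH) simp
    ultimately show ?case by (rule conn_trans)
  qed (simp add: vertex_def)
  have "num_classes {..card Ent} (jump_edge ` Ent) = 1"
  proof (subst num_classes_1_iff_root[of _ "card Ent"], simp_all only: finite_atMost atMost_iff order_refl, intro ballI)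
    fix x assume "x \<in> {..card Ent}"
    then have "x \<le> card Ent" by simp
    then consider "x = card Ent" | "x < card Ent" by linarith
    then show "conn (jump_edge ` Ent) x (card Ent)"
    proof cases
      case 2
      obtain i k where ik: "entry_at x = (i, k)" by force
      then have "(i, k) \<in> Ent" using entry_at_Ent[OF 2] by simp
      then have "conn (jump_edge ` Ent) (vertex (i, Suc k)) (card Ent)" by (intro c) (auto simp: Ent_def)
      moreover have "vertex (i, Suc k) = x" using position_entry_at[OF 2] ik by (simp add: vertex_def)
      ultimately show ?thesis by simp
    qed simp
  qed
  moreover have "jump_edge ` Ent \<subseteq> {..card Ent} \<times> {..card Ent}" using jump_edge_le by blast
  ultimately show ?thesis
    unfolding jump_matrix_def using det_incidence[of ?es "card Ent"] unfolding es by simp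
qed

text \<open>The Laplacian of the corner edges in jump coordinates: a hyperbolic plane with the sign
  of the crossing for each crossing of cores.\<close>

definition hyperbolic :: "nat \<Rightarrow> nat \<Rightarrow> int" where
  "hyperbolic a b = (\<Sum>c\<in>Cs. sign (sg c) *
     (of_bool (a = position (over_loc c)) * of_bool (b = position (under_loc c)) +
      of_bool (a = position (under_loc c)) * of_bool (b = position (over_loc c))))"

lemma sum_hyperbolic:
  "(\<Sum>a<card Ent. \<Sum>b<card Ent. f a * hyperbolic a b * g b) =
   (\<Sum>c\<in>Cs. sign (sg c) * (f (position (over_loc c)) * g (position (under_loc c)) +
      f (position (under_loc c)) * g (position (over_loc c))))"
proof -
  let ?m = "card Ent"
  have delta: "(\<Sum>a<?m. \<Sum>b<?m. f a * (s * (of_bool (a = x) * of_bool (b = y) + of_bool (a = y) * of_bool (b = x))) * g b) =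
      s * (f x * g y + f y * g x)" if "x < ?m" "y < ?m" for x y s
  proof -
    have 1: "(\<Sum>a<?m. \<Sum>b<?m. f a * (s * (of_bool (a = x) * of_bool (b = y))) * g b) = s * (f x * g y)"
      if "x < ?m" "y < ?m" for x y
    proof -
      have "(\<Sum>a<?m. \<Sum>b<?m. f a * (s * (of_bool (a = x) * of_bool (b = y))) * g b) =
          (\<Sum>a<?m. \<Sum>b<?m. if b = y then if a = x then s * (f x * g y) else 0 else 0)"
        by (intro sum.cong refl) simp
      also have "\<dots> = s * (f x * g y)" using that by (simp add: sum.delta)
      finally show ?thesis .
    qed
    show ?thesis
      using 1[OF that] 1[OF that(2,1)]
      by (simp add: distrib_left distrib_right sum.distrib mult_ac)
  qed
  have "(\<Sum>a<?m. \<Sum>b<?m. f a * hyperbolic a b * g b) =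
      (\<Sum>a<?m. \<Sum>b<?m. \<Sum>c\<in>Cs. f a * (sign (sg c) *
     (of_bool (a = position (over_loc c)) * of_bool (b = position (under_loc c)) +
      of_bool (a = position (under_loc c)) * of_bool (b = position (over_loc c)))) * g b)"
    unfolding hyperbolic_def sum_distrib_left sum_distrib_right ..
  also have "\<dots> = (\<Sum>a<?m. \<Sum>c\<in>Cs. \<Sum>b<?m. f a * (sign (sg c) *
     (of_bool (a = position (over_loc c)) * of_bool (b = position (under_loc c)) +
      of_bool (a = position (under_loc c)) * of_bool (b = position (over_loc c)))) * g b)"
    by (intro sum.cong refl sum.swap)
  also have "\<dots> = (\<Sum>c\<in>Cs. \<Sum>a<?m. \<Sum>b<?m. f a * (sign (sg c) *
     (of_bool (a = position (over_loc c)) * of_bool (b = position (under_loc c)) +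
      of_bool (a = position (under_loc c)) * of_bool (b = position (over_loc c)))) * g b)"
    by (rule sum.swap)
  also have "\<dots> = (\<Sum>c\<in>Cs. sign (sg c) * (f (position (over_loc c)) * g (position (under_loc c)) +
      f (position (under_loc c)) * g (position (over_loc c))))"
    by (intro sum.cong refl delta) (simp_all add: loc_Ent)
  finally show ?thesis .
qed

lemma loc_inj:
  assumes "c \<in> Cs" "c' \<in> Cs"
  shows "over_loc c = over_loc c' \<longleftrightarrow> c = c'" "under_loc c = under_loc c' \<longleftrightarrow> c = c'" "over_loc c \<noteq> under_loc c'"
  using core_loc(3,6)[OF assms(1)] core_loc(3,6)[OF assms(2)] by (metis prod.inject)+

lemma hyperbolic_position:
  assumes "c \<in> Cs"
  shows "hyperbolic a (position (over_loc c)) = sign (sg c) * of_bool (a = position (under_loc c))"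
    "hyperbolic a (position (under_loc c)) = sign (sg c) * of_bool (a = position (over_loc c))"
proof -
  have eq: "hyperbolic a (position (over_loc c)) = (\<Sum>c'\<in>Cs. if c' = c then sign (sg c) * of_bool (a = position (under_loc c)) else 0)"
    "hyperbolic a (position (under_loc c)) = (\<Sum>c'\<in>Cs. if c' = c then sign (sg c) * of_bool (a = position (over_loc c)) else 0)"
    unfolding hyperbolic_def
  proof (rule_tac [!] sum.cong[OF refl])
    fix c' assume c': "c' \<in> Cs"
    note p = position_inj[OF loc_Ent(1)[OF assms] loc_Ent(1)[OF c']] position_inj[OF loc_Ent(1)[OF assms] loc_Ent(2)[OF c']]
      position_inj[OF loc_Ent(2)[OF assms] loc_Ent(1)[OF c']] position_inj[OF loc_Ent(2)[OF assms] loc_Ent(2)[OF c']]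
      loc_inj[OF assms c'] loc_inj(3)[OF c' assms]
    have p': "position (over_loc c) = position (over_loc c') \<longleftrightarrow> c' = c" "position (over_loc c) \<noteq> position (under_loc c')"
      "position (under_loc c) \<noteq> position (over_loc c')" "position (under_loc c) = position (under_loc c') \<longleftrightarrow> c' = c"
      using p by metis+
    show "sign (sg c') * (of_bool (a = position (over_loc c')) * of_bool (position (over_loc c) = position (under_loc c')) +
        of_bool (a = position (under_loc c')) * of_bool (position (over_loc c) = position (over_loc c'))) =
        (if c' = c then sign (sg c) * of_bool (a = position (under_loc c)) else 0)"
      by (cases "c' = c") (use p' in simp_all)
    show "sign (sg c') * (of_bool (a = position (over_loc c')) * of_bool (position (under_loc c) = position (under_loc c')) +
        of_bool (a = position (under_loc c')) * of_bool (position (under_loc c) = position (over_loc c'))) =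
        (if c' = c then sign (sg c) * of_bool (a = position (over_loc c)) else 0)"
      by (cases "c' = c") (use p' in simp_all)
  qed
  show "hyperbolic a (position (over_loc c)) = sign (sg c) * of_bool (a = position (under_loc c))"
    "hyperbolic a (position (under_loc c)) = sign (sg c) * of_bool (a = position (over_loc c))"
    unfolding eq using assms by simp_all
qed

text \<open>It is a symmetric signed permutation matrix exchanging the two passages of each
  crossing.\<close>

lemma hyperbolic_square:
  assumes "i < card Ent" "j < card Ent"
  shows "(\<Sum>a<card Ent. hyperbolic i a * hyperbolic a j) = of_bool (i = j)"
proof -
  have "(\<Sum>a<card Ent. hyperbolic i a * hyperbolic a j) =
      (\<Sum>a<card Ent. \<Sum>b<card Ent. hyperbolic i a * hyperbolic a b * of_bool (b = j))"
    using assms(2) by (simp add: of_bool_def if_distrib cong: if_cong)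
  also have "\<dots> = (\<Sum>c\<in>Cs. of_bool (i = position (over_loc c)) * of_bool (position (over_loc c) = j) +
      of_bool (i = position (under_loc c)) * of_bool (position (under_loc c) = j))"
    unfolding sum_hyperbolic
    by (intro sum.cong refl) (simp add: hyperbolic_position sign_def)
  also have "\<dots> = (\<Sum>a<card Ent. of_bool (i = position (entry_at a)) * of_bool (position (entry_at a) = j))"
    unfolding sum_core_entries[of "\<lambda>p. of_bool (i = position p) * of_bool (position p = j)"]
      sum_entry_at[of "\<lambda>p. of_bool (i = position p) * of_bool (position p = j)"] ..
  also have "\<dots> = (\<Sum>a<card Ent. if a = i then of_bool (i = j) else 0)" by (intro sum.cong refl) auto
  finally show ?thesis using assms(1) by simp
qed

definition twist :: "nat \<times> bool \<times> bool \<Rightarrow> int" where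
  "twist z = (if type_A z then 1 else - 1)"

lemma inc_edges:
  "inc (corner_edge z) j = of_bool (vertex (end_over z) = j) - of_bool (vertex (end_under z) = j)"
  "inc (jump_edge p) j = of_bool (vertex (fst p, Suc (snd p)) = j) - of_bool (vertex p = j)"
  by (simp_all add: inc_def corner_edge_def jump_edge_def)

text \<open>Additive counterpart of \<open>crossing_weight\<close>: at a crossing of cores the
  squares occur with both signs and cancel, and the mixed terms combine to products of
  jumps.\<close>

lemma twist_form:
  assumes "i < card Ent" "j < card Ent"
  shows "(\<Sum>z\<in>Q. twist z * inc (corner_edge z) i * inc (corner_edge z) j) =
    (\<Sum>a<card Ent. \<Sum>b<card Ent. jump_matrix $$ (a, i) * hyperbolic a b * jump_matrix $$ (b, j))"
proof -
  have "(\<Sum>d\<in>UNIV. \<Sum>e\<in>UNIV. twist (c, d, e) * inc (corner_edge (c, d, e)) i * inc (corner_edge (c, d, e)) j) =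
      sign (sg c) * (inc (jump_edge (over_loc c)) i * inc (jump_edge (under_loc c)) j +
        inc (jump_edge (under_loc c)) i * inc (jump_edge (over_loc c)) j)" for c
  proof -
    obtain x k y l where loc: "over_loc c = (x, k)" "under_loc c = (y, l)" by (metis surj_pair)
    define o0 o1 u0 u1 where ou: "o0 = (\<lambda>j. of_bool (vertex (x, k) = j) :: int)" "o1 = (\<lambda>j. of_bool (vertex (x, Suc k) = j) :: int)"
      "u0 = (\<lambda>j. of_bool (vertex (y, l) = j) :: int)" "u1 = (\<lambda>j. of_bool (vertex (y, Suc l) = j) :: int)"
    have J: "inc (jump_edge (over_loc c)) = (\<lambda>j. o1 j - o0 j)" "inc (jump_edge (under_loc c)) = (\<lambda>j. u1 j - u0 j)"
      by (simp_all add: fun_eq_iff inc_edges loc ou)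
    have E: "inc (corner_edge (c, d, e)) = (\<lambda>j. (if e = sg c then o1 j else o0 j) - (if d \<noteq> sg c then u1 j else u0 j))" for d e
      by (simp add: fun_eq_iff inc_edges ou end_over_def end_under_def arm_over_def arm_under_def loc)
    show ?thesis
      unfolding J E twist_def type_A_def UNIV_bool
      by (cases "sg c") (simp_all add: sign_def algebra_simps)
  qed
  then have "(\<Sum>z\<in>Q. twist z * inc (corner_edge z) i * inc (corner_edge z) j) =
      (\<Sum>c\<in>Cs. sign (sg c) * (inc (jump_edge (over_loc c)) i * inc (jump_edge (under_loc c)) j +
        inc (jump_edge (under_loc c)) i * inc (jump_edge (over_loc c)) j))"
    unfolding sum_Q by (intro sum.cong refl)
  also have "\<dots> = (\<Sum>a<card Ent. \<Sum>b<card Ent. jump_matrix $$ (a, i) * hyperbolic a b * jump_matrix $$ (b, j))"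
    unfolding sum_hyperbolic
    by (intro sum.cong refl) (simp add: jump_matrix_entry assms loc_Ent)
  finally show ?thesis .
qed

text \<open>The jumps along a core telescope from its far end to its start, which is the
  root.\<close>

lemma disc_form:
  assumes "r < n" "j < card Ent"
  shows "inc (disc_edges ! r) j = (\<Sum>a<card Ent. of_bool (fst (entry_at a) = r) * jump_matrix $$ (a, j))"
proof -
  let ?w = "\<lambda>k. of_bool (vertex (r, k) = j) :: int"
  have "(\<Sum>a<card Ent. of_bool (fst (entry_at a) = r) * jump_matrix $$ (a, j)) =
      (\<Sum>a<card Ent. of_bool (fst (entry_at a) = r) * inc (jump_edge (entry_at a)) j)"
    by (intro sum.cong refl) (simp add: jump_matrix_entry assms(2))
  also have "\<dots> = (\<Sum>i<n. \<Sum>k<len i. of_bool (i = r) * inc (jump_edge (i, k)) j)"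
    using sum_entry_at[of "\<lambda>p. of_bool (fst p = r) * inc (jump_edge p) j"] by simp
  also have "\<dots> = (\<Sum>i<n. if i = r then \<Sum>k<len r. inc (jump_edge (r, k)) j else 0)"
    by (intro sum.cong refl) auto
  also have "\<dots> = (\<Sum>k<len r. ?w (Suc k) - ?w k)" using assms(1) by (simp add: inc_edges)
  also have "\<dots> = ?w (len r) - ?w 0" by (rule sum_lessThan_telescope)
  also have "\<dots> = inc (disc_edges ! r) j" using assms by (simp add: disc_edges_def inc_def vertex_def)
  finally show ?thesis by simp
qed

text \<open>In jump coordinates the Laplacian is \<open>hyperbolic\<close> and border row
  \<open>r\<close> is the indicator of the entries of core \<open>r\<close>. The entry
  \<open>(i, j)\<close> of the Schur complement therefore adds the signs of crossings between the
  cores \<open>i\<close> and \<open>j\<close> in both orders.\<close>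

theorem sum_trees:
  assumes "n > 0"
  shows "\<bar>\<Sum>T\<in>Pow Q. (\<Prod>z\<in>T. twist z) * of_bool (n + card T = 2 * card Cs \<and> regions T = 1)\<bar> =
    \<bar>det (mat n n (\<lambda>(i, j). core_seifert_matrix F $$ (i, j) + core_seifert_matrix F $$ (j, i)))\<bar>"
proof -
  let ?m = "card Ent"
  let ?M = "\<lambda>i j. \<Sum>z\<in>Q. twist z * inc (corner_edge z) i * inc (corner_edge z) j"
  let ?N = "map (\<lambda>r a. of_bool (fst (entry_at a) = r) :: int) [0..<n]"
  let ?f = "\<lambda>T. (\<Prod>z\<in>T. twist z) * of_bool (n + card T = 2 * card Cs \<and> regions T = 1)"
  have es: "set disc_edges \<subseteq> {..?m} \<times> {..?m}" and len: "length disc_edges = n"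
    using vertex_le by (auto simp: disc_edges_def V_def)
  have e: "corner_edge ` Q \<subseteq> {..?m} \<times> {..?m}"
    unfolding corner_edge_def using vertex_le[OF ends_in_V(1)] vertex_le[OF ends_in_V(2)] by blast
  obtain \<kappa> :: int where \<kappa>: "\<kappa> ^ 2 = 1" "det (bordered ?m ?M (map inc disc_edges)) =
      \<kappa> * (\<Sum>T\<in>Pow Q. (\<Prod>z\<in>T. - twist z) *
        of_bool (length disc_edges + card T = ?m \<and> num_classes {..?m} (set disc_edges \<union> corner_edge ` T) = 1))"
  proof (rule matrix_tree[of ?m corner_edge twist])
    fix \<kappa> :: int
    assume k: "\<kappa> ^ 2 = 1" "\<And>A es. \<lbrakk>finite A; set es \<subseteq> {..?m} \<times> {..?m}; corner_edge ` A \<subseteq> {..?m} \<times> {..?m}\<rbrakk> \<Longrightarrow>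
      det (bordered ?m (\<lambda>i j. \<Sum>z\<in>A. twist z * inc (corner_edge z) i * inc (corner_edge z) j) (map inc es)) =
      \<kappa> * (\<Sum>T\<in>Pow A. (\<Prod>z\<in>T. - twist z) * of_bool (length es + card T = ?m \<and> num_classes {..?m} (set es \<union> corner_edge ` T) = 1))"
    show thesis by (rule that[OF k(1) k(2)[OF finite_Q es e]])
  qed
  \<comment> \<open>All contributing \<open>T\<close> have the same size, so the signs come out as a
    common factor.\<close>
  have "(\<Sum>T\<in>Pow Q. (\<Prod>z\<in>T. - twist z) *
        of_bool (length disc_edges + card T = ?m \<and> num_classes {..?m} (set disc_edges \<union> corner_edge ` T) = 1)) =
      (\<Sum>T\<in>Pow Q. (- 1) ^ (?m - n) * ?f T)"
  proof (intro sum.cong refl)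
    fix T assume "T \<in> Pow Q"
    then have T: "T \<subseteq> Q" by simp
    show "(\<Prod>z\<in>T. - twist z) *
        of_bool (length disc_edges + card T = ?m \<and> num_classes {..?m} (set disc_edges \<union> corner_edge ` T) = 1) =
        (- 1) ^ (?m - n) * ?f T"
    proof (cases "n + card T = ?m")
      case True
      then have c: "card T = ?m - n" by simp
      have "(\<Prod>z\<in>T. - twist z) = (- 1) ^ card T * (\<Prod>z\<in>T. twist z)"
        using prod.distrib[of "\<lambda>_. - 1" twist T] by simp
      then show ?thesis unfolding num_classes_vertices[OF assms T] len c by (simp add: card_Ent)
    next
      case False
      then show ?thesis by (simp add: len card_Ent)
    qed
  qed
  then have "\<bar>det (bordered ?m ?M (map inc disc_edges))\<bar> = \<bar>\<kappa>\<bar> * \<bar>\<Sum>T\<in>Pow Q. ?f T\<bar>"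
    unfolding \<kappa>(2) by (simp add: abs_mult power_abs flip: sum_distrib_left)
  moreover have "\<bar>\<kappa>\<bar> = 1" using \<kappa>(1) by (auto simp: power2_eq_1_iff)
  moreover have "det (bordered ?m ?M (map inc disc_edges)) = det jump_matrix ^ 2 * det (bordered ?m hyperbolic ?N)"
  proof (rule det_bordered_change[OF jump_matrix_carrier])
    show "?M i j = (\<Sum>a<?m. \<Sum>b<?m. jump_matrix $$ (a, i) * hyperbolic a b * jump_matrix $$ (b, j))"
      if "i < ?m" "j < ?m" for i j by (rule twist_form[OF that])
    show "length (map inc disc_edges) = length ?N" by (simp add: len)
    show "(map inc disc_edges ! r) j = (\<Sum>a<?m. (?N ! r) a * jump_matrix $$ (a, j))"
      if "r < length ?N" "j < ?m" for r j
      using that disc_form[of r j] by (simp add: len)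
  qed
  moreover have "\<bar>det (bordered ?m hyperbolic ?N)\<bar> =
      \<bar>det (mat n n (\<lambda>(i, j). \<Sum>a<?m. \<Sum>b<?m. (?N ! i) a * hyperbolic a b * (?N ! j) b))\<bar>"
    using det_bordered_schur[of ?m hyperbolic ?N, OF hyperbolic_square] by simp
  moreover have "mat n n (\<lambda>(i, j). \<Sum>a<?m. \<Sum>b<?m. (?N ! i) a * hyperbolic a b * (?N ! j) b) =
      mat n n (\<lambda>(i, j). core_seifert_matrix F $$ (i, j) + core_seifert_matrix F $$ (j, i))"
  proof (rule eq_matI)
    fix i j assume "i < dim_row (mat n n (\<lambda>(i, j). core_seifert_matrix F $$ (i, j) + core_seifert_matrix F $$ (j, i)))"
      "j < dim_col (mat n n (\<lambda>(i, j). core_seifert_matrix F $$ (i, j) + core_seifert_matrix F $$ (j, i)))"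
    then have ij: "i < n" "j < n" by simp_all
    have "(\<Sum>a<?m. \<Sum>b<?m. (?N ! i) a * hyperbolic a b * (?N ! j) b) =
        (\<Sum>c\<in>Cs. (if fst (over_loc c) = i \<and> fst (under_loc c) = j then sign (sg c) else 0) +
          (if fst (over_loc c) = j \<and> fst (under_loc c) = i then sign (sg c) else 0))"
      unfolding sum_hyperbolic
    proof (rule sum.cong[OF refl])
      fix c assume c: "c \<in> Cs"
      have N: "(?N ! r) (position (over_loc c)) = of_bool (fst (over_loc c) = r)"
        "(?N ! r) (position (under_loc c)) = of_bool (fst (under_loc c) = r)" if "r < n" for r
        using that position_Ent(2)[OF loc_Ent(1)[OF c]] position_Ent(2)[OF loc_Ent(2)[OF c]] by simp_all
      show "sign (sg c) * ((?N ! i) (position (over_loc c)) * (?N ! j) (position (under_loc c)) +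
          (?N ! i) (position (under_loc c)) * (?N ! j) (position (over_loc c))) =
        (if fst (over_loc c) = i \<and> fst (under_loc c) = j then sign (sg c) else 0) +
          (if fst (over_loc c) = j \<and> fst (under_loc c) = i then sign (sg c) else 0)"
        unfolding N[OF ij(1)] N[OF ij(2)]
        by (cases "fst (over_loc c) = i"; cases "fst (under_loc c) = j"; cases "fst (over_loc c) = j";
          cases "fst (under_loc c) = i"; simp only: of_bool_eq mult_1_right mult_zero_right mult_zero_left add_0_left add_0_right simp_thms if_True if_False distrib_left)
    qed
    also have "\<dots> = core_seifert_matrix F $$ (i, j) + core_seifert_matrix F $$ (j, i)"
      unfolding seifert_matrix_entry[OF ij] seifert_matrix_entry[OF ij(2,1)] by (rule sum.distrib)
    finally show "mat n n (\<lambda>(i, j). \<Sum>a<?m. \<Sum>b<?m. (?N ! i) a * hyperbolic a b * (?N ! j) b) $$ (i, j) =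
        mat n n (\<lambda>(i, j). core_seifert_matrix F $$ (i, j) + core_seifert_matrix F $$ (j, i)) $$ (i, j)"
      using ij by simp
  qed simp_all
  ultimately show ?thesis using det_jump_matrix by (simp add: abs_mult)
qed

lemma regions_le:
  assumes "n > 0" "T \<subseteq> Q"
  shows "regions T \<le> num_classes X (smoothed T)"
  unfolding regions_def
proof (rule num_classes_surj(1)[OF finite_X, of "smoothed T" "region_rel T" region_of V])
  have "smoothed T \<subseteq> smoothed {} \<union> (\<Union>z\<in>T. merging z)" by (auto simp: smoothed_def split: if_splits)
  then show "conn (region_rel T) (region_of a) (region_of b)" if "(a, b) \<in> smoothed T" for a b
    using that by (intro region_of_joined[OF assms(2)]) blast
next
  show "\<exists>x\<in>X. conn (region_rel T) v (region_of x)" if "v \<in> V" for v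
    using region_of_edge[of v] region_edge_X[OF that] by (intro bexI[of _ "region_edge v"]) simp_all
  show "region_of ` X \<subseteq> V" using region_of_V by auto
qed

text \<open>At \<open>\<i>\<close> the loop value is 0, so only states with one loop count. They
  have one region, hence \<open>card T\<close> is fixed by \<open>loops_regions\<close> and the
  power of \<open>\<i>\<close> is a common factor.\<close>

theorem cmod_spin_bracket_ii:
  assumes "n > 0"
  shows "cmod (spin_bracket \<i>) =
    \<bar>det (mat n n (\<lambda>(i, j). core_seifert_matrix F $$ (i, j) + core_seifert_matrix F $$ (j, i)))\<bar>"
proof -
  let ?f = "\<lambda>T. (\<Prod>z\<in>T. twist z) * of_bool (n + card T = 2 * card Cs \<and> regions T = 1)"
  have VX: "V \<noteq> {}" using assms by (auto simp: V_def)
  have "(\<Prod>z\<in>T. if type_A z then \<i> else inverse \<i>) * (- (\<i> + inverse \<i>)) ^ (num_classes X (smoothed T) - 1) =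
      \<i> ^ (2 * card Cs - n) * of_int (?f T)" if "T \<in> Pow Q" for T
  proof -
    have T: "T \<subseteq> Q" using that by simp
    have pos: "regions T > 0" unfolding regions_def by (rule num_classes_pos[OF finite_V VX])
    have iff: "num_classes X (smoothed T) = 1 \<longleftrightarrow> n + card T = 2 * card Cs \<and> regions T = 1"
      using loops_regions(1)[OF assms T] regions_le[OF assms T] pos by linarith
    have "(\<Prod>z\<in>T. if type_A z then \<i> else inverse \<i>) = (\<Prod>z\<in>T. \<i> * of_int (twist z))"
      by (intro prod.cong refl) (simp add: twist_def)
    also have "\<dots> = \<i> ^ card T * of_int (\<Prod>z\<in>T. twist z)" by (simp add: prod.distrib)
    finally have p: "(\<Prod>z\<in>T. if type_A z then \<i> else inverse \<i>) = \<i> ^ card T * of_int (\<Prod>z\<in>T. twist z)" .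
    show ?thesis
    proof (cases "num_classes X (smoothed T) = 1")
      case True
      then have "n + card T = 2 * card Cs \<and> regions T = 1" using iff by simp
      then have "card T = 2 * card Cs - n" by linarith
      then show ?thesis using True iff p by simp
    next
      case False
      then have "num_classes X (smoothed T) - 1 > 0" using regions_le[OF assms T] pos by linarith
      then have "(- (\<i> + inverse \<i>)) ^ (num_classes X (smoothed T) - 1) = 0" by simp
      moreover have "?f T = 0" using False iff by (simp del: One_nat_def)
      ultimately show ?thesis by (simp only: mult_zero_right of_int_0)
    qed
  qed
  then have "spin_bracket \<i> = \<i> ^ (2 * card Cs - n) * of_int (\<Sum>T\<in>Pow Q. ?f T)"
    unfolding spin_bracket_def of_int_sum sum_distrib_left by (intro sum.cong refl)
  then have "cmod (spin_bracket \<i>) = of_int \<bar>\<Sum>T\<in>Pow Q. ?f T\<bar>"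
    by (simp add: norm_mult norm_power del: of_int_sum of_int_mult)
  then show ?thesis unfolding sum_trees[OF assms] by simp
qed

end

section \<open>Invariance under S-equivalence\<close>

text \<open>An enlargement adds two dimensions and multiplies the Gauss sum by \<open>q\<close>;
  dividing by a square root of \<open>q\<close> per dimension compensates for this.\<close>

definition normalized_gauss :: "nat \<Rightarrow> complex \<Rightarrow> complex \<Rightarrow> int mat \<Rightarrow> complex" where
  "normalized_gauss q e d W = gauss_sum q e (dim_row W) W / d ^ dim_row W"

definition abs_det_sym :: "int mat \<Rightarrow> int" where
  "abs_det_sym W = \<bar>det (W + transpose_mat W)\<bar>"

lemma congruent_form:
  fixes x :: "nat \<Rightarrow> int"
  assumes "V \<in> carrier_mat n n" "P \<in> carrier_mat n n"
  shows "(\<Sum>i<n. \<Sum>j<n. (transpose_mat P * V * P) $$ (i, j) * (x i * x j)) =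
    (\<Sum>a<n. \<Sum>b<n. V $$ (a, b) * ((\<Sum>i<n. P $$ (a, i) * x i) * (\<Sum>j<n. P $$ (b, j) * x j)))"
proof -
  have "(\<Sum>i<n. \<Sum>j<n. (transpose_mat P * V * P) $$ (i, j) * (x i * x j)) =
      (\<Sum>i<n. \<Sum>j<n. \<Sum>a<n. \<Sum>b<n. V $$ (a, b) * ((P $$ (a, i) * x i) * (P $$ (b, j) * x j)))"
    by (intro sum.cong refl) (simp add: congruent_entry[OF assms] sum_distrib_left sum_distrib_right mult_ac)
  also have "\<dots> = (\<Sum>i<n. \<Sum>a<n. \<Sum>j<n. \<Sum>b<n. V $$ (a, b) * ((P $$ (a, i) * x i) * (P $$ (b, j) * x j)))"
    by (intro sum.cong refl sum.swap)
  also have "\<dots> = (\<Sum>a<n. \<Sum>i<n. \<Sum>j<n. \<Sum>b<n. V $$ (a, b) * ((P $$ (a, i) * x i) * (P $$ (b, j) * x j)))"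
    by (rule sum.swap)
  also have "\<dots> = (\<Sum>a<n. \<Sum>i<n. \<Sum>b<n. \<Sum>j<n. V $$ (a, b) * ((P $$ (a, i) * x i) * (P $$ (b, j) * x j)))"
    by (intro sum.cong refl sum.swap)
  also have "\<dots> = (\<Sum>a<n. \<Sum>b<n. \<Sum>i<n. \<Sum>j<n. V $$ (a, b) * ((P $$ (a, i) * x i) * (P $$ (b, j) * x j)))"
    by (intro sum.cong refl sum.swap)
  also have "\<dots> = (\<Sum>a<n. \<Sum>b<n. V $$ (a, b) * ((\<Sum>i<n. P $$ (a, i) * x i) * (\<Sum>j<n. P $$ (b, j) * x j)))"
    unfolding sum_product by (simp only: sum_distrib_left)
  finally show ?thesis .
qed

lemma congruent_cases:
  assumes "congruent V W"
  obtains n P R where "V \<in> carrier_mat n n" "P \<in> carrier_mat n n" "R \<in> carrier_mat n n"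
    "P * R = 1\<^sub>m n" "R * P = 1\<^sub>m n" "W = transpose_mat P * V * P"
proof -
  obtain n P where V: "V \<in> carrier_mat n n" and P: "P \<in> carrier_mat n n" "invertible_mat P"
    and W: "W = transpose_mat P * V * P"
    using assms by (auto simp: congruent_def)
  obtain R where R: "P * R = 1\<^sub>m (dim_row P)" "R * P = 1\<^sub>m (dim_row R)"
    using P(2) unfolding invertible_mat_def inverts_mat_def by blast
  have "dim_col R = n" "dim_row R = n"
    using arg_cong[OF R(1), of dim_col] arg_cong[OF R(2), of dim_col] P(1) by auto
  then show thesis using that[OF V P(1), of R] R P(1) W by auto
qed

definition apply_mod :: "nat \<Rightarrow> nat \<Rightarrow> int mat \<Rightarrow> (nat \<Rightarrow> nat) \<Rightarrow> nat \<Rightarrow> nat" where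
  "apply_mod q n P x = restrict (\<lambda>a. nat ((\<Sum>j<n. P $$ (a, j) * int (x j)) mod int q)) {..<n}"

lemma apply_mod:
  assumes "q > 0"
  shows "a < n \<Longrightarrow> int (apply_mod q n P x a) = (\<Sum>j<n. P $$ (a, j) * int (x j)) mod int q"
    and "apply_mod q n P x \<in> {..<n} \<rightarrow>\<^sub>E {..<q}"
  using assms by (auto simp: apply_mod_def nat_less_iff)

lemma apply_mod_inverse:
  assumes "q > 0" "P \<in> carrier_mat n n" "R \<in> carrier_mat n n" "R * P = 1\<^sub>m n"
    and x: "x \<in> {..<n} \<rightarrow>\<^sub>E {..<q}"
  shows "apply_mod q n R (apply_mod q n P x) = x"
proof
  fix a show "apply_mod q n R (apply_mod q n P x) a = x a"
  proof (cases "a < n")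
    case True
    have "[(\<Sum>j<n. R $$ (a, j) * int (apply_mod q n P x j)) = (\<Sum>j<n. R $$ (a, j) * (\<Sum>k<n. P $$ (j, k) * int (x k)))] (mod int q)"
      by (intro cong_sum cong_mult cong_refl) (simp add: apply_mod[OF assms(1)] cong_def)
    also have "(\<Sum>j<n. R $$ (a, j) * (\<Sum>k<n. P $$ (j, k) * int (x k))) = (\<Sum>k<n. (\<Sum>j<n. R $$ (a, j) * P $$ (j, k)) * int (x k))"
      unfolding sum_distrib_left sum_distrib_right mult.assoc by (rule sum.swap)
    also have "\<dots> = (\<Sum>k<n. (R * P) $$ (a, k) * int (x k))"
      using assms(2,3) True by (intro sum.cong refl) (simp add: scalar_prod_def atLeast0LessThan)
    also have "\<dots> = (\<Sum>k<n. if k = a then int (x a) else 0)"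
      unfolding assms(4) using True by (intro sum.cong refl) auto
    also have "\<dots> = int (x a)" using True by simp
    finally have "int (apply_mod q n R (apply_mod q n P x) a) = int (x a) mod int q"
      unfolding apply_mod(1)[OF assms(1) True] cong_def .
    moreover have "x a < q" using x True by auto
    ultimately show ?thesis by simp
  next
    case False
    then show ?thesis using x by (auto simp: apply_mod_def PiE_def extensional_def)
  qed
qed

text \<open>The Gauss sum depends on vectors modulo \<open>q\<close> only, and an invertible integer
  matrix permutes these.\<close>

lemma normalized_gauss_congruent:
  assumes "primitive_root q e" "congruent V W"
  shows "normalized_gauss q e d V = normalized_gauss q e d W"
proof -
  have q: "q > 0" using assms(1) by (simp add: primitive_root_def)
  obtain n P R where *: "V \<in> carrier_mat n n" "P \<in> carrier_mat n n" "R \<in> carrier_mat n n"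
    "P * R = 1\<^sub>m n" "R * P = 1\<^sub>m n" and W: "W = transpose_mat P * V * P"
    using congruent_cases[OF assms(2)] by metis
  have "gauss_sum q e n W = gauss_sum q e n V"
    unfolding gauss_sum_def
  proof (rule sum.reindex_bij_witness[of _ "apply_mod q n R" "apply_mod q n P"])
    fix x assume x: "x \<in> {..<n} \<rightarrow>\<^sub>E {..<q}"
    show "apply_mod q n R (apply_mod q n P x) = x" "apply_mod q n P (apply_mod q n R x) = x"
      by (rule apply_mod_inverse[OF q]; use * x in simp)+
    show "apply_mod q n P x \<in> {..<n} \<rightarrow>\<^sub>E {..<q}" "apply_mod q n R x \<in> {..<n} \<rightarrow>\<^sub>E {..<q}"
      by (rule apply_mod(2)[OF q])+
    show "e powi (- (\<Sum>i<n. \<Sum>j<n. V $$ (i, j) * (int (apply_mod q n P x i) * int (apply_mod q n P x j)))) =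
        e powi (- (\<Sum>i<n. \<Sum>j<n. W $$ (i, j) * (int (x i) * int (x j))))"
    proof (rule primitive_root_cong[OF assms(1)])
      have "[- (\<Sum>i<n. \<Sum>j<n. V $$ (i, j) * (int (apply_mod q n P x i) * int (apply_mod q n P x j))) =
          - (\<Sum>i<n. \<Sum>j<n. W $$ (i, j) * (int (x i) * int (x j)))] (mod int q)"
        unfolding W congruent_form[OF *(1,2)] cong_minus_minus_iff
        by (intro cong_sum cong_mult cong_refl) (simp_all add: apply_mod(1)[OF q] cong_def)
      then show "- (\<Sum>i<n. \<Sum>j<n. V $$ (i, j) * (int (apply_mod q n P x i) * int (apply_mod q n P x j))) mod int q =
          - (\<Sum>i<n. \<Sum>j<n. W $$ (i, j) * (int (x i) * int (x j))) mod int q"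
        by (simp only: cong_def)
    qed
  qed
  moreover have "dim_row W = n" "dim_row V = n" using * W by auto
  ultimately show ?thesis by (simp add: normalized_gauss_def)
qed

lemma abs_det_sym_congruent:
  assumes "congruent V W"
  shows "abs_det_sym V = abs_det_sym W"
proof -
  obtain n P R where *: "V \<in> carrier_mat n n" "P \<in> carrier_mat n n" "R \<in> carrier_mat n n"
    "P * R = 1\<^sub>m n" and W: "W = transpose_mat P * V * P"
    using congruent_cases[OF assms] by metis
  have PT: "transpose_mat P \<in> carrier_mat n n" and VT: "transpose_mat V \<in> carrier_mat n n" using * by auto
  have VV: "V + transpose_mat V \<in> carrier_mat n n" using * by auto
  have "W + transpose_mat W = transpose_mat P * (V + transpose_mat V) * P"
  proof (rule eq_matI)
    fix i j assume "i < dim_row (transpose_mat P * (V + transpose_mat V) * P)" "j < dim_col (transpose_mat P * (V + transpose_mat V) * P)"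
    then have ij: "i < n" "j < n" using *(2) by auto
    have "(\<Sum>a<n. \<Sum>b<n. P $$ (a, j) * V $$ (a, b) * P $$ (b, i)) = (\<Sum>a<n. \<Sum>b<n. P $$ (b, j) * V $$ (b, a) * P $$ (a, i))"
      by (rule sum.swap)
    also have "\<dots> = (\<Sum>a<n. \<Sum>b<n. P $$ (a, i) * transpose_mat V $$ (a, b) * P $$ (b, j))"
      using *(1) by (intro sum.cong refl) simp
    finally have "W $$ (j, i) = (\<Sum>a<n. \<Sum>b<n. P $$ (a, i) * transpose_mat V $$ (a, b) * P $$ (b, j))"
      unfolding W congruent_entry[OF *(1,2) ij(2,1)] .
    moreover have "W $$ (i, j) = (\<Sum>a<n. \<Sum>b<n. P $$ (a, i) * V $$ (a, b) * P $$ (b, j))"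
      unfolding W congruent_entry[OF *(1,2) ij] ..
    moreover have "(transpose_mat P * (V + transpose_mat V) * P) $$ (i, j) =
        (\<Sum>a<n. \<Sum>b<n. P $$ (a, i) * V $$ (a, b) * P $$ (b, j) + P $$ (a, i) * transpose_mat V $$ (a, b) * P $$ (b, j))"
      unfolding congruent_entry[OF VV *(2) ij] using *(1)
      by (intro sum.cong refl) (simp add: distrib_left distrib_right)
    moreover have "(W + transpose_mat W) $$ (i, j) = W $$ (i, j) + W $$ (j, i)"
      using ij *(2) unfolding W by simp
    ultimately show "(W + transpose_mat W) $$ (i, j) = (transpose_mat P * (V + transpose_mat V) * P) $$ (i, j)"
      by (simp add: sum.distrib)
  qed (use * W in auto)
  moreover have "det (transpose_mat P * (V + transpose_mat V) * P) = det P * det (V + transpose_mat V) * det P"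
    using det_mult[OF mult_carrier_mat[OF PT VV] *(2)] det_mult[OF PT VV] det_transpose[OF *(2)] by simp
  moreover have "\<bar>det P\<bar> = 1"
  proof -
    have "det P * det R = 1" using det_mult[OF *(2,3)] *(4) by simp
    then have "det P dvd 1" by (rule dvdI[OF sym])
    then show ?thesis by simp
  qed
  ultimately show ?thesis by (simp add: abs_det_sym_def abs_mult)
qed

text \<open>Row and column enlargements have the same symmetric part, which is recorded by adding
  opposite entries; so both are treated together.\<close>

lemma enlargement_entries:
  assumes "elementary_enlargement V W"
  obtains n \<xi> where "V \<in> carrier_mat n n" "W \<in> carrier_mat (Suc (Suc n)) (Suc (Suc n))"
    "\<And>i j. i < n \<Longrightarrow> j < n \<Longrightarrow> W $$ (i, j) = V $$ (i, j)"
    "\<And>i. i < n \<Longrightarrow> W $$ (i, n) + W $$ (n, i) = \<xi> i"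
    "\<And>i. i < n \<Longrightarrow> W $$ (i, Suc n) + W $$ (Suc n, i) = 0"
    "W $$ (n, n) = 0" "W $$ (Suc n, Suc n) = 0" "W $$ (n, Suc n) + W $$ (Suc n, n) = 1"
  using assms
proof cases
  case (column n \<xi>)
  show thesis by (rule that[of n "\<lambda>i. \<xi> $ i"]) (use column in auto)
next
  case (row n \<xi>)
  show thesis by (rule that[of n "\<lambda>i. \<xi> $ i"]) (use row in auto)
qed

text \<open>The new coordinates enter as \<open>lin x * \<alpha> + \<alpha> * \<beta>\<close>.
  Summing over \<open>\<beta>\<close> forces \<open>\<alpha> = 0\<close> and yields the factor
  \<open>q\<close>.\<close>

lemma normalized_gauss_enlargement:
  assumes "primitive_root q e" "elementary_enlargement V W" "d ^ 2 = of_nat q"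
  shows "normalized_gauss q e d V = normalized_gauss q e d W"
proof -
  have q: "q > 0" using assms(1) by (simp add: primitive_root_def)
  note e0 = primitive_root_nonzero[OF assms(1)]
  obtain n \<xi> where V: "V \<in> carrier_mat n n" and W: "W \<in> carrier_mat (Suc (Suc n)) (Suc (Suc n))"
    and E: "\<And>i j. i < n \<Longrightarrow> j < n \<Longrightarrow> W $$ (i, j) = V $$ (i, j)"
    "\<And>i. i < n \<Longrightarrow> W $$ (i, n) + W $$ (n, i) = \<xi> i"
    "\<And>i. i < n \<Longrightarrow> W $$ (i, Suc n) + W $$ (Suc n, i) = 0"
    "W $$ (n, n) = 0" "W $$ (Suc n, Suc n) = 0" "W $$ (n, Suc n) + W $$ (Suc n, n) = 1"
    using enlargement_entries[OF assms(2)] by metis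
  let ?G = "\<lambda>n. {..<n} \<rightarrow>\<^sub>E {..<q}"
  define Vf where "Vf x = (\<Sum>i<n. \<Sum>j<n. V $$ (i, j) * (int (x i) * int (x j)))" for x :: "nat \<Rightarrow> nat"
  define lin where "lin x = (\<Sum>i<n. \<xi> i * int (x i))" for x :: "nat \<Rightarrow> nat"
  let ?up = "\<lambda>(x, \<alpha>, \<beta>). x(n := \<alpha>, Suc n := \<beta>)"
  have form: "(\<Sum>i<Suc (Suc n). \<Sum>j<Suc (Suc n). W $$ (i, j) * (int (z i) * int (z j))) =
      Vf x + lin x * int \<alpha> + int \<alpha> * int \<beta>" if z: "z = x(n := \<alpha>, Suc n := \<beta>)" for x z \<alpha> \<beta>
  proof -
    have zi: "z i = x i" if "i < n" for i using that by (simp add: z)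
    have zn: "z n = \<alpha>" "z (Suc n) = \<beta>" by (simp_all add: z)
    have "(\<Sum>i<Suc (Suc n). \<Sum>j<Suc (Suc n). W $$ (i, j) * (int (z i) * int (z j))) =
        (\<Sum>i<n. \<Sum>j<n. W $$ (i, j) * (int (z i) * int (z j))) +
        (\<Sum>i<n. (W $$ (i, n) + W $$ (n, i)) * (int (z i) * int \<alpha>)) +
        (\<Sum>i<n. (W $$ (i, Suc n) + W $$ (Suc n, i)) * (int (z i) * int \<beta>)) +
        (W $$ (n, Suc n) + W $$ (Suc n, n)) * (int \<alpha> * int \<beta>)"
      using E(4,5) by (simp add: zn sum.distrib algebra_simps)
    also have "(\<Sum>i<n. \<Sum>j<n. W $$ (i, j) * (int (z i) * int (z j))) = Vf x"
      unfolding Vf_def by (intro sum.cong refl) (simp add: E zi)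
    also have "(\<Sum>i<n. (W $$ (i, n) + W $$ (n, i)) * (int (z i) * int \<alpha>)) = lin x * int \<alpha>"
      unfolding lin_def sum_distrib_right by (intro sum.cong refl) (simp add: E zi)
    also have "(\<Sum>i<n. (W $$ (i, Suc n) + W $$ (Suc n, i)) * (int (z i) * int \<beta>)) = 0"
      by (intro sum.neutral) (simp add: E)
    finally show ?thesis using E(6) by simp
  qed
  have "gauss_sum q e (Suc (Suc n)) W =
      (\<Sum>(x, \<alpha>, \<beta>)\<in>?G n \<times> {..<q} \<times> {..<q}. e powi (- (Vf x + lin x * int \<alpha> + int \<alpha> * int \<beta>)))"
    unfolding gauss_sum_def
  proof (rule sum.reindex_bij_witness[of _ ?up "\<lambda>z. (restrict z {..<n}, z n, z (Suc n))"])
    fix z assume z: "z \<in> ?G (Suc (Suc n))"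
    show zz: "?up (restrict z {..<n}, z n, z (Suc n)) = z"
    proof
      fix i
      consider "i < n" | "i = n" | "i = Suc n" | "\<not> i < Suc (Suc n)" by linarith
      then show "?up (restrict z {..<n}, z n, z (Suc n)) i = z i"
      proof cases
        case 4
        then have "z i = undefined" using z by (auto simp: PiE_def extensional_def)
        then show ?thesis using 4 by simp
      qed simp_all
    qed
    have zq: "z i < q" if "i < Suc (Suc n)" for i using PiE_mem[OF z, of i] that by simp
    have "restrict z {..<n} \<in> ?G n" by (rule restrict_PiE_iff[THEN iffD2]) (use zq in simp)
    then show "(restrict z {..<n}, z n, z (Suc n)) \<in> ?G n \<times> {..<q} \<times> {..<q}" using zq[of n] zq[of "Suc n"] by simp
    show "(case (restrict z {..<n}, z n, z (Suc n)) of
        (x, \<alpha>, \<beta>) \<Rightarrow> e powi (- (Vf x + lin x * int \<alpha> + int \<alpha> * int \<beta>))) =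
        e powi (- (\<Sum>i<Suc (Suc n). \<Sum>j<Suc (Suc n). W $$ (i, j) * (int (z i) * int (z j))))"
      unfolding prod.case form[OF zz[symmetric, unfolded prod.case]] ..
  next
    fix t assume "t \<in> ?G n \<times> {..<q} \<times> {..<q}"
    then obtain x \<alpha> \<beta> where t: "t = (x, \<alpha>, \<beta>)" "x \<in> ?G n" "\<alpha> < q" "\<beta> < q" by auto
    have xo: "x i = undefined" if "\<not> i < n" for i using PiE_arb[OF t(2)] that by simp
    have xq: "x i < q" if "i < n" for i using PiE_mem[OF t(2)] that by simp
    have "restrict (x(n := \<alpha>, Suc n := \<beta>)) {..<n} = x"
      using xo by (simp add: fun_eq_iff)
    then show "(restrict (?up t) {..<n}, ?up t n, ?up t (Suc n)) = t" by (simp add: t)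
    show "?up t \<in> ?G (Suc (Suc n))" unfolding t(1) prod.case
      by (rule PiE_I) (use xq xo t(3,4) in \<open>auto simp: less_Suc_eq\<close>)
  qed
  also have "\<dots> = (\<Sum>x\<in>?G n. \<Sum>(\<alpha>, \<beta>)\<in>{..<q} \<times> {..<q}. e powi (- (Vf x + lin x * int \<alpha> + int \<alpha> * int \<beta>)))"
    by (simp add: sum.cartesian_product)
  also have "\<dots> = (\<Sum>x\<in>?G n. e powi (- Vf x) * of_nat q)"
  proof (intro sum.cong refl)
    fix x
    have "(\<Sum>(\<alpha>, \<beta>)\<in>{..<q} \<times> {..<q}. e powi (- (Vf x + lin x * int \<alpha> + int \<alpha> * int \<beta>))) =
        e powi (- Vf x) * (\<Sum>(\<alpha>, \<beta>)\<in>{..<q} \<times> {..<q}. e powi (- 1 * (int \<alpha> * int \<beta>) + (- lin x) * int \<alpha> + 0 * int \<beta>))"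
      unfolding sum_distrib_left
    proof (intro sum.cong refl)
      fix p :: "nat \<times> nat"
      obtain \<alpha> \<beta> where p: "p = (\<alpha>, \<beta>)" by force
      have "- (Vf x + lin x * int \<alpha> + int \<alpha> * int \<beta>) = - Vf x + (- 1 * (int \<alpha> * int \<beta>) + (- lin x) * int \<alpha> + 0 * int \<beta>)" by simp
      then show "(case p of (\<alpha>, \<beta>) \<Rightarrow> e powi (- (Vf x + lin x * int \<alpha> + int \<alpha> * int \<beta>))) =
          e powi (- Vf x) * (case p of (\<alpha>, \<beta>) \<Rightarrow> e powi (- 1 * (int \<alpha> * int \<beta>) + (- lin x) * int \<alpha> + 0 * int \<beta>))"
        unfolding p prod.case by (simp only: power_int_add[OF disjI1, OF e0])
    qed
    also have "(\<Sum>(\<alpha>, \<beta>)\<in>{..<q} \<times> {..<q}. e powi (- 1 * (int \<alpha> * int \<beta>) + (- lin x) * int \<alpha> + 0 * int \<beta>)) = of_nat q"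
      by (subst gauss_pair_sum[OF assms(1)]) simp_all
    finally show "(\<Sum>(\<alpha>, \<beta>)\<in>{..<q} \<times> {..<q}. e powi (- (Vf x + lin x * int \<alpha> + int \<alpha> * int \<beta>))) =
        e powi (- Vf x) * of_nat q" .
  qed
  also have "\<dots> = gauss_sum q e n V * d ^ 2" by (simp add: gauss_sum_def Vf_def sum_distrib_right assms(3))
  finally have "gauss_sum q e (Suc (Suc n)) W = gauss_sum q e n V * d ^ 2" .
  moreover have "d \<noteq> 0" using assms(3) q by auto
  ultimately show ?thesis using V W by (simp add: normalized_gauss_def power2_eq_square)
qed

text \<open>The last column of \<open>W + transpose_mat W\<close> has a single entry 1, in row
  \<open>n\<close>. Expanding there leaves a block triangular matrix with diagonal blocks
  \<open>V + transpose_mat V\<close> and 1.\<close>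

lemma abs_det_sym_enlargement:
  assumes "elementary_enlargement V W"
  shows "abs_det_sym V = abs_det_sym W"
proof -
  obtain n \<xi> where V: "V \<in> carrier_mat n n" and W: "W \<in> carrier_mat (Suc (Suc n)) (Suc (Suc n))"
    and E: "\<And>i j. i < n \<Longrightarrow> j < n \<Longrightarrow> W $$ (i, j) = V $$ (i, j)"
    "\<And>i. i < n \<Longrightarrow> W $$ (i, n) + W $$ (n, i) = \<xi> i"
    "\<And>i. i < n \<Longrightarrow> W $$ (i, Suc n) + W $$ (Suc n, i) = 0"
    "W $$ (n, n) = 0" "W $$ (Suc n, Suc n) = 0" "W $$ (n, Suc n) + W $$ (Suc n, n) = 1"
    using enlargement_entries[OF assms(1)] by metis
  let ?S = "V + transpose_mat V"
  have S: "?S \<in> carrier_mat n n" using V by simp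
  let ?T = "bordered1 ?S (\<lambda>_. 0) \<xi> 1"
  have W': "W + transpose_mat W \<in> carrier_mat (Suc (Suc n)) (Suc (Suc n))" using W by simp
  have col: "(W + transpose_mat W) $$ (i, Suc n) = of_bool (i = n)" if i: "i < Suc (Suc n)" for i
  proof -
    consider "i < n" | "i = n" | "i = Suc n" using i by linarith
    then show ?thesis using W E by cases simp_all
  qed
  have "det (W + transpose_mat W) = (\<Sum>i<Suc (Suc n). (W + transpose_mat W) $$ (i, Suc n) * cofactor (W + transpose_mat W) i (Suc n))"
    by (rule laplace_expansion_column[OF W']) simp
  also have "\<dots> = (\<Sum>i<Suc (Suc n). if i = n then cofactor (W + transpose_mat W) n (Suc n) else 0)"
    by (intro sum.cong refl) (simp add: col)
  also have "\<dots> = cofactor (W + transpose_mat W) n (Suc n)" by simp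
  also have "\<dots> = - det (mat_delete (W + transpose_mat W) n (Suc n))" by (simp add: cofactor_def)
  also have "mat_delete (W + transpose_mat W) n (Suc n) = ?T"
  proof (rule eq_matI)
    fix i j assume "i < dim_row ?T" "j < dim_col ?T"
    then have ij: "i < Suc n" "j < Suc n" using V by (auto simp: bordered1_def)
    have D: "mat_delete (W + transpose_mat W) n (Suc n) $$ (i, j) =
        (let i' = if i < n then i else Suc n in W $$ (i', j) + W $$ (j, i'))"
      using ij W by (auto simp: mat_delete_def Let_def less_Suc_eq)
    consider "i < n" "j < n" | "i < n" "j = n" | "i = n" "j < n" | "i = n" "j = n" using ij by linarith
    then show "mat_delete (W + transpose_mat W) n (Suc n) $$ (i, j) = ?T $$ (i, j)"
      unfolding D using V by cases (use E in \<open>simp_all add: bordered1_def add.commute\<close>)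
  qed (use V W in \<open>auto simp: bordered1_def\<close>)
  also have "det ?T = det ?S"
  proof -
    have "transpose_mat ?T = bordered1 (transpose_mat ?S) \<xi> (\<lambda>_. 0) 1"
      by (rule eq_matI) (use V in \<open>auto simp: bordered1_def\<close>)
    moreover obtain C where "\<And>a x. det (bordered1 (transpose_mat ?S) \<xi> a x) = (\<Sum>i<n. a i * C i) + x * det (transpose_mat ?S)"
      using det_bordered1[of "transpose_mat ?S" n \<xi>] S by (metis transpose_carrier_mat)
    ultimately have "det (transpose_mat ?T) = det (transpose_mat ?S)" by simp
    then show ?thesis using det_transpose[OF S] det_transpose[OF bordered1_carrier[OF S]] by metis
  qed
  finally show ?thesis by (simp add: abs_det_sym_def)
qed

lemma S_equivalent_invariant:
  assumes "\<And>V W. congruent V W \<Longrightarrow> f V = f W" "\<And>V W. elementary_enlargement V W \<Longrightarrow> f V = f W"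
    and "S_equivalent V W"
  shows "f V = f W"
  using assms(3) unfolding S_equivalent_def
  by (induction rule: equivclp_induct) (use assms(1,2) in metis)+

section \<open>Divisibility\<close>

text \<open>One integer polynomial is evaluated both at a Laurent polynomial and at complex numbers,
  hence the general ring.\<close>

definition int_eval :: "int poly \<Rightarrow> 'a :: comm_ring_1 \<Rightarrow> 'a" where
  "int_eval p x = poly (map_poly of_int p) x"

lemma int_eval_pCons [simp]: "int_eval (pCons a p) x = of_int a + x * int_eval p x"
  by (simp add: int_eval_def map_poly_pCons)

lemma int_eval_0 [simp]: "int_eval 0 x = 0"
  by (simp add: int_eval_def)

lemma int_eval_1 [simp]: "int_eval 1 x = 1"
  by (simp add: one_pCons)

lemma int_eval_add [simp]: "int_eval (p + r) x = int_eval p x + int_eval r x"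
  by (induction p r rule: poly_induct2) (simp_all add: algebra_simps)

lemma int_eval_minus [simp]: "int_eval (- p) x = - int_eval p x"
  using int_eval_add[of p "- p" x] by (simp add: eq_neg_iff_add_eq_0 add.commute)

lemma int_eval_diff [simp]: "int_eval (p - r) x = int_eval p x - int_eval r x"
  using int_eval_add[of p "- r" x] by simp

lemma int_eval_smult [simp]: "int_eval (smult c p) x = of_int c * int_eval p x"
  by (induction p) (simp_all add: algebra_simps)

lemma int_eval_mult [simp]: "int_eval (p * r) x = int_eval p x * int_eval r x"
  by (induction p) (simp_all add: algebra_simps)

lemma int_eval_power [simp]: "int_eval (p ^ k) x = int_eval p x ^ k"
  by (induction k) simp_all

lemma int_eval_sum [simp]: "int_eval (\<Sum>i\<in>A. f i) x = (\<Sum>i\<in>A. int_eval (f i) x)"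
  by (induction A rule: infinite_finite_induct) simp_all

lemma int_eval_of_int: "int_eval p (of_int k) = of_int (poly p k)"
  by (induction p) simp_all

lemma degree_le_if_int_eval_zero:
  fixes Z :: "complex set"
  assumes "p \<noteq> 0" "\<And>x. x \<in> Z \<Longrightarrow> int_eval p x = 0"
  shows "card Z \<le> degree p"
proof -
  let ?p = "map_poly of_int p :: complex poly"
  have p: "?p \<noteq> 0" using assms(1) by (simp add: map_poly_eq_0_iff)
  have "card Z \<le> card {x. poly ?p x = 0}"
    using assms(2) poly_roots_finite[OF p] by (intro card_mono) (auto simp: int_eval_def)
  also have "\<dots> \<le> degree ?p" by (rule card_poly_roots_bound[OF p])
  also have "\<dots> \<le> degree p" by (simp add: degree_map_poly)
  finally show ?thesis .
qed

text \<open>Pseudo-division by a monic polynomial is division over the integers, and the remainder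
  has more zeros than its degree allows.\<close>

lemma monic_dvd_if_roots:
  fixes Z :: "complex set"
  assumes "lead_coeff H = 1" "degree H \<le> card Z" "\<And>x. x \<in> Z \<Longrightarrow> int_eval H x = 0"
    and "\<And>x. x \<in> Z \<Longrightarrow> int_eval p x = 0"
  shows "H dvd p"
proof -
  obtain K r where Kr: "pseudo_divmod p H = (K, r)" by force
  have H: "H \<noteq> 0" using assms(1) by auto
  have p: "p = H * K + r" and r: "r = 0 \<or> degree r < degree H"
    using pseudo_divmod[OF H Kr] assms(1) by auto
  have "r = 0"
  proof (rule ccontr)
    assume "r \<noteq> 0"
    moreover have "int_eval r x = 0" if "x \<in> Z" for x
      using arg_cong[OF p, of "\<lambda>p. int_eval p x"] assms(3,4)[OF that] by simp
    ultimately have "card Z \<le> degree r" by (rule degree_le_if_int_eval_zero)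
    then show False using \<open>r \<noteq> 0\<close> r assms(2) by simp
  qed
  then show ?thesis using p by simp
qed

text \<open>Taylor expansion at 1 with step -2; the terms of order two and higher are divisible by
  4.\<close>

lemma poly_at_minus_1_mod_4: "[poly p (- 1) = poly p 1 - 2 * poly (pderiv p) 1] (mod (4 :: int))"
proof (induction p)
  case (pCons a p)
  have "poly p 1 mod 2 = poly p (-1) mod 2" using pCons.IH by (auto simp: cong_iff_dvd_diff) presburger
  with pCons.IH show ?case by (simp add: pderiv_pCons cong_iff_dvd_diff) presburger
qed simp

text \<open>Since \<open>- (y + 1/y)\<close> is \<open>- (1 + y^2)\<close> divided by
  \<open>y\<close>, extracting one \<open>y\<close> per factor leaves this exponent of
  \<open>y\<close>. \<open>R\<close> is a shift that keeps the subtraction from truncating and makes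
  the exponent even, so that the state sum is a polynomial in \<open>y^2\<close>.\<close>

definition state_exponent :: "gauss_code \<Rightarrow> nat \<Rightarrow> nat set \<Rightarrow> nat" where
  "state_exponent w R S = card S + R - (loops w S - 1)"

definition state_poly :: "gauss_code \<Rightarrow> nat \<Rightarrow> int poly" where
  "state_poly w R = (\<Sum>S\<in>Pow (labels w). [:0, 1:] ^ (state_exponent w R S div 2) * (- [:1, 1:]) ^ (loops w S - 1))"

lemma int_eval_state_poly:
  fixes y z :: "'a :: comm_ring_1"
  assumes "y * z = 1"
    and "\<And>S. S \<subseteq> labels w \<Longrightarrow> loops w S - 1 \<le> R \<and> even (state_exponent w R S)"
  shows "int_eval (state_poly w R) (y ^ 2) = (\<Sum>S\<in>Pow (labels w). y ^ (card S + R) * (- (y + z)) ^ (loops w S - 1))"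
proof -
  have "int_eval (state_poly w R) (y ^ 2) =
      (\<Sum>S\<in>Pow (labels w). (y ^ 2) ^ (state_exponent w R S div 2) * (- (1 + y ^ 2)) ^ (loops w S - 1))"
    by (simp add: state_poly_def)
  also have "\<dots> = (\<Sum>S\<in>Pow (labels w). y ^ (card S + R) * (- (y + z)) ^ (loops w S - 1))"
  proof (intro sum.cong refl)
    fix S assume "S \<in> Pow (labels w)"
    then have S: "loops w S - 1 \<le> R" "even (state_exponent w R S)" using assms(2)[of S] by auto
    have "- (1 + y ^ 2) = y * (- (y + z))" using assms(1) by (simp add: algebra_simps power2_eq_square)
    then have "(y ^ 2) ^ (state_exponent w R S div 2) * (- (1 + y ^ 2)) ^ (loops w S - 1) =
        y ^ state_exponent w R S * (y ^ (loops w S - 1) * (- (y + z)) ^ (loops w S - 1))"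
      using S(2) by (simp add: power_mult_distrib flip: power_mult)
    also have "\<dots> = y ^ (state_exponent w R S + (loops w S - 1)) * (- (y + z)) ^ (loops w S - 1)"
      by (simp only: power_add mult.assoc)
    also have "state_exponent w R S + (loops w S - 1) = card S + R" using S(1) by (simp add: state_exponent_def)
    finally show "(y ^ 2) ^ (state_exponent w R S div 2) * (- (1 + y ^ 2)) ^ (loops w S - 1) =
        y ^ (card S + R) * (- (y + z)) ^ (loops w S - 1)" .
  qed
  finally show ?thesis .
qed

lemma state_poly_at_1:
  assumes w: "matched w" "even (card (labels w))" "writhe w = 0"
    and "\<And>S. S \<subseteq> labels w \<Longrightarrow> loops w S - 1 \<le> R \<and> even (state_exponent w R S)"
  shows "poly (state_poly w R) 1 = 1"
    and "4 * poly (pderiv (state_poly w R)) 1 = int (2 * R + card (labels w))"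
proof -
  have s: "(\<Sum>S\<in>Pow (labels w). (-2 :: int) ^ (loops w S - 1)) = 1"
    "(\<Sum>S\<in>Pow (labels w). (2 * int (card S) - int (card (labels w))) * (-2) ^ (loops w S - 1)) = 0"
    using state_sums_at_1[OF w(1)] w(2,3) by simp_all
  show "poly (state_poly w R) 1 = 1" using s(1) by (simp add: state_poly_def poly_sum)
  have d: "4 * poly (pderiv ([:0, 1:] ^ (state_exponent w R S div 2) * (- [:1, 1:]) ^ k)) 1 =
      (2 * int (card S) + 2 * int R) * (-2) ^ k"
    if "S \<subseteq> labels w" "k = loops w S - 1" for S k
  proof -
    have S: "k \<le> R" "even (state_exponent w R S)" using assms(4)[OF that(1)] that(2) by auto
    obtain h where h: "state_exponent w R S = 2 * h" using S(2) by (elim evenE)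
    have hk: "int (card S) + int R = 2 * int h + int k"
      using h S(1) unfolding state_exponent_def that(2) by linarith
    \<comment> \<open>The factor 4 avoids halves: differentiating \<open>(- (1 + u)) ^ k\<close> at
      1 gives \<open>k / 2\<close> times its value.\<close>
    have "4 * poly (pderiv ([:0, 1:] ^ h * (- [:1, 1:]) ^ k)) 1 = (4 * int h + 2 * int k) * (-2 :: int) ^ k"
      by (cases h; cases k) (simp_all add: pderiv_mult pderiv_power_Suc pderiv_pCons algebra_simps del: power_Suc, simp_all add: algebra_simps)
    moreover have "2 * int (card S) + 2 * int R = 4 * int h + 2 * int k" using hk by simp
    moreover have "state_exponent w R S div 2 = h" using h by simp
    ultimately show ?thesis by (simp only:)
  qed
  have "4 * poly (pderiv (state_poly w R)) 1 = (\<Sum>S\<in>Pow (labels w). 4 * poly (pderiv ([:0, 1:] ^ (state_exponent w R S div 2) * (- [:1, 1:]) ^ (loops w S - 1))) 1)"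
    by (simp add: state_poly_def poly_sum higher_pderiv_sum[of 1, simplified] sum_distrib_left)
  also have "\<dots> = (\<Sum>S\<in>Pow (labels w). (2 * int (card S) + 2 * int R) * (-2) ^ (loops w S - 1))"
    by (intro sum.cong refl d) auto
  also have "\<dots> = (\<Sum>S\<in>Pow (labels w). (2 * int (card S) - int (card (labels w))) * (-2) ^ (loops w S - 1) +
      (2 * int R + int (card (labels w))) * (-2) ^ (loops w S - 1))"
    by (intro sum.cong refl) (simp add: algebra_simps)
  also have "\<dots> = int (2 * R + card (labels w))"
    unfolding sum.distrib s(2) sum_distrib_left[symmetric] s(1) by simp
  finally show "4 * poly (pderiv (state_poly w R)) 1 = int (2 * R + card (labels w))" .
qed

text \<open>The points where \<open>spin_bracket_gauss\<close> applies, with the number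
  \<open>q\<close> of colours and the root of unity \<open>e\<close> belonging to them.\<close>

definition gauss_point :: "nat \<Rightarrow> complex \<Rightarrow> complex \<Rightarrow> bool" where
  "gauss_point q e y \<longleftrightarrow> y \<noteq> 0 \<and> (y + inverse y) ^ 2 = of_nat q \<and> primitive_root q e \<and>
     (q = 1 \<and> e = 1 \<or> q = 2 \<and> y ^ 8 = 1 \<and> e = y powi (-4) \<or> q = 3 \<and> y ^ 6 = -1 \<and> e = y powi (-4))"

text \<open>Everything known about the polynomial at the roots of the divisor depends only on
  \<open>M\<close> and \<open>W\<close>, at -1 up to sign; the code \<open>w\<close> enters through
  \<open>f_poly\<close> alone.\<close>

definition knot_poly :: "nat \<Rightarrow> gauss_code \<Rightarrow> int mat \<Rightarrow> int poly \<Rightarrow> bool" where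
  "knot_poly M w W G \<longleftrightarrow> poly G 1 = 1 \<and> poly (pderiv G) 1 = int M \<and>
     int_eval G (A_var ^ 4) = A_var ^ (4 * M) * f_poly w \<and> \<bar>poly G (- 1)\<bar> = abs_det_sym W \<and>
     (\<forall>q e y. gauss_point q e y \<longrightarrow>
        int_eval G (y ^ 2) = y ^ (2 * M) * normalized_gauss q e (- (y + inverse y)) W)"

section \<open>The state polynomial of the boundary\<close>

context surface begin

text \<open>Of the four crossings at a crossing of cores two are positive and two negative.\<close>

lemma writhe_boundary: "n > 0 \<Longrightarrow> writhe (boundary F) = 0"
proof -
  assume n: "n > 0"
  have "writhe (boundary F) = (\<Sum>z\<in>Q. sign (crossing_sign (boundary F) (lab z)))"
    unfolding writhe_labels[OF boundary_matched] labels_boundary[OF n]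
    by (rule sum.reindex_cong[OF inj_on_subset[OF inj_lab]]) simp_all
  also have "\<dots> = (\<Sum>c\<in>Cs. \<Sum>d\<in>UNIV. \<Sum>e\<in>UNIV. sign (sg c = ((d :: bool) = e)))"
    unfolding sum_Q by (intro sum.cong refl) (simp add: lab_def sign_boundary[OF n] Q_def)
  also have "\<dots> = 0" by (rule sum.neutral, rule ballI) (simp add: UNIV_bool sign_def)
  finally show ?thesis .
qed

lemma card_labels_boundary: "n > 0 \<Longrightarrow> card (labels (boundary F)) = 4 * card Cs"
  using card_image[OF inj_on_subset[OF inj_lab], of Q] by (simp add: labels_boundary card_Q)

definition A_states :: "(nat \<times> bool \<times> bool) set \<Rightarrow> nat set" where
  "A_states T = lab ` {z \<in> Q. (z \<in> T) = type_A z}"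

definition merged :: "nat set \<Rightarrow> (nat \<times> bool \<times> bool) set" where
  "merged S = {z \<in> Q. (lab z \<in> S) = type_A z}"

lemma lab_A_states: "z \<in> Q \<Longrightarrow> lab z \<in> A_states T \<longleftrightarrow> (z \<in> T) = type_A z"
  unfolding A_states_def inj_image_mem_iff[OF inj_lab] by simp

lemma merged_A_states: "T \<subseteq> Q \<Longrightarrow> merged (A_states T) = T"
  using lab_A_states by (auto simp: merged_def)

lemma A_states_merged: "S \<subseteq> lab ` Q \<Longrightarrow> A_states (merged S) = S"
  using lab_A_states unfolding A_states_def merged_def by auto

text \<open>Two of the four crossings at each crossing of cores are of type A.
  \<open>A_states T\<close> contains those of type A in \<open>T\<close> and those of the other type
  outside \<open>T\<close>.\<close>

lemma card_A_states:
  assumes "T \<subseteq> Q"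
  shows "card (A_states T) + card {z \<in> T. \<not> type_A z} = card {z \<in> T. type_A z} + 2 * card Cs"
proof -
  have fin: "finite T" using assms by (rule finite_subset) simp
  have "card {z \<in> Q. \<not> type_A z} = (\<Sum>z\<in>Q. of_bool (\<not> type_A z))" by (simp add: Collect_conj_eq Int_commute)
  also have "\<dots> = (\<Sum>c\<in>Cs. 2)"
    unfolding sum_Q by (intro sum.cong refl) (simp add: UNIV_bool type_A_def)
  finally have B: "card {z \<in> Q. \<not> type_A z} = 2 * card Cs" by simp
  have "card (A_states T) = card {z \<in> Q. (z \<in> T) = type_A z}"
    unfolding A_states_def by (rule card_image[OF inj_on_subset[OF inj_lab]]) simp
  also have "{z \<in> Q. (z \<in> T) = type_A z} = {z \<in> T. type_A z} \<union> ({z \<in> Q. \<not> type_A z} - {z \<in> T. \<not> type_A z})"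
    using assms by auto
  also have "card \<dots> = card {z \<in> T. type_A z} + (card {z \<in> Q. \<not> type_A z} - card {z \<in> T. \<not> type_A z})"
  proof (subst card_Un_disjoint)
    have "{z \<in> T. \<not> type_A z} \<subseteq> {z \<in> Q. \<not> type_A z}" using assms by auto
    then show "card {z \<in> T. type_A z} + card ({z \<in> Q. \<not> type_A z} - {z \<in> T. \<not> type_A z}) =
        card {z \<in> T. type_A z} + (card {z \<in> Q. \<not> type_A z} - card {z \<in> T. \<not> type_A z})"
      by (subst card_Diff_subset) (use fin in auto)
  qed (use fin in auto)
  finally have "card (A_states T) = card {z \<in> T. type_A z} + (card {z \<in> Q. \<not> type_A z} - card {z \<in> T. \<not> type_A z})" .
  moreover have "card {z \<in> T. \<not> type_A z} \<le> card {z \<in> Q. \<not> type_A z}"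
    by (rule card_mono) (use assms in auto)
  ultimately show ?thesis using B by linarith
qed

lemma loops_A_states: "n > 0 \<Longrightarrow> loops (boundary F) (A_states T) = num_classes X (smoothed T)"
  unfolding A_states_def by (rule loops_boundary)

lemma loops_parity:
  assumes "n > 0" "S \<subseteq> labels (boundary F)"
  shows "loops (boundary F) S > 0" "loops (boundary F) S \<le> card X" "even (loops (boundary F) S + card S + n + 1)"
proof -
  define T where "T = merged S"
  have T: "T \<subseteq> Q" by (auto simp: T_def merged_def)
  have S: "S = A_states T" using A_states_merged assms by (simp add: T_def labels_boundary)
  have fin: "finite T" using T by (rule finite_subset) simp
  have "X \<noteq> {}" using assms(1) by (auto simp: X_def)
  then show "loops (boundary F) S > 0" "loops (boundary F) S \<le> card X"
    unfolding S loops_A_states[OF assms(1)] by (simp_all add: num_classes_pos num_classes_le_card)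
  have "card T = card ({z \<in> T. type_A z} \<union> {z \<in> T. \<not> type_A z})" by (rule arg_cong[of _ _ card]) auto
  also have "\<dots> = card {z \<in> T. type_A z} + card {z \<in> T. \<not> type_A z}"
    by (rule card_Un_disjoint) (use fin in auto)
  finally have "card T = card {z \<in> T. type_A z} + card {z \<in> T. \<not> type_A z}" .
  then have "even (card S + card T)" using card_A_states[OF T] unfolding S[symmetric] by presburger
  moreover have "loops (boundary F) S + (2 * card Cs + 1) = 2 * regions T + card T + n"
    unfolding S loops_A_states[OF assms(1)] by (rule loops_regions(1)[OF assms(1) T])
  ultimately show "even (loops (boundary F) S + card S + n + 1)" by presburger
qed

text \<open>For odd \<open>n\<close> loops and \<open>card S\<close> would have equal parity, so
  each term of the displayed sum would be even: a single loop forces \<open>card S\<close> to be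
  odd. By the state sums at 1 the total is -1.\<close>

lemma even_n: "n > 0 \<Longrightarrow> even n"
proof (rule ccontr)
  assume n: "n > 0" and odd: "odd n"
  let ?w = "boundary F" and ?c = "int (card Cs)"
  have s: "(\<Sum>S\<in>Pow (labels ?w). (-2 :: int) ^ (loops ?w S - 1)) = 1"
    "(\<Sum>S\<in>Pow (labels ?w). (2 * int (card S) - 4 * ?c) * (-2) ^ (loops ?w S - 1)) = 0"
    using state_sums_at_1[OF boundary_matched] writhe_boundary[OF n] by (simp_all add: card_labels_boundary[OF n])
  have "even (\<Sum>S\<in>Pow (labels ?w). (int (card S) - 2 * ?c - 1) * (-2) ^ (loops ?w S - 1))"
  proof (rule dvd_sum)
    fix S assume "S \<in> Pow (labels ?w)"
    then have S: "loops ?w S > 0" "even (loops ?w S + card S + n + 1)" using loops_parity[OF n] by auto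
    show "even ((int (card S) - 2 * ?c - 1) * (-2) ^ (loops ?w S - 1))"
      using S odd by (cases "loops ?w S = 1") auto
  qed
  moreover have "2 * (\<Sum>S\<in>Pow (labels ?w). (int (card S) - 2 * ?c - 1) * (-2) ^ (loops ?w S - 1)) =
      (\<Sum>S\<in>Pow (labels ?w). (2 * int (card S) - 4 * ?c) * (-2) ^ (loops ?w S - 1)) - 2 * (\<Sum>S\<in>Pow (labels ?w). (-2) ^ (loops ?w S - 1))"
    unfolding sum_distrib_left sum_subtractf[symmetric] by (intro sum.cong refl) (simp add: algebra_simps)
  ultimately show False unfolding s by presburger
qed

lemma state_sum_spin:
  assumes "n > 0" "y \<noteq> 0"
  shows "(\<Sum>S\<in>Pow (labels (boundary F)). y ^ (card S + R) * (- (y + inverse y)) ^ (loops (boundary F) S - 1)) =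
    y ^ (2 * card Cs + R) * spin_bracket y"
proof -
  have "(\<Sum>S\<in>Pow (labels (boundary F)). y ^ (card S + R) * (- (y + inverse y)) ^ (loops (boundary F) S - 1)) =
      (\<Sum>T\<in>Pow Q. y ^ (2 * card Cs + R) * ((\<Prod>z\<in>T. if type_A z then y else inverse y) *
        (- (y + inverse y)) ^ (num_classes X (smoothed T) - 1)))"
  proof (rule sum.reindex_bij_witness[of _ A_states merged])
    fix S assume S: "S \<in> Pow (labels (boundary F))"
    then show "A_states (merged S) = S" using A_states_merged labels_boundary[OF assms(1)] by simp
    show "merged S \<in> Pow Q" by (auto simp: merged_def)
  next
    fix T assume "T \<in> Pow Q"
    then have T: "T \<subseteq> Q" by simp
    then show "merged (A_states T) = T" by (rule merged_A_states)
    show "A_states T \<in> Pow (labels (boundary F))" by (auto simp: A_states_def labels_boundary[OF assms(1)])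
  next
    fix S assume S: "S \<in> Pow (labels (boundary F))"
    define T where "T = merged S"
    have T: "T \<subseteq> Q" by (auto simp: T_def merged_def)
    have ST: "S = A_states T" using A_states_merged S assms(1) by (simp add: T_def labels_boundary)
    have fin: "finite T" using T by (rule finite_subset) simp
    have P: "(\<Prod>z\<in>T. if type_A z then y else inverse y) = y ^ card {z \<in> T. type_A z} * inverse y ^ card {z \<in> T. \<not> type_A z}"
      unfolding prod.If_cases[OF fin] prod_constant by (intro arg_cong2[of _ _ _ _ "(*)"] arg_cong2[of _ _ _ _ "(^)"] arg_cong[of _ _ card]) auto
    have a: "y ^ card S * y ^ card {z \<in> T. \<not> type_A z} = y ^ card {z \<in> T. type_A z} * y ^ (2 * card Cs)"
      using card_A_states[OF T] unfolding ST[symmetric] power_add[symmetric] by simp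
    have b: "y ^ card {z \<in> T. \<not> type_A z} * inverse y ^ card {z \<in> T. \<not> type_A z} = 1"
      unfolding power_mult_distrib[symmetric] right_inverse[OF assms(2)] by (rule power_one)
    have "y ^ card S = y ^ card {z \<in> T. type_A z} * y ^ (2 * card Cs) * inverse y ^ card {z \<in> T. \<not> type_A z}"
      unfolding a[symmetric] mult.assoc b by (rule mult_1_right[symmetric])
    then have "y ^ card S = y ^ (2 * card Cs) * (\<Prod>z\<in>T. if type_A z then y else inverse y)"
      unfolding P by (simp only: mult_ac)
    then have "y ^ (card S + R) = y ^ (2 * card Cs + R) * (\<Prod>z\<in>T. if type_A z then y else inverse y)"
      by (simp only: power_add mult_ac)
    then show "y ^ (2 * card Cs + R) * ((\<Prod>z\<in>merged S. if type_A z then y else inverse y) *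
        (- (y + inverse y)) ^ (num_classes X (smoothed (merged S)) - 1)) =
        y ^ (card S + R) * (- (y + inverse y)) ^ (loops (boundary F) S - 1)"
      unfolding T_def[symmetric] loops_A_states[OF assms(1), of T, folded ST] by (simp add: mult.assoc)
  qed
  then show ?thesis by (simp add: spin_bracket_def sum_distrib_left)
qed

lemma knot_poly_exists:
  assumes "n > 0" "M \<ge> card Cs + card X"
  shows "knot_poly M (boundary F) (core_seifert_matrix F) (state_poly (boundary F) (2 * M - 2 * card Cs))"
proof -
  let ?w = "boundary F" and ?W = "core_seifert_matrix F"
  \<comment> \<open>Chosen with \<open>2 * card Cs + R = 2 * M\<close>: the first summand is the
    exponent relating \<open>card S\<close> to the corner weights, so the total shift is
    \<open>A ^ (4 * M)\<close>.\<close>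
  define R where "R = 2 * M - 2 * card Cs"
  have R: "2 * card Cs + R = 2 * M" "even R" "R \<ge> card X" using assms(2) by (auto simp: R_def)
  let ?G = "state_poly ?w R"
  have ok: "loops ?w S - 1 \<le> R \<and> even (state_exponent ?w R S)" if "S \<subseteq> labels ?w" for S
    using loops_parity[OF assms(1) that] even_n[OF assms(1)] R(2,3) unfolding state_exponent_def by auto
  note at1 = state_poly_at_1[OF boundary_matched _ writhe_boundary[OF assms(1)] ok]
  have "poly ?G 1 = 1" using at1(1) card_labels_boundary[OF assms(1)] by simp
  moreover have "poly (pderiv ?G) 1 = int M"
    using at1(2) card_labels_boundary[OF assms(1)] R(1) by simp
  moreover have "int_eval ?G (A_var ^ 4) = A_var ^ (4 * M) * f_poly ?w"
  proof -
    have A: "A_var * A_inv = 1" by (simp add: A_cancel)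
    have A2: "A_var ^ 2 * A_inv ^ 2 = 1" by (simp add: A flip: power_mult_distrib)
    have "int_eval ?G (A_var ^ 4) = (\<Sum>S\<in>Pow (labels ?w). (A_var ^ 2) ^ (card S + R) * (- (A_var ^ 2 + A_inv ^ 2)) ^ (loops ?w S - 1))"
      using int_eval_state_poly[OF A2 ok] by (simp flip: power_mult)
    also have "\<dots> = (\<Sum>S\<in>Pow (labels ?w). A_var ^ (4 * M) * (A_var ^ card S * A_inv ^ card (labels ?w - S) * loop_value ^ (loops ?w S - 1)))"
    proof (intro sum.cong refl)
      fix S assume "S \<in> Pow (labels ?w)"
      then have S: "S \<subseteq> labels ?w" by simp
      have fin: "finite (labels ?w)" by (simp add: labels_def)
      have c: "card (labels ?w - S) + card S = 4 * card Cs"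
        using card_Diff_subset[OF finite_subset[OF S fin] S] card_mono[OF fin S] card_labels_boundary[OF assms(1)] by simp
      have "4 * M = card S + 2 * R + card (labels ?w - S)" using c R(1) by simp
      then have "A_var ^ (4 * M) = A_var ^ card S * A_var ^ (2 * R) * A_var ^ card (labels ?w - S)"
        by (simp only: power_add)
      moreover have "A_var ^ k * A_inv ^ k = 1" for k by (simp add: A flip: power_mult_distrib)
      ultimately have "A_var ^ (4 * M) * (A_var ^ card S * A_inv ^ card (labels ?w - S)) = A_var ^ card S * A_var ^ (2 * R) * A_var ^ card S"
        by (simp add: mult_ac)
      also have "\<dots> = (A_var ^ 2) ^ (card S + R)" unfolding power_mult[symmetric] power_add[symmetric] by (rule arg_cong[of _ _ "(^) A_var"]) simp
      finally show "(A_var ^ 2) ^ (card S + R) * (- (A_var ^ 2 + A_inv ^ 2)) ^ (loops ?w S - 1) =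
          A_var ^ (4 * M) * (A_var ^ card S * A_inv ^ card (labels ?w - S) * loop_value ^ (loops ?w S - 1))"
        by (simp add: loop_value_def mult.assoc[symmetric])
    qed
    also have "\<dots> = A_var ^ (4 * M) * f_poly ?w"
      by (simp add: f_poly_def writhe_boundary[OF assms(1)] bracket_loops[OF boundary_matched] sum_distrib_left)
    finally show ?thesis .
  qed
  moreover have ev: "int_eval ?G (y ^ 2) = y ^ (2 * M) * spin_bracket y" if "y \<noteq> 0" for y :: complex
    using int_eval_state_poly[of y "inverse y" ?w R] ok state_sum_spin[OF assms(1) that, of R] that by (simp add: R(1))
  moreover have "\<bar>poly ?G (- 1)\<bar> = abs_det_sym ?W"
  proof -
    have "complex_of_int (poly ?G (- 1)) = int_eval ?G (\<i> ^ 2)" using int_eval_of_int[of ?G "- 1", where ?'a = complex] by simp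
    also have "\<dots> = \<i> ^ (2 * M) * spin_bracket \<i>" by (rule ev) simp
    finally have "cmod (of_int (poly ?G (- 1))) = cmod (spin_bracket \<i>)" by (simp add: norm_mult norm_power)
    also have "mat n n (\<lambda>(i, j). ?W $$ (i, j) + ?W $$ (j, i)) = ?W + transpose_mat ?W"
      by (rule eq_matI) (auto simp: core_seifert_matrix_def n_def)
    then have "cmod (spin_bracket \<i>) = of_int (abs_det_sym ?W)"
      using cmod_spin_bracket_ii[OF assms(1)] by (simp add: abs_det_sym_def)
    finally show ?thesis by (simp flip: of_int_abs)
  qed
  moreover have "int_eval ?G (y ^ 2) = y ^ (2 * M) * normalized_gauss q e (- (y + inverse y)) ?W"
    if g: "gauss_point q e y" for q e y
  proof -
    let ?d = "- (y + inverse y)"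
    have y: "y \<noteq> 0" and d2: "?d ^ 2 = of_nat q" and e: "primitive_root q e"
      and q: "q = 1 \<and> e = 1 \<or> q = 2 \<and> y ^ 8 = 1 \<and> e = y powi (-4) \<or> q = 3 \<and> y ^ 6 = -1 \<and> e = y powi (-4)"
      using g unfolding gauss_point_def power2_minus by blast+
    have "q > 0" using e by (simp add: primitive_root_def)
    then have "?d \<noteq> 0" using d2 by (metis of_nat_0_less_iff less_irrefl of_nat_0 of_nat_eq_0_iff power_zero_numeral)
    moreover have "dim_row ?W = n" by (simp add: core_seifert_matrix_def n_def)
    ultimately have "spin_bracket y = normalized_gauss q e ?d ?W"
      using spin_bracket_gauss[OF assms(1) y refl d2 q e] by (simp add: normalized_gauss_def field_simps)
    then show ?thesis using ev[OF y] by simp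
  qed
  ultimately show ?thesis unfolding knot_poly_def R_def by blast
qed

end

section \<open>Points at which Gauss sums give the value\<close>

lemma primitive_rootI:
  assumes "q > 0" "e ^ q = 1" "\<And>m. \<not> int q dvd m \<Longrightarrow> e powi m \<noteq> 1"
  shows "primitive_root q e"
proof -
  have e0: "e \<noteq> 0" using assms(1,2) by (auto simp: power_0_left)
  have "(\<Sum>t<q. e powi (int t * m)) = (if int q dvd m then of_nat q else 0)" for m
  proof -
    let ?r = "e powi m"
    have r: "e powi (int t * m) = ?r ^ t" for t by (simp add: power_int_power' mult.commute flip: power_int_of_nat power_int_mult)
    have "?r ^ q = e powi (m * int q)" by (simp only: power_int_mult power_int_of_nat)
    also have "\<dots> = (e ^ q) powi m" by (simp only: mult.commute[of m] power_int_mult power_int_of_nat)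
    finally have rq: "?r ^ q = 1" using assms(2) by simp
    show ?thesis
    proof (cases "int q dvd m")
      case True
      then obtain k where "m = int q * k" by (elim dvdE)
      then have "?r = 1" using assms(2) by (simp add: power_int_mult)
      then show ?thesis using True by (simp add: r)
    next
      case False
      then have "(\<Sum>t<q. ?r ^ t) = 0" using assms(3) rq geometric_sum[of ?r q] by simp
      then show ?thesis using False by (simp add: r)
    qed
  qed
  then show ?thesis using assms(1,2) by (simp add: primitive_root_def)
qed

lemma primitive_root_3:
  assumes "e ^ 3 = 1" "e \<noteq> (1 :: complex)"
  shows "primitive_root 3 e"
proof (rule primitive_rootI)
  fix m :: int assume m: "\<not> int 3 dvd m"
  have e0: "e \<noteq> 0" using assms(1) by auto
  have m3: "e powi m = e powi (m mod 3)"
  proof -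
    have "e powi m = e powi (3 * (m div 3) + m mod 3)" by simp
    also have "\<dots> = (e powi 3) powi (m div 3) * e powi (m mod 3)"
      by (simp only: power_int_add[OF disjI1, OF e0] power_int_mult)
    finally show ?thesis using assms(1) by simp
  qed
  have "m mod 3 = 1 \<or> m mod 3 = 2" using m by presburger
  then show "e powi m \<noteq> 1"
  proof
    assume "m mod 3 = 1"
    then show ?thesis using m3 assms(2) by simp
  next
    assume "m mod 3 = 2"
    moreover have "e ^ 2 \<noteq> 1"
    proof
      assume "e ^ 2 = 1"
      then have "e ^ 3 = e" by (simp add: power3_eq_cube power2_eq_square)
      then show False using assms by simp
    qed
    ultimately show ?thesis using m3 by simp
  qed
qed (use assms in simp_all)

text \<open>For a square root \<open>y\<close> of \<open>u\<close>,
  \<open>(y + inverse y) ^ 2 = (u + 1) ^ 2 / u\<close>, which is 1, 2, 3 in the three cases;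
  \<open>e\<close> is the inverse of \<open>u ^ 2\<close>, equal to 1 or a power suited to
  \<open>q\<close> colours only in the last two, while \<open>q = 1\<close> takes
  \<open>e = 1\<close>.\<close>

lemma gauss_point_exists:
  fixes u :: complex
  assumes "u ^ 2 + u + 1 = 0 \<or> u ^ 2 + 1 = 0 \<or> u ^ 2 - u + 1 = 0"
  obtains q e y where "gauss_point q e y" "u = y ^ 2"
proof -
  define y where "y = csqrt u"
  have u: "u = y ^ 2" by (simp add: y_def)
  have u0: "u \<noteq> 0" using assms by auto
  then have y0: "y \<noteq> 0" using u by auto
  have sq: "(y + inverse y) ^ 2 = (u ^ 2 + 2 * u + 1) / u"
    unfolding u using y0 by (simp add: field_simps power2_eq_square)
  from assms show thesis
  proof (elim disjE)
    assume a: "u ^ 2 + u + 1 = 0"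
    have "u ^ 2 + 2 * u + 1 = u" using a by (simp add: algebra_simps)
    then have "gauss_point 1 1 y"
      using y0 u0 sq by (simp add: gauss_point_def primitive_root_def)
    then show thesis using u that by blast
  next
    assume a: "u ^ 2 + 1 = 0"
    have a': "u ^ 2 = - 1" using a by (simp add: eq_neg_iff_add_eq_0)
    have "u ^ 2 + 2 * u + 1 = 2 * u" using a by (simp add: algebra_simps)
    then have "(y + inverse y) ^ 2 = 2" unfolding sq using u0 by (simp only:) simp
    moreover have "y ^ 4 = - 1" using a' unfolding u by (simp flip: power_mult)
    then have "y ^ 8 = 1" "y powi (- 4) = - 1"
      by (simp_all add: power_int_minus) (metis power2_eq_1_iff power_even_eq numeral_Bit0 mult_2 mult_numeral_1 power2_minus power_one power_mult[of y 4 2] num_double numeral_times_numeral)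
    moreover have "primitive_root 2 (- 1)"
    proof (rule primitive_rootI)
      fix m :: int assume "\<not> int 2 dvd m"
      then have "odd m" by simp
      then show "(- 1 :: complex) powi m \<noteq> 1" by (simp add: power_int_minus_left)
    qed simp_all
    ultimately have "gauss_point 2 (- 1) y"
      using y0 by (simp add: gauss_point_def)
    then show thesis using u that by blast
  next
    assume a: "u ^ 2 - u + 1 = 0"
    have a2: "u ^ 2 = u - 1" using a by (simp add: algebra_simps)
    have "u ^ 3 = u * u ^ 2" by (simp add: power3_eq_cube power2_eq_square)
    also have "\<dots> = u ^ 2 - u" unfolding a2 by (simp add: algebra_simps a2[unfolded power2_eq_square])
    finally have a3: "u ^ 3 = - 1" using a2 by simp
    have y6: "y ^ 6 = - 1" using a3 unfolding u by (simp flip: power_mult)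
    have "u ^ 2 + 2 * u + 1 = 3 * u" unfolding a2 by simp
    then have "(y + inverse y) ^ 2 = 3" unfolding sq using u0 by (simp only:) simp
    moreover have "primitive_root 3 (inverse (u ^ 2))"
    proof (rule primitive_root_3)
      have "(u ^ 2) ^ 3 = (u ^ 3) ^ 2" by (simp flip: power_mult)
      then show "inverse (u ^ 2) ^ 3 = 1" unfolding a3 by (simp add: power_inverse)
      show "inverse (u ^ 2) \<noteq> 1"
      proof
        assume "inverse (u ^ 2) = 1"
        then have "u ^ 2 = 1" by (metis inverse_1 inverse_inverse_eq)
        then have "u = 2" using a2 by (simp add: algebra_simps)
        then show False using \<open>u ^ 2 = 1\<close> by simp
      qed
    qed
    moreover have "y powi (- 4) = inverse (u ^ 2)" unfolding u by (simp add: power_int_minus flip: power_mult)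
    ultimately have "gauss_point 3 (inverse (u ^ 2)) y"
      using y0 y6 by (simp add: gauss_point_def)
    then show thesis using u that by blast
  qed
qed

lemma knot_poly_difference:
  assumes "knot_poly M w W G" "knot_poly M w' W' G'" "S_equivalent W W'"
  shows "[:-1, 1:] * [:-1, 0, -1, 0, 0, 0, 1, 0, 1:] dvd G - G'"
proof -
  let ?D = "G - G'" and ?H = "[:-1, 0, -1, 0, 0, 0, 1, 0, 1:] :: int poly"
  have "poly ?D 1 = 0" using assms(1,2) by (simp add: knot_poly_def)
  then have "[:-1, 1:] dvd ?D" by (simp only: poly_eq_0_iff_dvd)
  then obtain D1 where D1: "?D = [:-1, 1:] * D1" by (elim dvdE)
  have ev: "int_eval ?D u = (u - 1) * int_eval D1 u" for u :: complex
    unfolding D1 by (simp add: algebra_simps)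
  have at1: "int_eval D1 (1 :: complex) = 0"
  proof -
    have "poly (pderiv ?D) 1 = poly D1 1" unfolding D1 pderiv_mult poly_add poly_mult by (simp add: pderiv_pCons)
    moreover have "poly (pderiv ?D) 1 = 0" using assms(1,2) by (simp add: knot_poly_def pderiv_diff)
    ultimately show ?thesis using int_eval_of_int[of D1 1, where ?'a = complex] by simp
  qed
  have atm1: "int_eval ?D (- 1 :: complex) = 0"
  proof -
    have "abs_det_sym W = abs_det_sym W'"
      using S_equivalent_invariant[of abs_det_sym, OF abs_det_sym_congruent abs_det_sym_enlargement assms(3)] .
    then have abs: "\<bar>poly G (- 1)\<bar> = \<bar>poly G' (- 1)\<bar>" using assms(1,2) by (simp add: knot_poly_def)
    have "[poly G (- 1) = 1 - 2 * int M] (mod 4)" "[poly G' (- 1) = 1 - 2 * int M] (mod 4)"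
      using poly_at_minus_1_mod_4[of G] poly_at_minus_1_mod_4[of G'] assms(1,2) by (simp_all add: knot_poly_def)
    then obtain k l where "poly G (- 1) - (1 - 2 * int M) = 4 * k" "poly G' (- 1) - (1 - 2 * int M) = 4 * l"
      unfolding cong_iff_dvd_diff by (elim dvdE)
    moreover have "poly G (- 1) = poly G' (- 1) \<or> poly G (- 1) = - poly G' (- 1)" using abs by linarith
    \<comment> \<open>Both values are congruent to the same odd number modulo 4, so they cannot be
      opposite.\<close>
    ultimately have "poly G (- 1) = poly G' (- 1)" by presburger
    then show ?thesis using int_eval_of_int[of ?D "- 1", where ?'a = complex] by simp
  qed
  have gauss: "int_eval ?D (y ^ 2) = 0" if g: "gauss_point q e y" for q e y
  proof -
    have e: "primitive_root q e" and d: "(- (y + inverse y)) ^ 2 = of_nat q"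
      using g unfolding gauss_point_def power2_minus by blast+
    have "normalized_gauss q e (- (y + inverse y)) W = normalized_gauss q e (- (y + inverse y)) W'"
      using S_equivalent_invariant[of "normalized_gauss q e (- (y + inverse y))", OF normalized_gauss_congruent[OF e] normalized_gauss_enlargement[OF e _ d] assms(3)] .
    then show ?thesis using assms(1,2) g by (auto simp: knot_poly_def)
  qed
  \<comment> \<open>The eight simple roots of the second factor
    \<open>(u ^ 6 - 1) * (u ^ 2 + 1)\<close>; at 1 the derivative of the difference shows that
    \<open>D1\<close> vanishes too.\<close>
  define Z where "Z = {u :: complex. u ^ 6 = 1} \<union> {\<i>, - \<i>}"
  have i6: "\<i> ^ 6 = - 1" "(- \<i>) ^ 6 = - 1" by (simp_all add: power_minus_even numeral_eq_Suc)
  have "card Z = 6 + 2"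
  proof -
    have "finite {u :: complex. u ^ 6 = 1}" using card_roots_unity_eq[of 6] by (intro card_ge_0_finite) simp
    moreover have "{u :: complex. u ^ 6 = 1} \<inter> {\<i>, - \<i>} = {}" using i6 by auto
    moreover have "card {\<i>, - \<i>} = 2" by (simp add: complex_eq_iff)
    ultimately show ?thesis unfolding Z_def by (subst card_Un_disjoint) (simp_all add: card_roots_unity_eq)
  qed
  then have cardZ: "card Z = 8" by simp
  have H: "int_eval ?H u = (u ^ 6 - 1) * (u ^ 2 + 1)" for u :: complex
    by (simp add: algebra_simps eval_nat_numeral)
  have "?H dvd D1"
  proof (rule monic_dvd_if_roots[of _ Z])
    show "int_eval ?H u = 0" if "u \<in> Z" for u using that unfolding H by (auto simp: Z_def)
    show "int_eval D1 u = 0" if u: "u \<in> Z" for u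
    proof (cases "u = 1")
      case False
      have "int_eval ?D u = 0"
      proof (cases "u = - 1")
        case True
        then show ?thesis using atm1 by simp
      next
        case False
        have "(u ^ 2 + u + 1) * (u ^ 2 - u + 1) = 0 \<or> u ^ 2 + 1 = 0"
        proof (cases "u ^ 6 = 1")
          case True
          have "(u - 1) * (u + 1) * ((u ^ 2 + u + 1) * (u ^ 2 - u + 1)) = u ^ 6 - 1"
            by (simp add: algebra_simps eval_nat_numeral)
          then have "(u - 1) * (u + 1) * ((u ^ 2 + u + 1) * (u ^ 2 - u + 1)) = 0" using True by simp
          then show ?thesis using \<open>u \<noteq> 1\<close> False by (auto simp: add_eq_0_iff2)
        next
          case False
          then show ?thesis using u by (auto simp: Z_def)
        qed
        then have "u ^ 2 + u + 1 = 0 \<or> u ^ 2 + 1 = 0 \<or> u ^ 2 - u + 1 = 0" by auto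
        then obtain q e y where "gauss_point q e y" "u = y ^ 2" by (rule gauss_point_exists)
        then show ?thesis using gauss by simp
      qed
      then show ?thesis using ev[of u] False by simp
    qed (use at1 in simp)
  qed (simp_all add: cardZ)
  then show ?thesis unfolding D1 by (intro mult_dvd_mono) simp_all
qed

text \<open>Existence for every large \<open>M\<close>, so that two knots can be given the same
  \<open>M\<close>.\<close>

lemma knot_poly_eventually:
  assumes "seifert_surface F" "matched (boundary F)"
  obtains M0 where "\<And>M. M \<ge> M0 \<Longrightarrow> \<exists>G. knot_poly M (boundary F) (core_seifert_matrix F) G"
proof (cases "num_bands F = 0")
  case False
  interpret surface F using assms by unfold_locales
  have "n > 0" using False by (simp add: n_def)
  then show thesis using knot_poly_exists by (intro that[of "card Cs + card X"]) blast
next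
  \<comment> \<open>Without bands the surface is a disc with empty boundary code, and
    \<open>u ^ M\<close> has the required values.\<close>
  case True
  have feet: "feet F = []" using assms(1) True by (simp add: seifert_surface_def)
  have b: "boundary F = []" by (simp add: boundary_def boundary_feet_def feet)
  have f: "f_poly [] = 1"
    by (simp add: f_poly_def writhe_def bracket_def crossings_def edges_def)
  have W: "core_seifert_matrix F = 0\<^sub>m 0 0" by (rule eq_matI) (simp_all add: core_seifert_matrix_def True)
  have "knot_poly M (boundary F) (core_seifert_matrix F) (monom 1 M)" for M
  proof -
    have m: "int_eval (monom 1 M) x = x ^ M" for x :: "'a :: comm_ring_1"
      by (induction M) (simp_all add: monom_Suc monom_0)
    have "\<bar>poly (monom 1 M) (- 1)\<bar> = (1 :: int)" by (simp add: poly_monom power_abs)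
    moreover have "det (0\<^sub>m 0 0 + transpose_mat (0\<^sub>m 0 0)) = (1 :: int)" by (simp add: det_dim_zero)
    ultimately show ?thesis
      unfolding knot_poly_def b f W m abs_det_sym_def normalized_gauss_def gauss_sum_def
      by (simp add: poly_monom pderiv_monom power_mult)
  qed
  then show thesis using that by blast
qed

theorem corollary3p12:
  fixes K K' :: gauss_code
  assumes "knot_diagram K" and "knot_diagram K'"
    and "S_equivalent_knots K K'"
  shows "(A_var ^ 36 - A_var ^ 32 + A_var ^ 28 - A_var ^ 24 - A_var ^ 12 + A_var ^ 8 - A_var ^ 4 + 1) dvd (f_poly K - f_poly K')"
proof -
  obtain V V' where V: "is_seifert_matrix V K" "is_seifert_matrix V' K'" "S_equivalent V V'"
    using assms(3) by (auto simp: S_equivalent_knots_def)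
  obtain F where F: "seifert_surface F" "knot_equiv (boundary F) K" "congruent (core_seifert_matrix F) V"
    using V(1) by (auto simp: is_seifert_matrix_def)
  obtain F' where F': "seifert_surface F'" "knot_equiv (boundary F') K'" "congruent (core_seifert_matrix F') V'"
    using V(2) by (auto simp: is_seifert_matrix_def)
  have S: "S_equivalent (core_seifert_matrix F) (core_seifert_matrix F')"
  proof -
    let ?R = "\<lambda>V W. congruent V W \<or> elementary_enlargement V W"
    have "equivclp ?R (core_seifert_matrix F) V" using F(3) by (intro r_into_equivclp) simp
    moreover have "equivclp ?R V V'" using V(3) by (simp add: S_equivalent_def)
    moreover have "equivclp ?R V' (core_seifert_matrix F')"
      by (rule equivclp_sym[OF r_into_equivclp]) (use F'(3) in simp)
    ultimately show ?thesis unfolding S_equivalent_def by (meson equivclp_trans)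
  qed
  have "matched K" "matched K'" using assms(1,2) by (simp_all add: knot_diagram_def)
  then have m: "matched (boundary F)" "matched (boundary F')"
    using knot_equiv_matched F(2) F'(2) by blast+
  obtain M0 where M0: "\<And>M. M \<ge> M0 \<Longrightarrow> \<exists>G. knot_poly M (boundary F) (core_seifert_matrix F) G"
    using knot_poly_eventually[OF F(1) m(1)] by blast
  obtain M1 where M1: "\<And>M. M \<ge> M1 \<Longrightarrow> \<exists>G. knot_poly M (boundary F') (core_seifert_matrix F') G"
    using knot_poly_eventually[OF F'(1) m(2)] by blast
  define M where "M = max M0 M1"
  obtain G where G: "knot_poly M (boundary F) (core_seifert_matrix F) G" using M0[of M] by (auto simp: M_def)
  obtain G' where G': "knot_poly M (boundary F') (core_seifert_matrix F') G'" using M1[of M] by (auto simp: M_def)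
  obtain H where H: "G - G' = [:-1, 1:] * [:-1, 0, -1, 0, 0, 0, 1, 0, 1:] * H"
    using knot_poly_difference[OF G G' S] by (elim dvdE)
  let ?P = "A_var ^ 36 - A_var ^ 32 + A_var ^ 28 - A_var ^ 24 - A_var ^ 12 + A_var ^ 8 - A_var ^ 4 + 1"
  have "A_var ^ (4 * M) * (f_poly (boundary F) - f_poly (boundary F')) = int_eval (G - G') (A_var ^ 4)"
    using G G' by (simp add: knot_poly_def right_diff_distrib)
  also have "\<dots> = ?P * int_eval H (A_var ^ 4)"
  proof -
    have e: "int_eval ([:-1, 1:] * [:-1, 0, -1, 0, 0, 0, 1, 0, 1:]) x = x ^ 9 - x ^ 8 + x ^ 7 - x ^ 6 - x ^ 3 + x ^ 2 - x + 1"
      for x :: laurent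
      unfolding int_eval_mult by (simp add: algebra_simps eval_nat_numeral)
    show ?thesis unfolding H int_eval_mult[of _ H] e power_mult[symmetric] by simp
  qed
  finally have "A_inv ^ (4 * M) * (A_var ^ (4 * M) * (f_poly (boundary F) - f_poly (boundary F'))) =
      ?P * (A_inv ^ (4 * M) * int_eval H (A_var ^ 4))" by (simp only: mult_ac)
  \<comment> \<open>\<open>A_var\<close> is a unit, so the common shift can be removed
    again.\<close>
  moreover have "A_inv ^ (4 * M) * (A_var ^ (4 * M) * x) = x" for x
    by (simp add: A_cancel mult.assoc[symmetric] flip: power_mult_distrib)
  ultimately have "?P dvd f_poly (boundary F) - f_poly (boundary F')" by (metis dvd_triv_left)
  then show ?thesis using f_poly_knot_equiv[OF F(2)] f_poly_knot_equiv[OF F'(2)] by simp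
qed

end
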